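(* Let $n\ge 2$ and let $\Omega\subseteq\mathbb{R}^n$ be open. The map $\Upsilon\colon L^\infty(\hat\Omega,\hat{\mathscr{A}},\hat{\mathscr{I}}^{n-1})\to L^1(\Omega,\mathscr{B}(\Omega),\mathscr{I}^{n-1})^*$ defined by $$\Upsilon(g)(f)=\int_{\hat\Omega} g\,(f\circ p)\,d\hat{\mathscr{I}}^{n-1}$$ is an isometric isomorphism.
   Context: Notation. $\mathscr{H}^{n-1}$ is the $(n-1)$-dimensional Hausdorff measure on $\mathbb{R}^n$ (normalized to agree with Lebesgue measure on $\mathbb{R}^{n-1}$); $\boldsymbol{\alpha}(n-1)$ is the volume of the unit ball of $\mathbb{R}^{n-1}$; $B(x,r)$ is the ball with center $x$ and radius $r$. $\mathscr{B}(E)$ and $\mathscr{M}_{\mathscr{H}^{n-1}}(E)$ are the $\sigma$-algebras of Borel, respectively $\mathscr{H}^{n-1}$-measurable, subsets of $E\subseteq\mathbb{R}^n$. $\ominus$ is symmetric difference. $\Theta^{n-1}(E,x)=\lim_{r\to0}\frac{\mathscr{H}^{n-1}(E\cap B(x,r))}{\boldsymbol{\alpha}(n-1)r^{n-1}}$ when the limit exists. Rectifiability. $E\subseteq\mathbb{R}^n$ is countably $(n-1)$-rectifiable if there are countably many Lipschitz maps $f_k\colon\mathbb{R}^{n-1}\to\mathbb{R}^n$ with $\mathscr{H}^{n-1}(E\setminus\bigcup_k f_k(\mathbb{R}^{n-1}))=0$; it is $(n-1)$-rectifiable if it is moreover $\mathscr{H}^{n-1}$-measurable and $\mathscr{H}^{n-1}(E)<\infty$.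 The measure $\mathscr{I}^{n-1}$. For $S\subseteq\Omega$, $\mathscr{I}^{n-1}(S)=\sup\{\mathscr{H}^{n-1}(S\cap E):E\subseteq\Omega\text{ is an }(n-1)\text{-rectifiable set}\}$; this is a Borel regular outer measure on $\Omega$, restricted to a measure on $\mathscr{B}(\Omega)$. The measure space $(\hat\Omega,\hat{\mathscr{A}},\hat{\mathscr{I}}^{n-1})$. Let $\mathscr{E}$ be the collection of all Borel $(n-1)$-rectifiable subsets $E$ of $\Omega$ such that, for each $x\in\Omega$, $x\in E$ if and only if $\Theta^{n-1}(E,x)=1$. For $x\in\Omega$ let $\mathscr{E}_x=\{E\in\mathscr{E}:x\in E\}$, and for $E,E'\in\mathscr{E}_x$ write $E\sim_x E'$ iff $\Theta^{n-1}(E\ominus E',x)=0$ (equivalently $\Theta^{n-1}(E\cap E',x)=1$); this is an equivalence relation. The class $[E]_x$ of $E$ is called the approximate germ of $E$ at $x$. Let $\hat\Omega$ be the set of pairs $(x,[E]_x)$ with $x\in\Omega$ and $[E]_x$ an approximate germ at $x$ (so $E\in\mathscr{E}_x$), and let $p\colon\hat\Omega\to\Omega$, $p(x,[E]_x)=x$. For $E\in\mathscr{E}$ let $\gamma_E\colon E\to\hat\Omega$, $\gamma_E(x)=(x,[E]_x)$. Put $\hat{\mathscr{A}}=\{A\subseteq\hat\Omega:\gamma_E^{-1}(A)\in\mathscr{M}_{\mathscr{H}^{n-1}}(E)\text{ for all }E\in\mathscr{E}\}$, and for $E\in\mathscr{E}$ let $\mu_E(A)=\mathscr{H}^{n-1}(\gamma_E^{-1}(A))$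 for $A\in\hat{\mathscr{A}}$. $\hat{\mathscr{I}}^{n-1}$ is the least upper bound of the measures $\mu_E$, $E\in\mathscr{E}$, i.e. the smallest measure on $(\hat\Omega,\hat{\mathscr{A}})$ that dominates every $\mu_E$. The map $p$ is $(\hat{\mathscr{A}},\mathscr{B}(\Omega))$-measurable. All $L^1$ and $L^\infty$ spaces consist of real-valued functions modulo equality almost everywhere ($L^\infty$: essentially bounded measurable functions with the essential supremum norm), and $X^*$ is the space of continuous linear functionals on $X$ with the operator norm. *)

theory Defs
  imports "HOL-Analysis.Analysis" "HOL-Probability.Essential_Supremum"
begin

section \<open>Hausdorff measure, density and rectifiability\<close>

text \<open>
  The constant (volume of the unit ball)/$2^k$ normalises $k$-dimensional Hausdorff measure to
  agree with Lebesgue measure on $k$-dimensional Euclidean space. The library's \<^const>\<open>diameter\<close>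
  is meaningful for bounded sets only. The case distinction matters only for \<open>k = 0\<close>.
\<close>

definition hausdorff_pre :: "nat \<Rightarrow> real \<Rightarrow> 'a::metric_space set \<Rightarrow> ennreal" where
  "hausdorff_pre k \<delta> S =
    (INF U \<in> {U :: nat \<Rightarrow> 'a set. S \<subseteq> (\<Union>i. U i) \<and> (\<forall>i. bounded (U i) \<and> diameter (U i) \<le> \<delta>)}.
       \<Sum>i. if U i = {} then 0 else ennreal (unit_ball_vol (real k) * (diameter (U i) / 2) ^ k))"

definition hausdorff :: "nat \<Rightarrow> 'a::metric_space set \<Rightarrow> ennreal" where
  "hausdorff k S = (SUP \<delta> \<in> {0<..}. hausdorff_pre k \<delta> S)"

text \<open>Measurability is in the sense of Caratheodory.\<close>

definition hausdorff_sets :: "nat \<Rightarrow> 'a::metric_space set set" where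
  "hausdorff_sets k = lambda_system UNIV (Pow UNIV) (hausdorff k)"

definition has_density :: "nat \<Rightarrow> 'a::metric_space set \<Rightarrow> 'a \<Rightarrow> ennreal \<Rightarrow> bool" where
  "has_density k E x \<theta> \<longleftrightarrow>
    ((\<lambda>r. hausdorff k (E \<inter> cball x r) / ennreal (unit_ball_vol (real k) * r ^ k)) \<longlongrightarrow> \<theta>) (at_right 0)"

text \<open>
  The argument of type \<open>'m itself\<close> fixes the parameter space of the Lipschitz maps, and
  thereby the dimension \<open>DIM('m)\<close>; for $(n-1)$-rectifiability it is to be \<open>real ^ 'm\<close> with
  \<open>CARD('m) = n - 1\<close>.
\<close>

definition countably_rectifiable ::
    "'m::euclidean_space itself \<Rightarrow> 'a::euclidean_space set \<Rightarrow> bool" where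
  "countably_rectifiable m E \<longleftrightarrow>
    (\<exists>f :: nat \<Rightarrow> 'm \<Rightarrow> 'a.
       (\<forall>i. \<exists>L. L-lipschitz_on UNIV (f i)) \<and>
       hausdorff DIM('m) (E - (\<Union>i. range (f i))) = 0)"

definition rectifiable ::
    "'m::euclidean_space itself \<Rightarrow> 'a::euclidean_space set \<Rightarrow> bool" where
  "rectifiable m E \<longleftrightarrow>
    countably_rectifiable m E \<and> E \<in> hausdorff_sets DIM('m) \<and> hausdorff DIM('m) E < \<infinity>"

definition rect_outer ::
    "'m::euclidean_space itself \<Rightarrow> 'a::euclidean_space set \<Rightarrow> 'a set \<Rightarrow> ennreal" where
  "rect_outer m \<Omega> S = (SUP E \<in> {E. E \<subseteq> \<Omega> \<and> rectifiable m E}. hausdorff DIM('m) (S \<inter> E))"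

definition rect_measure ::
    "'m::euclidean_space itself \<Rightarrow> 'a::euclidean_space set \<Rightarrow> 'a measure" where
  "rect_measure m \<Omega> = measure_of \<Omega> (sets (restrict_space borel \<Omega>)) (rect_outer m \<Omega>)"


section \<open>The space of approximate germs\<close>

definition germ_base ::
    "'m::euclidean_space itself \<Rightarrow> 'a::euclidean_space set \<Rightarrow> 'a set set" where
  "germ_base m \<Omega> =
    {E. E \<subseteq> \<Omega> \<and> E \<in> sets borel \<and> rectifiable m E \<and>
        (\<forall>x\<in>\<Omega>. x \<in> E \<longleftrightarrow> has_density DIM('m) E x 1)}"

definition germ_base_at ::
    "'m::euclidean_space itself \<Rightarrow> 'a::euclidean_space set \<Rightarrow> 'a \<Rightarrow> 'a set set" where
  "germ_base_at m \<Omega> x = {E \<in> germ_base m \<Omega>. x \<in> E}"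

definition germ_rel ::
    "'m::euclidean_space itself \<Rightarrow> 'a::euclidean_space set \<Rightarrow> 'a \<Rightarrow> ('a set \<times> 'a set) set" where
  "germ_rel m \<Omega> x =
    {(E, E'). E \<in> germ_base_at m \<Omega> x \<and> E' \<in> germ_base_at m \<Omega> x \<and>
              has_density DIM('m) ((E - E') \<union> (E' - E)) x 0}"

definition germ_space ::
    "'m::euclidean_space itself \<Rightarrow> 'a::euclidean_space set \<Rightarrow> ('a \<times> 'a set set) set" where
  "germ_space m \<Omega> = (SIGMA x:\<Omega>. germ_base_at m \<Omega> x // germ_rel m \<Omega> x)"

definition germ_map ::
    "'m::euclidean_space itself \<Rightarrow> 'a::euclidean_space set \<Rightarrow> 'a set \<Rightarrow> 'a \<Rightarrow> 'a \<times> 'a set set" where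
  "germ_map m \<Omega> E x = (x, germ_rel m \<Omega> x `` {E})"

definition germ_sets ::
    "'m::euclidean_space itself \<Rightarrow> 'a::euclidean_space set \<Rightarrow> ('a \<times> 'a set set) set set" where
  "germ_sets m \<Omega> =
    {A. A \<subseteq> germ_space m \<Omega> \<and>
        (\<forall>E\<in>germ_base m \<Omega>. {x \<in> E. germ_map m \<Omega> E x \<in> A} \<in> hausdorff_sets DIM('m))}"

definition germ_push ::
    "'m::euclidean_space itself \<Rightarrow> 'a::euclidean_space set \<Rightarrow> 'a set \<Rightarrow> ('a \<times> 'a set set) measure" where
  "germ_push m \<Omega> E =
    measure_of (germ_space m \<Omega>) (germ_sets m \<Omega>)
      (\<lambda>A. hausdorff DIM('m) {x \<in> E. germ_map m \<Omega> E x \<in> A})"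

text \<open>
  The supremum is taken in the complete lattice \<open>'a measure\<close>. All the \<^const>\<open>germ_push\<close>
  have the same space and the same measurable sets, and on such measures the order is the
  setwise one (\<open>le_measure\<close>), so this is the smallest measure on the germ space dominating
  all of them. The index set is never empty, since it contains the empty set.
\<close>

definition germ_measure ::
    "'m::euclidean_space itself \<Rightarrow> 'a::euclidean_space set \<Rightarrow> ('a \<times> 'a set set) measure" where
  "germ_measure m \<Omega> = (SUP E \<in> germ_base m \<Omega>. germ_push m \<Omega> E)"


section \<open>Normed spaces with explicit carrier\<close>

record 'v normed_carrier =
  elems :: "'v set"
  vadd :: "'v \<Rightarrow> 'v \<Rightarrow> 'v"
  vscale :: "real \<Rightarrow> 'v \<Rightarrow> 'v"
  vnorm :: "'v \<Rightarrow> real"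

definition linear_between ::
    "'v normed_carrier \<Rightarrow> 'w normed_carrier \<Rightarrow> ('v \<Rightarrow> 'w) \<Rightarrow> bool" where
  "linear_between X Y T \<longleftrightarrow>
    (\<forall>x\<in>elems X. T x \<in> elems Y) \<and>
    (\<forall>x\<in>elems X. \<forall>y\<in>elems X. T (vadd X x y) = vadd Y (T x) (T y)) \<and>
    (\<forall>c. \<forall>x\<in>elems X. T (vscale X c x) = vscale Y c (T x))"

definition isometric_isomorphism ::
    "'v normed_carrier \<Rightarrow> 'w normed_carrier \<Rightarrow> ('v \<Rightarrow> 'w) \<Rightarrow> bool" where
  "isometric_isomorphism X Y T \<longleftrightarrow>
    linear_between X Y T \<and> bij_betw T (elems X) (elems Y) \<and>
    (\<forall>x\<in>elems X. vnorm Y (T x) = vnorm X x)"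

definition real_space :: "real normed_carrier" where
  "real_space = \<lparr>elems = UNIV, vadd = (+), vscale = (*), vnorm = abs\<rparr>"

definition continuous_between ::
    "'v normed_carrier \<Rightarrow> 'w normed_carrier \<Rightarrow> ('v \<Rightarrow> 'w) \<Rightarrow> bool" where
  "continuous_between X Y T \<longleftrightarrow>
    (\<forall>x\<in>elems X. \<forall>\<epsilon>>0. \<exists>\<delta>>0. \<forall>y\<in>elems X.
       vnorm X (vadd X y (vscale X (-1) x)) < \<delta> \<longrightarrow>
       vnorm Y (vadd Y (T y) (vscale Y (-1) (T x))) < \<epsilon>)"

text \<open>
  Functionals are required to be extensional, i.e. to take a fixed dummy value outside the
  carrier, so that equality of functionals is equality on the carrier.
\<close>

definition dual_space :: "'v normed_carrier \<Rightarrow> ('v \<Rightarrow> real) normed_carrier" where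
  "dual_space X =
    \<lparr>elems = {\<phi> \<in> extensional (elems X). linear_between X real_space \<phi> \<and>
                                          continuous_between X real_space \<phi>},
     vadd = (\<lambda>\<phi> \<psi>. \<lambda>x\<in>elems X. \<phi> x + \<psi> x),
     vscale = (\<lambda>c \<phi>. \<lambda>x\<in>elems X. c * \<phi> x),
     vnorm = (\<lambda>\<phi>. SUP x \<in> {x \<in> elems X. vnorm X x \<le> 1}. \<bar>\<phi> x\<bar>)\<rparr>"


section \<open>Lebesgue spaces of classes modulo equality almost everywhere\<close>

definition ae_rel :: "'a measure \<Rightarrow> ('a \<Rightarrow> real) set \<Rightarrow> (('a \<Rightarrow> real) \<times> ('a \<Rightarrow> real)) set" where
  "ae_rel M F = {(f, g). f \<in> F \<and> g \<in> F \<and> (AE x in M. f x = g x)}"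

text \<open>
  The operations on classes are the usual ones by representatives; the seminorm \<open>N\<close> is
  constant on each class in the two instances below.
\<close>

definition ae_quotient ::
    "'a measure \<Rightarrow> ('a \<Rightarrow> real) set \<Rightarrow> (('a \<Rightarrow> real) \<Rightarrow> real) \<Rightarrow> ('a \<Rightarrow> real) set normed_carrier" where
  "ae_quotient M F N =
    \<lparr>elems = F // ae_rel M F,
     vadd = (\<lambda>A B. \<Union>f\<in>A. \<Union>g\<in>B. ae_rel M F `` {\<lambda>x. f x + g x}),
     vscale = (\<lambda>c A. \<Union>f\<in>A. ae_rel M F `` {\<lambda>x. c * f x}),
     vnorm = (\<lambda>A. the_elem (N ` A))\<rparr>"

definition L1_fun :: "'a measure \<Rightarrow> ('a \<Rightarrow> real) set" where
  "L1_fun M = {f. integrable M f}"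

definition Linf_fun :: "'a measure \<Rightarrow> ('a \<Rightarrow> real) set" where
  "Linf_fun M = {g \<in> borel_measurable M. esssup M (\<lambda>x. ennreal \<bar>g x\<bar>) < \<infinity>}"

definition L1_class :: "'a measure \<Rightarrow> ('a \<Rightarrow> real) \<Rightarrow> ('a \<Rightarrow> real) set" where
  "L1_class M f = ae_rel M (L1_fun M) `` {f}"

definition Linf_class :: "'a measure \<Rightarrow> ('a \<Rightarrow> real) \<Rightarrow> ('a \<Rightarrow> real) set" where
  "Linf_class M g = ae_rel M (Linf_fun M) `` {g}"

definition L1_space :: "'a measure \<Rightarrow> ('a \<Rightarrow> real) set normed_carrier" where
  "L1_space M = ae_quotient M (L1_fun M) (\<lambda>f. \<integral>x. \<bar>f x\<bar> \<partial>M)"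

definition Linf_space :: "'a measure \<Rightarrow> ('a \<Rightarrow> real) set normed_carrier" where
  "Linf_space M =
    ae_quotient M (Linf_fun M) (\<lambda>g. enn2real (esssup M (\<lambda>x. ennreal \<bar>g x\<bar>)))"


section \<open>The duality map\<close>

text \<open>
  On classes \<open>G\<close> and \<open>F\<close> the value is the common value of the integral over all pairs of
  representatives; that there is such a common value is part of what is to be proved. The
  projection $p$ is \<^const>\<open>fst\<close>.
\<close>

definition Upsilon ::
    "'m::euclidean_space itself \<Rightarrow> 'a::euclidean_space set \<Rightarrow>
     ('a \<times> 'a set set \<Rightarrow> real) set \<Rightarrow> ('a \<Rightarrow> real) set \<Rightarrow> real" where
  "Upsilon m \<Omega> G =
    (\<lambda>F\<in>elems (L1_space (rect_measure m \<Omega>)).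
       the_elem ((\<lambda>(g, f). \<integral>z. g z * (f \<circ> fst) z \<partial>germ_measure m \<Omega>) ` (G \<times> F)))"

end

theory Submission
  imports Defs "HOL-Probability.Distribution_Functions"
begin

text \<open>
  Write \<open>k\<close> for the dimension and \<open>H\<close> for \<open>k\<close>-dimensional Hausdorff measure.
  Integration against a bounded function is an isometry from \<open>L\<^sup>\<infinity>\<close> onto the dual of \<open>L\<^sup>1\<close> when the measure
  is finite, but on \<open>\<Omega>\<close> the measure \<open>rect_measure\<close> is far from \<open>\<sigma>\<close>-finite: a functional has a density
  \<open>D E\<close> on each rectifiable set \<open>E\<close> separately. Two of them, \<open>D E\<close> and \<open>D E'\<close>, agree \<open>H\<close>-almost
  everywhere on \<open>E \<inter> E'\<close>, but uncountably many exceptional null sets stand in the way of gluing all the densities to one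
  measurable function on \<open>\<Omega>\<close>. The value of \<open>D E\<close> at almost every \<open>x \<in> E\<close> depends only on the germ of \<open>E\<close> at
  \<open>x\<close>, however, so that the densities are glued on the space of germs.

  \<^bold>\<open>The measures.\<close> A rectifiable set has density one at almost all of its points
  (\<open>rectifiable_density_1_ae\<close>), and every measurable set of finite measure has density zero at almost all
  points of its complement (\<open>density_zero_ae\<close>). Hence the points of density one of a rectifiable set form
  a member of the germ base which differs from it by a null set, and two members of the germ base define the
  same germ at almost every common point. It follows that the measures \<open>mu E\<close> form a directed family, so that
  the germ measure is their setwise supremum (\<open>emeasure_germ_measure\<close>), that its image under the projection
  is \<open>rect_measure\<close> (\<open>rect_measure_eq_distr\<close>), and that over a fixed \<open>E\<close> it sees a single germ in
  almost every fibre (\<open>emeasure_Int_fibre\<close>). In particular every measurable set over \<open>E\<close> is, up to a null set,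
  the full preimage of a Borel set.

  \<^bold>\<open>The duality.\<close> If \<open>\<bar>g\<bar>\<close> exceeds \<open>c\<close> on a set of positive measure, then it does so with constant sign on a
  set of positive measure over some \<open>E\<close>, and the normalised indicator of the Borel set below it pairs with
  \<open>g\<close> to at least \<open>c\<close> in modulus (\<open>pairing_lower_bound\<close>); so the map is isometric. Conversely, let \<open>\<phi>\<close> be
  a bounded functional. At almost every \<open>x \<in> E\<close> the density \<open>D E x\<close> is the limit of the
  quotients of \<open>\<phi>\<close> at the indicator of \<open>E \<inter> B(x, r)\<close> by the volume of a \<open>k\<close>-dimensional ball of radius
  \<open>r\<close>, because \<open>E\<close> has density one at \<open>x\<close> and almost every point is a Lebesgue point. This limit does not
  change when \<open>E\<close> is replaced by a set with the same germ at \<open>x\<close>. It is therefore a function of the germ,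
  and this function represents \<open>\<phi>\<close> (\<open>representation\<close>), first on indicators of Borel subsets of the sets \<open>E\<close> and
  then everywhere, since these sets exhaust every set of finite measure.

  \<^bold>\<open>The density theorem.\<close> By Rademacher's theorem almost all of a Lipschitz image consists of images of
  compact sets on which the map is a linear map followed by a map with distortion at most \<open>c\<close>, for any
  \<open>c > 1\<close>, and of the images of points with degenerate derivative, which form a null set (\<open>lipschitz_image_pieces\<close>). The density of
  such a piece lies between powers of \<open>1 / c\<close> and \<open>c\<close>, provided that \<open>H\<close> gives balls of \<open>\<real>\<^sup>k\<close> the right
  volume. That \<open>H\<close> is Lebesgue measure on \<open>\<real>\<^sup>k\<close> rests on the isodiametric inequality, which
  is obtained from the Brunn-Minkowski inequality for unions of boxes (\<open>measure_midpoints\<close>).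
\<close>

section \<open>Hausdorff measure as a metric outer measure\<close>

definition hgauge :: "nat \<Rightarrow> 'a::metric_space set \<Rightarrow> ennreal" where
  "hgauge k U = (if U = {} then 0 else ennreal (unit_ball_vol (real k) * (diameter U / 2) ^ k))"

definition fine_cover :: "real \<Rightarrow> 'a::metric_space set \<Rightarrow> (nat \<Rightarrow> 'a set) \<Rightarrow> bool" where
  "fine_cover \<delta> S U \<longleftrightarrow> S \<subseteq> (\<Union>i. U i) \<and> (\<forall>i. bounded (U i) \<and> diameter (U i) \<le> \<delta>)"

lemma hausdorff_pre_eq: "hausdorff_pre k \<delta> S = (INF U \<in> {U. fine_cover \<delta> S U}. \<Sum>i. hgauge k (U i))"
  unfolding hausdorff_pre_def fine_cover_def hgauge_def ..

lemma hgauge_empty [simp]: "hgauge k {} = 0"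
  by (simp add: hgauge_def)

lemma hgauge_mono: "A \<subseteq> B \<Longrightarrow> bounded B \<Longrightarrow> hgauge k A \<le> hgauge k B"
  unfolding hgauge_def
  by (auto intro!: ennreal_leI mult_left_mono power_mono divide_right_mono diameter_subset
      diameter_ge_0 dest: bounded_subset)

lemma hausdorff_pre_le: "fine_cover \<delta> S U \<Longrightarrow> hausdorff_pre k \<delta> S \<le> (\<Sum>i. hgauge k (U i))"
  unfolding hausdorff_pre_eq by (rule INF_lower) simp

lemma hausdorff_pre_approx:
  assumes "hausdorff_pre k \<delta> S < \<infinity>" "e > 0"
  obtains U where "fine_cover \<delta> S U" "(\<Sum>i. hgauge k (U i)) < hausdorff_pre k \<delta> S + ennreal e"
  using INF_approx_ennreal[OF assms(2) hausdorff_pre_eq[of k \<delta> S]] assms(1) by (force simp: less_top)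

lemma fine_cover_mono: "fine_cover \<delta> S U \<Longrightarrow> T \<subseteq> S \<Longrightarrow> \<delta> \<le> \<delta>' \<Longrightarrow> fine_cover \<delta>' T U"
  unfolding fine_cover_def by (meson order_trans)

lemma hausdorff_pre_mono: "T \<subseteq> S \<Longrightarrow> \<delta> \<le> \<delta>' \<Longrightarrow> hausdorff_pre k \<delta>' T \<le> hausdorff_pre k \<delta> S"
  unfolding hausdorff_pre_eq
  by (rule INF_superset_mono) (auto intro: fine_cover_mono)

lemma fine_cover_Int: "fine_cover \<delta> S U \<Longrightarrow> fine_cover \<delta> (S \<inter> T) (\<lambda>i. U i \<inter> T)"
  unfolding fine_cover_def
  by (auto intro: bounded_subset) (metis Int_lower1 diameter_subset order_trans)

lemma hausdorff_pre_empty: "0 < \<delta> \<Longrightarrow> hausdorff_pre k \<delta> {} = 0"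
  using hausdorff_pre_le[of \<delta> "{}" "\<lambda>_. {}" k] by (simp add: fine_cover_def)

lemma hausdorff_pre_countable_subadditive:
  "hausdorff_pre k \<delta> (\<Union>n. A n) \<le> (\<Sum>n. hausdorff_pre k \<delta> (A n))"
proof (rule ennreal_le_epsilon)
  fix e :: real assume e: "0 < e" and fin: "(\<Sum>n. hausdorff_pre k \<delta> (A n)) < top"
  have "\<exists>U. fine_cover \<delta> (A n) U \<and> 
      (\<Sum>i. hgauge k (U i)) \<le> hausdorff_pre k \<delta> (A n) + ennreal (e * (1/2) ^ Suc n)" for n
  proof -
    have "hausdorff_pre k \<delta> (A n) < \<infinity>"
      using ennreal_suminf_lessD[OF fin, of n] by simp
    then show ?thesis
      by (rule hausdorff_pre_approx[of k \<delta> "A n" "e * (1/2) ^ Suc n"]) (use e in \<open>auto intro: less_imp_le\<close>)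
  qed
  then obtain U where U: "\<And>n. fine_cover \<delta> (A n) (U n)"
    and Ule: "\<And>n. (\<Sum>i. hgauge k (U n i)) \<le> hausdorff_pre k \<delta> (A n) + ennreal (e * (1/2) ^ Suc n)"
    by metis
  \<comment> \<open>The double sequence of covers is enumerated as one sequence.\<close>
  define V where "V = case_prod U \<circ> prod_decode"
  have "fine_cover \<delta> (\<Union>n. A n) V"
    unfolding fine_cover_def
  proof (intro conjI allI)
    show "(\<Union>n. A n) \<subseteq> (\<Union>i. V i)"
    proof
      fix x assume "x \<in> (\<Union>n. A n)"
      then obtain n i where "x \<in> U n i"
        using U unfolding fine_cover_def by blast
      then have "x \<in> V (prod_encode (n, i))" by (simp add: V_def)
      then show "x \<in> (\<Union>i. V i)" by blast
    qed
  qed (use U in \<open>auto simp: V_def fine_cover_def split: prod.split\<close>)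
  then have "hausdorff_pre k \<delta> (\<Union>n. A n) \<le> (\<Sum>i. hgauge k (V i))"
    by (rule hausdorff_pre_le)
  also have "\<dots> = (\<Sum>n. \<Sum>i. hgauge k (U n i))"
    using suminf_ennreal_2dimen[of "\<lambda>n. \<Sum>i. hgauge k (U n i)" "\<lambda>(n, i). hgauge k (U n i)"]
    by (simp add: V_def comp_def case_prod_beta)
  also have "\<dots> \<le> (\<Sum>n. hausdorff_pre k \<delta> (A n) + ennreal (e * (1/2) ^ Suc n))"
    by (intro suminf_le Ule) auto
  also have "\<dots> = (\<Sum>n. hausdorff_pre k \<delta> (A n)) + (\<Sum>n. ennreal (e * (1/2) ^ Suc n))"
    by (subst suminf_add[symmetric]) auto
  also have "(\<Sum>n. ennreal (e * (1/2) ^ Suc n)) = e"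
  proof (rule suminf_ennreal_eq)
    show "(\<lambda>n. e * (1/2) ^ Suc n) sums e"
      using sums_mult[OF power_half_series, of e] by simp
  qed (use e in auto)
  finally show "hausdorff_pre k \<delta> (\<Union>n. A n) \<le> (\<Sum>n. hausdorff_pre k \<delta> (A n)) + ennreal e" .
qed

lemma hausdorff_pre_le_hausdorff: "0 < \<delta> \<Longrightarrow> hausdorff_pre k \<delta> S \<le> hausdorff k S"
  unfolding hausdorff_def by (rule SUP_upper) simp

lemma hausdorff_leI: "(\<And>\<delta>. 0 < \<delta> \<Longrightarrow> hausdorff_pre k \<delta> S \<le> c) \<Longrightarrow> hausdorff k S \<le> c"
  unfolding hausdorff_def by (rule SUP_least) simp

lemma hausdorff_empty [simp]: "hausdorff k {} = 0"
  using hausdorff_leI[of k "{}" 0] by (simp add: hausdorff_pre_empty)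

lemma hausdorff_mono: "T \<subseteq> S \<Longrightarrow> hausdorff k T \<le> hausdorff k S"
  by (rule hausdorff_leI)
    (meson hausdorff_pre_mono hausdorff_pre_le_hausdorff order_refl order_trans)

lemma hausdorff_countable_subadditive: "hausdorff k (\<Union>n. A n) \<le> (\<Sum>n. hausdorff k (A n))"
proof (rule hausdorff_leI)
  fix \<delta> :: real assume "0 < \<delta>"
  have "hausdorff_pre k \<delta> (\<Union>n. A n) \<le> (\<Sum>n. hausdorff_pre k \<delta> (A n))"
    by (rule hausdorff_pre_countable_subadditive)
  also have "\<dots> \<le> (\<Sum>n. hausdorff k (A n))"
    by (intro suminf_le hausdorff_pre_le_hausdorff \<open>0 < \<delta>\<close>) auto
  finally show "hausdorff_pre k \<delta> (\<Union>n. A n) \<le> (\<Sum>n. hausdorff k (A n))" .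
qed

lemma outer_measure_space_hausdorff: "outer_measure_space (Pow UNIV) (hausdorff k)"
  unfolding outer_measure_space_def positive_def increasing_def countably_subadditive_def
  by (auto intro: hausdorff_mono hausdorff_countable_subadditive)

lemma hausdorff_Un: "hausdorff k (A \<union> B) \<le> hausdorff k A + hausdorff k B"
proof -
  have "hausdorff k (\<Union>n. if n = 0 then A else if n = Suc 0 then B else {}) \<le>
     (\<Sum>n. hausdorff k (if n = 0 then A else if n = Suc 0 then B else {}))"
    by (rule hausdorff_countable_subadditive)
  also have "\<dots> = (\<Sum>n<2. hausdorff k (if n = 0 then A else if n = Suc 0 then B else {}))"
    by (rule suminf_finite) auto
  also have "\<dots> = hausdorff k A + hausdorff k B" by (simp add: numeral_2_eq_2)
  also have "(\<Union>n::nat. if n = 0 then A else if n = Suc 0 then B else {}) = A \<union> B"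
    by (auto split: if_splits)
  finally show ?thesis .
qed

lemma hausdorff_null_UN:
  assumes "countable I" "\<And>i. i \<in> I \<Longrightarrow> hausdorff k (A i) = 0"
  shows "hausdorff k (\<Union>i\<in>I. A i) = 0"
proof (cases "I = {}")
  case False
  have "(\<Union>i\<in>I. A i) = (\<Union>n. A (from_nat_into I n))"
    using assms(1) False by (metis image_image range_from_nat_into)
  moreover have "hausdorff k (A (from_nat_into I n)) = 0" for n
    by (simp add: False assms(2) from_nat_into)
  ultimately show ?thesis
    using hausdorff_countable_subadditive[of k "\<lambda>n. A (from_nat_into I n)"] by simp
qed simp

lemma hausdorff_null_Un: "hausdorff k A = 0 \<Longrightarrow> hausdorff k B = 0 \<Longrightarrow> hausdorff k (A \<union> B) = 0"
  using hausdorff_Un[of k A B] by simp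

lemma hausdorff_null_subset: "hausdorff k B = 0 \<Longrightarrow> A \<subseteq> B \<Longrightarrow> hausdorff k A = 0"
  using hausdorff_mono[of A B k] by simp

lemma hausdorff_le_of_diff_null:
  assumes "hausdorff k (A - B) = 0" shows "hausdorff k A \<le> hausdorff k B"
  using hausdorff_mono[of A "B \<union> (A - B)" k] hausdorff_Un[of k B "A - B"] assms by auto

text \<open>On sets a positive distance apart no small set meets both, so any fine cover of the union
  splits into two.\<close>

lemma hausdorff_separated:
  assumes "0 < d" and sep: "\<And>x y. x \<in> A \<Longrightarrow> y \<in> B \<Longrightarrow> d \<le> dist x y"
  shows "hausdorff k A + hausdorff k B \<le> hausdorff k (A \<union> B)"
proof -
  have *: "hausdorff_pre k \<delta> A + hausdorff_pre k \<delta> B \<le> hausdorff_pre k \<delta> (A \<union> B)" if "\<delta> < d" for \<delta>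
    unfolding hausdorff_pre_eq[of k \<delta> "A \<union> B"]
  proof (rule INF_greatest, clarsimp)
    fix U assume U: "fine_cover \<delta> (A \<union> B) U"
    have UA: "fine_cover \<delta> A (\<lambda>i. U i \<inter> A)"
      using fine_cover_Int[OF U, of A] by (simp add: Int_Un_distrib2 Un_Int_eq)
    have UB: "fine_cover \<delta> B (\<lambda>i. U i \<inter> B)"
      using fine_cover_Int[OF U, of B] by (simp add: Un_Int_eq)
    have "hgauge k (U i \<inter> A) + hgauge k (U i \<inter> B) \<le> hgauge k (U i)" for i
    proof -
      have bd: "bounded (U i)" "diameter (U i) \<le> \<delta>" using U by (auto simp: fine_cover_def)
      have "U i \<inter> A = {} \<or> U i \<inter> B = {}"
      proof (rule ccontr)
        assume "\<not> ?thesis"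
        then obtain x y where "x \<in> U i" "y \<in> U i" "x \<in> A" "y \<in> B" by auto
        then show False
          using sep[of x y] diameter_bounded_bound[OF bd(1), of x y] bd(2) that by auto
      qed
      then show ?thesis
        using hgauge_mono[of "U i \<inter> A" "U i" k] hgauge_mono[of "U i \<inter> B" "U i" k] bd by auto
    qed
    then have "(\<Sum>i. hgauge k (U i \<inter> A)) + (\<Sum>i. hgauge k (U i \<inter> B)) \<le> (\<Sum>i. hgauge k (U i))"
      by (subst suminf_add) (auto intro!: suminf_le)
    then show "hausdorff_pre k \<delta> A + hausdorff_pre k \<delta> B \<le> (\<Sum>i. hgauge k (U i))"
      using hausdorff_pre_le[OF UA, of k] hausdorff_pre_le[OF UB, of k]
      by (meson add_mono order_trans)
  qed
  have "hausdorff k A + hausdorff k B = (SUP \<delta>\<in>{0<..}. hausdorff_pre k \<delta> A + hausdorff_pre k \<delta> B)"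
    unfolding hausdorff_def
  proof (rule SUP_add_directed_ennreal[symmetric])
    fix i j :: real assume "i \<in> {0<..}" "j \<in> {0<..}"
    then show "\<exists>m\<in>{0<..}. hausdorff_pre k i A + hausdorff_pre k j B \<le> hausdorff_pre k m A + hausdorff_pre k m B"
      by (intro bexI[of _ "min i j"] add_mono hausdorff_pre_mono) auto
  qed
  also have "\<dots> \<le> hausdorff k (A \<union> B)"
  proof (rule SUP_least)
    fix \<delta> :: real assume "\<delta> \<in> {0<..}"
    then have m: "0 < min \<delta> (d/2)" using \<open>0 < d\<close> by simp
    have "hausdorff_pre k \<delta> A + hausdorff_pre k \<delta> B \<le>
        hausdorff_pre k (min \<delta> (d/2)) A + hausdorff_pre k (min \<delta> (d/2)) B"
      by (intro add_mono hausdorff_pre_mono) auto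
    also have "\<dots> \<le> hausdorff_pre k (min \<delta> (d/2)) (A \<union> B)"
      using \<open>0 < d\<close> by (intro *) auto
    also have "\<dots> \<le> hausdorff k (A \<union> B)"
      by (rule hausdorff_pre_le_hausdorff[OF m])
    finally show "hausdorff_pre k \<delta> A + hausdorff_pre k \<delta> B \<le> hausdorff k (A \<union> B)" .
  qed
  finally show ?thesis .
qed

lemma hausdorff_sets_iff:
  "A \<in> hausdorff_sets k \<longleftrightarrow> (\<forall>T. hausdorff k (T \<inter> A) + hausdorff k (T - A) = hausdorff k T)"
  unfolding hausdorff_sets_def lambda_system_def
  by (auto simp: Int_commute Diff_eq)

lemma hausdorff_setsI:
  assumes "\<And>T. hausdorff k T < \<infinity> \<Longrightarrow> hausdorff k (T \<inter> A) + hausdorff k (T - A) \<le> hausdorff k T"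
  shows "A \<in> hausdorff_sets k"
  unfolding hausdorff_sets_iff
proof (intro allI antisym)
  fix T
  show "hausdorff k (T \<inter> A) + hausdorff k (T - A) \<le> hausdorff k T"
    by (cases "hausdorff k T < \<infinity>") (auto simp: assms less_top[symmetric])
  have "hausdorff k T = hausdorff k ((T \<inter> A) \<union> (T - A))" by (simp add: Int_Diff_Un)
  then show "hausdorff k T \<le> hausdorff k (T \<inter> A) + hausdorff k (T - A)"
    using hausdorff_Un by metis
qed

text \<open>Caratheodory's criterion for a closed set \<open>C\<close>: the test set is exhausted by its parts at
  distance at least \<open>1/(n+1)\<close> from \<open>C\<close>. The layers between consecutive parts, taken with every
  second one left out, are pairwise separated, so their measures are summable and the exhaustion loses nothing.\<close>

lemma closed_in_hausdorff_sets:
  fixes C :: "'a::metric_space set"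
  assumes C: "closed C"
  shows "C \<in> hausdorff_sets k"
proof (cases "C = {}")
  case True then show ?thesis by (simp add: hausdorff_sets_iff)
next
  case ne: False
  show ?thesis
  proof (rule hausdorff_setsI)
    fix T :: "'a set" assume fin: "hausdorff k T < \<infinity>"
    define a where "a n = 1 / real (Suc n)" for n
    have a_less: "a (Suc n) < a n" for n by (simp add: a_def field_simps)
    have a_anti: "m \<le> n \<Longrightarrow> a n \<le> a m" for m n
      by (simp add: a_def field_simps)
    define F where "F n = {x\<in>T. a n \<le> infdist x C}" for n
    define R where "R n = {x\<in>T. a (Suc n) \<le> infdist x C \<and> infdist x C < a n}" for n
    have lip: "infdist x C \<le> infdist y C + dist x y" for x y
      by (rule infdist_triangle)
    \<comment> \<open>The parity \<open>p\<close> selects every second layer; consecutive selected layers are separated by a full layer.\<close>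
    have sepsum: "(\<Sum>j<N. hausdorff k (R (2 * j + p + 1))) \<le> hausdorff k (F (2 * N + p))" for N p
    proof (induction N)
      case (Suc N)
      let ?r = "2 * N + p"
      have "(\<Sum>j<Suc N. hausdorff k (R (2 * j + p + 1))) \<le> hausdorff k (F ?r) + hausdorff k (R (?r + 1))"
        using Suc by (simp add: add_right_mono)
      also have "\<dots> \<le> hausdorff k (F ?r \<union> R (?r + 1))"
      proof (rule hausdorff_separated)
        show "0 < a ?r - a (?r + 1)" using a_less[of ?r] by simp
        show "a ?r - a (?r + 1) \<le> dist x y" if "x \<in> F ?r" "y \<in> R (?r + 1)" for x y
          using that lip[of x y] by (auto simp: F_def R_def)
      qed
      also have "\<dots> \<le> hausdorff k (F (2 * Suc N + p))"
        using a_anti[of ?r "?r + 2"] by (intro hausdorff_mono) (auto simp: F_def R_def)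
      finally show ?case .
    qed simp
    have FT: "hausdorff k (F n) \<le> hausdorff k T" for n
      by (rule hausdorff_mono) (auto simp: F_def)
    have "(\<Sum>n<m. hausdorff k (R (Suc n))) \<le> hausdorff k T + hausdorff k T" for m
    proof -
      have "(\<Sum>n<m. hausdorff k (R (Suc n))) \<le> (\<Sum>n<2*m. hausdorff k (R (Suc n)))"
        by (rule sum_mono2) auto
      also have "\<dots> = (\<Sum>j<m. hausdorff k (R (2 * j + 0 + 1))) + (\<Sum>j<m. hausdorff k (R (2 * j + 1 + 1)))"
        by (induction m) (auto simp: algebra_simps)
      also have "\<dots> \<le> hausdorff k T + hausdorff k T"
        by (intro add_mono order_trans[OF sepsum FT])
      finally show ?thesis .
    qed
    then have "(\<Sum>n. hausdorff k (R (Suc n))) \<le> hausdorff k T + hausdorff k T"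
      by (intro suminf_le_const) auto
    then have sfin: "(\<Sum>n. hausdorff k (R (Suc n))) < \<infinity>"
      using fin by (auto simp: less_top[symmetric] top_unique)
    define r where "r n = enn2real (hausdorff k (R (Suc n)))" for n
    have r: "hausdorff k (R (Suc n)) = ennreal (r n)" for n
      using ennreal_suminf_lessD[of "\<lambda>n. hausdorff k (R (Suc n))" top n] sfin by (simp add: r_def)
    have rnn: "0 \<le> r i" for i by (simp add: r_def)
    have "summable r"
      using sfin by (intro summable_suminf_not_top) (auto simp: r_def r[unfolded r_def, symmetric])
    show "hausdorff k (T \<inter> C) + hausdorff k (T - C) \<le> hausdorff k T"
    proof (rule ennreal_le_epsilon)
      fix e :: real assume "0 < e"
      then obtain n where n: "norm (\<Sum>i. r (i + n)) < e"
        using suminf_exist_split[OF _ \<open>summable r\<close>] by blast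
      have "T - C \<subseteq> F (Suc n) \<union> (\<Union>i. R (Suc (i + n)))"
      proof
        fix x assume x: "x \<in> T - C"
        then have pos: "0 < infdist x C"
          using C ne in_closed_iff_infdist_zero[of C x] infdist_nonneg[of x C] by force
        define M where "M = (LEAST m. a m \<le> infdist x C)"
        obtain m where "a m \<le> infdist x C"
          using reals_Archimedean[OF pos] by (auto simp: a_def inverse_eq_divide intro: less_imp_le)
        then have M: "a M \<le> infdist x C" unfolding M_def by (rule LeastI)
        show "x \<in> F (Suc n) \<union> (\<Union>i. R (Suc (i + n)))"
        proof (cases "M \<le> Suc n")
          case True then show ?thesis
            using x M a_anti[OF True] by (auto simp: F_def)
        next
          case False
          then obtain i where i: "M = Suc (Suc (i + n))"
            by (metis add.commute less_iff_Suc_add not_le plus_nat.simps(2))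
          have "infdist x C < a (Suc (i + n))"
            using not_less_Least[of "Suc (i + n)" "\<lambda>m. a m \<le> infdist x C"] i by (auto simp: M_def)
          then show ?thesis using x M i by (auto simp: R_def)
        qed
      qed
      then have "hausdorff k (T - C) \<le> hausdorff k (F (Suc n) \<union> (\<Union>i. R (Suc (i + n))))"
        by (rule hausdorff_mono)
      also have "\<dots> \<le> hausdorff k (F (Suc n)) + hausdorff k (\<Union>i. R (Suc (i + n)))"
        by (rule hausdorff_Un)
      also have "\<dots> \<le> hausdorff k (F (Suc n)) + (\<Sum>i. hausdorff k (R (Suc (i + n))))"
        by (intro add_left_mono hausdorff_countable_subadditive)
      also have "(\<Sum>i. hausdorff k (R (Suc (i + n)))) = ennreal (\<Sum>i. r (i + n))"
        unfolding r using \<open>summable r\<close> by (intro suminf_ennreal2 summable_ignore_initial_segment) (auto simp add: rnn)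
      also have "\<dots> \<le> ennreal e" using n by (intro ennreal_leI) auto
      finally have "hausdorff k (T \<inter> C) + hausdorff k (T - C) 
          \<le> hausdorff k (T \<inter> C) + (hausdorff k (F (Suc n)) + e)"
        by (meson add_left_mono order_refl order_trans)
      also have "hausdorff k (T \<inter> C) + (hausdorff k (F (Suc n)) + e) =
          hausdorff k (T \<inter> C) + hausdorff k (F (Suc n)) + e" by (simp add: add.assoc)
      also have "hausdorff k (T \<inter> C) + hausdorff k (F (Suc n)) \<le> hausdorff k (T \<inter> C \<union> F (Suc n))"
      proof (rule hausdorff_separated)
        show "0 < a (Suc n)" by (simp add: a_def)
        show "a (Suc n) \<le> dist x y" if "x \<in> T \<inter> C" "y \<in> F (Suc n)" for x y
          using that lip[of y x] by (auto simp: F_def dist_commute)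
      qed
      also have "\<dots> \<le> hausdorff k T" by (rule hausdorff_mono) (auto simp: F_def)
      finally show "hausdorff k (T \<inter> C) + hausdorff k (T - C) \<le> hausdorff k T + ennreal e"
        by (simp add: add_right_mono)
    qed
  qed
qed

lemma measure_space_hausdorff: "measure_space UNIV (hausdorff_sets k) (hausdorff k)"
  unfolding hausdorff_sets_def
  by (rule sigma_algebra.caratheodory_lemma[OF sigma_algebra_Pow outer_measure_space_hausdorff])

lemma sigma_algebra_hausdorff_sets: "sigma_algebra UNIV (hausdorff_sets k)"
  using measure_space_hausdorff by (auto simp: measure_space_def)

lemma borel_subset_hausdorff_sets: "sets borel \<subseteq> hausdorff_sets k"
  unfolding borel_eq_closed sets_measure_of[OF subset_UNIV[of "Collect closed", folded Pow_UNIV]]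
  by (rule sigma_algebra.sigma_sets_subset[OF sigma_algebra_hausdorff_sets])
    (auto intro: closed_in_hausdorff_sets)

lemma null_in_hausdorff_sets: 
  assumes "hausdorff k N = 0" shows "N \<in> hausdorff_sets k"
proof (rule hausdorff_setsI)
  fix T
  show "hausdorff k (T \<inter> N) + hausdorff k (T - N) \<le> hausdorff k T"
    using hausdorff_null_subset[OF assms, of "T \<inter> N"] hausdorff_mono[of "T - N" T k] by auto
qed

definition hausdorff_measure :: "nat \<Rightarrow> 'a::metric_space measure" where
  "hausdorff_measure k = measure_of UNIV (hausdorff_sets k) (hausdorff k)"

lemma space_hausdorff_measure [simp]: "space (hausdorff_measure k) = UNIV"
  by (simp add: hausdorff_measure_def)

lemma sets_hausdorff_measure [simp]: "sets (hausdorff_measure k) = hausdorff_sets k"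
  unfolding hausdorff_measure_def
  using sigma_algebra.sets_measure_of_eq[OF sigma_algebra_hausdorff_sets] by metis

lemma emeasure_hausdorff_measure:
  "A \<in> hausdorff_sets k \<Longrightarrow> emeasure (hausdorff_measure k) A = hausdorff k A"
  unfolding hausdorff_measure_def
  using measure_space_hausdorff[of k]
  by (intro emeasure_measure_of_sigma) (auto simp: measure_space_def)

lemma hausdorff_sets_Int: "A \<in> hausdorff_sets k \<Longrightarrow> B \<in> hausdorff_sets k \<Longrightarrow> A \<inter> B \<in> hausdorff_sets k"
  and hausdorff_sets_Un: "A \<in> hausdorff_sets k \<Longrightarrow> B \<in> hausdorff_sets k \<Longrightarrow> A \<union> B \<in> hausdorff_sets k"
  and hausdorff_sets_Diff: "A \<in> hausdorff_sets k \<Longrightarrow> B \<in> hausdorff_sets k \<Longrightarrow> A - B \<in> hausdorff_sets k"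
  using sets.Int[of A "hausdorff_measure k" B] sets.Un[of A "hausdorff_measure k" B]
    sets.Diff[of A "hausdorff_measure k" B] by simp_all

lemma hausdorff_sets_cong_null:
  assumes "A \<in> hausdorff_sets k" "hausdorff k (A - B) = 0" "hausdorff k (B - A) = 0"
  shows "B \<in> hausdorff_sets k"
proof -
  have "B = (A - (A - B)) \<union> (B - A)" by auto
  then show ?thesis
    using assms by (metis hausdorff_sets_Diff hausdorff_sets_Un null_in_hausdorff_sets)
qed

lemma hausdorff_add_Diff:
  "A \<in> hausdorff_sets k \<Longrightarrow> hausdorff k T = hausdorff k (T \<inter> A) + hausdorff k (T - A)"
  by (simp add: hausdorff_sets_iff)

text \<open>Borel regularity: passing to closures changes neither the diameters nor the gauge of a cover,
  so \<open>S\<close> may be enlarged to a countable intersection of countable unions of closed sets.\<close>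

lemma hausdorff_borel_hull:
  fixes S :: "'a::metric_space set"
  obtains B where "B \<in> sets borel" "S \<subseteq> B" "hausdorff k B = hausdorff k S"
proof (cases "hausdorff k S < \<infinity>")
  case False
  then have "hausdorff k (UNIV::'a set) = hausdorff k S"
    using hausdorff_mono[of S UNIV k] by (simp add: less_top[symmetric] top_unique)
  then show ?thesis using that[of UNIV] by auto
next
  case True
  define d where "d n = 1 / real (Suc n)" for n
  have d: "0 < d n" for n by (simp add: d_def)
  have "\<exists>U. fine_cover (d n) S U \<and> (\<Sum>i. hgauge k (U i)) \<le> hausdorff_pre k (d n) S + ennreal (d n)" for n
    using hausdorff_pre_approx[OF order_le_less_trans[OF hausdorff_pre_le_hausdorff[OF d] True] d]
    by (metis less_imp_le)
  then obtain U where U: "\<And>n. fine_cover (d n) S (U n)"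
    and Ule: "\<And>n. (\<Sum>i. hgauge k (U n i)) \<le> hausdorff_pre k (d n) S + ennreal (d n)"
    by metis
  define B where "B = (\<Inter>n. \<Union>i. closure (U n i))"
  have SB: "S \<subseteq> B"
    using U closure_subset unfolding B_def fine_cover_def by (meson INT_greatest SUP_mono' order_trans)
  have le: "hausdorff k B \<le> hausdorff k S"
  proof (rule hausdorff_leI)
    fix \<delta> :: real assume "0 < \<delta>"
    show "hausdorff_pre k \<delta> B \<le> hausdorff k S"
    proof (rule ennreal_le_epsilon)
      fix e :: real assume "0 < e"
      obtain n where "inverse (real (Suc n)) < min \<delta> e"
        using reals_Archimedean[of "min \<delta> e"] \<open>0 < \<delta>\<close> \<open>0 < e\<close> by auto
      then have n: "d n \<le> \<delta>" "d n \<le> e" by (auto simp: d_def inverse_eq_divide)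
      have gc: "hgauge k (closure A) = hgauge k A" if "bounded A" for A :: "'a set"
        using diameter_closure[OF that] closure_eq_empty[of A] by (simp add: hgauge_def)
      have "hausdorff_pre k \<delta> B \<le> (\<Sum>i. hgauge k (closure (U n i)))"
        using U[of n] n(1) by (intro hausdorff_pre_le)
          (auto simp: fine_cover_def B_def diameter_closure intro: order_trans)
      also have "\<dots> = (\<Sum>i. hgauge k (U n i))"
        using U[of n] by (intro suminf_cong gc) (auto simp: fine_cover_def)
      also have "\<dots> \<le> hausdorff_pre k (d n) S + ennreal (d n)" by (rule Ule)
      also have "\<dots> \<le> hausdorff k S + ennreal e"
        using n by (intro add_mono hausdorff_pre_le_hausdorff d ennreal_leI)
      finally show "hausdorff_pre k \<delta> B \<le> hausdorff k S + ennreal e" .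
    qed
  qed
  show ?thesis
  proof (rule that)
    show "B \<in> sets borel" unfolding B_def by (intro sets.countable_INT'' sets.countable_UN' ) auto
    show "hausdorff k B = hausdorff k S" using le hausdorff_mono[OF SB, of k] by (rule antisym)
  qed (rule SB)
qed

text \<open>A Borel hull of \<open>A\<close> exceeds \<open>A\<close> by a null set; removing a Borel hull of this null set leaves a
  Borel part of \<open>A\<close>.\<close>

lemma hausdorff_sets_inner_borel:
  assumes A: "A \<in> hausdorff_sets k" and fin: "hausdorff k A < \<infinity>"
  obtains B where "B \<in> sets borel" "B \<subseteq> A" "hausdorff k (A - B) = 0"
proof -
  obtain H where H: "H \<in> sets borel" "A \<subseteq> H" "hausdorff k H = hausdorff k A"
    by (rule hausdorff_borel_hull)
  have "hausdorff k H = hausdorff k A + hausdorff k (H - A)"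
    using hausdorff_add_Diff[OF A, of H] H(2) by (simp add: Int_absorb1)
  then have "hausdorff k (H - A) = 0"
    using H(3) fin by (metis add.right_neutral ennreal_add_left_cancel infinity_ennreal_def less_irrefl)
  moreover obtain N where N: "N \<in> sets borel" "H - A \<subseteq> N" "hausdorff k N = hausdorff k (H - A)"
    by (rule hausdorff_borel_hull)
  ultimately have "hausdorff k (A - (H - N)) = 0"
    using H(2) by (auto intro: hausdorff_null_subset)
  then show ?thesis using that[of "H - N"] H N by auto
qed

text \<open>The images of the members of a fine cover form a cover of the image, and diameters grow at most by
  the factor \<open>L\<close>.\<close>

lemma hausdorff_lipschitz_image:
  fixes f :: "'a::metric_space \<Rightarrow> 'b::metric_space"
  assumes f: "L-lipschitz_on A f"
  shows "hausdorff k (f ` A) \<le> ennreal (L ^ k) * hausdorff k A"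
proof (rule hausdorff_leI)
  fix \<delta>' :: real assume "0 < \<delta>'"
  have L: "0 \<le> L" using f by (rule lipschitz_on_nonneg)
  define \<delta> where "\<delta> = \<delta>' / (L + 1)"
  have \<delta>: "0 < \<delta>" "L * \<delta> \<le> \<delta>'" using \<open>0 < \<delta>'\<close> L by (auto simp: \<delta>_def field_simps)
  have diam: "bounded (f ` V)" "diameter (f ` V) \<le> L * diameter V"
    if "bounded V" "V \<subseteq> A" for V
  proof -
    have *: "dist (f x) (f y) \<le> L * diameter V" if "x \<in> V" "y \<in> V" for x y
    proof -
      have "dist (f x) (f y) \<le> L * dist x y"
        using \<open>V \<subseteq> A\<close> that by (intro lipschitz_onD[OF f]) auto
      also have "\<dots> \<le> L * diameter V"
        by (intro mult_left_mono diameter_bounded_bound \<open>bounded V\<close> that L)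
      finally show ?thesis .
    qed
    show "bounded (f ` V)" using * by (auto simp: bounded_two_points)
    show "diameter (f ` V) \<le> L * diameter V"
      using * by (auto simp: diameter_def[of "f ` V"] intro!: cSUP_least)
  qed
  show "hausdorff_pre k \<delta>' (f ` A) \<le> ennreal (L ^ k) * hausdorff k A"
  proof (cases "hausdorff k A < \<infinity>")
    case False
    show ?thesis
    proof (cases "L ^ k = 0")
      case False then show ?thesis using \<open>\<not> hausdorff k A < \<infinity>\<close> L
        by (simp add: less_top[symmetric] ennreal_mult_eq_top_iff)
    next
      case True
      \<comment> \<open>\<open>f\<close> is constant and \<open>k > 0\<close>\<close>
      then have "L = 0" "0 < k" by (auto intro: gr0I)
      have "f x = f y" if "x \<in> A" "y \<in> A" for x y
        using lipschitz_onD[OF f that] \<open>L = 0\<close> by simp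
      then obtain c where c: "f ` A \<subseteq> {c}" by (metis image_subsetI insertI1)
      have "hausdorff_pre k \<delta>' (f ` A) \<le> (\<Sum>i::nat. hgauge k ({c}))"
        using c \<open>0 < \<delta>'\<close> by (intro hausdorff_pre_le) (auto simp: fine_cover_def)
      then show ?thesis using \<open>0 < k\<close> by (simp add: hgauge_def zero_power)
    qed
  next
    case True
    show ?thesis
    proof (rule ennreal_le_epsilon)
      fix e :: real assume "0 < e"
      define e' where "e' = e / (L ^ k + 1)"
      have Lk: "0 \<le> L ^ k" using L by simp
      have e': "0 < e'" unfolding e'_def using \<open>0 < e\<close> Lk by (intro divide_pos_pos) auto
      have "e = (L ^ k + 1) * e'" unfolding e'_def using Lk by simp
      then have "e = L ^ k * e' + e'" by (simp add: algebra_simps)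
      with e' have e'_le: "L ^ k * e' \<le> e" by linarith
      obtain U where U: "fine_cover \<delta> A U"
        and Ule: "(\<Sum>i. hgauge k (U i)) < hausdorff_pre k \<delta> A + ennreal e'"
        by (rule hausdorff_pre_approx[OF order_le_less_trans[OF hausdorff_pre_le_hausdorff[OF \<delta>(1)] True] e'])
      have bd: "bounded (U i \<inter> A)" "diameter (U i \<inter> A) \<le> diameter (U i)" "diameter (U i) \<le> \<delta>" for i
        using U by (auto simp: fine_cover_def intro: bounded_subset diameter_subset)
      have "fine_cover \<delta>' (f ` A) (\<lambda>i. f ` (U i \<inter> A))"
        unfolding fine_cover_def
      proof (intro conjI allI)
        fix i
        have "diameter (f ` (U i \<inter> A)) \<le> L * diameter (U i \<inter> A)" by (intro diam bd) auto
        also have "\<dots> \<le> L * \<delta>" using bd[of i] L by (intro mult_left_mono) auto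
        finally show "diameter (f ` (U i \<inter> A)) \<le> \<delta>'" using \<delta>(2) by simp
        show "bounded (f ` (U i \<inter> A))" by (intro diam bd) auto
      next
        show "f ` A \<subseteq> (\<Union>i. f ` (U i \<inter> A))" using U unfolding fine_cover_def by blast
      qed
      then have "hausdorff_pre k \<delta>' (f ` A) \<le> (\<Sum>i. hgauge k (f ` (U i \<inter> A)))"
        by (rule hausdorff_pre_le)
      also have "\<dots> \<le> (\<Sum>i. ennreal (L ^ k) * hgauge k (U i))"
      proof (intro suminf_le allI)
        fix i
        show "hgauge k (f ` (U i \<inter> A)) \<le> ennreal (L ^ k) * hgauge k (U i)"
        proof (cases "U i \<inter> A = {}")
          case False
          have "unit_ball_vol (real k) * (diameter (f ` (U i \<inter> A)) / 2) ^ k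
              \<le> unit_ball_vol (real k) * (L * diameter (U i) / 2) ^ k"
          proof (intro mult_left_mono power_mono divide_right_mono)
            have "diameter (f ` (U i \<inter> A)) \<le> L * diameter (U i \<inter> A)" by (intro diam bd) auto
            also have "\<dots> \<le> L * diameter (U i)" using bd[of i] L by (intro mult_left_mono) auto
            finally show "diameter (f ` (U i \<inter> A)) \<le> L * diameter (U i)" .
          qed (use diameter_ge_0[OF diam(1)[OF bd(1)], of i] in auto)
          also have "\<dots> = L ^ k * (unit_ball_vol (real k) * (diameter (U i) / 2) ^ k)"
            by (simp add: power_mult_distrib power_divide)
          finally show ?thesis
            using False L by (auto simp: hgauge_def ennreal_mult'[symmetric] intro!: ennreal_leI)
        qed simp
      qed auto
      also have "\<dots> = ennreal (L ^ k) * (\<Sum>i. hgauge k (U i))" by simp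
      also have "\<dots> \<le> ennreal (L ^ k) * (hausdorff k A + ennreal e')"
        using order_trans[OF less_imp_le[OF Ule] add_right_mono[OF hausdorff_pre_le_hausdorff[OF \<delta>(1)]]]
        by (rule mult_left_mono) simp
      also have "\<dots> = ennreal (L ^ k) * hausdorff k A + ennreal (L ^ k * e')"
        using L e' by (simp add: distrib_left ennreal_mult)
      also have "\<dots> \<le> ennreal (L ^ k) * hausdorff k A + ennreal e"
        using e'_le by (intro add_left_mono ennreal_leI)
      finally show "hausdorff_pre k \<delta>' (f ` A) \<le> ennreal (L ^ k) * hausdorff k A + ennreal e" .
    qed
  qed
qed

section \<open>Vitali coverings and points of density zero\<close>

text \<open>For every set \<open>E\<close>, measurable or not, the trace of Hausdorff measure on \<open>E\<close> is a Borel measure.\<close>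

definition hausdorff_on :: "nat \<Rightarrow> 'a::metric_space set \<Rightarrow> 'a measure" where
  "hausdorff_on k E = measure_of UNIV (sets borel) (\<lambda>A. hausdorff k (A \<inter> E))"

lemma space_hausdorff_on [simp]: "space (hausdorff_on k E) = UNIV"
  by (simp add: hausdorff_on_def)

lemma sets_hausdorff_on [simp]: "sets (hausdorff_on k E) = sets borel"
  unfolding hausdorff_on_def using sets.sets_measure_of_eq[of borel] by simp

lemma emeasure_hausdorff_on:
  assumes "A \<in> sets borel"
  shows "emeasure (hausdorff_on k E) A = hausdorff k (A \<inter> E)"
  unfolding hausdorff_on_def
proof (rule emeasure_measure_of_sigma)
  show "sigma_algebra UNIV (sets (borel :: 'a measure))"
    using sets.sigma_algebra_axioms[of borel] by simp
  show "positive (sets borel) (\<lambda>A. hausdorff k (A \<inter> E))"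
    by (simp add: positive_def)
  show "countably_additive (sets borel) (\<lambda>A. hausdorff k (A \<inter> E))"
  proof (rule countably_additiveI)
    fix A :: "nat \<Rightarrow> 'a set"
    assume A: "range A \<subseteq> sets borel" "disjoint_family A"
    have meas: "A i \<in> hausdorff_sets k" for i
      using A(1) borel_subset_hausdorff_sets by blast
    have fin: "(\<Sum>i<n. hausdorff k (A i \<inter> E)) \<le> hausdorff k ((\<Union>i<n. A i) \<inter> E)" for n
    proof (induction n)
      case (Suc n)
      have "((\<Union>i<Suc n. A i) \<inter> E) \<inter> A n = A n \<inter> E"
        "((\<Union>i<Suc n. A i) \<inter> E) - A n = (\<Union>i<n. A i) \<inter> E"
        using A(2) by (auto simp: lessThan_Suc disjoint_family_on_def disjoint_iff) (metis less_irrefl)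
      then show ?case
        using hausdorff_add_Diff[OF meas[of n], of "(\<Union>i<Suc n. A i) \<inter> E"] Suc
        by (simp add: add.commute add_mono)
    qed simp
    show "(\<Sum>i. hausdorff k (A i \<inter> E)) = hausdorff k (\<Union> (range A) \<inter> E)"
    proof (rule antisym)
      show "(\<Sum>i. hausdorff k (A i \<inter> E)) \<le> hausdorff k (\<Union> (range A) \<inter> E)"
        by (intro suminf_le_const order_trans[OF fin] hausdorff_mono) auto
      show "hausdorff k (\<Union> (range A) \<inter> E) \<le> (\<Sum>i. hausdorff k (A i \<inter> E))"
        using hausdorff_countable_subadditive[of k "\<lambda>i. A i \<inter> E"] by simp
    qed
  qed
qed (use assms in auto)

lemma finite_measure_hausdorff_on:
  "hausdorff k E < \<infinity> \<Longrightarrow> finite_measure (hausdorff_on k E)"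
  by (intro finite_measureI) (simp add: emeasure_hausdorff_on)

text \<open>Vitali's covering results give families over arbitrary countable index sets, whereas covers are
  sequences; the family is padded with empty sets, whose gauge is \<open>0\<close>.\<close>

lemma hausdorff_pre_le_finite_sums:
  assumes I: "countable I" and S: "S \<subseteq> (\<Union>i\<in>I. V i)"
    and V: "\<And>i. i \<in> I \<Longrightarrow> bounded (V i) \<and> diameter (V i) \<le> \<delta>" and "0 \<le> \<delta>"
    and le: "\<And>F. finite F \<Longrightarrow> F \<subseteq> I \<Longrightarrow> (\<Sum>i\<in>F. hgauge k (V i)) \<le> c"
  shows "hausdorff_pre k \<delta> S \<le> c"
proof -
  define W where "W n = (if n \<in> to_nat_on I ` I then V (from_nat_into I n) else {})" for n
  have inv: "from_nat_into I (to_nat_on I i) = i" if "i \<in> I" for i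
    using I that by simp
  have "fine_cover \<delta> S W"
    unfolding fine_cover_def
  proof (intro conjI allI)
    show "S \<subseteq> (\<Union>n. W n)"
    proof
      fix x assume "x \<in> S"
      then obtain i where "i \<in> I" "x \<in> V i" using S by blast
      then have "x \<in> W (to_nat_on I i)" by (simp add: W_def inv)
      then show "x \<in> (\<Union>n. W n)" by blast
    qed
  qed (use V inv \<open>0 \<le> \<delta>\<close> in \<open>auto simp: W_def\<close>)
  then have "hausdorff_pre k \<delta> S \<le> (\<Sum>n. hgauge k (W n))" by (rule hausdorff_pre_le)
  also have "\<dots> \<le> c"
  proof (rule suminf_le_const)
    fix n
    let ?J = "{..<n} \<inter> to_nat_on I ` I"
    have inj: "inj_on (from_nat_into I) ?J" by (rule inj_onI) (use inv in auto)
    have "(\<Sum>m<n. hgauge k (W m)) = (\<Sum>m\<in>?J. hgauge k (V (from_nat_into I m)))"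
      by (rule sum.mono_neutral_cong_right) (auto simp: W_def)
    also have "\<dots> = (\<Sum>i\<in>from_nat_into I ` ?J. hgauge k (V i))"
      by (simp add: sum.reindex[OF inj])
    also have "\<dots> \<le> c" by (rule le) (use inv in auto)
    finally show "(\<Sum>m<n. hgauge k (W m)) \<le> c" .
  qed simp
  finally show ?thesis .
qed

lemma hgauge_cball:
  fixes x :: "'a::euclidean_space"
  shows "0 \<le> r \<Longrightarrow> hgauge k (cball x r) = ennreal (unit_ball_vol (real k) * r ^ k)"
  by (simp add: hgauge_def)

text \<open>By Vitali's covering lemma the small balls around the points of \<open>S\<close> which lie in \<open>U\<close> and have
  enough \<open>M\<close>-measure contain a disjoint family whose fivefold enlargements cover \<open>S\<close>.\<close>

lemma hausdorff_le_of_fine_balls: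
  fixes M :: "'a::euclidean_space measure"
  assumes M: "sets M = sets borel" and U: "open U" "S \<subseteq> U" and "0 < t"
    and fine: "\<And>x d. x \<in> S \<Longrightarrow> 0 < d \<Longrightarrow>
      \<exists>r. 0 < r \<and> r < d \<and> ennreal (t * (unit_ball_vol (real k) * r ^ k)) \<le> emeasure M (cball x r)"
  shows "hausdorff k S \<le> ennreal (5 ^ k / t) * emeasure M U"
proof (rule hausdorff_leI)
  fix \<delta> :: real assume "0 < \<delta>"
  let ?v = "unit_ball_vol (real k)"
  \<comment> \<open>The enlarged balls of radius at most \<open>5 * (\<delta> / 10)\<close> have diameter at most \<open>\<delta>\<close>.\<close>
  define K where "K = {(x, r). x \<in> S \<and> 0 < r \<and> r \<le> \<delta> / 10 \<and> cball x r \<subseteq> U \<and>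
     ennreal (t * (?v * r ^ k)) \<le> emeasure M (cball x r)}"
  have cov: "S \<subseteq> (\<Union>i\<in>K. cball (fst i) (snd i))"
  proof
    fix x assume x: "x \<in> S"
    obtain e where e: "0 < e" "cball x e \<subseteq> U" using U x by (meson open_contains_cball subsetD)
    obtain r where r: "0 < r" "r < min e (\<delta> / 10)"
       "ennreal (t * (?v * r ^ k)) \<le> emeasure M (cball x r)"
      using fine[OF x, of "min e (\<delta> / 10)"] e \<open>0 < \<delta>\<close> by auto
    then have "(x, r) \<in> K" using x e by (auto simp: K_def)
    then show "x \<in> (\<Union>i\<in>K. cball (fst i) (snd i))" using r by force
  qed
  have r: "0 < snd i \<and> snd i \<le> \<delta> / 10" if "i \<in> K" for i using that by (auto simp: K_def)
  obtain C where C: "countable C" "C \<subseteq> K"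
     "pairwise (\<lambda>i j. disjnt (cball (fst i) (snd i)) (cball (fst j) (snd j))) C"
     "S \<subseteq> (\<Union>i\<in>C. cball (fst i) (5 * snd i))"
    using Vitali_covering_lemma_cballs[OF cov r] .
  show "hausdorff_pre k \<delta> S \<le> ennreal (5 ^ k / t) * emeasure M U"
  proof (rule hausdorff_pre_le_finite_sums[OF C(1,4)])
    show "bounded (cball (fst i) (5 * snd i)) \<and> diameter (cball (fst i) (5 * snd i)) \<le> \<delta>" if "i \<in> C" for i
      using that C(2) by (auto simp: K_def)
    fix F assume F: "finite F" "F \<subseteq> C"
    have "(\<Sum>i\<in>F. hgauge k (cball (fst i) (5 * snd i))) 
        \<le> (\<Sum>i\<in>F. ennreal (5 ^ k / t) * emeasure M (cball (fst i) (snd i)))"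
    proof (rule sum_mono)
      fix i assume "i \<in> F"
      then have i: "0 < snd i" "ennreal (t * (?v * snd i ^ k)) \<le> emeasure M (cball (fst i) (snd i))"
        using F C(2) by (auto simp: K_def)
      have "?v * (5 * snd i) ^ k = 5 ^ k / t * (t * (?v * snd i ^ k))"
        using \<open>0 < t\<close> by (simp add: power_mult_distrib)
      then have "hgauge k (cball (fst i) (5 * snd i)) = ennreal (5 ^ k / t * (t * (?v * snd i ^ k)))"
        using hgauge_cball[of "5 * snd i" k "fst i"] i(1) by simp
      also have "\<dots> = ennreal (5 ^ k / t) * ennreal (t * (?v * snd i ^ k))"
        using \<open>0 < t\<close> i by (intro ennreal_mult) auto
      also have "\<dots> \<le> ennreal (5 ^ k / t) * emeasure M (cball (fst i) (snd i))"
        by (intro mult_left_mono i) auto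
      finally show "hgauge k (cball (fst i) (5 * snd i)) \<le> ennreal (5 ^ k / t) * emeasure M (cball (fst i) (snd i))" .
    qed
    also have "\<dots> = ennreal (5 ^ k / t) * (\<Sum>i\<in>F. emeasure M (cball (fst i) (snd i)))"
      by (simp add: sum_distrib_left)
    also have "(\<Sum>i\<in>F. emeasure M (cball (fst i) (snd i))) = emeasure M (\<Union>i\<in>F. cball (fst i) (snd i))"
    proof (rule sum_emeasure)
      show "(\<lambda>i. cball (fst i) (snd i)) ` F \<subseteq> sets M"
        unfolding M by (rule image_subsetI) simp
      show "disjoint_family_on (\<lambda>i. cball (fst i) (snd i)) F"
        using pairwise_subset[OF C(3) F(2)]
        unfolding disjoint_family_on_def pairwise_def disjnt_def by blast
    qed (rule F(1))
    also have "\<dots> \<le> emeasure M U"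
    proof (rule emeasure_mono)
      have "cball (fst i) (snd i) \<subseteq> U" if "i \<in> F" for i
        using that F(2) C(2) unfolding K_def by fastforce
      then show "(\<Union>i\<in>F. cball (fst i) (snd i)) \<subseteq> U" by blast
    qed (use M U in simp)
    finally show "(\<Sum>i\<in>F. hgauge k (cball (fst i) (5 * snd i))) \<le> ennreal (5 ^ k / t) * emeasure M U"
      by (simp add: mult_left_mono)
  qed (use \<open>0 < \<delta>\<close> in auto)
qed

definition ball_ratio :: "nat \<Rightarrow> 'a::metric_space measure \<Rightarrow> 'a \<Rightarrow> real \<Rightarrow> ennreal" where
  "ball_ratio k M x r = emeasure M (cball x r) / ennreal (unit_ball_vol (real k) * r ^ k)"

lemma has_density_iff: "has_density k E x \<theta> \<longleftrightarrow> (ball_ratio k (hausdorff_on k E) x \<longlongrightarrow> \<theta>) (at_right 0)"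
  unfolding has_density_def ball_ratio_def
  by (simp add: emeasure_hausdorff_on Int_commute)

lemma unit_ball_vol_power_pos: "0 < r \<Longrightarrow> 0 < unit_ball_vol (real k) * r ^ k"
  by simp

lemma le_ball_ratio_iff:
  assumes "0 < r" "0 \<le> t"
  shows "ennreal t \<le> ball_ratio k M x r \<longleftrightarrow> ennreal (t * (unit_ball_vol (real k) * r ^ k)) \<le> emeasure M (cball x r)"
proof -
  let ?c = "unit_ball_vol (real k) * r ^ k"
  have c: "0 < ?c" using assms(1) by (rule unit_ball_vol_power_pos)
  show ?thesis
  proof (cases "emeasure M (cball x r)")
    case (real m)
    then show ?thesis using c assms(2)
      by (simp add: ball_ratio_def divide_ennreal pos_le_divide_eq)
  next
    case top
    then show ?thesis by (simp add: ball_ratio_def ennreal_top_divide)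
  qed
qed

text \<open>If \<open>M\<close> lives on \<open>N\<close>, then it nearly lives on a compact part of \<open>N\<close>; the balls of large
  \<open>M\<close>-measure around points outside \<open>N\<close> can be kept away from this part, so there is little 
  \<open>M\<close>-measure left to be covered by them.\<close>

lemma ball_ratio_tendsto_0_ae:
  fixes M :: "'a::euclidean_space measure"
  assumes M: "sets M = sets borel" "emeasure M (space M) < \<infinity>"
    and N: "N \<in> sets borel" "emeasure M (- N) = 0"
  shows "hausdorff k {x. x \<notin> N \<and> \<not> (ball_ratio k M x \<longlongrightarrow> 0) (at_right 0)} = 0"
proof -
  interpret finite_measure M using M(2) by (intro finite_measureI) auto
  define B where "B m = {x. x \<notin> N \<and> (\<forall>d>0. \<exists>r. 0 < r \<and> r < d \<and>
      ennreal (1 / Suc m) \<le> ball_ratio k M x r)}" for m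
  have "hausdorff k (B m) = 0" for m
  proof -
    define c where "c = 5 ^ k / (1 / real (Suc m))"
    have c: "0 < c" by (simp add: c_def)
    have le: "hausdorff k (B m) \<le> 0 + ennreal e" if "0 < e" for e
    proof -
      have N_eq: "emeasure M N = (SUP K\<in>{K. K \<subseteq> N \<and> compact K}. emeasure M K)"
        using M(2) by (intro inner_regular M(1) N(1)) auto
      obtain K where K: "K \<subseteq> N" "compact K" "emeasure M N < emeasure M K + ennreal (e / c)"
      proof -
        have ne: "{K. K \<subseteq> N \<and> compact K} \<noteq> {}" by (metis (mono_tags) compact_empty empty_iff empty_subsetI mem_Collect_eq)
        have "0 < e / c" using \<open>0 < e\<close> c by (rule divide_pos_pos)
        from SUP_approx_ennreal[OF this ne N_eq] show ?thesis
          using emeasure_finite[of N] that by auto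
      qed
      have Kb: "K \<in> sets M" using K(2) M(1) by (simp add: compact_imp_closed)
      have "emeasure M (- K) \<le> emeasure M (- N \<union> (N - K))"
        using N Kb M by (intro emeasure_mono) auto
      also have "\<dots> \<le> emeasure M (- N) + emeasure M (N - K)"
        using N Kb M by (intro emeasure_subadditive) auto
      also have "\<dots> = emeasure M N - emeasure M K"
        using N Kb K M by (simp add: emeasure_Diff)
      also have "\<dots> \<le> ennreal (e / c)"
        using K(3) emeasure_finite[of K] by (intro ennreal_minus_le_iff[THEN iffD2] disjI2 conjI) 
          (auto simp: add.commute less_imp_le)
      finally have small: "emeasure M (- K) \<le> ennreal (e / c)" .
      have "hausdorff k (B m) \<le> ennreal c * emeasure M (- K)"
        unfolding c_def
      proof (rule hausdorff_le_of_fine_balls[OF M(1)])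
        show "open (- K)" using K(2) by (simp add: compact_imp_closed open_Compl)
        show "B m \<subseteq> - K" using K(1) by (auto simp: B_def)
        fix x and d :: real assume "x \<in> B m" "0 < d"
        then obtain r where "0 < r" "r < d" "ennreal (1 / Suc m) \<le> ball_ratio k M x r"
          by (auto simp: B_def)
        then show "\<exists>r. 0 < r \<and> r < d \<and> ennreal (1 / real (Suc m) * (unit_ball_vol (real k) * r ^ k)) \<le> emeasure M (cball x r)"
          by (intro exI[of _ r]) (auto simp: le_ball_ratio_iff)
      qed simp
      also have "\<dots> \<le> ennreal c * ennreal (e / c)" by (intro mult_left_mono small) auto
      also have "\<dots> = ennreal e"
        using c \<open>0 < e\<close> by (simp add: ennreal_mult[symmetric])
      finally show ?thesis by simp
    qed
    have "hausdorff k (B m) \<le> 0" by (rule ennreal_le_epsilon) (rule le)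
    then show ?thesis by simp
  qed
  then have "hausdorff k (\<Union>m. B m) = 0" by (intro hausdorff_null_UN) auto
  moreover have "{x. x \<notin> N \<and> \<not> (ball_ratio k M x \<longlongrightarrow> 0) (at_right 0)} \<subseteq> (\<Union>m. B m)"
  proof safe
    fix x assume x: "x \<notin> N" "\<not> (ball_ratio k M x \<longlongrightarrow> 0) (at_right 0)"
    obtain a where a: "0 < a" "\<not> (\<forall>\<^sub>F r in at_right 0. ball_ratio k M x r < a)"
      using x(2) by (auto simp: order_tendsto_iff)
    obtain c where c: "0 < c" "ennreal c < a"
    proof (cases a)
      case (real s) then show ?thesis using a(1) that[of "s / 2"] by (simp add: ennreal_less_iff)
    next
      case top then show ?thesis using that[of 1] by simp
    qed
    obtain m where m: "inverse (real (Suc m)) < c" using reals_Archimedean[OF c(1)] by blast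
    have "\<exists>r. 0 < r \<and> r < d \<and> ennreal (1 / Suc m) \<le> ball_ratio k M x r" if "0 < d" for d
    proof -
      obtain r where r: "0 < r" "r < d" "a \<le> ball_ratio k M x r"
        using a(2) \<open>0 < d\<close> unfolding eventually_at_right_field by (metis not_less)
      have "ennreal (1 / Suc m) \<le> ennreal c" using m by (intro ennreal_leI) (simp add: inverse_eq_divide)
      then show ?thesis using r c(2) by (meson less_imp_le order_trans)
    qed
    then show "x \<in> (\<Union>m. B m)" using x(1) by (auto simp: B_def)
  qed
  ultimately show ?thesis by (rule hausdorff_null_subset)
qed

lemma has_density_local:
  assumes "x \<in> U" "open U"
  shows "has_density k (E \<inter> U) x \<theta> \<longleftrightarrow> has_density k E x \<theta>"
  unfolding has_density_def
proof (rule tendsto_cong)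
  obtain d where d: "0 < d" "cball x d \<subseteq> U" using open_contains_cball[of U] assms by blast
  have "E \<inter> U \<inter> cball x r = E \<inter> cball x r" if "r < d" for r
    using subset_cball[of r d x] d(2) that by auto
  then show "\<forall>\<^sub>F r in at_right 0. hausdorff k (E \<inter> U \<inter> cball x r) / ennreal (unit_ball_vol (real k) * r ^ k) =
      hausdorff k (E \<inter> cball x r) / ennreal (unit_ball_vol (real k) * r ^ k)"
    unfolding eventually_at_right_field using d(1) by (intro exI[of _ d]) auto
qed

text \<open>The trace of Hausdorff measure on a bounded part of \<open>E\<close> is a finite measure living on a Borel subset
  of \<open>E\<close>; density is a local notion, so bounded parts suffice.\<close>

theorem density_zero_ae:
  fixes E :: "'a::euclidean_space set"
  assumes E: "E \<in> hausdorff_sets k" and fin: "\<And>R. hausdorff k (E \<inter> ball 0 R) < \<infinity>"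
  shows "hausdorff k {x. x \<notin> E \<and> \<not> has_density k E x 0} = 0"
proof -
  define Z where "Z n = {x. x \<notin> E \<inter> ball 0 (real n) \<and> \<not> has_density k (E \<inter> ball 0 (real n)) x 0}" for n
  have "hausdorff k (Z n) = 0" for n
  proof -
    let ?E = "E \<inter> ball 0 (real n)"
    have "ball 0 (real n) \<in> hausdorff_sets k"
      using borel_subset_hausdorff_sets by (meson borel_open open_ball subsetD)
    then have "?E \<in> hausdorff_sets k" using E by (intro hausdorff_sets_Int)
    then obtain B where B: "B \<in> sets borel" "B \<subseteq> ?E" "hausdorff k (?E - B) = 0"
      using hausdorff_sets_inner_borel[of ?E k] fin by blast
    have "hausdorff k {x. x \<notin> B \<and> \<not> (ball_ratio k (hausdorff_on k ?E) x \<longlongrightarrow> 0) (at_right 0)} = 0"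
    proof (rule ball_ratio_tendsto_0_ae)
      have "- B \<inter> ?E = ?E - B" by auto
      then show "emeasure (hausdorff_on k ?E) (- B) = 0"
        using B by (simp add: emeasure_hausdorff_on)
    qed (use B fin in \<open>auto simp: emeasure_hausdorff_on\<close>)
    then show ?thesis
      by (rule hausdorff_null_subset) (use B in \<open>auto simp: has_density_iff Z_def\<close>)
  qed
  then have "hausdorff k (\<Union>n. Z n) = 0" by (intro hausdorff_null_UN) auto
  moreover have "{x. x \<notin> E \<and> \<not> has_density k E x 0} \<subseteq> (\<Union>n. Z n)"
  proof safe
    fix x assume x: "x \<notin> E" "\<not> has_density k E x 0"
    obtain n where "norm x < real n" using reals_Archimedean2 by blast
    then have "x \<in> Z n" using x has_density_local[of x "ball 0 (real n)" k E 0] by (simp add: Z_def)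
    then show "x \<in> (\<Union>n. Z n)" by blast
  qed
  ultimately show ?thesis by (rule hausdorff_null_subset)
qed

definition mean_osc :: "nat \<Rightarrow> 'a::metric_space measure \<Rightarrow> ('a \<Rightarrow> real) \<Rightarrow> 'a \<Rightarrow> real \<Rightarrow> ennreal" where
  "mean_osc k M \<psi> x r =
     (\<integral>\<^sup>+y\<in>cball x r. ennreal \<bar>\<psi> y - \<psi> x\<bar> \<partial>M) / ennreal (unit_ball_vol (real k) * r ^ k)"

text \<open>Lebesgue points for Hausdorff measure on \<open>E\<close>: near almost every point of the level set
  \<open>{j \<epsilon> \<le> \<psi> < (j + 1) \<epsilon>}\<close> the rest of \<open>E\<close> has density zero, and on the level set itself \<open>\<psi>\<close>
  varies by at most \<open>\<epsilon>\<close>.\<close>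

theorem mean_osc_tendsto_0_ae:
  fixes E :: "'a::euclidean_space set"
  assumes E: "E \<in> sets borel" and fin: "\<And>R. hausdorff k (E \<inter> ball 0 R) < \<infinity>"
    and \<psi>[measurable]: "\<psi> \<in> borel_measurable borel" and bd: "\<And>x. \<bar>\<psi> x\<bar> \<le> C"
  shows "hausdorff k {x\<in>E. has_density k E x 1 \<and> 
      \<not> (mean_osc k (hausdorff_on k E) \<psi> x \<longlongrightarrow> 0) (at_right 0)} = 0"
proof -
  let ?M = "hausdorff_on k E"
  \<comment> \<open>The level sets for \<open>\<epsilon> = 1 / (m + 1)\<close>.\<close>
  define A where "A m j = {y\<in>E. \<lfloor>\<psi> y * real (Suc m)\<rfloor> = j}" for m j
  define Z where "Z = (\<lambda>(m, j). {x. x \<notin> E - A m j \<and> \<not> has_density k (E - A m j) x 0})"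
  have A_borel: "A m j \<in> sets borel" for m j
  proof -
    have "A m j = E \<inter> {y\<in>space borel. \<lfloor>\<psi> y * real (Suc m)\<rfloor> = j}" by (auto simp: A_def)
    also have "\<dots> \<in> sets borel" using E by measurable
    finally show ?thesis .
  qed
  have "hausdorff k (Z p) = 0" for p
  proof -
    obtain m j where p: "p = (m, j)" by (cases p)
    show ?thesis unfolding Z_def p prod.case
    proof (rule density_zero_ae)
      show "E - A m j \<in> hausdorff_sets k"
        using E A_borel borel_subset_hausdorff_sets by (meson sets.Diff subsetD)
      show "hausdorff k ((E - A m j) \<inter> ball 0 R) < \<infinity>" for R
        using hausdorff_mono[of "(E - A m j) \<inter> ball 0 R" "E \<inter> ball 0 R" k] fin[of R]
        by (auto intro: order_le_less_trans)
    qed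
  qed
  then have null: "hausdorff k (\<Union>p. Z p) = 0" by (intro hausdorff_null_UN) auto
  have "(mean_osc k ?M \<psi> x \<longlongrightarrow> 0) (at_right 0)"
    if x: "x \<in> E" "has_density k E x 1" "x \<notin> (\<Union>p. Z p)" for x
  proof (rule order_tendstoI)
    fix a :: ennreal assume "0 < a"
    obtain m where m: "ennreal (1 / Suc m) < a"
    proof (cases a)
      case (real s)
      obtain m where "inverse (real (Suc m)) < s" using reals_Archimedean[of s] \<open>0 < a\<close> real by auto
      then show ?thesis using real that[of m] by (simp add: inverse_eq_divide ennreal_less_iff)
    next
      case top then show ?thesis using that[of 0] by simp
    qed
    define j where "j = \<lfloor>\<psi> x * real (Suc m)\<rfloor>"
    have xA: "x \<in> A m j" using x(1) by (simp add: A_def j_def)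
    have dens0: "has_density k (E - A m j) x 0"
      using x(3) xA by (auto simp: Z_def)
    let ?v = "\<lambda>r. ennreal (unit_ball_vol (real k) * r ^ k)"
    have bound: "mean_osc k ?M \<psi> x r \<le> ennreal (1 / Suc m) * (hausdorff k (E \<inter> cball x r) / ?v r)
        + ennreal (2 * C) * (hausdorff k ((E - A m j) \<inter> cball x r) / ?v r)" for r
    proof -
      have osc: "\<bar>\<psi> y - \<psi> x\<bar> \<le> 1 / Suc m" if "y \<in> A m j" for y
      proof -
        have "\<bar>\<psi> y * real (Suc m) - \<psi> x * real (Suc m)\<bar> \<le> 1"
          using that xA unfolding A_def by (simp add: abs_le_iff) linarith
        then have "\<bar>\<psi> y - \<psi> x\<bar> * real (Suc m) \<le> 1"
          by (simp add: left_diff_distrib[symmetric] abs_mult)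
        then show ?thesis by (simp add: pos_le_divide_eq)
      qed
      have "(\<integral>\<^sup>+y\<in>cball x r. ennreal \<bar>\<psi> y - \<psi> x\<bar> \<partial>?M) \<le>
         (\<integral>\<^sup>+y. ennreal (1 / Suc m) * indicator (cball x r) y 
            + ennreal (2 * C) * indicator (cball x r - A m j) y \<partial>?M)"
      proof (rule nn_integral_mono)
        fix y
        have "\<bar>\<psi> y - \<psi> x\<bar> \<le> 2 * C" using bd[of x] bd[of y] by linarith
        then show "ennreal \<bar>\<psi> y - \<psi> x\<bar> * indicator (cball x r) y \<le> 
          ennreal (1 / Suc m) * indicator (cball x r) y + ennreal (2 * C) * indicator (cball x r - A m j) y"
          using osc[of y] by (auto simp: indicator_def intro!: ennreal_leI add_increasing)
      qed
      also have "\<dots> = ennreal (1 / Suc m) * emeasure ?M (cball x r) + ennreal (2 * C) * emeasure ?M (cball x r - A m j)"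
      proof -
        have [measurable]: "A m j \<in> sets borel" "cball x r \<in> sets borel" by (simp_all add: A_borel)
        have "(\<integral>\<^sup>+y. ennreal (1 / Suc m) * indicator (cball x r) y 
            + ennreal (2 * C) * indicator (cball x r - A m j) y \<partial>?M) =
          (\<integral>\<^sup>+y. ennreal (1 / Suc m) * indicator (cball x r) y \<partial>?M)
            + (\<integral>\<^sup>+y. ennreal (2 * C) * indicator (cball x r - A m j) y \<partial>?M)"
        proof (rule nn_integral_add)
          have "(\<lambda>y. ennreal (1 / Suc m) * indicator (cball x r) y) \<in> borel_measurable borel"
            "(\<lambda>y. ennreal (2 * C) * indicator (cball x r - A m j) y) \<in> borel_measurable borel"
            by measurable
          then show "(\<lambda>y. ennreal (1 / Suc m) * indicator (cball x r) y) \<in> borel_measurable ?M"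
            "(\<lambda>y. ennreal (2 * C) * indicator (cball x r - A m j) y) \<in> borel_measurable ?M"
            by (simp_all only: measurable_cong_sets[OF sets_hausdorff_on refl])
        qed
        also have "(\<integral>\<^sup>+y. ennreal (1 / Suc m) * indicator (cball x r) y \<partial>?M) =
            ennreal (1 / Suc m) * emeasure ?M (cball x r)"
          by (rule nn_integral_cmult_indicator) simp
        also have "(\<integral>\<^sup>+y. ennreal (2 * C) * indicator (cball x r - A m j) y \<partial>?M) =
            ennreal (2 * C) * emeasure ?M (cball x r - A m j)"
          by (rule nn_integral_cmult_indicator) simp
        finally show ?thesis .
      qed
      also have "\<dots> = ennreal (1 / Suc m) * hausdorff k (E \<inter> cball x r) 
            + ennreal (2 * C) * hausdorff k ((E - A m j) \<inter> cball x r)"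
      proof -
        have e: "cball x r \<inter> E = E \<inter> cball x r" "(cball x r - A m j) \<inter> E = (E - A m j) \<inter> cball x r" by auto
        have "emeasure ?M (cball x r) = hausdorff k (E \<inter> cball x r)"
          by (subst emeasure_hausdorff_on) (simp_all only: e, simp)
        moreover have "emeasure ?M (cball x r - A m j) = hausdorff k ((E - A m j) \<inter> cball x r)"
          using A_borel[of m j] by (subst emeasure_hausdorff_on) (simp_all only: e, simp)
        ultimately show ?thesis by (simp only:)
      qed
      finally have "(\<integral>\<^sup>+y\<in>cball x r. ennreal \<bar>\<psi> y - \<psi> x\<bar> \<partial>?M) / ?v r \<le> \<dots> / ?v r"
        by (rule divide_right_mono_ennreal)
      then show ?thesis
        unfolding mean_osc_def by (simp only: ennreal_times_divide add_divide_distrib_ennreal)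
    qed
    have "((\<lambda>r. ennreal (1 / Suc m) * (hausdorff k (E \<inter> cball x r) / ?v r)
        + ennreal (2 * C) * (hausdorff k ((E - A m j) \<inter> cball x r) / ?v r)) \<longlongrightarrow> 
          ennreal (1 / Suc m) * 1 + ennreal (2 * C) * 0) (at_right 0)"
      using x(2) dens0 unfolding has_density_def by (intro tendsto_add ennreal_tendsto_cmult) simp_all
    then have "\<forall>\<^sub>F r in at_right 0. ennreal (1 / Suc m) * (hausdorff k (E \<inter> cball x r) / ?v r)
        + ennreal (2 * C) * (hausdorff k ((E - A m j) \<inter> cball x r) / ?v r) < a"
      by (rule order_tendstoD(2)) (use m in simp)
    then show "\<forall>\<^sub>F r in at_right 0. mean_osc k ?M \<psi> x r < a"
      by eventually_elim (rule order_le_less_trans[OF bound])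
  qed (simp)
  then have "{x\<in>E. has_density k E x 1 \<and> \<not> (mean_osc k ?M \<psi> x \<longlongrightarrow> 0) (at_right 0)} \<subseteq> (\<Union>p. Z p)"
    by (intro subsetI) (metis (mono_tags, lifting) mem_Collect_eq)
  with null show ?thesis by (rule hausdorff_null_subset)
qed

section \<open>The isodiametric inequality and Lebesgue measure\<close>

definition box_family :: "'a::euclidean_space set set \<Rightarrow> bool" where
  "box_family P \<longleftrightarrow> finite P \<and> disjoint P \<and> (\<forall>S\<in>P. S \<noteq> {} \<and> (\<exists>a b. S = box a b))"

text \<open>The Minkowski average \<open>(A + B) / 2\<close>.\<close>

definition midpoints :: "'a::real_vector set \<Rightarrow> 'a set \<Rightarrow> 'a set" where
  "midpoints A B = (\<lambda>(x, y). midpoint x y) ` (A \<times> B)"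

lemma midpoints_commute: "midpoints A B = midpoints B A"
  unfolding midpoints_def by (auto simp: image_iff) (metis midpoint_sym)+

lemma midpoints_mono: "A \<subseteq> A' \<Longrightarrow> B \<subseteq> B' \<Longrightarrow> midpoints A B \<subseteq> midpoints A' B'"
  unfolding midpoints_def by auto

lemma open_midpoints:
  fixes A :: "'a::real_normed_vector set"
  assumes "open A" shows "open (midpoints A B)"
proof -
  have "open ((\<lambda>x. midpoint x y) ` A)" for y
  proof -
    have "(\<lambda>x. midpoint x y) ` A = (+) ((1/2) *\<^sub>R y) ` ((\<lambda>x. (1/2) *\<^sub>R x) ` A)"
      by (auto simp: midpoint_def image_image algebra_simps)
    also have "open \<dots>" by (intro open_translation open_scaling assms) auto
    finally show ?thesis .
  qed
  moreover have "midpoints A B = (\<Union>y\<in>B. (\<lambda>x. midpoint x y) ` A)"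
    by (auto simp: midpoints_def)
  ultimately show ?thesis by auto
qed

lemma bounded_midpoints:
  fixes A :: "'a::real_normed_vector set"
  assumes "bounded A" "bounded B" shows "bounded (midpoints A B)"
proof -
  obtain a b where ab: "\<And>x. x \<in> A \<Longrightarrow> norm x \<le> a" "\<And>x. x \<in> B \<Longrightarrow> norm x \<le> b"
    using assms unfolding bounded_iff by blast
  have "norm (midpoint x y) \<le> (a + b) / 2" if "x \<in> A" "y \<in> B" for x y
    using ab(1)[OF that(1)] ab(2)[OF that(2)] norm_triangle_ineq[of x y]
    by (simp add: midpoint_def)
  then show ?thesis unfolding bounded_iff midpoints_def by (intro exI[of _ "(a + b) / 2"]) auto
qed

lemma box_Int_less:
  fixes a b :: "'a::euclidean_space"
  assumes "i \<in> Basis"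
  shows "box a b \<inter> {x. x \<bullet> i < t} = box a (b + (min (b \<bullet> i) t - b \<bullet> i) *\<^sub>R i)"
  using assms by (auto simp: mem_box inner_add_left inner_Basis split: if_splits)

lemma box_Int_greater:
  fixes a b :: "'a::euclidean_space"
  assumes "i \<in> Basis"
  shows "box a b \<inter> {x. t < x \<bullet> i} = box (a + (max (a \<bullet> i) t - a \<bullet> i) *\<^sub>R i) b"
  using assms by (auto simp: mem_box inner_add_left inner_Basis split: if_splits)

definition cut :: "'a set set \<Rightarrow> 'a set \<Rightarrow> 'a set set" where
  "cut P H = (\<lambda>S. S \<inter> H) ` P - {{}}"

lemma Union_cut: "\<Union> (cut P H) = \<Union> P \<inter> H"
  unfolding cut_def by auto

lemma card_cut: "finite P \<Longrightarrow> card (cut P H) \<le> card P"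
  unfolding cut_def by (meson card_Diff1_le card_image_le order_trans finite_imageI)

lemma card_cut_less:
  assumes "finite P" "S \<in> P" "S \<inter> H = {}"
  shows "card (cut P H) < card P"
proof -
  have "cut P H \<subseteq> (\<lambda>S. S \<inter> H) ` (P - {S})" using assms(3) by (auto simp: cut_def)
  then have "card (cut P H) \<le> card (P - {S})"
    using assms(1) by (meson card_image_le card_mono finite_Diff finite_imageI order_trans)
  also have "\<dots> < card P" using assms by (meson card_Diff1_less)
  finally show ?thesis .
qed

lemma box_family_cut:
  assumes P: "box_family P" and H: "\<And>a b. \<exists>c d. box a b \<inter> H = box c d"
  shows "box_family (cut P H)"
  unfolding box_family_def
proof (intro conjI ballI)
  show "finite (cut P H)" using P by (simp add: cut_def box_family_def)
  show "disjoint (cut P H)" using P unfolding box_family_def disjoint_def cut_def by blast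
  show "S \<noteq> {}" if "S \<in> cut P H" for S using that by (simp add: cut_def)
  show "\<exists>a b. S = box a b" if S: "S \<in> cut P H" for S
  proof -
    obtain T where "T \<in> P" "S = T \<inter> H" using S by (auto simp: cut_def)
    then show ?thesis using P H unfolding box_family_def by metis
  qed
qed

lemma box_family_open_bounded:
  assumes "box_family P" shows "open (\<Union> P)" "bounded (\<Union> P)"
proof -
  show "open (\<Union> P)" using assms unfolding box_family_def by (metis open_Union open_box)
  show "bounded (\<Union> P)" using assms unfolding box_family_def by (metis bounded_Union bounded_box)
qed

lemma emeasure_bounded_open:
  fixes A :: "'a::euclidean_space set"
  assumes "open A" "bounded A"
  shows "emeasure lborel A = ennreal (measure lborel A)" "emeasure lborel A \<noteq> \<infinity>" "A \<in> sets lborel"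
  using emeasure_bounded_finite[OF assms(2)] assms(1) by (auto simp: emeasure_eq_ennreal_measure)

lemma measure_box_family_pos:
  assumes "box_family P" "P \<noteq> {}"
  shows "0 < measure lborel (\<Union> P)"
proof -
  obtain S a b where S: "S \<in> P" "S = box a b" "S \<noteq> {}" using assms unfolding box_family_def by blast
  have "0 < measure lborel S"
    using S(2,3) by (auto simp: measure_lborel_box_eq box_ne_empty inner_diff_left intro!: prod_pos)
  also have "\<dots> \<le> measure lborel (\<Union> P)"
    using S box_family_open_bounded[OF assms(1)] emeasure_bounded_open(2,3)[of "\<Union> P"]
    by (intro measure_mono_fmeasurable) (auto simp: fmeasurable_def less_top)
  finally show ?thesis .
qed

lemma emeasure_hyperplane:
  fixes i :: "'a::euclidean_space"
  assumes "i \<in> Basis" shows "emeasure lborel {x. x \<bullet> i = t} = 0"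
proof -
  have "negligible {x::'a. x \<bullet> i = t}" using assms by (rule negligible_standard_hyperplane)
  then have "emeasure lebesgue {x::'a. x \<bullet> i = t} = 0"
    by (simp add: negligible_iff_null_sets null_setsD1)
  moreover have "{x::'a. x \<bullet> i = t} \<in> sets borel" by simp
  ultimately show ?thesis by simp
qed

lemma measure_split_hyperplane:
  fixes A :: "'a::euclidean_space set"
  assumes A: "open A" "bounded A" and i: "i \<in> Basis"
  shows "measure lborel A = measure lborel (A \<inter> {x. x \<bullet> i < t}) + measure lborel (A \<inter> {x. t < x \<bullet> i})"
    and "measure lborel (A \<inter> {x. x \<bullet> i \<le> t}) = measure lborel (A \<inter> {x. x \<bullet> i < t})"
proof -
  let ?L = "A \<inter> {x. x \<bullet> i < t}" and ?G = "A \<inter> {x. t < x \<bullet> i}"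
  have null: "A \<inter> {x. x \<bullet> i = t} \<in> null_sets lborel"
  proof (rule null_sets_subset)
    show "{x. x \<bullet> i = t} \<in> null_sets lborel"
      using emeasure_hyperplane[OF i, of t] by (intro null_setsI) auto
    show "A \<inter> {x. x \<bullet> i = t} \<in> sets lborel" using A(1) by (intro sets.Int) auto
  qed auto
  have op: "open ?L" "open ?G" "bounded ?L" "bounded ?G"
    using A by (auto intro!: open_Int open_halfspace_component_lt open_halfspace_component_gt bounded_Int)
  have "A = (?L \<union> ?G) \<union> (A \<inter> {x. x \<bullet> i = t})" by auto
  then have "measure lborel A = measure lborel (?L \<union> ?G)"
    using null op measure_Un_null_set[of "?L \<union> ?G" lborel "A \<inter> {x. x \<bullet> i = t}"] by simp
  also have "\<dots> = measure lborel ?L + measure lborel ?G"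
    using op emeasure_bounded_open by (intro measure_Union) auto
  finally show "measure lborel A = measure lborel ?L + measure lborel ?G" .
  have "A \<inter> {x. x \<bullet> i \<le> t} = ?L \<union> (A \<inter> {x. x \<bullet> i = t})" by auto
  then show "measure lborel (A \<inter> {x. x \<bullet> i \<le> t}) = measure lborel ?L"
    using null op measure_Un_null_set[of ?L lborel "A \<inter> {x. x \<bullet> i = t}"] by simp
qed

text \<open>Hyperplanes are null sets, so the volume of \<open>B\<close> below the level \<open>s\<close> is a continuous function of \<open>s\<close>
  (the distribution function of the image of the volume under the coordinate), which takes all intermediate values.\<close>

lemma exists_proportional_cut:
  fixes B :: "'a::euclidean_space set"
  assumes B: "open B" "bounded B" and i: "i \<in> Basis" and c: "0 < c" "c < 1" and pos: "0 < measure lborel B"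
  obtains s where "measure lborel (B \<inter> {x. x \<bullet> i < s}) = c * measure lborel B"
proof -
  define M where "M = distr (restrict_space lborel B) borel (\<lambda>x. x \<bullet> i)"
  have Bs: "B \<in> sets lborel" using B by simp
  have [measurable]: "(\<lambda>x. x \<bullet> i) \<in> restrict_space lborel B \<rightarrow>\<^sub>M borel"
    by (intro measurable_restrict_space1) measurable
  have M: "measure M T = measure lborel (B \<inter> {x. x \<bullet> i \<in> T})" if [measurable]: "T \<in> sets borel" for T
  proof -
    have "measure M T = measure (restrict_space lborel B) ((\<lambda>x. x \<bullet> i) -` T \<inter> space (restrict_space lborel B))"
      unfolding M_def by (rule measure_distr) measurable
    also have "(\<lambda>x. x \<bullet> i) -` T \<inter> space (restrict_space lborel B) = B \<inter> {x. x \<bullet> i \<in> T}"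
      using B by (auto simp: space_restrict_space)
    also have "measure (restrict_space lborel B) \<dots> = measure lborel (B \<inter> {x. x \<bullet> i \<in> T})"
      using Bs by (intro measure_restrict_space) auto
    finally show ?thesis .
  qed
  interpret finite_borel_measure M
  proof (intro finite_borel_measure.intro finite_borel_measure_axioms.intro finite_measureI)
    have "emeasure M (space M) = emeasure lborel B"
      unfolding M_def using B by (subst emeasure_distr)
        (auto simp: space_restrict_space emeasure_restrict_space)
    then show "emeasure M (space M) \<noteq> \<infinity>" using emeasure_bounded_open(2)[OF B] by simp
  qed (simp add: M_def)
  have cont: "isCont (cdf M) x" for x
  proof -
    have "measure M {x} = measure lborel (B \<inter> {y. y \<bullet> i = x})" by (subst M) auto
    moreover have "emeasure lborel (B \<inter> {y. y \<bullet> i = x}) = 0"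
      by (rule emeasure_eq_0[OF _ emeasure_hyperplane[OF i, of x]]) auto
    ultimately have "measure M {x} = 0" by (simp add: measure_def)
    then show ?thesis by (simp add: isCont_cdf)
  qed
  have top: "measure M (space M) = measure lborel B" 
    using M[of UNIV] by (simp add: M_def)
  have cB: "0 < c * measure lborel B" "c * measure lborel B < measure lborel B" using c pos by auto
  have "\<forall>\<^sub>F x in at_bot. cdf M x < c * measure lborel B"
    using cdf_lim_at_bot cB(1) by (rule order_tendstoD)
  then obtain l where l: "\<And>x. x \<le> l \<Longrightarrow> cdf M x < c * measure lborel B" 
    unfolding eventually_at_bot_linorder by blast
  have "\<forall>\<^sub>F x in at_top. c * measure lborel B < cdf M x"
    using cdf_lim_at_top[unfolded top] cB(2) by (rule order_tendstoD)
  then obtain u where u: "\<And>x. u \<le> x \<Longrightarrow> c * measure lborel B < cdf M x" 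
    unfolding eventually_at_top_linorder by blast
  have "\<exists>s. l \<le> s \<and> s \<le> max l u \<and> cdf M s = c * measure lborel B"
    using l[of l] u[of "max l u"] cont by (intro IVT) auto
  then obtain s where "cdf M s = c * measure lborel B" by blast
  then have "measure lborel (B \<inter> {x. x \<bullet> i \<le> s}) = c * measure lborel B"
    using M[of "{..s}"] by (simp add: cdf_def)
  then show ?thesis using that[of s] measure_split_hyperplane(2)[OF B i, of s] by simp
qed

text \<open>The sides of the box of midpoints are the arithmetic means of the sides of the two boxes; they dominate the
  geometric means.\<close>

lemma midpoints_box:
  fixes a b c d :: "'a::euclidean_space"
  assumes ab: "box a b \<noteq> {}" and cd: "box c d \<noteq> {}"
  shows "sqrt (measure lborel (box a b) * measure lborel (box c d)) \<le> measure lborel (midpoints (box a b) (box c d))"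
proof -
  have lt: "a \<bullet> i < b \<bullet> i" "c \<bullet> i < d \<bullet> i" if "i \<in> Basis" for i
    using ab cd that by (auto simp: box_ne_empty)
  let ?m = "midpoint a c" and ?M = "midpoint b d"
  have mM: "(?M - ?m) \<bullet> i = ((b - a) \<bullet> i + (d - c) \<bullet> i) / 2" for i
    by (simp add: midpoint_def algebra_simps inner_add_left inner_diff_left)
  have pos: "0 < (?M - ?m) \<bullet> i" if "i \<in> Basis" for i
    unfolding mM using lt[OF that] by (simp add: inner_diff_left)
  have sub: "box ?m ?M \<subseteq> midpoints (box a b) (box c d)"
  proof
    fix z assume z: "z \<in> box ?m ?M"
    define s where "s i = ((z - ?m) \<bullet> i) / ((?M - ?m) \<bullet> i)" for i
    have s: "0 < s i" "s i < 1" if "i \<in> Basis" for i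
      using z pos[OF that] that by (auto simp: s_def mem_box inner_diff_left divide_simps)
    define x where "x = (\<Sum>i\<in>Basis. (a \<bullet> i + s i * ((b - a) \<bullet> i)) *\<^sub>R i)"
    define y where "y = (\<Sum>i\<in>Basis. (c \<bullet> i + s i * ((d - c) \<bullet> i)) *\<^sub>R i)"
    have conv: "u < u + t * (v - u) \<and> u + t * (v - u) < v" if "0 < t" "t < 1" "u < v" for t u v :: real
    proof -
      have "0 < t * (v - u)" "t * (v - u) < 1 * (v - u)" using that by (auto intro!: mult_strict_right_mono)
      then show ?thesis by simp
    qed
    have "x \<in> box a b" unfolding mem_box x_def using conv[OF s lt(1)] by (auto simp: inner_diff_left)
    moreover have "y \<in> box c d" unfolding mem_box y_def using conv[OF s lt(2)] by (auto simp: inner_diff_left)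
    moreover have "z = midpoint x y"
    proof (rule euclidean_eqI)
      fix i :: 'a assume i: "i \<in> Basis"
      have "z \<bullet> i = ?m \<bullet> i + s i * ((?M - ?m) \<bullet> i)"
        using pos[OF i] by (simp add: s_def inner_diff_left)
      also have "\<dots> = midpoint x y \<bullet> i"
      proof -
        have "x \<bullet> i = a \<bullet> i + s i * ((b - a) \<bullet> i)" "y \<bullet> i = c \<bullet> i + s i * ((d - c) \<bullet> i)"
          using i by (simp_all add: x_def y_def)
        then have "midpoint x y \<bullet> i = (a \<bullet> i + s i * ((b - a) \<bullet> i) + (c \<bullet> i + s i * ((d - c) \<bullet> i))) / 2"
          by (simp add: midpoint_def inner_add_left)
        then show ?thesis unfolding mM by (simp add: midpoint_def inner_add_left field_simps)
      qed
      finally show "z \<bullet> i = midpoint x y \<bullet> i" .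
    qed
    ultimately show "z \<in> midpoints (box a b) (box c d)" by (auto simp: midpoints_def)
  qed
  have m1: "measure lborel (box a b) = (\<Prod>i\<in>Basis. (b - a) \<bullet> i)"
    "measure lborel (box c d) = (\<Prod>i\<in>Basis. (d - c) \<bullet> i)"
    "measure lborel (box ?m ?M) = (\<Prod>i\<in>Basis. (?M - ?m) \<bullet> i)"
    using lt pos by (auto simp: measure_lborel_box_eq inner_diff_left less_imp_le)
  have "sqrt (measure lborel (box a b) * measure lborel (box c d)) = sqrt (\<Prod>i\<in>Basis. (b - a) \<bullet> i * ((d - c) \<bullet> i))"
    by (simp add: m1 prod.distrib)
  also have "\<dots> \<le> (\<Prod>i\<in>Basis. (?M - ?m) \<bullet> i)"
  proof (rule real_le_lsqrt)
    show "0 \<le> (\<Prod>i\<in>Basis. (?M - ?m) \<bullet> i)" using pos by (intro prod_nonneg) (auto intro: less_imp_le)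
    have "(\<Prod>i\<in>Basis. (b - a) \<bullet> i * ((d - c) \<bullet> i)) \<le> (\<Prod>i\<in>Basis. ((?M - ?m) \<bullet> i)\<^sup>2)"
    proof (rule prod_mono)
      fix i :: 'a assume i: "i \<in> Basis"
      define u v where "u = (b - a) \<bullet> i" and "v = (d - c) \<bullet> i"
      have "0 \<le> u" "0 \<le> v" using lt[OF i] by (simp_all add: u_def v_def inner_diff_left)
      moreover have "0 \<le> (u - v)\<^sup>2" by simp
      then have "u * v \<le> ((u + v) / 2)\<^sup>2" by (simp add: power2_eq_square field_simps)
      ultimately show "0 \<le> (b - a) \<bullet> i * ((d - c) \<bullet> i) \<and> (b - a) \<bullet> i * ((d - c) \<bullet> i) \<le> ((?M - ?m) \<bullet> i)\<^sup>2"
        unfolding mM by (simp add: u_def v_def)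
    qed
    then show "(\<Prod>i\<in>Basis. (b - a) \<bullet> i * ((d - c) \<bullet> i)) \<le> (\<Prod>i\<in>Basis. (?M - ?m) \<bullet> i)\<^sup>2"
      by (simp add: prod_power_distrib)
  qed
  also have "\<dots> = measure lborel (box ?m ?M)" by (simp add: m1)
  also have "\<dots> \<le> measure lborel (midpoints (box a b) (box c d))"
    using sub emeasure_bounded_open[OF open_midpoints[OF open_box] bounded_midpoints[OF bounded_box bounded_box], of a b c d]
    by (intro measure_mono_fmeasurable) (auto simp: fmeasurable_def less_top)
  finally show ?thesis .
qed

text \<open>The Hadwiger-Ohmann step: a hyperplane separates two boxes of \<open>P\<close>; a parallel hyperplane cuts
  \<open>\<Union> Q\<close> in the same proportion, and the midpoints of corresponding pieces lie on different sides
  of a third one. Geometric means scale with the common proportion.\<close>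

lemma midpoints_step:
  fixes P Q :: "'a::euclidean_space set set"
  assumes P: "box_family P" and Q: "box_family Q" and ne: "Q \<noteq> {}" and card2: "2 \<le> card P"
    and IH: "\<And>P' Q' :: 'a set set. box_family P' \<Longrightarrow> box_family Q' \<Longrightarrow> P' \<noteq> {} \<Longrightarrow> Q' \<noteq> {} \<Longrightarrow>
      card P' + card Q' < card P + card Q \<Longrightarrow>
      sqrt (measure lborel (\<Union> P') * measure lborel (\<Union> Q')) \<le> measure lborel (midpoints (\<Union> P') (\<Union> Q'))"
  shows "sqrt (measure lborel (\<Union> P) * measure lborel (\<Union> Q)) \<le> measure lborel (midpoints (\<Union> P) (\<Union> Q))"
proof -
  have finP: "finite P" and finQ: "finite Q" using P Q by (auto simp: box_family_def)
  obtain S T where ST: "S \<in> P" "T \<in> P" "S \<noteq> T"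
    using card2 finP by (metis card_le_Suc0_iff_eq not_less_eq_eq numeral_2_eq_2)
  obtain a b c d where abcd: "S = box a b" "T = box c d" "S \<noteq> {}" "T \<noteq> {}"
    using P ST unfolding box_family_def by meson
  have "S \<inter> T = {}" using P ST unfolding box_family_def by (meson disjointD)
  then obtain i where i: "i \<in> Basis" and sep: "b \<bullet> i \<le> c \<bullet> i \<or> d \<bullet> i \<le> a \<bullet> i"
    using abcd unfolding abcd(1,2) disjoint_interval(4) box_ne_empty by (metis not_le)
  from sep obtain S' T' t where t: "S' \<in> P" "T' \<in> P" "S' \<noteq> {}" "T' \<noteq> {}" 
      "S' \<subseteq> {x. x \<bullet> i < t}" "T' \<subseteq> {x. t < x \<bullet> i}"
  proof
    assume "b \<bullet> i \<le> c \<bullet> i"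
    then show ?thesis
      using that[of S T "b \<bullet> i"] ST abcd i by (force simp: mem_box)
  next
    assume "d \<bullet> i \<le> a \<bullet> i"
    then show ?thesis
      using that[of T S "d \<bullet> i"] ST abcd i by (force simp: mem_box)
  qed
  let ?L = "\<lambda>t. {x::'a. x \<bullet> i < t}" and ?G = "\<lambda>t. {x::'a. t < x \<bullet> i}"
  let ?m = "measure lborel :: 'a set \<Rightarrow> real"
  have cutL: "box_family (cut R (?L s))" and cutG: "box_family (cut R (?G s))" if "box_family R" for R s
    using box_Int_less[OF i] box_Int_greater[OF i] by (blast intro: box_family_cut[OF that])+
  let ?A = "\<Union> P" and ?B = "\<Union> Q"
  have "S' \<inter> ?L t = S'" "T' \<inter> ?G t = T'" "S' \<inter> ?G t = {}" "T' \<inter> ?L t = {}" using t by auto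
  then have neP: "cut P (?L t) \<noteq> {}" "cut P (?G t) \<noteq> {}"
    and cP: "card (cut P (?L t)) < card P" "card (cut P (?G t)) < card P"
  proof -
    show "cut P (?L t) \<noteq> {}" "cut P (?G t) \<noteq> {}"
      using t(1-4) \<open>S' \<inter> ?L t = S'\<close> \<open>T' \<inter> ?G t = T'\<close> unfolding cut_def by blast+
    show "card (cut P (?L t)) < card P" "card (cut P (?G t)) < card P"
      using card_cut_less[OF finP t(2)] card_cut_less[OF finP t(1)] \<open>S' \<inter> ?G t = {}\<close> \<open>T' \<inter> ?L t = {}\<close>
      by blast+
  qed
  have Aob: "open ?A" "bounded ?A" and Bob: "open ?B" "bounded ?B"
    using box_family_open_bounded P Q by auto
  define mA mB where "mA = ?m ?A" and "mB = ?m ?B"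
  define r where "r = ?m (?A \<inter> ?L t) / mA"
  have posL: "0 < ?m (?A \<inter> ?L t)" "0 < ?m (?A \<inter> ?G t)"
    using measure_box_family_pos[OF cutL[OF P] neP(1)] measure_box_family_pos[OF cutG[OF P] neP(2)]
    by (simp_all add: Union_cut)
  have split: "mA = ?m (?A \<inter> ?L t) + ?m (?A \<inter> ?G t)"
    unfolding mA_def by (rule measure_split_hyperplane(1)[OF Aob i])
  have r: "0 < r" "r < 1" using posL split by (auto simp: r_def)
  have mL: "?m (?A \<inter> ?L t) = r * mA" and mG: "?m (?A \<inter> ?G t) = (1 - r) * mA"
    using posL split by (auto simp: r_def field_simps)
  have mBpos: "0 < mB" unfolding mB_def by (rule measure_box_family_pos[OF Q ne])
  obtain s where sL: "?m (?B \<inter> ?L s) = r * mB"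
    using exists_proportional_cut[OF Bob i r] mBpos unfolding mB_def by blast
  then have sG: "?m (?B \<inter> ?G s) = (1 - r) * mB"
    using measure_split_hyperplane(1)[OF Bob i, of s] by (simp add: mB_def algebra_simps)
  have neQ: "cut Q (?L s) \<noteq> {}" "cut Q (?G s) \<noteq> {}"
    using sL sG r mBpos Union_cut[of Q "?L s"] Union_cut[of Q "?G s"] by (auto simp: zero_less_mult_iff)
  have cQ: "card (cut Q H) \<le> card Q" for H by (rule card_cut[OF finQ])
  let ?U = "midpoints (?A \<inter> ?L t) (?B \<inter> ?L s)" and ?V = "midpoints (?A \<inter> ?G t) (?B \<inter> ?G s)"
  have IHL: "r * sqrt (mA * mB) \<le> ?m ?U"
  proof -
    have "sqrt (?m (?A \<inter> ?L t) * ?m (?B \<inter> ?L s)) \<le> ?m ?U"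
      using IH[OF cutL[OF P] cutL[OF Q] neP(1) neQ(1)] cP(1) cQ[of "?L s"]
      by (simp add: Union_cut)
    moreover have "?m (?A \<inter> ?L t) * ?m (?B \<inter> ?L s) = r\<^sup>2 * (mA * mB)"
      unfolding mL sL by (simp add: power2_eq_square)
    ultimately show ?thesis using r by (simp add: real_sqrt_mult)
  qed
  have IHG: "(1 - r) * sqrt (mA * mB) \<le> ?m ?V"
  proof -
    have "sqrt (?m (?A \<inter> ?G t) * ?m (?B \<inter> ?G s)) \<le> ?m ?V"
      using IH[OF cutG[OF P] cutG[OF Q] neP(2) neQ(2)] cP(2) cQ[of "?G s"]
      by (simp add: Union_cut)
    moreover have "?m (?A \<inter> ?G t) * ?m (?B \<inter> ?G s) = (1 - r)\<^sup>2 * (mA * mB)"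
      unfolding mG sG by (simp add: power2_eq_square)
    ultimately show ?thesis using r by (simp add: real_sqrt_mult)
  qed
  have opU: "open ?U" "bounded ?U" "open ?V" "bounded ?V"
    using Aob Bob by (auto intro!: open_midpoints bounded_midpoints open_Int bounded_Int
      open_halfspace_component_lt open_halfspace_component_gt)
  have "?U \<inter> ?V = {}"
  proof -
    have "?U \<subseteq> ?L ((s + t) / 2)" "?V \<subseteq> ?G ((s + t) / 2)"
      by (auto simp: midpoints_def midpoint_def inner_add_left)
    then show ?thesis by fastforce
  qed
  then have "?m ?U + ?m ?V = ?m (?U \<union> ?V)"
    using emeasure_bounded_open[OF opU(1,2)] emeasure_bounded_open[OF opU(3,4)]
    by (intro measure_Union[symmetric]) auto
  also have "\<dots> \<le> ?m (midpoints ?A ?B)"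
    using emeasure_bounded_open[OF open_midpoints bounded_midpoints, OF Aob(1) Aob(2) Bob(2)] opU
      midpoints_mono[of "?A \<inter> ?L t" ?A "?B \<inter> ?L s" ?B] midpoints_mono[of "?A \<inter> ?G t" ?A "?B \<inter> ?G s" ?B]
    by (intro measure_mono_fmeasurable) (auto simp: fmeasurable_def less_top)
  finally have "r * sqrt (mA * mB) + (1 - r) * sqrt (mA * mB) \<le> ?m (midpoints ?A ?B)"
    using IHL IHG by linarith
  then show ?thesis by (simp add: mA_def mB_def algebra_simps)
qed

text \<open>The Brunn-Minkowski inequality, in multiplicative form, for finite unions of boxes, by induction on
  the total number of boxes.\<close>

theorem measure_midpoints:
  fixes P Q :: "'a::euclidean_space set set"
  assumes "box_family P" "box_family Q" "P \<noteq> {}" "Q \<noteq> {}"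
  shows "sqrt (measure lborel (\<Union> P) * measure lborel (\<Union> Q)) \<le> measure lborel (midpoints (\<Union> P) (\<Union> Q))"
  using assms
proof (induction "card P + card Q" arbitrary: P Q rule: less_induct)
  case less
  have fin: "finite P" "finite Q" using less by (auto simp: box_family_def)
  have card: "card P \<noteq> 0" "card Q \<noteq> 0" using less fin by auto
  consider "2 \<le> card P" | "2 \<le> card Q" | "card P = 1" "card Q = 1" using card by linarith
  then show ?case
  proof cases
    case 1
    then show ?thesis using midpoints_step[OF less(2,3,5)] less(1) by blast
  next
    case 2
    have "sqrt (measure lborel (\<Union> Q) * measure lborel (\<Union> P)) \<le> measure lborel (midpoints (\<Union> Q) (\<Union> P))"
      using less(1) by (intro midpoints_step[OF less(3,2,4) 2]) (simp add: add.commute)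
    then show ?thesis by (simp add: midpoints_commute mult.commute)
  next
    case 3
    then obtain S T where ST: "P = {S}" "Q = {T}" by (auto simp: card_1_singleton_iff)
    then obtain a b c d where "S = box a b" "T = box c d" "S \<noteq> {}" "T \<noteq> {}"
      using less(2,3) unfolding box_family_def by auto
    then show ?thesis using midpoints_box[of a b c d] ST by simp
  qed
qed


text \<open>A set of diameter \<open>D\<close> is nearly a union \<open>A\<close> of small boxes; reflecting \<open>A\<close> does not change its
  volume, and the midpoints of \<open>A\<close> and \<open>- A\<close>, i.e. \<open>(A - A) / 2\<close>, lie in a ball of radius about \<open>D / 2\<close>.\<close>

theorem isodiametric:
  fixes S :: "'a::euclidean_space set"
  assumes S: "bounded S"
  shows "emeasure lborel (closure S) \<le> hgauge DIM('a) S"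
proof (cases "S = {}")
  case ne: False
  define D where "D = diameter (closure S)"
  have bS: "bounded (closure S)" using S by (rule bounded_closure)
  have D0: "0 \<le> D" unfolding D_def by (rule diameter_ge_0[OF bS])
  obtain w where w: "closure S \<subseteq> cbox (- w) w" using bounded_subset_cbox_symmetric[OF bS] by blast
  have bound: "emeasure lborel (closure S) \<le> ennreal (unit_ball_vol DIM('a) * (D / 2 + 2 * e) ^ DIM('a))" if e: "0 < e" for e
  proof -
    obtain p where p: "p tagged_division_of cbox (- w) w" "(\<lambda>x. ball x e) fine p"
      using fine_division_exists[OF gauge_ball[OF e]] by blast
    \<comment> \<open>The boxes of a division of mesh at most \<open>2 e\<close> which meet \<open>closure S\<close>.\<close>
    define K where "K = {k \<in> snd ` p. k \<inter> closure S \<noteq> {}}"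
    have div: "snd ` p division_of cbox (- w) w" using p(1) by (rule division_of_tagged_division)
    have finK: "finite K" using division_ofD(1)[OF div] by (simp add: K_def)
    have Kbox: "\<exists>a b. k = cbox a b" if "k \<in> K" for k
      using that division_ofD(4)[OF div, of k] by (auto simp: K_def)
    have Ksmall: "dist x y \<le> 2 * e" if k: "k \<in> K" "x \<in> k" "y \<in> k" for k x y
    proof -
      obtain c where "(c, k) \<in> p" using k(1) by (auto simp: K_def)
      then have "k \<subseteq> ball c e" using p(2) by (auto simp: fine_def)
      then have "dist c x < e" "dist c y < e" using k by auto
      then show ?thesis using dist_triangle3[of x y c] by linarith
    qed
    define P where "P = interior ` K - {{}}"
    have P: "box_family P"
      unfolding box_family_def
    proof (intro conjI ballI)
      show "finite P" using finK by (simp add: P_def)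
      show "disjoint P"
      proof (rule disjointI)
        fix S T assume ST: "S \<in> P" "T \<in> P" "S \<noteq> T"
        then obtain k l where kl: "k \<in> K" "l \<in> K" "S = interior k" "T = interior l" "k \<noteq> l"
          by (auto simp: P_def)
        then show "S \<inter> T = {}" using division_ofD(5)[OF div, of k l] by (auto simp: K_def)
      qed
      show "S \<noteq> {}" if "S \<in> P" for S using that by (simp add: P_def)
      show "\<exists>a b. S = box a b" if SP: "S \<in> P" for S
      proof -
        obtain k where "k \<in> K" "S = interior k" using SP by (auto simp: P_def)
        then show ?thesis using Kbox[of k] interior_cbox by metis
      qed
    qed
    define m where "m = measure lborel (\<Union> P)"
    note PO = box_family_open_bounded[OF P]
    have eP: "emeasure lborel (\<Union> P) = ennreal m" unfolding m_def by (rule emeasure_bounded_open(1)[OF PO])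
    have cov: "emeasure lborel (closure S) \<le> ennreal m"
    proof -
      have neg: "emeasure lborel (\<Union>k\<in>K. k - interior k) = 0"
      proof -
        have "emeasure lborel (k - interior k) = 0" "k - interior k \<in> sets lborel" if kK: "k \<in> K" for k
        proof -
          obtain a b where k: "k = cbox a b" using Kbox[OF kK] by blast
          have "k - interior k = cbox a b - box a b" by (simp add: k interior_cbox)
          then show "emeasure lborel (k - interior k) = 0"
            using emeasure_Diff[of lborel "box a b" "cbox a b"] box_subset_cbox[of a b]
            by (simp add: emeasure_lborel_box_eq emeasure_lborel_cbox_eq)
          show "k - interior k \<in> sets lborel" by (simp add: k interior_cbox)
        qed
        then have "(\<Union>k\<in>K. k - interior k) \<in> null_sets lborel"
          using finK by (intro null_sets_UN' countable_finite null_setsI) auto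
        then show ?thesis by (rule null_setsD1)
      qed
      have NK: "(\<Union>k\<in>K. k - interior k) \<in> sets lborel"
        using finK Kbox by (intro sets.finite_UN) (metis sets.Diff sets_lborel borel_closed borel_open closed_cbox open_interior)+
      have "closure S \<subseteq> \<Union> P \<union> (\<Union>k\<in>K. k - interior k)"
      proof
        fix x assume x: "x \<in> closure S"
        then have "x \<in> \<Union> (snd ` p)" using w division_ofD(6)[OF div] by blast
        then obtain k where "k \<in> snd ` p" "x \<in> k" by blast
        then have "k \<in> K" using x by (auto simp: K_def)
        then show "x \<in> \<Union> P \<union> (\<Union>k\<in>K. k - interior k)" using \<open>x \<in> k\<close> by (auto simp: P_def)
      qed
      then have "emeasure lborel (closure S) \<le> emeasure lborel (\<Union> P \<union> (\<Union>k\<in>K. k - interior k))"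
        using PO NK by (intro emeasure_mono) auto
      also have "\<dots> \<le> emeasure lborel (\<Union> P) + emeasure lborel (\<Union>k\<in>K. k - interior k)"
        using PO NK by (intro emeasure_subadditive) auto
      finally show ?thesis using neg eP by simp
    qed
    show ?thesis
    proof (cases "P = {}")
      case True
      then have "m = 0" by (simp add: m_def)
      then show ?thesis using cov by simp
    next
      case False
      define P' where "P' = (\<lambda>S. uminus ` S) ` P"
      have neg_box: "uminus ` box a b = box (- b) (- a)" for a b :: 'a
      proof (intro set_eqI iffI)
        fix x assume "x \<in> box (- b) (- a)"
        then have "- x \<in> box a b" by (auto simp: mem_box)
        then show "x \<in> uminus ` box a b" by (metis image_eqI minus_minus)
      qed (auto simp: mem_box)
      have UP': "\<Union> P' = uminus ` \<Union> P" by (auto simp: P'_def)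
      have P': "box_family P'"
        unfolding box_family_def
      proof (intro conjI ballI)
        show "finite P'" using P by (simp add: P'_def box_family_def)
        show "disjoint P'"
        proof (rule disjointI)
          fix S T assume "S \<in> P'" "T \<in> P'" "S \<noteq> T"
          then obtain S' T' where "S' \<in> P" "T' \<in> P" "S = uminus ` S'" "T = uminus ` T'" "S' \<noteq> T'"
            by (auto simp: P'_def)
          then show "S \<inter> T = {}" using P unfolding box_family_def disjoint_def by fastforce
        qed
        show "S \<noteq> {}" if "S \<in> P'" for S using that P by (auto simp: P'_def box_family_def)
        show "\<exists>a b. S = box a b" if SP: "S \<in> P'" for S
        proof -
          obtain T where T: "T \<in> P" "S = uminus ` T" using SP by (auto simp: P'_def)
          then obtain a b where "T = box a b" using P unfolding box_family_def by blast
          then show ?thesis using neg_box T(2) by blast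
        qed
      qed
      have mP': "measure lborel (\<Union> P') = m"
      proof -
        have "measure (distr lborel borel uminus) (\<Union> P) = measure lborel (uminus -` \<Union> P \<inter> space (lborel :: 'a measure))"
          using PO by (intro measure_distr) auto
        moreover have "uminus -` \<Union> P = uminus ` \<Union> P"
          by (metis bij_uminus bij_vimage_eq_inv_image inv_equality minus_minus)
        moreover have "distr lborel borel uminus = (lborel :: 'a measure)"
          using lborel_affine[of "-1" "0::'a"] by (simp add: density_1 one_ennreal_def[symmetric])
        ultimately show ?thesis by (simp add: m_def UP')
      qed
      have "P' \<noteq> {}" using False by (simp add: P'_def)
      then have "m \<le> measure lborel (midpoints (\<Union> P) (\<Union> P'))"
        using measure_midpoints[OF P P' False] by (simp add: mP' m_def[symmetric])
      also have "\<dots> \<le> measure lborel (cball (0::'a) (D / 2 + 2 * e))"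
      proof (rule measure_mono_fmeasurable)
        show "midpoints (\<Union> P) (\<Union> P') \<subseteq> cball 0 (D / 2 + 2 * e)"
        proof
          fix z assume "z \<in> midpoints (\<Union> P) (\<Union> P')"
          then obtain x y where xy: "x \<in> \<Union> P" "y \<in> \<Union> P" "z = midpoint x (- y)"
            unfolding midpoints_def UP' by auto
          obtain k l where kl: "k \<in> K" "x \<in> k" "l \<in> K" "y \<in> l"
            using xy(1,2) interior_subset by (fastforce simp: P_def)
          obtain s t where st: "s \<in> k" "s \<in> closure S" "t \<in> l" "t \<in> closure S"
            using kl by (auto simp: K_def)
          have "dist x y \<le> dist x s + dist s t + dist t y"
            using dist_triangle[of x y s] dist_triangle[of s y t] by linarith
          also have "\<dots> \<le> 2 * e + D + 2 * e"
            using Ksmall[OF kl(1,2) st(1)] Ksmall[OF kl(3) st(3) kl(4)]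
              diameter_bounded_bound[OF bS st(2,4)] by (simp add: D_def)
          finally have "norm (x - y) \<le> D + 4 * e" by (simp add: dist_norm)
          then show "z \<in> cball 0 (D / 2 + 2 * e)" using xy(3) by (simp add: midpoint_def)
        qed
        show "midpoints (\<Union> P) (\<Union> P') \<in> sets lborel" using open_midpoints[OF PO(1)] by simp
        show "cball (0::'a) (D / 2 + 2 * e) \<in> fmeasurable lborel"
          using emeasure_bounded_finite[of "cball (0::'a) (D / 2 + 2 * e)"] by (simp add: fmeasurable_def)
      qed
      also have "\<dots> = unit_ball_vol DIM('a) * (D / 2 + 2 * e) ^ DIM('a)"
        using content_cball[of "D / 2 + 2 * e" "0::'a"] D0 e by simp
      finally show ?thesis using cov by (meson ennreal_leI order_trans)
    qed
  qed
  have lim: "((\<lambda>e. ennreal (unit_ball_vol DIM('a) * (D / 2 + 2 * e) ^ DIM('a))) \<longlongrightarrow>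
      ennreal (unit_ball_vol DIM('a) * (D / 2 + 2 * 0) ^ DIM('a))) (at_right 0)"
    by (intro tendsto_ennrealI tendsto_intros)
  have "emeasure lborel (closure S) \<le> ennreal (unit_ball_vol DIM('a) * (D / 2 + 2 * 0) ^ DIM('a))"
    using lim
    by (rule tendsto_lowerbound) (auto simp: eventually_at_right_field intro!: exI[of _ 1] bound)
  then show ?thesis using ne diameter_closure[OF S] by (simp add: hgauge_def D_def)
qed simp

text \<open>By the isodiametric inequality the gauge of each member of a cover is at least its volume.\<close>

lemma lborel_le_hausdorff:
  fixes A :: "'a::euclidean_space set"
  assumes "A \<in> sets lebesgue"
  shows "emeasure lebesgue A \<le> hausdorff DIM('a) A"
proof -
  have "emeasure lebesgue A \<le> hausdorff_pre DIM('a) 1 A"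
    unfolding hausdorff_pre_eq
  proof (rule INF_greatest, clarify)
    fix U assume U: "fine_cover 1 A U"
    have "A \<subseteq> (\<Union>i. closure (U i))"
      using U closure_subset unfolding fine_cover_def by (meson SUP_mono' order_trans)
    then have "emeasure lebesgue A \<le> emeasure lebesgue (\<Union>i. closure (U i))"
      by (intro emeasure_mono) (auto intro!: sets.countable_UN'' )
    also have "\<dots> \<le> (\<Sum>i. emeasure lebesgue (closure (U i)))"
      by (intro emeasure_subadditive_countably) auto
    also have "\<dots> \<le> (\<Sum>i. hgauge DIM('a) (U i))"
      using U isodiametric by (intro suminf_le allI) (auto simp: fine_cover_def)
    finally show "emeasure lebesgue A \<le> (\<Sum>i. hgauge DIM('a) (U i))" .
  qed
  also have "\<dots> \<le> hausdorff DIM('a) A" by (rule hausdorff_pre_le_hausdorff) simp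
  finally show ?thesis .
qed

lemma emeasure_lborel_cball:
  fixes x :: "'a::euclidean_space"
  assumes "0 \<le> r"
  shows "emeasure lborel (cball x r) = ennreal (unit_ball_vol DIM('a) * r ^ DIM('a))"
  using emeasure_cball[OF assms, of x] by simp

text \<open>A null set lies in open sets of small volume; there the volume of every small ball is its gauge, so the
  covering lemma loses only the factor \<open>5 ^ k\<close>.\<close>

lemma negligible_hausdorff_null:
  fixes N :: "'a::euclidean_space set"
  assumes "negligible N"
  shows "hausdorff DIM('a) N = 0"
proof -
  let ?k = "DIM('a)"
  have le: "hausdorff ?k N \<le> 0 + ennreal e" if "0 < e" for e
  proof -
    have N: "N \<in> sets lebesgue" "emeasure lebesgue N = 0"
      using assms by (auto simp: negligible_iff_null_sets null_sets_def)
    obtain U where U: "open U" "N \<subseteq> U" "emeasure lebesgue (U - N) < ennreal (e / 5 ^ ?k)"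
    proof -
      have "0 < e / 5 ^ ?k" using \<open>0 < e\<close> by simp
      then show ?thesis by (rule sets_lebesgue_outer_open[OF N(1)]) (rule that)
    qed
    have "emeasure lebesgue U = emeasure lebesgue ((U - N) \<union> N)" using U(2) by (simp add: Un_absorb2)
    also have "\<dots> \<le> emeasure lebesgue (U - N) + emeasure lebesgue N"
      using U N by (intro emeasure_subadditive) auto
    finally have "emeasure lebesgue U \<le> emeasure lebesgue (U - N) + emeasure lebesgue N" .
    then have "emeasure lborel U \<le> ennreal (e / 5 ^ ?k)" using U N by simp
    moreover have "hausdorff ?k N \<le> ennreal (5 ^ ?k / 1) * emeasure lborel U"
    proof (rule hausdorff_le_of_fine_balls[OF _ U(1,2)])
      fix x :: 'a and d :: real assume "0 < d"
      then show "\<exists>r. 0 < r \<and> r < d \<and> ennreal (1 * (unit_ball_vol (real ?k) * r ^ ?k)) \<le> emeasure lborel (cball x r)"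
        by (intro exI[of _ "d / 2"]) (simp add: emeasure_lborel_cball)
    qed auto
    ultimately have "hausdorff ?k N \<le> ennreal (5 ^ ?k) * ennreal (e / 5 ^ ?k)"
      using mult_left_mono[of "emeasure lborel U" "ennreal (e / 5 ^ ?k)" "ennreal (5 ^ ?k)"] by simp
    also have "\<dots> = ennreal e" using \<open>0 < e\<close> by (simp add: ennreal_mult[symmetric])
    finally show ?thesis by simp
  qed
  have "hausdorff ?k N \<le> 0" by (rule ennreal_le_epsilon) (rule le)
  then show ?thesis by simp
qed

text \<open>By Vitali's covering theorem an open set is, up to a null set, a disjoint union of small balls, and
  balls are optimal covering sets: their gauge equals their volume.\<close>

lemma hausdorff_le_lborel_open:
  fixes U :: "'a::euclidean_space set"
  assumes U: "open U"
  shows "hausdorff DIM('a) U \<le> emeasure lborel U"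
proof (rule hausdorff_leI)
  let ?k = "DIM('a)"
  fix \<delta> :: real assume "0 < \<delta>"
  define K where "K = {(x, r). x \<in> U \<and> 0 < r \<and> r \<le> \<delta> / 2 \<and> cball x r \<subseteq> U}"
  have K: "0 < snd i" "snd i \<le> \<delta> / 2" "cball (fst i) (snd i) \<subseteq> U" if "i \<in> K" for i
    using that by (auto simp: K_def split: prod.splits)
  have fine: "\<exists>i. i \<in> K \<and> x \<in> cball (fst i) (snd i) \<and> snd i < d" if x: "x \<in> U" "0 < d" for x d
  proof -
    obtain e where e: "0 < e" "cball x e \<subseteq> U" using U x by (meson open_contains_cball)
    define r where "r = min e (min (\<delta> / 2) (d / 2))"
    have "cball x r \<subseteq> U" using e(2) subset_cball[of r e x] by (auto simp: r_def)
    then have "(x, r) \<in> K" using x e \<open>0 < \<delta>\<close> by (auto simp: K_def r_def)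
    then show ?thesis using x e \<open>0 < \<delta>\<close> by (intro exI[of _ "(x, r)"]) (auto simp: r_def)
  qed
  obtain C where C: "countable C" "C \<subseteq> K"
     "pairwise (\<lambda>i j. disjnt (cball (fst i) (snd i)) (cball (fst j) (snd j))) C"
     "negligible (U - (\<Union>i \<in> C. cball (fst i) (snd i)))"
    using Vitali_covering_theorem_cballs[of K snd U fst, OF K(1) fine] .
  let ?V = "\<Union>i\<in>C. cball (fst i) (snd i)"
  have "hausdorff_pre ?k \<delta> ?V \<le> emeasure lborel U"
  proof (rule hausdorff_pre_le_finite_sums[OF C(1) order_refl])
    show "bounded (cball (fst i) (snd i)) \<and> diameter (cball (fst i) (snd i)) \<le> \<delta>" if "i \<in> C" for i
      using K[of i] that C(2) by auto
    fix F assume F: "finite F" "F \<subseteq> C"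
    have "(\<Sum>i\<in>F. hgauge ?k (cball (fst i) (snd i))) = (\<Sum>i\<in>F. emeasure lborel (cball (fst i) (snd i)))"
    proof (rule sum.cong)
      fix i assume "i \<in> F"
      then have "0 \<le> snd i" using K(1)[of i] F C(2) by auto
      then show "hgauge ?k (cball (fst i) (snd i)) = emeasure lborel (cball (fst i) (snd i))"
        by (simp only: hgauge_cball emeasure_lborel_cball)
    qed simp
    also have "\<dots> = emeasure lborel (\<Union>i\<in>F. cball (fst i) (snd i))"
    proof (rule sum_emeasure)
      show "disjoint_family_on (\<lambda>i. cball (fst i) (snd i)) F"
        using pairwise_subset[OF C(3) F(2)]
        unfolding disjoint_family_on_def pairwise_def disjnt_def by blast
    qed (use F in auto)
    also have "\<dots> \<le> emeasure lborel U"
    proof (rule emeasure_mono)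
      show "(\<Union>i\<in>F. cball (fst i) (snd i)) \<subseteq> U" using K(3) F C(2) by blast
    qed (use U in simp)
    finally show "(\<Sum>i\<in>F. hgauge ?k (cball (fst i) (snd i))) \<le> emeasure lborel U" .
  qed (use \<open>0 < \<delta>\<close> in auto)
  moreover have "hausdorff_pre ?k \<delta> (U - ?V) = 0"
    using negligible_hausdorff_null[OF C(4)] hausdorff_pre_le_hausdorff[OF \<open>0 < \<delta>\<close>, of ?k "U - ?V"] by simp
  moreover have "hausdorff_pre ?k \<delta> U \<le> hausdorff_pre ?k \<delta> ?V + hausdorff_pre ?k \<delta> (U - ?V)"
  proof -
    have "hausdorff_pre ?k \<delta> U \<le> hausdorff_pre ?k \<delta> (\<Union>n. if n = 0 then ?V else if n = Suc 0 then U - ?V else {})"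
      by (rule hausdorff_pre_mono) (auto split: if_splits)
    also have "\<dots> \<le> (\<Sum>n. hausdorff_pre ?k \<delta> (if n = 0 then ?V else if n = Suc 0 then U - ?V else {}))"
      by (rule hausdorff_pre_countable_subadditive)
    also have "\<dots> = (\<Sum>n<2. hausdorff_pre ?k \<delta> (if n = 0 then ?V else if n = Suc 0 then U - ?V else {}))"
      using \<open>0 < \<delta>\<close> by (intro suminf_finite) (auto simp: hausdorff_pre_empty)
    finally show ?thesis by (simp add: numeral_2_eq_2)
  qed
  ultimately show "hausdorff_pre ?k \<delta> U \<le> emeasure lborel U" by simp
qed

theorem hausdorff_eq_lebesgue:
  fixes A :: "'a::euclidean_space set"
  assumes A: "A \<in> sets lebesgue"
  shows "hausdorff DIM('a) A = emeasure lebesgue A"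
proof (rule antisym)
  show "hausdorff DIM('a) A \<le> emeasure lebesgue A"
  proof (rule ennreal_le_epsilon)
    fix e :: real assume "0 < e"
    from sets_lebesgue_outer_open[OF A this]
    obtain U where U: "open U" "A \<subseteq> U" "emeasure lebesgue (U - A) < ennreal e" by metis
    have "hausdorff DIM('a) A \<le> emeasure lborel U"
      using hausdorff_mono[OF U(2)] hausdorff_le_lborel_open[OF U(1)] by (rule order_trans)
    also have "\<dots> = emeasure lebesgue (A \<union> (U - A))" using U by (simp add: Un_absorb1)
    also have "\<dots> \<le> emeasure lebesgue A + emeasure lebesgue (U - A)"
      using U A by (intro emeasure_subadditive) auto
    also have "\<dots> \<le> emeasure lebesgue A + ennreal e" using U(3) by (intro add_left_mono) simp
    finally show "hausdorff DIM('a) A \<le> emeasure lebesgue A + ennreal e" .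
  qed
qed (rule lborel_le_hausdorff[OF A])

corollary hausdorff_eq_lborel:
  fixes A :: "'a::euclidean_space set"
  shows "A \<in> sets borel \<Longrightarrow> hausdorff DIM('a) A = emeasure lborel A"
  using hausdorff_eq_lebesgue[of A] by simp

corollary hausdorff_null_imp_negligible:
  fixes N :: "'a::euclidean_space set"
  assumes "hausdorff DIM('a) N = 0" shows "negligible N"
proof -
  obtain B where B: "B \<in> sets borel" "N \<subseteq> B" "hausdorff DIM('a) B = hausdorff DIM('a) N"
    by (rule hausdorff_borel_hull)
  then have "negligible B" using assms hausdorff_eq_lborel[of B]
    by (simp add: negligible_iff_null_sets null_sets_def)
  then show ?thesis using B(2) by (rule negligible_subset)
qed

lemma hausdorff_on_UNIV: "hausdorff_on DIM('a) (UNIV :: 'a::euclidean_space set) = lborel"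
  by (rule measure_eqI) (simp_all add: emeasure_hausdorff_on hausdorff_eq_lborel)

lemma has_density_UNIV:
  fixes x :: "'a::euclidean_space"
  shows "has_density DIM('a) UNIV x 1"
  unfolding has_density_def
proof (rule tendsto_eventually)
  have "hausdorff DIM('a) (UNIV \<inter> cball x r) / ennreal (unit_ball_vol (real DIM('a)) * r ^ DIM('a)) = 1"
    if "0 < r" for r
  proof -
    define c where "c = unit_ball_vol (real DIM('a)) * r ^ DIM('a)"
    have "0 < c" unfolding c_def using that by (rule unit_ball_vol_power_pos)
    moreover have "hausdorff DIM('a) (cball x r) = ennreal c"
      using that by (simp add: hausdorff_eq_lborel emeasure_lborel_cball c_def)
    ultimately show ?thesis by (simp add: c_def[symmetric] divide_ennreal)
  qed
  then show "\<forall>\<^sub>F r in at_right 0. hausdorff DIM('a) (UNIV \<inter> cball x r) / ennreal (unit_ball_vol (real DIM('a)) * r ^ DIM('a)) = 1"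
    unfolding eventually_at_right_field by (intro exI[of _ 1]) auto
qed

corollary lebesgue_points_ae:
  fixes \<psi> :: "'a::euclidean_space \<Rightarrow> real"
  assumes "\<psi> \<in> borel_measurable borel" "\<And>x. \<bar>\<psi> x\<bar> \<le> C"
  shows "negligible {x. \<not> (mean_osc DIM('a) lborel \<psi> x \<longlongrightarrow> 0) (at_right 0)}"
proof -
  have "hausdorff DIM('a) (UNIV \<inter> ball (0::'a) R) < \<infinity>" for R
    using emeasure_bounded_finite[of "ball (0::'a) R"] by (simp add: hausdorff_eq_lborel)
  from mean_osc_tendsto_0_ae[OF _ this assms] show ?thesis
    by (intro hausdorff_null_imp_negligible) (simp add: has_density_UNIV hausdorff_on_UNIV)
qed

section \<open>Rademacher's theorem\<close>

text \<open>The Radon-Nikodym derivative exceeds \<open>c\<close> only on a null set, by the domination of \<open>N\<close>; so it may be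
  truncated.\<close>

lemma bounded_density:
  fixes c :: real
  assumes "sigma_finite_measure M" and N: "sets N = sets M" and "0 \<le> c"
    and le: "\<And>A. A \<in> sets M \<Longrightarrow> emeasure N A \<le> ennreal c * emeasure M A"
  obtains D where "D \<in> borel_measurable M" "\<And>x. 0 \<le> D x" "\<And>x. D x \<le> c" "density M (\<lambda>x. ennreal (D x)) = N"
proof -
  interpret sigma_finite_measure M by fact
  have "absolutely_continuous M N"
    unfolding absolutely_continuous_def
  proof
    fix A assume "A \<in> null_sets M"
    then show "A \<in> null_sets N" using le[of A] N by (auto simp: null_sets_def)
  qed
  from Radon_Nikodym[OF this N] obtain f where f[measurable]: "f \<in> borel_measurable M" and fN: "density M f = N"
    by blast
  obtain A :: "nat \<Rightarrow> 'a set" where A: "range A \<subseteq> sets M" "(\<Union>i. A i) = space M" "\<And>i. emeasure M (A i) \<noteq> \<infinity>"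
    using sigma_finite by blast
  have "AE x in M. \<forall>i. \<not> (x \<in> A i \<and> ennreal c < f x)"
    unfolding AE_all_countable
  proof
    fix i
    define B where "B = A i \<inter> {x\<in>space M. ennreal c < f x}"
    have [measurable]: "A i \<in> sets M" using A(1) by auto
    have B[measurable]: "B \<in> sets M" unfolding B_def by measurable
    have fin: "ennreal c * emeasure M B < top"
    proof -
      have "emeasure M B \<le> emeasure M (A i)" unfolding B_def by (intro emeasure_mono) auto
      then have "emeasure M B < top" using A(3)[of i] by (simp add: less_top order_le_less_trans)
      then show ?thesis by (simp add: ennreal_mult_less_top)
    qed
    have cB: "(\<integral>\<^sup>+x. ennreal c * indicator B x \<partial>M) = ennreal c * emeasure M B"
      by (rule nn_integral_cmult_indicator) (rule B)
    have fB: "(\<integral>\<^sup>+x. f x * indicator B x \<partial>M) = emeasure N B"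
      using f B by (simp add: fN[symmetric] emeasure_density)
    have "(\<integral>\<^sup>+x. f x * indicator B x - ennreal c * indicator B x \<partial>M) =
       (\<integral>\<^sup>+x. f x * indicator B x \<partial>M) - (\<integral>\<^sup>+x. ennreal c * indicator B x \<partial>M)"
    proof (rule nn_integral_diff)
      show "AE x in M. ennreal c * indicator B x \<le> f x * indicator B x"
        by (intro AE_I2) (auto simp: B_def indicator_def)
      show "(\<lambda>x. f x * indicator B x) \<in> borel_measurable M" by measurable
      show "(\<lambda>x. ennreal c * indicator B x) \<in> borel_measurable M" by measurable
      show "(\<integral>\<^sup>+x. ennreal c * indicator B x \<partial>M) \<noteq> \<infinity>" using fin by (simp add: cB)
    qed
    also have "\<dots> = 0" unfolding cB fB using le[OF B] fin by (simp add: diff_eq_0_iff_ennreal)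
    finally have "AE x in M. f x * indicator B x - ennreal c * indicator B x = 0"
      by (subst (asm) nn_integral_0_iff_AE) measurable
    then show "AE x in M. \<not> (x \<in> A i \<and> ennreal c < f x)"
    proof eventually_elim
      fix x assume x: "f x * indicator B x - ennreal c * indicator B x = 0"
      show "\<not> (x \<in> A i \<and> ennreal c < f x)"
      proof
        assume h: "x \<in> A i \<and> ennreal c < f x"
        then have "x \<in> B" using A(2) by (auto simp: B_def)
        then show False using x h by (auto simp: diff_eq_0_iff_ennreal)
      qed
    qed
  qed
  then have AE: "AE x in M. f x \<le> ennreal c"
    using AE_space
  proof eventually_elim
    fix x assume "\<forall>i. \<not> (x \<in> A i \<and> ennreal c < f x)" "x \<in> space M"
    then show "f x \<le> ennreal c" unfolding A(2)[symmetric] by (auto simp: not_less)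
  qed
  define D where "D x = enn2real (min (f x) (ennreal c))" for x
  have eD: "ennreal (D x) = min (f x) (ennreal c)" for x
    unfolding D_def by (subst ennreal_enn2real) (auto simp: min_less_iff_disj)
  show ?thesis
  proof (rule that)
    show "D \<in> borel_measurable M" unfolding D_def by measurable
    show "0 \<le> D x" for x by (simp add: D_def)
    show "D x \<le> c" for x using eD[of x] \<open>0 \<le> c\<close> by (metis ennreal_le_iff min.cobounded2)
    have "density M (\<lambda>x. ennreal (D x)) = density M f"
      unfolding eD using AE by (intro density_cong) (auto simp: min_def)
    then show "density M (\<lambda>x. ennreal (D x)) = N" using fN by simp
  qed
qed

lemma hgauge_real:
  fixes U :: "real set"
  assumes "U \<noteq> {}" "bounded U"
  obtains a b where "a \<le> b" "U \<subseteq> {a..b}" "hgauge 1 U = ennreal (b - a)"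
proof -
  have c: "compact (closure U)" "closure U \<noteq> {}" using assms by (auto simp: compact_closure)
  obtain a where a: "a \<in> closure U" "\<And>x. x \<in> closure U \<Longrightarrow> a \<le> x" using compact_attains_inf[OF c] by blast
  obtain b where b: "b \<in> closure U" "\<And>x. x \<in> closure U \<Longrightarrow> x \<le> b" using compact_attains_sup[OF c] by blast
  have sub: "closure U \<subseteq> {a..b}" using a b by auto
  have ab: "a \<le> b" using a b by auto
  have "diameter (closure U) \<le> diameter {a..b}" using sub by (intro diameter_subset) auto
  moreover have "dist a b \<le> diameter (closure U)"
    using a b assms(2) by (intro diameter_bounded_bound) (auto intro: bounded_closure)
  ultimately have "diameter U = b - a" using ab assms(2) by (simp add: diameter_closure dist_real_def)
  then have "hgauge 1 U = ennreal (b - a)" using assms(1) by (simp add: hgauge_def diff_divide_distrib)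
  then show ?thesis using that[OF ab] sub closure_subset by blast
qed

text \<open>Adding \<open>L s\<close> to \<open>\<phi>\<close> makes it monotone, with an associated interval measure of at most \<open>2 L\<close>
  times the length; its Radon-Nikodym density, minus \<open>L\<close>, is the derivative of \<open>\<phi>\<close>.\<close>

lemma lipschitz_density:
  fixes \<phi> :: "real \<Rightarrow> real"
  assumes \<phi>: "L-lipschitz_on UNIV \<phi>"
  obtains \<psi> where "\<psi> \<in> borel_measurable borel" "\<And>s. \<bar>\<psi> s\<bar> \<le> L"
    "\<And>a b. a \<le> b \<Longrightarrow> (LINT s|lborel. indicator {a..b} s * \<psi> s) = \<phi> b - \<phi> a"
proof -
  have L: "0 \<le> L" using \<phi> by (rule lipschitz_on_nonneg)
  have lip: "\<bar>\<phi> x - \<phi> y\<bar> \<le> L * \<bar>x - y\<bar>" for x y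
    using lipschitz_onD[OF \<phi>, of x y] by (simp add: dist_real_def)
  define h where "h x = \<phi> x + L * x" for x
  have mono: "h x \<le> h y" if "x \<le> y" for x y
    using lip[of x y] that by (simp add: h_def algebra_simps)
  have cont: "continuous_on UNIV h"
    unfolding h_def using lipschitz_on_continuous_on[OF \<phi>] by (intro continuous_intros)
  let ?N = "interval_measure h"
  have Icc: "emeasure ?N {a..b} = ennreal (h b - h a)" if "a \<le> b" for a b
    using emeasure_interval_measure_Icc[OF that mono cont] by simp
  have Icc_le: "emeasure ?N {a..b} \<le> ennreal (2 * L * (b - a))" if "a \<le> b" for a b
    unfolding Icc[OF that] using lip[of b a] that by (intro ennreal_leI) (simp add: h_def algebra_simps)
  \<comment> \<open>The bound extends from intervals to Borel sets because length is one-dimensional Hausdorff measure.\<close>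
  have dom: "emeasure ?N A \<le> ennreal (2 * L) * emeasure lborel A" if A: "A \<in> sets lborel" for A
  proof -
    have le: "emeasure ?N A \<le> ennreal (2 * L) * hausdorff_pre 1 1 A + ennreal e" if e: "0 < e" for e
    proof (cases "hausdorff_pre 1 1 A < \<infinity>")
      case False
      show ?thesis
      proof (cases "L = 0")
        case True
        have "emeasure ?N A \<le> emeasure ?N (\<Union>n. {- real n .. real n})"
          using A by (intro emeasure_mono) (auto, metis abs_le_iff minus_le_iff real_nat_ceiling_ge real_arch_simple)
        also have "\<dots> \<le> (\<Sum>n. emeasure ?N {- real n .. real n})"
          by (intro emeasure_subadditive_countably) auto
        also have "\<dots> = 0" using Icc_le[of "- real n" "real n" for n] True by (simp add: suminf_zero)
        finally show ?thesis by simp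
      next
        case nz: False
        then show ?thesis using False L by (simp add: less_top[symmetric] ennreal_mult_eq_top_iff)
      qed
    next
      case True
      define d where "d = e / (2 * L + 1)"
      have d: "0 < d" using e L by (simp add: d_def)
      have "e = (2 * L + 1) * d" using L by (simp add: d_def)
      then have "e = 2 * L * d + d" by (simp add: algebra_simps)
      with d have d_le: "2 * L * d \<le> e" by linarith
      obtain U where U: "fine_cover 1 A U" "(\<Sum>i. hgauge 1 (U i)) < hausdorff_pre 1 1 A + ennreal d"
        by (rule hausdorff_pre_approx[OF True d])
      have "\<exists>V. V \<in> sets borel \<and> U i \<subseteq> V \<and> emeasure ?N V \<le> ennreal (2 * L) * hgauge 1 (U i)" for i
      proof (cases "U i = {}")
        case True then show ?thesis by (intro exI[of _ "{}"]) auto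
      next
        case False
        have "bounded (U i)" using U(1) by (simp add: fine_cover_def)
        then obtain a b where ab: "a \<le> b" "U i \<subseteq> {a..b}" "hgauge 1 (U i) = ennreal (b - a)"
          using hgauge_real[OF False] by blast
        have "emeasure ?N {a..b} \<le> ennreal (2 * L) * hgauge 1 (U i)"
          using Icc_le[OF ab(1)] ab L by (simp add: ennreal_mult)
        then show ?thesis using ab by (intro exI[of _ "{a..b}"]) auto
      qed
      then obtain V where V: "\<And>i. V i \<in> sets borel" "\<And>i. U i \<subseteq> V i"
        "\<And>i. emeasure ?N (V i) \<le> ennreal (2 * L) * hgauge 1 (U i)" by metis
      have "A \<subseteq> (\<Union>i. V i)" using U(1) V(2) unfolding fine_cover_def by blast
      then have "emeasure ?N A \<le> emeasure ?N (\<Union>i. V i)" using V(1) by (intro emeasure_mono) auto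
      also have "\<dots> \<le> (\<Sum>i. emeasure ?N (V i))" using V(1) by (intro emeasure_subadditive_countably) auto
      also have "\<dots> \<le> (\<Sum>i. ennreal (2 * L) * hgauge 1 (U i))" by (intro suminf_le V) auto
      also have "\<dots> = ennreal (2 * L) * (\<Sum>i. hgauge 1 (U i))" by simp
      also have "\<dots> \<le> ennreal (2 * L) * (hausdorff_pre 1 1 A + ennreal d)"
        using U(2) by (intro mult_left_mono) auto
      also have "\<dots> = ennreal (2 * L) * hausdorff_pre 1 1 A + ennreal (2 * L * d)"
        using L d by (simp add: distrib_left ennreal_mult)
      also have "\<dots> \<le> ennreal (2 * L) * hausdorff_pre 1 1 A + ennreal e"
        using d_le by (intro add_left_mono ennreal_leI)
      finally show ?thesis .
    qed
    have "emeasure ?N A \<le> ennreal (2 * L) * hausdorff_pre 1 1 A"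
      by (rule ennreal_le_epsilon) (rule le)
    also have "\<dots> \<le> ennreal (2 * L) * hausdorff 1 A"
      by (intro mult_left_mono hausdorff_pre_le_hausdorff) auto
    also have "hausdorff 1 A = emeasure lborel A" using hausdorff_eq_lborel[of A] A by simp
    finally show ?thesis .
  qed
  obtain D where D[measurable]: "D \<in> borel_measurable lborel" and D0: "\<And>x. 0 \<le> D x" "\<And>x. D x \<le> 2 * L"
      and dens: "density lborel (\<lambda>x. ennreal (D x)) = ?N"
    using bounded_density[of lborel ?N "2 * L"] sigma_finite_lborel dom L by auto
  show ?thesis
  proof (rule that[of "\<lambda>s. D s - L"])
    show "(\<lambda>s. D s - L) \<in> borel_measurable borel" using D by simp
    show "\<bar>D s - L\<bar> \<le> L" for s using D0[of s] by auto
    fix a b :: real assume ab: "a \<le> b"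
    have nn: "(\<integral>\<^sup>+s. ennreal (indicator {a..b} s * D s) \<partial>lborel) = ennreal (h b - h a)"
    proof -
      have "(\<integral>\<^sup>+s. ennreal (indicator {a..b} s * D s) \<partial>lborel) = (\<integral>\<^sup>+s. ennreal (D s) * indicator {a..b} s \<partial>lborel)"
        by (intro nn_integral_cong) (auto simp: indicator_def)
      also have "\<dots> = emeasure (density lborel (\<lambda>x. ennreal (D x))) {a..b}"
        by (rule emeasure_density[symmetric]) auto
      finally show ?thesis using Icc[OF ab] dens by simp
    qed
    have hb: "has_bochner_integral lborel (\<lambda>s. indicator {a..b} s * D s) (h b - h a)"
      by (rule has_bochner_integral_nn_integral[OF _ _ _ nn]) (use D0 mono[OF ab] in auto)
    have hc: "has_bochner_integral lborel (\<lambda>s. indicator {a..b} s * L) ((b - a) * L)"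
      using has_bochner_integral_mult_left[OF has_bochner_integral_real_indicator[of "{a..b}" lborel], of L] ab
      by simp
    have "has_bochner_integral lborel (\<lambda>s. indicator {a..b} s * (D s - L)) ((h b - h a) - (b - a) * L)"
      using has_bochner_integral_diff[OF hb hc] by (simp add: right_diff_distrib)
    then show "(LINT s|lborel. indicator {a..b} s * (D s - L)) = \<phi> b - \<phi> a"
      by (simp add: has_bochner_integral_integral_eq h_def algebra_simps)
  qed
qed

lemma abs_integral_sub_const_le:
  fixes \<psi> :: "real \<Rightarrow> real"
  assumes \<psi>[measurable]: "\<psi> \<in> borel_measurable borel" and bd: "\<And>s. \<bar>\<psi> s\<bar> \<le> L" and "a \<le> b"
  shows "ennreal \<bar>(LINT s|lborel. indicator {a..b} s * \<psi> s) - (b - a) * c\<bar> \<le> (\<integral>\<^sup>+s\<in>{a..b}. ennreal \<bar>\<psi> s - c\<bar> \<partial>lborel)"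
proof -
  have int: "integrable lborel (\<lambda>s. indicator {a..b} s * \<psi> s)"
  proof (rule Bochner_Integration.integrable_bound)
    show "integrable lborel (\<lambda>s. indicator {a..b} s * L)" using assms(3) by (intro integrable_mult_left integrable_real_indicator) simp_all
    show "AE s in lborel. norm (indicator {a..b} s * \<psi> s) \<le> norm (indicator {a..b} s * L)"
      using bd order_trans[OF bd abs_ge_self] by (intro AE_I2) (auto simp: indicator_def)
  qed auto
  have "integrable lborel (\<lambda>s. indicator {a..b} s * c)"
    using assms(3) by (intro integrable_mult_left integrable_real_indicator) simp_all
  then have int': "integrable lborel (\<lambda>s. indicator {a..b} s * (\<psi> s - c))"
    unfolding right_diff_distrib using int by (intro Bochner_Integration.integrable_diff)
  have "(LINT s|lborel. indicator {a..b} s * (\<psi> s - c)) = (LINT s|lborel. indicator {a..b} s * \<psi> s) - (b - a) * c"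
    using int assms(3) by (simp add: right_diff_distrib)
  moreover have "ennreal \<bar>(LINT s|lborel. indicator {a..b} s * (\<psi> s - c))\<bar> \<le> (\<integral>\<^sup>+s. ennreal \<bar>indicator {a..b} s * (\<psi> s - c)\<bar> \<partial>lborel)"
    using integral_norm_bound_ennreal[OF int'] by simp
  moreover have "(\<integral>\<^sup>+s. ennreal \<bar>indicator {a..b} s * (\<psi> s - c)\<bar> \<partial>lborel) = (\<integral>\<^sup>+s\<in>{a..b}. ennreal \<bar>\<psi> s - c\<bar> \<partial>lborel)"
    by (intro nn_integral_cong) (auto simp: indicator_def)
  ultimately show ?thesis by simp
qed

definition diff_quot :: "('a::real_vector \<Rightarrow> real) \<Rightarrow> 'a \<Rightarrow> nat \<Rightarrow> 'a \<Rightarrow> real" where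
  "diff_quot f b m x = (f (x + (1 / real (Suc m)) *\<^sub>R b) - f x) * real (Suc m)"

text \<open>The truncation makes the function bounded also where the limit does not exist.\<close>

definition dir_deriv :: "real \<Rightarrow> ('a::real_vector \<Rightarrow> real) \<Rightarrow> 'a \<Rightarrow> 'a \<Rightarrow> real" where
  "dir_deriv L f b x = max (- L) (min L (lim (\<lambda>m. diff_quot f b m x)))"

lemma dir_deriv_bounded: "0 \<le> L \<Longrightarrow> \<bar>dir_deriv L f b x\<bar> \<le> L"
  unfolding dir_deriv_def by auto

lemma dir_deriv_borel:
  fixes f :: "'a::euclidean_space \<Rightarrow> real"
  assumes "continuous_on UNIV f"
  shows "dir_deriv L f b \<in> borel_measurable borel"
proof -
  have "diff_quot f b m \<in> borel_measurable borel" for m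
    unfolding diff_quot_def
    by (intro borel_measurable_continuous_onI continuous_intros continuous_on_compose2[OF assms]) auto
  then have [measurable]: "(\<lambda>x. diff_quot f b m x) \<in> borel_measurable borel" for m by simp
  show ?thesis unfolding dir_deriv_def by measurable
qed

text \<open>Difference quotients are averages of \<open>\<psi>\<close> over short intervals, which converge at Lebesgue points.\<close>

lemma dir_deriv_ae_density:
  fixes \<phi> :: "real \<Rightarrow> real"
  assumes \<psi>: "\<psi> \<in> borel_measurable borel" "\<And>s. \<bar>\<psi> s\<bar> \<le> L"
    and int: "\<And>a b. a \<le> b \<Longrightarrow> (LINT s|lborel. indicator {a..b} s * \<psi> s) = \<phi> b - \<phi> a"
  shows "AE s in lborel. dir_deriv L \<phi> 1 s = \<psi> s"
proof -
  have "negligible {s. \<not> (mean_osc 1 lborel \<psi> s \<longlongrightarrow> 0) (at_right 0)}"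
    using lebesgue_points_ae[OF \<psi>] by simp
  then have "AE s in lebesgue. (mean_osc 1 lborel \<psi> s \<longlongrightarrow> 0) (at_right 0)"
    by (simp add: negligible_iff_null_sets AE_iff_null_sets)
      (metis (no_types, lifting) AE_I' mem_Collect_eq subsetI)
  then have "AE s in lborel. (mean_osc 1 lborel \<psi> s \<longlongrightarrow> 0) (at_right 0)"
    by (simp add: AE_completion_iff)
  then show ?thesis
  proof eventually_elim
    fix s assume s: "(mean_osc 1 lborel \<psi> s \<longlongrightarrow> 0) (at_right 0)"
    define d where "d m = 1 / real (Suc m)" for m
    have d0: "0 < d m" for m by (simp add: d_def)
    have "filterlim d (at_right 0) sequentially"
      unfolding filterlim_at d_def using LIMSEQ_inverse_real_of_nat
      by (auto simp: inverse_eq_divide intro!: always_eventually)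
    then have lim: "(\<lambda>m. ennreal 2 * mean_osc 1 lborel \<psi> s (d m)) \<longlonglongrightarrow> ennreal 2 * 0"
      by (intro ennreal_tendsto_cmult filterlim_compose[OF s]) auto
    have le: "ennreal \<bar>diff_quot \<phi> 1 m s - \<psi> s\<bar> \<le> ennreal 2 * mean_osc 1 lborel \<psi> s (d m)" for m
    proof -
      have eq: "\<bar>diff_quot \<phi> 1 m s - \<psi> s\<bar> = \<bar>(\<phi> (s + d m) - \<phi> s) - d m * \<psi> s\<bar> * real (Suc m)"
      proof -
        have "((\<phi> (s + d m) - \<phi> s) - d m * \<psi> s) * real (Suc m) = diff_quot \<phi> 1 m s - \<psi> s"
          by (simp add: diff_quot_def d_def left_diff_distrib)
        then show ?thesis by (metis abs_mult abs_of_nat)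
      qed
      have "ennreal \<bar>(\<phi> (s + d m) - \<phi> s) - d m * \<psi> s\<bar> \<le> (\<integral>\<^sup>+y\<in>{s..s + d m}. ennreal \<bar>\<psi> y - \<psi> s\<bar> \<partial>lborel)"
        using abs_integral_sub_const_le[OF \<psi>, of s "s + d m" "\<psi> s"] int[of s "s + d m"] d0[of m] by simp
      also have "\<dots> \<le> (\<integral>\<^sup>+y\<in>cball s (d m). ennreal \<bar>\<psi> y - \<psi> s\<bar> \<partial>lborel)"
        using d0[of m] by (intro nn_integral_mono) (auto simp: indicator_def dist_real_def)
      also have "\<dots> = mean_osc 1 lborel \<psi> s (d m) * ennreal (2 * d m)"
        using d0[of m] unfolding mean_osc_def
        by (simp add: ennreal_divide_times ennreal_divide_self)
      finally have "ennreal \<bar>(\<phi> (s + d m) - \<phi> s) - d m * \<psi> s\<bar> * ennreal (real (Suc m)) \<le>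
         mean_osc 1 lborel \<psi> s (d m) * ennreal (2 * d m) * ennreal (real (Suc m))"
        by (rule mult_right_mono) simp
      also have "\<dots> = mean_osc 1 lborel \<psi> s (d m) * ennreal (2 * d m * real (Suc m))"
        using d0[of m] by (simp add: ennreal_mult mult.assoc)
      also have "2 * d m * real (Suc m) = 2" unfolding d_def by (simp del: of_nat_Suc)
      finally show ?thesis unfolding eq by (simp add: ennreal_mult mult.commute)
    qed
    have "(\<lambda>m. ennreal \<bar>diff_quot \<phi> 1 m s - \<psi> s\<bar>) \<longlonglongrightarrow> 0"
      by (rule tendsto_sandwich[of "\<lambda>_. 0", OF _ _ tendsto_const lim[simplified]]) (auto simp: le[simplified])
    then have "(\<lambda>m. \<bar>diff_quot \<phi> 1 m s - \<psi> s\<bar>) \<longlonglongrightarrow> 0"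
      by (intro tendsto_ennrealD[of _ 0]) simp_all
    then have "(\<lambda>m. diff_quot \<phi> 1 m s) \<longlonglongrightarrow> \<psi> s"
      by (simp add: tendsto_rabs_zero_iff LIM_zero_iff)
    then have "lim (\<lambda>m. diff_quot \<phi> 1 m s) = \<psi> s" by (rule limI)
    then show "dir_deriv L \<phi> 1 s = \<psi> s" using \<psi>(2)[of s] by (simp add: dir_deriv_def min_def max_def abs_le_iff)
  qed
qed

text \<open>On every line \<open>f\<close> is the integral of its directional derivative.\<close>

lemma lipschitz_increment_le:
  fixes f :: "'a::euclidean_space \<Rightarrow> real"
  assumes f: "L-lipschitz_on UNIV f" and b: "norm b = 1" and t: "0 \<le> t"
  shows "ennreal \<bar>f (y + t *\<^sub>R b) - f y - t * c\<bar> \<le> (\<integral>\<^sup>+s\<in>{0..t}. ennreal \<bar>dir_deriv L f b (y + s *\<^sub>R b) - c\<bar> \<partial>lborel)"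
proof -
  define \<phi> where "\<phi> s = f (y + s *\<^sub>R b)" for s
  have "L-lipschitz_on UNIV \<phi>"
  proof (rule lipschitz_onI)
    show "dist (\<phi> u) (\<phi> v) \<le> L * dist u v" for u v
      using lipschitz_onD[OF f, of "y + u *\<^sub>R b" "y + v *\<^sub>R b"] b
      by (simp add: \<phi>_def dist_norm scaleR_left_diff_distrib[symmetric])
  qed (rule lipschitz_on_nonneg[OF f])
  then obtain \<psi> where \<psi>: "\<psi> \<in> borel_measurable borel" "\<And>s. \<bar>\<psi> s\<bar> \<le> L"
    and int: "\<And>a b. a \<le> b \<Longrightarrow> (LINT s|lborel. indicator {a..b} s * \<psi> s) = \<phi> b - \<phi> a"
    by (rule lipschitz_density) blast
  have dq: "diff_quot \<phi> 1 m s = diff_quot f b m (y + s *\<^sub>R b)" for m s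
    by (simp add: diff_quot_def \<phi>_def algebra_simps)
  have "AE s in lborel. dir_deriv L \<phi> 1 s = \<psi> s" by (rule dir_deriv_ae_density[OF \<psi> int])
  then have AE: "AE s in lborel. dir_deriv L f b (y + s *\<^sub>R b) = \<psi> s"
    by (simp add: dir_deriv_def dq)
  have "ennreal \<bar>\<phi> t - \<phi> 0 - t * c\<bar> \<le> (\<integral>\<^sup>+s\<in>{0..t}. ennreal \<bar>\<psi> s - c\<bar> \<partial>lborel)"
    using abs_integral_sub_const_le[OF \<psi> t, of c] int[OF t] by simp
  also have "\<dots> = (\<integral>\<^sup>+s\<in>{0..t}. ennreal \<bar>dir_deriv L f b (y + s *\<^sub>R b) - c\<bar> \<partial>lborel)"
    using AE by (intro nn_integral_cong_AE) (auto elim!: eventually_mono)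
  finally show ?thesis by (simp add: \<phi>_def)
qed


text \<open>At a Lebesgue point \<open>x\<close> of the directional derivative the increments of \<open>f\<close> near \<open>x\<close> in direction
  \<open>b\<close> are nearly linear: averaging the increment over a ball of radius \<open>\<delta> r\<close> changes it by at most \<open>2 L \<delta> r\<close>,
  and the averaged increment is an integral over a neighbourhood of \<open>x\<close> of radius comparable to \<open>r\<close>.\<close>

lemma increment_at_lebesgue_point:
  fixes f :: "'a::euclidean_space \<Rightarrow> real"
  assumes f: "L-lipschitz_on UNIV f" and b: "norm b = 1" and \<delta>: "0 < \<delta>" "\<delta> \<le> 1"
    and r: "0 < r" and y: "dist x y \<le> 2 * r" and t: "0 \<le> t" "t \<le> r"
  defines "c \<equiv> dir_deriv L f b x"
  shows "ennreal \<bar>f (y + t *\<^sub>R b) - f y - t * c\<bar> \<le> ennreal (2 * L * \<delta> * r)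
       + ennreal (r * (4 / \<delta>) ^ DIM('a)) * mean_osc DIM('a) lborel (dir_deriv L f b) x (4 * r)"
proof -
  let ?k = "DIM('a)" and ?B = "cball (0::'a) (\<delta> * r)"
  let ?g = "dir_deriv L f b"
  have L: "0 \<le> L" using f by (rule lipschitz_on_nonneg)
  have lip: "\<bar>f u - f v\<bar> \<le> L * norm (u - v)" for u v
    using lipschitz_onD[OF f, of u v] by (simp add: dist_real_def dist_norm)
  have cf: "continuous_on UNIV f" using f by (rule lipschitz_on_continuous_on)
  have [measurable]: "?g \<in> borel_measurable borel" by (rule dir_deriv_borel[OF cf])
  define v where "v = unit_ball_vol (real ?k) * (\<delta> * r) ^ ?k"
  have v: "0 < v" unfolding v_def using \<delta> r by (intro unit_ball_vol_power_pos) simp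
  have mB: "emeasure lborel ?B = ennreal v"
    unfolding v_def using \<delta> r by (intro emeasure_lborel_cball) simp
  define a where "a = \<bar>f (y + t *\<^sub>R b) - f y - t * c\<bar>"
  define I where "I = (\<integral>\<^sup>+z\<in>cball x (4 * r). ennreal \<bar>?g z - c\<bar> \<partial>lborel)"
  \<comment> \<open>The increment at \<open>y\<close> is compared with the increments at all \<open>w + y\<close>, \<open>w\<close> in the ball.\<close>
  have pw: "ennreal (a - 2 * L * \<delta> * r) * indicator ?B w \<le>
     (\<integral>\<^sup>+s. ennreal \<bar>?g (w + (y + s *\<^sub>R b)) - c\<bar> * (indicator {0..t} s * indicator ?B w) \<partial>lborel)" for w
  proof (cases "w \<in> ?B")
    case True
    have "\<bar>f (y + t *\<^sub>R b) - f (w + (y + t *\<^sub>R b))\<bar> \<le> L * (\<delta> * r)"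
      using lip[of "y + t *\<^sub>R b" "w + (y + t *\<^sub>R b)"] True mult_left_mono[of "norm w" "\<delta> * r" L] L by simp
    moreover have "\<bar>f y - f (w + y)\<bar> \<le> L * (\<delta> * r)"
      using lip[of y "w + y"] True mult_left_mono[of "norm w" "\<delta> * r" L] L by simp
    ultimately have "a - 2 * L * \<delta> * r \<le> \<bar>f ((w + y) + t *\<^sub>R b) - f (w + y) - t * c\<bar>"
      unfolding a_def by (simp add: add.assoc)
    then have "ennreal (a - 2 * L * \<delta> * r) \<le> ennreal \<bar>f ((w + y) + t *\<^sub>R b) - f (w + y) - t * c\<bar>"
      by (rule ennreal_leI)
    also have "\<dots> \<le> (\<integral>\<^sup>+s\<in>{0..t}. ennreal \<bar>?g ((w + y) + s *\<^sub>R b) - c\<bar> \<partial>lborel)"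
      by (rule lipschitz_increment_le[OF f b t(1)])
    finally show ?thesis using True by (simp add: add.assoc)
  qed simp
  have "ennreal (a - 2 * L * \<delta> * r) * ennreal v = (\<integral>\<^sup>+w. ennreal (a - 2 * L * \<delta> * r) * indicator ?B w \<partial>lborel)"
    by (simp add: nn_integral_cmult_indicator mB)
  also have "\<dots> \<le> (\<integral>\<^sup>+w. (\<integral>\<^sup>+s. ennreal \<bar>?g (w + (y + s *\<^sub>R b)) - c\<bar> * (indicator {0..t} s * indicator ?B w) \<partial>lborel) \<partial>lborel)"
    by (rule nn_integral_mono) (rule pw)
  also have "\<dots> = (\<integral>\<^sup>+s. (\<integral>\<^sup>+w. ennreal \<bar>?g (w + (y + s *\<^sub>R b)) - c\<bar> * (indicator {0..t} s * indicator ?B w) \<partial>lborel) \<partial>lborel)"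
  proof (rule lborel_pair.Fubini'[symmetric])
    have [measurable]: "?B \<in> sets borel" by simp
    have "(\<lambda>p::'a \<times> real. fst p + (y + snd p *\<^sub>R b)) \<in> borel \<rightarrow>\<^sub>M borel"
      by (intro borel_measurable_continuous_onI continuous_intros)
    then have [measurable]: "(\<lambda>p::'a \<times> real. fst p + (y + snd p *\<^sub>R b)) \<in> lborel \<Otimes>\<^sub>M lborel \<rightarrow>\<^sub>M borel"
      by (simp add: lborel_prod)
    have "(\<lambda>p::'a \<times> real. ennreal \<bar>?g (fst p + (y + snd p *\<^sub>R b)) - c\<bar> * (indicator {0..t} (snd p) * indicator ?B (fst p)))
        \<in> borel_measurable (lborel \<Otimes>\<^sub>M lborel)"
      by measurable
    then show "(\<lambda>(w, s). ennreal \<bar>?g (w + (y + s *\<^sub>R b)) - c\<bar> * (indicator {0..t} s * indicator ?B w))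
        \<in> borel_measurable (lborel \<Otimes>\<^sub>M lborel)"
      by (simp add: case_prod_beta)
  qed
  also have "\<dots> \<le> (\<integral>\<^sup>+s. I * indicator {0..t} s \<partial>lborel)"
  proof (rule nn_integral_mono)
    fix s :: real
    show "(\<integral>\<^sup>+w. ennreal \<bar>?g (w + (y + s *\<^sub>R b)) - c\<bar> * (indicator {0..t} s * indicator ?B w) \<partial>lborel) \<le> I * indicator {0..t} s"
    proof (cases "s \<in> {0..t}")
      case s: True
      let ?y = "y + s *\<^sub>R b"
      \<comment> \<open>\<open>2 r\<close> for \<open>y\<close>, \<open>r\<close> for \<open>w\<close> and \<open>r\<close> for the step in direction \<open>b\<close>.\<close>
      have sub: "w + ?y \<in> cball x (4 * r)" if "w \<in> ?B" for w
      proof -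
        have "dist x (w + ?y) \<le> dist x y + norm (w + s *\<^sub>R b)"
        proof -
          have "dist y (w + ?y) = norm (- (w + s *\<^sub>R b))" by (simp add: dist_norm)
          then have "dist y (w + ?y) = norm (w + s *\<^sub>R b)" by (simp only: norm_minus_cancel)
          then show ?thesis using dist_triangle[of x "w + ?y" y] by simp
        qed
        also have "\<dots> \<le> 2 * r + (norm w + norm (s *\<^sub>R b))"
          using y norm_triangle_ineq by (rule add_mono)
        also have "\<dots> \<le> 2 * r + (1 * r + r)"
        proof (intro add_left_mono add_mono)
          have "\<delta> * r \<le> 1 * r" using \<delta> r by (intro mult_right_mono) auto
          then show "norm w \<le> 1 * r" using that by simp
          show "norm (s *\<^sub>R b) \<le> r" using s b t by simp
        qed
        finally show ?thesis by simp
      qed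
      have "(\<integral>\<^sup>+w. ennreal \<bar>?g (w + ?y) - c\<bar> * (indicator {0..t} s * indicator ?B w) \<partial>lborel) \<le>
        (\<integral>\<^sup>+w. ennreal \<bar>?g (?y + w) - c\<bar> * indicator (cball x (4 * r)) (?y + w) \<partial>lborel)"
        using sub by (intro nn_integral_mono) (auto simp: indicator_def add.commute)
      also have "\<dots> = (\<integral>\<^sup>+z. ennreal \<bar>?g z - c\<bar> * indicator (cball x (4 * r)) z \<partial>distr lborel borel ((+) ?y))"
      proof (rule nn_integral_distr[symmetric])
        have [measurable]: "cball x (4 * r) \<in> sets borel" by simp
        have "(\<lambda>z. ennreal \<bar>?g z - c\<bar> * indicator (cball x (4 * r)) z) \<in> borel_measurable borel"
          by measurable
        then show "(\<lambda>z. ennreal \<bar>?g z - c\<bar> * indicator (cball x (4 * r)) z) \<in> borel_measurable (distr lborel borel ((+) ?y))"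
          by simp
      qed simp
      also have "\<dots> = I" unfolding I_def lborel_distr_plus ..
      finally show ?thesis using s by simp
    qed simp
  qed
  also have "\<dots> = I * ennreal t" using t by (simp add: nn_integral_cmult_indicator)
  also have "\<dots> \<le> I * ennreal r" using t by (intro mult_left_mono ennreal_leI) auto
  also have "I = mean_osc ?k lborel ?g x (4 * r) * ennreal (unit_ball_vol (real ?k) * (4 * r) ^ ?k)"
  proof -
    define u where "u = unit_ball_vol (real ?k) * (4 * r) ^ ?k"
    have "0 < u" unfolding u_def using r by (intro unit_ball_vol_power_pos) simp
    then show ?thesis unfolding mean_osc_def u_def[symmetric] I_def c_def
      by (simp add: ennreal_divide_times ennreal_divide_self)
  qed
  also have "unit_ball_vol (real ?k) * (4 * r) ^ ?k = (4 / \<delta>) ^ ?k * v"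
    using \<delta> by (simp add: v_def power_mult_distrib power_divide)
  finally have "ennreal (a - 2 * L * \<delta> * r) * ennreal v \<le>
      (ennreal (r * (4 / \<delta>) ^ ?k) * mean_osc ?k lborel ?g x (4 * r)) * ennreal v"
    using v r \<delta> by (simp add: ennreal_mult mult_ac)
  then have "ennreal (a - 2 * L * \<delta> * r) \<le> ennreal (r * (4 / \<delta>) ^ ?k) * mean_osc ?k lborel ?g x (4 * r)"
    using v by (subst (asm) ennreal_mult_le_mult_iff[of "ennreal v", unfolded mult.commute[of "ennreal v"]]) auto
  moreover have "ennreal a \<le> ennreal (2 * L * \<delta> * r) + ennreal (a - 2 * L * \<delta> * r)"
    using L \<delta> r by (cases "0 \<le> a - 2 * L * \<delta> * r") (auto simp: ennreal_plus[symmetric] ennreal_neg simp del: ennreal_plus intro!: ennreal_leI)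
  ultimately show ?thesis unfolding a_def by (meson add_left_mono order_trans)
qed

text \<open>The increments are controlled uniformly in the base point \<open>y\<close> near \<open>x\<close>. A step with negative \<open>t\<close> is a step with
  positive \<open>t\<close> from the other end, which is why the preceding estimate admits base points at distance \<open>2 r\<close>.\<close>

lemma increment_nearly_linear:
  fixes f :: "'a::euclidean_space \<Rightarrow> real"
  assumes f: "L-lipschitz_on UNIV f" and b: "norm b = 1" and "0 < \<epsilon>"
    and x: "(mean_osc DIM('a) lborel (dir_deriv L f b) x \<longlongrightarrow> 0) (at_right 0)"
  shows "\<exists>d>0. \<forall>r y t. 0 < r \<longrightarrow> r < d \<longrightarrow> dist x y \<le> r \<longrightarrow> \<bar>t\<bar> \<le> r \<longrightarrow>
     \<bar>f (y + t *\<^sub>R b) - f y - t * dir_deriv L f b x\<bar> \<le> \<epsilon> * r"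
proof -
  let ?k = "DIM('a)"
  let ?c = "dir_deriv L f b x"
  have L: "0 \<le> L" using f by (rule lipschitz_on_nonneg)
  \<comment> \<open>Both error terms of the preceding estimate are made at most \<open>\<epsilon> r / 2\<close>: the first by \<open>\<delta>\<close>, the second by \<open>\<eta>\<close>.\<close>
  define \<delta> where "\<delta> = min 1 (\<epsilon> / (4 * L + 1))"
  have \<delta>: "0 < \<delta>" "\<delta> \<le> 1" using \<open>0 < \<epsilon>\<close> L by (auto simp: \<delta>_def)
  have "\<delta> * (4 * L + 1) \<le> \<epsilon>" using L by (simp add: \<delta>_def pos_le_divide_eq[symmetric])
  then have L\<delta>: "2 * L * \<delta> \<le> \<epsilon> / 2" using \<delta> by (simp add: algebra_simps)
  define \<eta> where "\<eta> = \<epsilon> / 2 / (4 / \<delta>) ^ ?k"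
  have \<eta>: "0 < \<eta>" "(4 / \<delta>) ^ ?k * \<eta> = \<epsilon> / 2" using \<open>0 < \<epsilon>\<close> \<delta> by (auto simp: \<eta>_def)
  have "\<forall>\<^sub>F r in at_right 0. mean_osc ?k lborel (dir_deriv L f b) x r < ennreal \<eta>"
    using x \<eta>(1) by (intro order_tendstoD(2)) auto
  then obtain d where d: "0 < d" "\<And>r. 0 < r \<Longrightarrow> r < d \<Longrightarrow> mean_osc ?k lborel (dir_deriv L f b) x r < ennreal \<eta>"
    unfolding eventually_at_right_field by blast
  have pos: "\<bar>f (y + t *\<^sub>R b) - f y - t * ?c\<bar> \<le> \<epsilon> * r"
    if "0 < r" "r < d / 4" "dist x y \<le> 2 * r" "0 \<le> t" "t \<le> r" for r y t
  proof -
    have "ennreal \<bar>f (y + t *\<^sub>R b) - f y - t * ?c\<bar> \<le> ennreal (2 * L * \<delta> * r)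
       + ennreal (r * (4 / \<delta>) ^ ?k) * mean_osc ?k lborel (dir_deriv L f b) x (4 * r)"
      by (rule increment_at_lebesgue_point[OF f b \<delta> that(1,3,4,5)])
    also have "\<dots> \<le> ennreal (2 * L * \<delta> * r) + ennreal (r * (4 / \<delta>) ^ ?k) * ennreal \<eta>"
      using d(2)[of "4 * r"] that by (intro add_left_mono mult_left_mono) auto
    also have "\<dots> = ennreal (2 * L * \<delta> * r + r * ((4 / \<delta>) ^ ?k * \<eta>))"
      using that L \<delta> \<eta> by (simp add: ennreal_mult mult.assoc)
    also have "\<dots> \<le> ennreal (\<epsilon> * r)"
      unfolding \<eta>(2) using mult_right_mono[OF L\<delta>, of r] that(1) by (intro ennreal_leI) (simp add: field_simps)
    finally show ?thesis using that(1) \<open>0 < \<epsilon>\<close> by (simp add: ennreal_le_iff)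
  qed
  show ?thesis
  proof (intro exI[of _ "d / 4"] conjI allI impI)
    fix r y t assume h: "0 < r" "r < d / 4" "dist x y \<le> r" "\<bar>t\<bar> \<le> r"
    show "\<bar>f (y + t *\<^sub>R b) - f y - t * ?c\<bar> \<le> \<epsilon> * r"
    proof (cases "0 \<le> t")
      case True then show ?thesis using pos[of r y t] h by simp
    next
      case False
      have "dist x (y + t *\<^sub>R b) \<le> dist x y + \<bar>t\<bar>"
        using dist_triangle[of x "y + t *\<^sub>R b" y] b by (simp add: dist_norm)
      then have "\<bar>f ((y + t *\<^sub>R b) + (- t) *\<^sub>R b) - f (y + t *\<^sub>R b) - (- t) * ?c\<bar> \<le> \<epsilon> * r"
        using False h by (intro pos) auto
      then show ?thesis by (simp add: abs_minus_commute algebra_simps)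
    qed
  qed (use d in simp)
qed

text \<open>The point \<open>x + h\<close> is reached from \<open>x\<close> by changing one coordinate after the other; as the estimate of the
  increments is uniform in the base point, the errors add up to \<open>o(norm h)\<close>.\<close>

lemma differentiable_at_lebesgue_point:
  fixes f :: "'a::euclidean_space \<Rightarrow> real"
  assumes f: "L-lipschitz_on UNIV f"
    and x: "\<And>b. b \<in> Basis \<Longrightarrow> (mean_osc DIM('a) lborel (dir_deriv L f b) x \<longlongrightarrow> 0) (at_right 0)"
  shows "f differentiable at x"
proof -
  let ?g = "\<lambda>b. dir_deriv L f b x"
  have partial: "\<forall>\<epsilon>>0. \<exists>d>0. \<forall>h. 0 < norm h \<longrightarrow> norm h < d \<longrightarrow>
      \<bar>f (x + (\<Sum>b\<in>A. (h \<bullet> b) *\<^sub>R b)) - f x - (\<Sum>b\<in>A. (h \<bullet> b) * ?g b)\<bar> \<le> \<epsilon> * norm h"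
    if "finite A" "A \<subseteq> Basis" for A :: "'a set"
    using that
  proof (induction A rule: finite_induct)
    case empty then show ?case by (auto intro!: exI[of _ 1])
  next
    case (insert b A)
    show ?case
    proof (intro allI impI)
      fix \<epsilon> :: real assume "0 < \<epsilon>"
      then have e2: "0 < \<epsilon> / 2" by simp
      from insert obtain d1 where d1: "0 < d1" "\<And>h. 0 < norm h \<Longrightarrow> norm h < d1 \<Longrightarrow>
         \<bar>f (x + (\<Sum>b\<in>A. (h \<bullet> b) *\<^sub>R b)) - f x - (\<Sum>b\<in>A. (h \<bullet> b) * ?g b)\<bar> \<le> \<epsilon> / 2 * norm h"
        using e2 by (meson insert_subset)
      have b: "b \<in> Basis" using insert by simp
      obtain d2 where d2: "0 < d2" "\<And>r y t. 0 < r \<Longrightarrow> r < d2 \<Longrightarrow> dist x y \<le> r \<Longrightarrow> \<bar>t\<bar> \<le> r \<Longrightarrow>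
         \<bar>f (y + t *\<^sub>R b) - f y - t * ?g b\<bar> \<le> \<epsilon> / 2 * r"
        using increment_nearly_linear[OF f _ e2 x[OF b]] b by (auto simp: norm_Basis)
      show "\<exists>d>0. \<forall>h. 0 < norm h \<longrightarrow> norm h < d \<longrightarrow>
         \<bar>f (x + (\<Sum>b\<in>insert b A. (h \<bullet> b) *\<^sub>R b)) - f x - (\<Sum>b\<in>insert b A. (h \<bullet> b) * ?g b)\<bar> \<le> \<epsilon> * norm h"
      proof (intro exI[of _ "min d1 d2"] conjI allI impI)
        fix h :: 'a assume h: "0 < norm h" "norm h < min d1 d2"
        let ?y = "x + (\<Sum>b\<in>A. (h \<bullet> b) *\<^sub>R b)"
        have "norm (\<Sum>b\<in>A. (h \<bullet> b) *\<^sub>R b) \<le> norm h"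
        proof (rule norm_le_componentwise)
          fix i :: 'a assume i: "i \<in> Basis"
          have "(\<Sum>b\<in>A. (h \<bullet> b) *\<^sub>R b) \<bullet> i = (\<Sum>b\<in>A. if b = i then h \<bullet> i else 0)"
            unfolding inner_sum_left using insert.prems i
            by (intro sum.cong) (auto simp: inner_Basis)
          also have "\<dots> = (if i \<in> A then h \<bullet> i else 0)" using insert.hyps(1) by (simp add: sum.delta)
          finally show "\<bar>(\<Sum>b\<in>A. (h \<bullet> b) *\<^sub>R b) \<bullet> i\<bar> \<le> \<bar>h \<bullet> i\<bar>" by simp
        qed
        then have "dist x ?y \<le> norm h" by (simp add: dist_norm)
        then have "\<bar>f (?y + (h \<bullet> b) *\<^sub>R b) - f ?y - (h \<bullet> b) * ?g b\<bar> \<le> \<epsilon> / 2 * norm h"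
          using h Basis_le_norm[OF b, of h] by (intro d2) auto
        moreover have "\<bar>f ?y - f x - (\<Sum>b\<in>A. (h \<bullet> b) * ?g b)\<bar> \<le> \<epsilon> / 2 * norm h"
          using h by (intro d1) auto
        moreover have "x + (\<Sum>b\<in>insert b A. (h \<bullet> b) *\<^sub>R b) = ?y + (h \<bullet> b) *\<^sub>R b"
          using insert.hyps by (simp add: algebra_simps)
        moreover have "(\<Sum>b\<in>insert b A. (h \<bullet> b) * ?g b) = (h \<bullet> b) * ?g b + (\<Sum>b\<in>A. (h \<bullet> b) * ?g b)"
          using insert.hyps by simp
        ultimately show "\<bar>f (x + (\<Sum>b\<in>insert b A. (h \<bullet> b) *\<^sub>R b)) - f x - (\<Sum>b\<in>insert b A. (h \<bullet> b) * ?g b)\<bar> \<le> \<epsilon> * norm h"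
          by (simp only:)
      qed (use d1 d2 in simp)
    qed
  qed
  have "(f has_derivative (\<lambda>h. \<Sum>b\<in>Basis. (h \<bullet> b) * ?g b)) (at x)"
    unfolding has_derivative_at_alt
  proof (intro conjI allI impI)
    show "bounded_linear (\<lambda>h::'a. \<Sum>b\<in>Basis. (h \<bullet> b) * ?g b)"
      by (intro bounded_linear_sum bounded_linear_compose[OF bounded_linear_mult_left bounded_linear_inner_left])
    fix \<epsilon> :: real assume "0 < \<epsilon>"
    with partial[OF finite_Basis order_refl] obtain d where d: "0 < d" "\<And>h. 0 < norm h \<Longrightarrow> norm h < d \<Longrightarrow>
      \<bar>f (x + (\<Sum>b\<in>Basis. (h \<bullet> b) *\<^sub>R b)) - f x - (\<Sum>b\<in>Basis. (h \<bullet> b) * ?g b)\<bar> \<le> \<epsilon> * norm h"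
      by blast
    show "\<exists>d>0. \<forall>y. norm (y - x) < d \<longrightarrow>
      norm (f y - f x - (\<Sum>b\<in>Basis. ((y - x) \<bullet> b) * ?g b)) \<le> \<epsilon> * norm (y - x)"
    proof (intro exI[of _ d] conjI allI impI d(1))
      fix y assume y: "norm (y - x) < d"
      show "norm (f y - f x - (\<Sum>b\<in>Basis. ((y - x) \<bullet> b) * ?g b)) \<le> \<epsilon> * norm (y - x)"
      proof (cases "y = x")
        case False
        then show ?thesis using d(2)[of "y - x"] y euclidean_representation[of "y - x"] by simp
      qed simp
    qed
  qed
  then show ?thesis by (rule differentiableI)
qed

text \<open>Almost every point is a Lebesgue point of the directional derivatives, along the axes, of all components of \<open>f\<close>.\<close>

theorem rademacher:
  fixes f :: "'a::euclidean_space \<Rightarrow> 'b::euclidean_space"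
  assumes f: "L-lipschitz_on UNIV f"
  shows "negligible {x. \<not> f differentiable at x}"
proof -
  let ?f = "\<lambda>i x. f x \<bullet> i"
  define N where "N i b = {x. \<not> (mean_osc DIM('a) lborel (dir_deriv L (?f i) b) x \<longlongrightarrow> 0) (at_right 0)}" for i b
  have fi: "L-lipschitz_on UNIV (?f i)" if "i \<in> Basis" for i
  proof (rule lipschitz_onI)
    show "dist (f x \<bullet> i) (f y \<bullet> i) \<le> L * dist x y" for x y
      using lipschitz_onD[OF f, of x y] Basis_le_norm[OF that, of "f x - f y"]
      by (simp add: dist_norm inner_diff_left)
  qed (rule lipschitz_on_nonneg[OF f])
  have "negligible (N i b)" if "i \<in> Basis" for i b
    unfolding N_def
    using dir_deriv_borel[OF lipschitz_on_continuous_on[OF fi[OF that]]] dir_deriv_bounded[OF lipschitz_on_nonneg[OF f]]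
    by (rule lebesgue_points_ae)
  then have "negligible (\<Union>i\<in>Basis. \<Union>b\<in>Basis. N i b)"
    by (intro negligible_Union) (auto intro!: negligible_Union)
  moreover have "{x. \<not> f differentiable at x} \<subseteq> (\<Union>i\<in>Basis. \<Union>b\<in>Basis. N i b)"
  proof (rule subsetI, rule ccontr)
    fix x assume "x \<in> {x. \<not> f differentiable at x}" and "x \<notin> (\<Union>i\<in>Basis. \<Union>b\<in>Basis. N i b)"
    then have x: "\<not> f differentiable at x" "x \<notin> (\<Union>i\<in>Basis. \<Union>b\<in>Basis. N i b)" by auto
    have "(\<lambda>x. f x \<bullet> i) differentiable at x" if "i \<in> Basis" for i
      using x(2) that by (intro differentiable_at_lebesgue_point[OF fi]) (auto simp: N_def)
    then show False using x(1) differentiable_componentwise_within[of f x UNIV] by blast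
  qed
  ultimately show ?thesis by (rule negligible_subset)
qed

section \<open>The density of rectifiable sets\<close>

text \<open>On \<open>K\<close> the map \<open>f\<close> is \<open>g\<close> followed by a \<open>c\<close>-Lipschitz map.\<close>

lemma hausdorff_image_le:
  fixes f :: "'a \<Rightarrow> 'b::metric_space" and g :: "'a \<Rightarrow> 'c::metric_space"
  assumes c: "0 \<le> c" and fg: "\<And>y z. y \<in> K \<Longrightarrow> z \<in> K \<Longrightarrow> dist (f y) (f z) \<le> c * dist (g y) (g z)"
  shows "hausdorff k (f ` K) \<le> ennreal (c ^ k) * hausdorff k (g ` K)"
proof -
  define h where "h u = f (inv_into K g u)" for u
  have inv: "inv_into K g u \<in> K" "g (inv_into K g u) = u" if "u \<in> g ` K" for u
    using that by (auto intro: inv_into_into f_inv_into_f)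
  have "c-lipschitz_on (g ` K) h"
  proof (rule lipschitz_onI)
    fix u v assume uv: "u \<in> g ` K" "v \<in> g ` K"
    show "dist (h u) (h v) \<le> c * dist u v"
      unfolding h_def using fg[OF inv(1)[OF uv(1)] inv(1)[OF uv(2)]] inv(2) uv by simp
  qed (rule c)
  moreover have "h ` (g ` K) = f ` K"
  proof -
    have "h (g z) = f z" if "z \<in> K" for z
      using fg[OF inv(1)[of "g z"] that] inv(2)[of "g z"] that by (auto simp: h_def)
    then show ?thesis by (simp add: image_image)
  qed
  ultimately show ?thesis using hausdorff_lipschitz_image[of c "g ` K" h k] by simp
qed

lemma matrix_vector_norm_le:
  fixes M :: "real^'m^'n"
  shows "norm (M *v z) \<le> real (CARD('n)) * real (CARD('m)) * norm M * norm z"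
proof -
  have "\<bar>M $ i $ j\<bar> \<le> norm M" for i j
    using component_le_norm_cart[of "M $ i" j] Finite_Cartesian_Product.norm_nth_le[of M i] by linarith
  then have "onorm ((*v) M) \<le> real (CARD('n)) * real (CARD('m)) * norm M"
    by (rule onorm_le_matrix_component)
  moreover have "norm (M *v z) \<le> onorm ((*v) M) * norm z"
    by (intro onorm matrix_vector_mul_bounded_linear)
  ultimately show ?thesis by (meson mult_right_mono norm_ge_zero order_trans)
qed

text \<open>The range of \<open>T\<close> is isometric to the domain.\<close>

lemma norm_linear_inj_eq_matrix:
  fixes T :: "real^'m \<Rightarrow> real^'n"
  assumes T: "linear T" "inj T"
  obtains S :: "real^'m^'m" where "invertible S" "\<And>z. norm (S *v z) = norm (T z)"
proof -
  have dim: "dim (range T) = dim (UNIV :: (real^'m) set)" using dim_image_eq[OF T(1), of UNIV] T(2) by simp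
  have sub: "subspace (range T)" using T(1) by (intro linear_subspace_image subspace_UNIV)
  obtain h :: "real^'n \<Rightarrow> real^'m" where h: "linear h" "\<forall>x\<in>range T. norm (h x) = norm x"
  proof (rule isometries_subspaces[OF sub subspace_UNIV dim])
    fix h :: "real^'n \<Rightarrow> real^'m"
    assume "linear h" "\<And>x. x \<in> range T \<Longrightarrow> norm (h x) = norm x"
    then show ?thesis using that[of h] by simp
  qed
  define S where "S = matrix (h \<circ> T)"
  have lin: "linear (h \<circ> T)" using T(1) h(1) by (intro linear_compose)
  have S: "S *v z = h (T z)" for z unfolding S_def using fun_cong[OF matrix_vector_mul(2)[OF lin], of z] by simp
  have norm: "norm (S *v z) = norm (T z)" for z unfolding S using h(2) by simp
  have "invertible S"
  proof -
    have "S *v z = 0 \<longrightarrow> z = 0" for z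
      using norm[of z] T linear_injective_0[OF T(1)] by (metis norm_eq_zero)
    then show ?thesis
      by (meson invertible_left_inverse matrix_left_invertible_ker)
  qed
  then show ?thesis using that norm by blast
qed

definition squeeze :: "'m \<Rightarrow> real \<Rightarrow> real \<Rightarrow> real^'m^'m" where
  "squeeze j \<epsilon> B = (\<chi> i l. if i = l then (if i = j then \<epsilon> else B) else 0)"

lemma squeeze_component: "(squeeze j \<epsilon> B *v x) $ i = (if i = j then \<epsilon> else B) * x $ i"
  by (simp add: squeeze_def matrix_vector_mult_def if_distrib[of "\<lambda>a. a * _"] cong: if_cong)

text \<open>Rotate a unit vector of the kernel of \<open>T\<close> into the \<open>j\<close>-th axis; as \<open>T\<close> vanishes in this direction, it is bounded by a
  diagonal matrix with an arbitrarily small \<open>j\<close>-th entry.\<close>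

lemma linear_kernel_le_squeeze:
  fixes T :: "real^'m \<Rightarrow> real^'n"
  assumes T: "linear T" "\<not> inj T" and B: "0 \<le> B" "\<And>x. norm (T x) \<le> B * norm x"
  obtains R :: "real^'m^'m" where "orthogonal_matrix R" "\<And>z. norm (T z) \<le> norm ((squeeze j \<epsilon> B ** R) *v z)"
proof -
  obtain w where w: "T w = 0" "w \<noteq> 0" using T linear_injective_0[OF T(1)] by blast
  define v where "v = (1 / norm w) *\<^sub>R w"
  have v: "norm v = 1" "T v = 0" using w T(1) by (simp_all add: v_def linear_cmul)
  have "norm (axis j 1 :: real^'m) = 1" by (simp add: norm_axis_1)
  then obtain R :: "real^'m \<Rightarrow> real^'m" where R: "orthogonal_transformation R" "R v = axis j 1"
  proof (rule orthogonal_transformation_exists_1[OF v(1)])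
    fix R :: "real^'m \<Rightarrow> real^'m" assume "orthogonal_transformation R" "R v = axis j 1"
    then show ?thesis using that[of R] by simp
  qed
  have linR: "linear R" using R(1) by (rule orthogonal_transformation_linear)
  have Sz: "(squeeze j \<epsilon> B ** matrix R) *v z = squeeze j \<epsilon> B *v R z" for z
    using fun_cong[OF matrix_vector_mul(2)[OF linR], of z] by (simp add: matrix_vector_mul_assoc[symmetric])
  have le: "norm (T z) \<le> norm ((squeeze j \<epsilon> B ** matrix R) *v z)" for z
  proof -
    define t where "t = z \<bullet> v"
    have "T z = T (z - t *\<^sub>R v)" using T(1) v(2) by (simp add: linear_diff linear_cmul)
    then have "norm (T z) \<le> B * norm (z - t *\<^sub>R v)" using B(2) by metis
    also have "norm (z - t *\<^sub>R v) = norm (R (z - t *\<^sub>R v))" using R(1) by (simp add: orthogonal_transformation_norm)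
    also have "R (z - t *\<^sub>R v) = R z - t *\<^sub>R axis j 1" using linR R(2) by (simp add: linear_diff linear_cmul)
    also have "B * norm \<dots> = norm (B *\<^sub>R (R z - t *\<^sub>R axis j 1))" using B(1) by simp
    also have "\<dots> \<le> norm ((squeeze j \<epsilon> B ** matrix R) *v z)"
    proof (rule norm_le_componentwise_cart)
      fix i
      have "(R z) $ j = R z \<bullet> R v" by (simp add: R(2) inner_axis)
      also have "\<dots> = t" using R(1) by (simp add: orthogonal_transformation_def t_def)
      finally show "norm ((B *\<^sub>R (R z - t *\<^sub>R axis j 1)) $ i) \<le> norm (((squeeze j \<epsilon> B ** matrix R) *v z) $ i)"
        unfolding Sz squeeze_component by (simp add: axis_def)
    qed
    finally show ?thesis .
  qed
  have "orthogonal_matrix (matrix R)" using R(1) by (simp add: orthogonal_transformation_matrix)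
  then show ?thesis using that le by blast
qed

lemma inj_squeeze:
  assumes "0 < \<epsilon>" "0 < B" "orthogonal_matrix R"
  shows "inj ((*v) (squeeze j \<epsilon> B ** R))"
proof (rule injI)
  fix x y assume "(squeeze j \<epsilon> B ** R) *v x = (squeeze j \<epsilon> B ** R) *v y"
  then have eq: "squeeze j \<epsilon> B *v (R *v x) = squeeze j \<epsilon> B *v (R *v y)"
    by (simp add: matrix_vector_mul_assoc)
  have "(R *v x) $ i = (R *v y) $ i" for i
    using arg_cong[OF eq, of "\<lambda>v. v $ i"] assms unfolding squeeze_component by (cases "i = j") auto
  then have "R *v x = R *v y" by (simp add: vec_eq_iff)
  then have "transpose R *v (R *v x) = transpose R *v (R *v y)" by simp
  then show "x = y" using assms(3) by (simp add: matrix_vector_mul_assoc orthogonal_matrix)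
qed

text \<open>Both \<open>f z - f y\<close> and \<open>A (z - y)\<close> have a length close to that of \<open>S (z - y)\<close>, up to a relative error \<open>\<eta>\<close>.
  The tolerance \<open>e\<close> is found before \<open>A\<close>, so that \<open>A\<close> can be taken from a countable dense set.\<close>

lemma derivative_comparable:
  fixes f :: "real^'m \<Rightarrow> real^'n" and S :: "real^'m^'m"
  assumes f: "(f has_derivative T) (at y)" and S: "inj ((*v) S)" and c: "1 < c"
    and le: "\<And>z. norm (T z) \<le> norm (S *v z)"
  shows "\<exists>e>0. \<forall>A. (\<forall>x. norm (A *v x - S *v x) \<le> e * norm x) \<longrightarrow> (\<exists>d>0. \<forall>z. dist z y < d \<longrightarrow>
     norm (f z - f y) \<le> c * norm (A *v (z - y)) \<and>
     ((\<forall>u. norm (T u) = norm (S *v u)) \<longrightarrow> norm (A *v (z - y)) \<le> c * norm (f z - f y)))"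
proof -
  obtain \<sigma> where \<sigma>: "0 < \<sigma>" "\<And>x. \<sigma> * norm x \<le> norm (S *v x)"
    using linear_inj_bounded_below_pos[OF matrix_vector_mul_linear S] by metis
  \<comment> \<open>The solution of \<open>(1 + \<eta>) / (1 - \<eta>) = c\<close>.\<close>
  define \<eta> where "\<eta> = (c - 1) / (c + 1)"
  have \<eta>: "0 < \<eta>" using c by (simp add: \<eta>_def)
  have c\<eta>: "1 + \<eta> = c * (1 - \<eta>)" using c by (simp add: \<eta>_def field_simps)
  show ?thesis
  proof (rule exI[of _ "\<eta> * \<sigma>"], intro conjI allI impI)
    show "0 < \<eta> * \<sigma>" using \<eta> \<sigma> by simp
    fix A :: "real^'m^'m" assume A: "\<forall>x. norm (A *v x - S *v x) \<le> \<eta> * \<sigma> * norm x"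
    have near: "norm (A *v x - S *v x) \<le> \<eta> * norm (S *v x)" for x
    proof -
      have "\<eta> * \<sigma> * norm x \<le> \<eta> * norm (S *v x)" using \<sigma>(2)[of x] \<eta> by (simp add: mult.assoc)
      then show ?thesis using A order_trans by blast
    qed
    obtain d where d: "0 < d" "\<And>z. norm (z - y) < d \<Longrightarrow> norm (f z - f y - T (z - y)) \<le> \<eta> * \<sigma> * norm (z - y)"
      using f \<eta> \<sigma>(1) unfolding has_derivative_at_alt by (metis mult_pos_pos)
    show "\<exists>d>0. \<forall>z. dist z y < d \<longrightarrow>
     norm (f z - f y) \<le> c * norm (A *v (z - y)) \<and>
     ((\<forall>u. norm (T u) = norm (S *v u)) \<longrightarrow> norm (A *v (z - y)) \<le> c * norm (f z - f y))"
    proof (intro exI[of _ d] conjI allI impI d(1))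
      fix z assume z: "dist z y < d"
      define s where "s = norm (S *v (z - y))"
      have 1: "norm (f z - f y - T (z - y)) \<le> \<eta> * s"
      proof -
        have "norm (f z - f y - T (z - y)) \<le> \<eta> * \<sigma> * norm (z - y)" using z by (intro d) (simp add: dist_norm)
        also have "\<dots> \<le> \<eta> * s" using \<sigma>(2)[of "z - y"] \<eta> by (simp add: s_def mult.assoc)
        finally show ?thesis .
      qed
      have 2: "norm (A *v (z - y) - S *v (z - y)) \<le> \<eta> * s" using near by (simp add: s_def)
      have Tle: "norm (T (z - y)) \<le> s" using le by (simp add: s_def)
      have "norm (f z - f y) \<le> (1 + \<eta>) * s"
        using 1 Tle norm_triangle_sub[of "f z - f y" "T (z - y)"] by (simp add: algebra_simps)
      moreover have Alo: "(1 - \<eta>) * s \<le> norm (A *v (z - y))"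
        using 2 norm_triangle_sub[of "S *v (z - y)" "A *v (z - y)"] by (simp add: s_def norm_minus_commute algebra_simps)
      ultimately show "norm (f z - f y) \<le> c * norm (A *v (z - y))"
        using order_trans[OF _ mult_left_mono[OF Alo, of c]] c unfolding c\<eta> by (simp add: mult.assoc)
      assume eq: "\<forall>u. norm (T u) = norm (S *v u)"
      have "norm (A *v (z - y)) \<le> (1 + \<eta>) * s"
        using 2 norm_triangle_sub[of "A *v (z - y)" "S *v (z - y)"] by (simp add: s_def algebra_simps)
      moreover have flo: "(1 - \<eta>) * s \<le> norm (f z - f y)"
        using 1 eq norm_triangle_sub[of "T (z - y)" "f z - f y"] by (simp add: s_def norm_minus_commute algebra_simps)
      ultimately show "norm (A *v (z - y)) \<le> c * norm (f z - f y)"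
        using order_trans[OF _ mult_left_mono[OF flo, of c]] c unfolding c\<eta> by (simp add: mult.assoc)
    qed
  qed
qed

lemma closed_local_inequality:
  fixes F G :: "'a::metric_space \<Rightarrow> 'a \<Rightarrow> real"
  assumes "\<And>z. continuous_on UNIV (F z)" "\<And>z. continuous_on UNIV (G z)"
  shows "closed {y. \<forall>z. dist z y < d \<longrightarrow> F z y \<le> G z y}"
proof -
  have "{y. \<forall>z. dist z y < d \<longrightarrow> F z y \<le> G z y} = (\<Inter>z. {y. d \<le> dist z y} \<union> {y. F z y \<le> G z y})"
    by (simp add: set_eq_iff) (metis not_less)
  moreover have "closed ({y. d \<le> dist z y} \<union> {y. F z y \<le> G z y})" for z
    by (intro closed_Un closed_Collect_le continuous_intros assms)
  ultimately show ?thesis by auto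
qed

text \<open>A countable cover of the space by compact sets of diameter less than \<open>d\<close>, provided that \<open>d\<close> is positive.\<close>

definition near_pieces :: "real \<Rightarrow> 'a::euclidean_space set set" where
  "near_pieces d = (\<lambda>q. cball q (d / 3)) ` (SOME Q. countable Q \<and> closure Q = UNIV)"

lemma near_pieces:
  fixes d :: real and C :: "'a::euclidean_space set"
  assumes "0 < d"
  shows "countable (near_pieces d :: 'a set set)" "\<Union> (near_pieces d) = (UNIV :: 'a set)"
    "C \<in> near_pieces d \<Longrightarrow> compact C" "C \<in> near_pieces d \<Longrightarrow> x \<in> C \<Longrightarrow> y \<in> C \<Longrightarrow> dist x y < d"
proof -
  define Q :: "'a set" where "Q = (SOME Q. countable Q \<and> closure Q = UNIV)"
  obtain Q' :: "'a set" where "countable Q'" "Q' \<subseteq> UNIV" "UNIV \<subseteq> closure Q'"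
    using separable[of "UNIV :: 'a set"] .
  then have "\<exists>Q :: 'a set. countable Q \<and> closure Q = UNIV" by (intro exI[of _ Q']) auto
  then have Q: "countable Q \<and> closure Q = UNIV" unfolding Q_def by (rule someI_ex)
  have N: "near_pieces d = (\<lambda>q. cball q (d / 3)) ` Q" by (simp add: near_pieces_def Q_def)
  show "countable (near_pieces d :: 'a set set)" using Q N by simp
  show "\<Union> (near_pieces d) = (UNIV :: 'a set)"
  proof -
    have "\<exists>q\<in>Q. x \<in> cball q (d / 3)" for x
    proof -
      have "x \<in> closure Q" using Q by simp
      moreover have "0 < d / 3" using assms by simp
      ultimately obtain q where "q \<in> Q" "dist q x < d / 3" unfolding closure_approachable by blast
      then show ?thesis by (intro bexI[of _ q]) auto
    qed
    then show ?thesis unfolding N by blast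
  qed
  show "compact C" if "C \<in> near_pieces d" using that N by auto
  show "dist x y < d" if C: "C \<in> near_pieces d" "x \<in> C" "y \<in> C"
  proof -
    obtain q where "dist q x \<le> d / 3" "dist q y \<le> d / 3" using C N by auto
    then show ?thesis using dist_triangle3[of x y q] assms by linarith
  qed
qed

text \<open>Together with \<open>lower_set\<close> a closed substitute for the set of points at which the derivative of \<open>f\<close> is comparable with \<open>A\<close>:
  the comparison is required on a ball of a fixed radius.\<close>

definition upper_set :: "(real^'m \<Rightarrow> real^'n) \<Rightarrow> real \<Rightarrow> real^'m^'m \<Rightarrow> real \<Rightarrow> (real^'m) set" where
  "upper_set f c A d = {y. \<forall>z. dist z y < d \<longrightarrow> norm (f z - f y) \<le> c * norm (A *v (z - y))}"

definition lower_set :: "(real^'m \<Rightarrow> real^'n) \<Rightarrow> real \<Rightarrow> real^'m^'m \<Rightarrow> real \<Rightarrow> (real^'m) set" where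
  "lower_set f c A d = {y. \<forall>z. dist z y < d \<longrightarrow> norm (A *v (z - y)) \<le> c * norm (f z - f y)}"

lemma closed_upper_lower:
  assumes "continuous_on UNIV f"
  shows "closed (upper_set f c A d)" "closed (lower_set f c A d)"
  unfolding upper_set_def lower_set_def
  by (intro closed_local_inequality continuous_intros assms
      bounded_linear.continuous_on[OF matrix_vector_mul_bounded_linear])+

lemma countable_dense_matrices:
  fixes P :: "(real^'m^'m) set"
  obtains \<A> where "countable \<A>" "\<A> \<subseteq> P"
    "\<forall>S\<in>P. \<forall>e>0. \<exists>A\<in>\<A>. \<forall>x. norm (A *v x - S *v x) \<le> e * norm x"
proof -
  obtain \<A> where A: "countable \<A>" "\<A> \<subseteq> P" "P \<subseteq> closure \<A>"
    using separable[of P] by blast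
  define \<kappa> where "\<kappa> = real (CARD('m)) * real (CARD('m))"
  have \<kappa>: "0 < \<kappa>" by (simp add: \<kappa>_def)
  have "\<exists>A\<in>\<A>. \<forall>x. norm (A *v x - S *v x) \<le> e * norm x" if "S \<in> P" "0 < e" for S e
  proof -
    have "S \<in> closure \<A>" "0 < e / \<kappa>" using that A(3) \<kappa> by auto
    then obtain A where A: "A \<in> \<A>" "norm (A - S) < e / \<kappa>"
      unfolding closure_approachable dist_norm by blast
    have "norm (A *v x - S *v x) \<le> e * norm x" for x
    proof -
      have "norm (A *v x - S *v x) \<le> \<kappa> * norm (A - S) * norm x"
        using matrix_vector_norm_le[of "A - S" x] by (simp add: \<kappa>_def matrix_vector_mult_diff_rdistrib)
      also have "\<dots> \<le> e * norm x"
        using A(2) \<kappa> by (intro mult_right_mono) (auto simp: field_simps)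
      finally show ?thesis .
    qed
    then show ?thesis using A(1) by blast
  qed
  then show ?thesis using that[OF A(1,2)] by blast
qed

lemma exists_inverse_Suc_less:
  assumes "0 < (d::real)" obtains i where "1 / real (Suc i) < d"
  using reals_Archimedean[OF assms] by (auto simp: inverse_eq_divide)

lemma hausdorff_squeeze_image:
  fixes R :: "real^'m^'m"
  assumes K: "K \<in> sets borel" "bounded K" and R: "orthogonal_matrix R" and pos: "0 < \<epsilon>" "0 < B"
  shows "hausdorff CARD('m) ((*v) (squeeze j \<epsilon> B ** R) ` K) = ennreal (\<epsilon> * B ^ (CARD('m) - 1)) * emeasure lborel K"
proof -
  let ?k = "CARD('m)" and ?m = "\<lambda>i. if i = j then \<epsilon> else B"
  have trR: "transpose R ** R = mat 1" "R ** transpose R = mat 1" using R by (auto simp: orthogonal_matrix_def)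
  have "orthogonal_transformation ((*v) R)"
    using R by (simp add: orthogonal_transformation_matrix matrix_of_matrix_vector_mul)
  then have iso: "dist (R *v x) (R *v y) = dist x y" for x y
    by (simp add: orthogonal_transformation_isometry)
  have "(*v) R ` K = (*v) (transpose R) -` K"
  proof (intro set_eqI iffI)
    fix x assume "x \<in> (*v) (transpose R) -` K"
    moreover have "x = R *v (transpose R *v x)" by (metis matrix_vector_mul_assoc matrix_vector_mul_lid trR(2))
    ultimately show "x \<in> (*v) R ` K" by (metis image_eqI vimageD)
  next
    fix x assume "x \<in> (*v) R ` K"
    then obtain y where "y \<in> K" "x = R *v y" by blast
    moreover have "transpose R *v (R *v y) = y" by (metis matrix_vector_mul_assoc matrix_vector_mul_lid trR(1))
    ultimately show "x \<in> (*v) (transpose R) -` K" by simp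
  qed
  moreover have "(*v) (transpose R) \<in> borel_measurable borel"
    by (intro borel_measurable_continuous_onI linear_continuous_on matrix_vector_mul_bounded_linear)
  ultimately have RK: "(*v) R ` K \<in> sets borel" using K(1) by (simp add: measurable_sets_borel)
  have bRK: "bounded ((*v) R ` K)" using K(2) by (intro bounded_linear_image matrix_vector_mul_bounded_linear)
  have hR: "hausdorff ?k ((*v) R ` K) = hausdorff ?k K"
    using hausdorff_image_le[of 1 K "(*v) R" "\<lambda>x. x" ?k] hausdorff_image_le[of 1 K "\<lambda>x. x" "(*v) R" ?k] iso
    by (intro antisym) simp_all
  have lm: "(*v) R ` K \<in> lmeasurable" using RK bRK by (intro bounded_set_imp_lmeasurable) auto
  let ?D = "\<lambda>x::real^'m. \<chi> i. ?m i * x $ i"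
  have im: "?D ` ((*v) R ` K) \<in> lmeasurable"
    "measure lebesgue (?D ` ((*v) R ` K)) = \<bar>prod ?m UNIV\<bar> * measure lebesgue ((*v) R ` K)"
    using measurable_stretch[OF lm, of ?m] measure_stretch[OF lm, of ?m] by auto
  have prod: "prod ?m UNIV = \<epsilon> * B ^ (?k - 1)"
  proof -
    have "prod ?m UNIV = ?m j * prod ?m (UNIV - {j})" by (intro prod.remove) auto
    also have "prod ?m (UNIV - {j}) = (\<Prod>i\<in>UNIV - {j}. B)" by (intro prod.cong) auto
    finally show ?thesis by simp
  qed
  have "(*v) (squeeze j \<epsilon> B ** R) ` K = ?D ` ((*v) R ` K)"
    unfolding image_image
    by (intro image_cong) (auto simp: vec_eq_iff squeeze_component matrix_vector_mul_assoc[symmetric])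
  then have "hausdorff ?k ((*v) (squeeze j \<epsilon> B ** R) ` K) = emeasure lebesgue (?D ` ((*v) R ` K))"
    using hausdorff_eq_lebesgue[of "?D ` ((*v) R ` K)"] im(1) by (simp add: fmeasurableD)
  also have "\<dots> = ennreal (\<epsilon> * B ^ (?k - 1) * measure lebesgue ((*v) R ` K))"
    using im pos by (simp add: emeasure_eq_measure2 prod)
  also have "\<dots> = ennreal (\<epsilon> * B ^ (?k - 1)) * emeasure lebesgue ((*v) R ` K)"
    using lm pos by (simp add: ennreal_mult emeasure_eq_measure2)
  also have "emeasure lebesgue ((*v) R ` K) = hausdorff ?k ((*v) R ` K)"
    using hausdorff_eq_lebesgue[of "(*v) R ` K"] RK by simp
  also have "\<dots> = emeasure lborel K" unfolding hR using hausdorff_eq_lborel[OF K(1)] by simp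
  finally show ?thesis .
qed

text \<open>Where the derivative is degenerate, it is dominated by an invertible matrix of arbitrarily small determinant.\<close>

lemma hausdorff_degenerate_image:
  fixes f :: "real^'m \<Rightarrow> real^'n"
  assumes f: "L-lipschitz_on UNIV f"
  shows "hausdorff CARD('m) (f ` {y. \<exists>T. (f has_derivative T) (at y) \<and> \<not> inj T}) = 0"
proof -
  let ?k = "CARD('m)"
  let ?Z = "{y. \<exists>T. (f has_derivative T) (at y) \<and> \<not> inj T}"
  have cf: "continuous_on UNIV f" using f by (rule lipschitz_on_continuous_on)
  obtain \<R> :: "(real^'m^'m) set" where \<R>: "countable \<R>" "\<R> \<subseteq> Collect orthogonal_matrix"
    "\<forall>S\<in>Collect orthogonal_matrix. \<forall>e>0. \<exists>A\<in>\<R>. \<forall>x. norm (A *v x - S *v x) \<le> e * norm x"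
    by (rule countable_dense_matrices)
  obtain j :: 'm where True by simp
  have small: "hausdorff ?k (f ` (?Z \<inter> ball 0 R)) \<le> ennreal (2 ^ ?k * \<eta>) * emeasure lborel (ball (0::real^'m) R)"
    if \<eta>: "0 < \<eta>" for \<eta> R
  proof -
    \<comment> \<open>However large \<open>b\<close> is, the determinant of \<open>D b\<close> is \<open>\<eta>\<close>.\<close>
    define D :: "nat \<Rightarrow> real^'m^'m" where "D b = squeeze j (\<eta> / real (Suc b) ^ (?k - 1)) (real (Suc b))" for b
    define I where "I = (SIGMA A:(\<lambda>(b, R). D b ** R) ` (UNIV \<times> \<R>). SIGMA i:(UNIV::nat set). (near_pieces (1 / real (Suc i)) :: (real^'m) set set))"
    define V where "V = (\<lambda>(A, i, C). upper_set f 2 A (1 / real (Suc i)) \<inter> C \<inter> ball 0 R)"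
    have I: "countable I"
      unfolding I_def using \<R>(1) by (intro countable_SIGMA near_pieces countable_image) auto
    have cover: "?Z \<inter> ball 0 R \<subseteq> (\<Union>p\<in>I. V p)"
    proof
      fix y assume y: "y \<in> ?Z \<inter> ball 0 R"
      then obtain T where T: "(f has_derivative T) (at y)" "\<not> inj T" by blast
      have linT: "linear T" using T(1) by (rule has_derivative_linear)
      obtain B where B: "0 < B" "\<And>x. norm (T x) \<le> B * norm x" using linear_bounded_pos[OF linT] by blast
      obtain b where b: "B \<le> real b" using real_arch_simple by blast
      have b_le: "norm (T x) \<le> real (Suc b) * norm x" for x
        using B(2)[of x] mult_right_mono[of B "real (Suc b)" "norm x"] b by simp
      obtain R where R: "orthogonal_matrix R" "\<And>z. norm (T z) \<le> norm ((D b ** R) *v z)"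
        using linear_kernel_le_squeeze[OF linT T(2) _ b_le] unfolding D_def by (metis of_nat_0_le_iff)
      have "inj ((*v) (D b ** R))" unfolding D_def using \<eta> by (intro inj_squeeze R) auto
      then obtain e where e: "0 < e" "\<And>A. (\<forall>x. norm (A *v x - (D b ** R) *v x) \<le> e * norm x) \<Longrightarrow> (\<exists>d>0. \<forall>z. dist z y < d \<longrightarrow>
          norm (f z - f y) \<le> 2 * norm (A *v (z - y)))"
        using derivative_comparable[OF T(1) _ _ R(2), of 2] by fastforce
      \<comment> \<open>A bound for the operator norm of \<open>D b\<close>, made positive by the summand \<open>1\<close>.\<close>
      define \<beta> where "\<beta> = real (CARD('m)) * real (CARD('m)) * norm (D b) + 1"
      have \<beta>: "0 < \<beta>" unfolding \<beta>_def by (intro add_nonneg_pos) auto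
      obtain R' where R': "R' \<in> \<R>" "\<And>x. norm (R' *v x - R *v x) \<le> e / \<beta> * norm x"
        using \<R>(3) R(1) e(1) \<beta> by (metis divide_pos_pos mem_Collect_eq)
      define A where "A = D b ** R'"
      have "norm (A *v x - (D b ** R) *v x) \<le> e * norm x" for x
      proof -
        have "A *v x - (D b ** R) *v x = D b *v (R' *v x - R *v x)"
          by (simp add: A_def matrix_vector_mul_assoc[symmetric] matrix_vector_mult_diff_distrib)
        also have "norm \<dots> \<le> (\<beta> - 1) * norm (R' *v x - R *v x)"
          using matrix_vector_norm_le[of "D b" "R' *v x - R *v x"] by (simp add: \<beta>_def)
        also have "\<dots> \<le> \<beta> * (e / \<beta> * norm x)"
          using R'(2)[of x] \<beta> by (intro mult_mono) auto
        also have "\<dots> = e * norm x" using \<beta> by simp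
        finally show ?thesis .
      qed
      then obtain d where d: "0 < d" "\<And>z. dist z y < d \<Longrightarrow> norm (f z - f y) \<le> 2 * norm (A *v (z - y))"
        using e(2)[of A] by blast
      obtain i where i: "1 / real (Suc i) < d" by (rule exists_inverse_Suc_less[OF d(1)])
      have "0 < 1 / real (Suc i)" by simp
      from near_pieces(2)[OF this] obtain C :: "(real^'m) set" where C: "C \<in> near_pieces (1 / real (Suc i))" "y \<in> C" by blast
      have "(A, i, C) \<in> I" using R'(1) C(1) by (auto simp: I_def A_def)
      moreover have "y \<in> V (A, i, C)" using d(2) i y C(2) by (auto simp: V_def upper_set_def)
      ultimately show "y \<in> (\<Union>p\<in>I. V p)" by blast
    qed
    show ?thesis
    proof (cases "I = {}")
      case True
      then have "?Z \<inter> ball 0 R = {}" using cover by blast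
      then show ?thesis by simp
    next
      case False
      define W where "W n = V (from_nat_into I n)" for n
      have VB: "V p \<in> sets borel" "bounded (V p)" if "p \<in> I" for p
      proof -
        obtain A i C where p: "p = (A, i, C)" by (cases p)
        have "compact C" using that near_pieces(3)[of "1 / real (Suc i)" C] by (auto simp: I_def p)
        then show "V p \<in> sets borel"
          using closed_upper_lower(1)[OF cf, of 2 A "1 / real (Suc i)"] by (auto simp: V_def p compact_imp_closed)
        show "bounded (V p)" unfolding V_def p by (auto intro: bounded_subset[OF bounded_ball])
      qed
      have in_I: "from_nat_into I n \<in> I" for n by (rule from_nat_into[OF False])
      have W: "W n \<in> sets borel" for n unfolding W_def by (rule VB(1)[OF in_I])
      let ?W = "disjointed W"
      have dW: "?W n \<in> sets borel" for n using sets.range_disjointed_sets[of W borel] W by auto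
      have UW: "(\<Union>n. ?W n) = (\<Union>p\<in>I. V p)"
        unfolding UN_disjointed_eq W_def using I False by (metis image_image range_from_nat_into)
      have piece: "hausdorff ?k (f ` ?W n) \<le> ennreal (2 ^ ?k * \<eta>) * emeasure lborel (?W n)" for n
      proof -
        obtain A i C where p: "from_nat_into I n = (A, i, C)" by (cases "from_nat_into I n")
        obtain b R where A: "A = D b ** R" "R \<in> \<R>" "C \<in> near_pieces (1 / real (Suc i))"
          using in_I[of n, unfolded p] by (auto simp: I_def)
        have sub: "?W n \<subseteq> V (A, i, C)" using disjointed_subset[of W n] by (simp add: W_def p)
        have "hausdorff ?k (f ` ?W n) \<le> ennreal (2 ^ ?k) * hausdorff ?k ((*v) A ` ?W n)"
        proof (rule hausdorff_image_le)
          fix y z assume yz: "y \<in> ?W n" "z \<in> ?W n"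
          then have "y \<in> C" "z \<in> C" "z \<in> upper_set f 2 A (1 / real (Suc i))" using sub by (auto simp: V_def)
          moreover have "dist y z < 1 / real (Suc i)"
            using near_pieces(4)[OF _ A(3)] \<open>y \<in> C\<close> \<open>z \<in> C\<close> by simp
          ultimately show "dist (f y) (f z) \<le> 2 * dist (A *v y) (A *v z)"
            by (simp add: upper_set_def dist_norm matrix_vector_mult_diff_distrib)
        qed simp
        also have "hausdorff ?k ((*v) A ` ?W n) = ennreal (\<eta> / real (Suc b) ^ (?k - 1) * real (Suc b) ^ (?k - 1)) * emeasure lborel (?W n)"
          unfolding A(1) D_def
          using dW bounded_subset[OF VB(2)[OF in_I[of n], unfolded p] sub] A(2) \<R>(2) \<eta>
          by (intro hausdorff_squeeze_image) auto
        also have "\<eta> / real (Suc b) ^ (?k - 1) * real (Suc b) ^ (?k - 1) = \<eta>" by simp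
        finally show ?thesis using \<eta> by (simp add: ennreal_mult mult.assoc mult_left_mono)
      qed
      have "hausdorff ?k (f ` (?Z \<inter> ball 0 R)) \<le> hausdorff ?k (\<Union>n. f ` ?W n)"
        using image_mono[OF cover, of f] unfolding UW[symmetric] image_UN by (rule hausdorff_mono)
      also have "\<dots> \<le> (\<Sum>n. hausdorff ?k (f ` ?W n))" by (rule hausdorff_countable_subadditive)
      also have "\<dots> \<le> (\<Sum>n. ennreal (2 ^ ?k * \<eta>) * emeasure lborel (?W n))"
        by (intro suminf_le piece) auto
      also have "\<dots> = ennreal (2 ^ ?k * \<eta>) * emeasure lborel (\<Union>n. ?W n)"
        using dW by (simp add: suminf_emeasure disjoint_family_disjointed image_subset_iff)
      also have "\<dots> \<le> ennreal (2 ^ ?k * \<eta>) * emeasure lborel (ball (0::real^'m) R)"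
        unfolding UW by (intro mult_left_mono emeasure_mono) (auto simp: V_def)
      finally show ?thesis .
    qed
  qed
  have null: "hausdorff ?k (f ` (?Z \<inter> ball 0 R)) = 0" for R
  proof -
    define M where "M = measure lborel (ball (0::real^'m) R)"
    have M: "emeasure lborel (ball (0::real^'m) R) = ennreal M" "0 \<le> M"
      unfolding M_def using emeasure_bounded_open(1)[OF open_ball bounded_ball] by auto
    have le: "hausdorff ?k (f ` (?Z \<inter> ball 0 R)) \<le> 0 + ennreal e" if "0 < e" for e
    proof -
      define \<eta> where "\<eta> = e / (2 ^ ?k * (M + 1))"
      have \<eta>: "0 < \<eta>" using that M(2) by (simp add: \<eta>_def)
      have "2 ^ ?k * \<eta> * (M + 1) = e" using M(2) by (simp add: \<eta>_def)
      moreover have "0 \<le> 2 ^ ?k * \<eta>" using \<eta> by simp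
      ultimately have "2 ^ ?k * \<eta> * M \<le> e" by (simp add: distrib_left)
      then have "ennreal (2 ^ ?k * \<eta>) * ennreal M \<le> ennreal e"
        using \<eta> M(2) by (simp add: ennreal_mult[symmetric] ennreal_leI)
      then show ?thesis using small[OF \<eta>, of R] M(1) by (simp del: ennreal_mult'')
    qed
    have "hausdorff ?k (f ` (?Z \<inter> ball 0 R)) \<le> 0" by (rule ennreal_le_epsilon) (rule le)
    then show ?thesis by simp
  qed
  have "hausdorff ?k (\<Union>n::nat. f ` (?Z \<inter> ball 0 (real n))) = 0" using null by (intro hausdorff_null_UN) auto
  moreover have "f ` ?Z \<subseteq> (\<Union>n::nat. f ` (?Z \<inter> ball 0 (real n)))"
  proof
    fix x assume "x \<in> f ` ?Z"
    then obtain y where y: "y \<in> ?Z" "x = f y" by blast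
    obtain n where "norm y < real n" using reals_Archimedean2 by blast
    then show "x \<in> (\<Union>n::nat. f ` (?Z \<inter> ball 0 (real n)))" using y by (auto intro!: exI[of _ n])
  qed
  ultimately show ?thesis by (rule hausdorff_null_subset)
qed

definition comparable_on :: "real \<Rightarrow> (real^'m \<Rightarrow> real^'n) \<Rightarrow> real^'m^'m \<Rightarrow> (real^'m) set \<Rightarrow> bool" where
  "comparable_on c f A K \<longleftrightarrow> (\<forall>y\<in>K. \<forall>z\<in>K.
     dist (f y) (f z) \<le> c * dist (A *v y) (A *v z) \<and> dist (A *v y) (A *v z) \<le> c * dist (f y) (f z))"

text \<open>Apart from a null set and the points with degenerate derivative, the derivative preserves the lengths of some
  invertible matrix. By approximation countably many matrices suffice, with countably many scales on which
  \<open>f\<close> is comparable with its derivative.\<close>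

theorem lipschitz_image_pieces:
  fixes f :: "real^'m \<Rightarrow> real^'n"
  assumes f: "L-lipschitz_on UNIV f" and c: "1 < c"
  obtains \<K> :: "((real^'m) set \<times> (real^'m^'m)) set" where "countable \<K>"
    "\<And>K A. (K, A) \<in> \<K> \<Longrightarrow> compact K \<and> comparable_on c f A K"
    "hausdorff CARD('m) (range f - (\<Union>(K, A)\<in>\<K>. f ` K)) = 0"
proof -
  have cf: "continuous_on UNIV f" using f by (rule lipschitz_on_continuous_on)
  obtain \<A> :: "(real^'m^'m) set" where \<A>: "countable \<A>" "\<A> \<subseteq> UNIV"
    "\<forall>S\<in>UNIV. \<forall>e>0. \<exists>A\<in>\<A>. \<forall>x. norm (A *v x - S *v x) \<le> e * norm x"
    by (rule countable_dense_matrices)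
  define I where "I = (SIGMA A:\<A>. SIGMA i:(UNIV::nat set). (near_pieces (1 / real (Suc i)) :: (real^'m) set set))"
  define V where "V = (\<lambda>(A, i, C). upper_set f c A (1 / real (Suc i)) \<inter> lower_set f c A (1 / real (Suc i)) \<inter> C)"
  define \<K> where "\<K> = (\<lambda>p. (V p, fst p)) ` I"
  have I: "countable I" unfolding I_def using \<A>(1) by (intro countable_SIGMA near_pieces) auto
  show ?thesis
  proof (rule that[of \<K>])
    show "countable \<K>" unfolding \<K>_def using I by simp
    fix K A assume "(K, A) \<in> \<K>"
    then obtain i C where p: "(A, i, C) \<in> I" "K = V (A, i, C)" by (auto simp: \<K>_def)
    have pos: "0 < 1 / real (Suc i)" by simp
    have C: "C \<in> near_pieces (1 / real (Suc i))" using p(1) by (simp add: I_def)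
    have "compact (C \<inter> (upper_set f c A (1 / real (Suc i)) \<inter> lower_set f c A (1 / real (Suc i))))"
      using near_pieces(3)[OF pos C] closed_upper_lower[OF cf, of c A "1 / real (Suc i)"]
      by (intro compact_Int_closed closed_Int)
    moreover have "comparable_on c f A K"
      unfolding comparable_on_def
    proof (intro ballI)
      fix y z assume yz: "y \<in> K" "z \<in> K"
      then have *: "y \<in> C" "z \<in> C" "z \<in> upper_set f c A (1 / real (Suc i))" "z \<in> lower_set f c A (1 / real (Suc i))"
        by (auto simp: p(2) V_def)
      then have "dist y z < 1 / real (Suc i)" using near_pieces(4)[OF pos C] by simp
      then show "dist (f y) (f z) \<le> c * dist (A *v y) (A *v z) \<and> dist (A *v y) (A *v z) \<le> c * dist (f y) (f z)"
        using *(3,4) by (simp add: upper_set_def lower_set_def dist_norm matrix_vector_mult_diff_distrib)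
    qed
    ultimately show "compact K \<and> comparable_on c f A K" by (simp add: p(2) V_def Int_commute)
  next
    let ?N = "{y. \<not> f differentiable at y}" and ?Z = "{y. \<exists>T. (f has_derivative T) (at y) \<and> \<not> inj T}"
    have "hausdorff CARD('m) (f ` ?N) \<le> ennreal (L ^ CARD('m)) * hausdorff CARD('m) ?N"
      using f by (intro hausdorff_lipschitz_image) (rule lipschitz_on_subset, auto)
    also have "hausdorff CARD('m) ?N = 0" using negligible_hausdorff_null[OF rademacher[OF f]] by simp
    finally have N0: "hausdorff CARD('m) (f ` ?N) = 0" by simp
    have "range f - (\<Union>(K, A)\<in>\<K>. f ` K) \<subseteq> f ` ?N \<union> f ` ?Z"
    proof
      fix x assume x: "x \<in> range f - (\<Union>(K, A)\<in>\<K>. f ` K)"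
      then obtain y where y: "x = f y" by blast
      show "x \<in> f ` ?N \<union> f ` ?Z"
      proof (rule ccontr)
        assume "\<not> ?thesis"
        then have "y \<notin> ?N" "y \<notin> ?Z" using y by auto
        then obtain T where T: "(f has_derivative T) (at y)" "inj T" by (auto simp: differentiable_def)
        have linT: "linear T" using T(1) by (rule has_derivative_linear)
        obtain S :: "real^'m^'m" where S: "invertible S" "\<And>z. norm (S *v z) = norm (T z)"
          using norm_linear_inj_eq_matrix[OF linT T(2)] by metis
        have "inj ((*v) S)" using S(1) by (simp add: inj_matrix_vector_mult)
        then obtain e where e: "0 < e" "\<And>A. (\<forall>x. norm (A *v x - S *v x) \<le> e * norm x) \<Longrightarrow> (\<exists>d>0. \<forall>z. dist z y < d \<longrightarrow>
            norm (f z - f y) \<le> c * norm (A *v (z - y)) \<and> norm (A *v (z - y)) \<le> c * norm (f z - f y))"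
          using derivative_comparable[OF T(1) _ c, of S] S(2) by fastforce
        obtain A where A: "A \<in> \<A>" "\<forall>x. norm (A *v x - S *v x) \<le> e * norm x" using \<A>(3) e(1) by blast
        then obtain d where d: "0 < d" "\<And>z. dist z y < d \<Longrightarrow> norm (f z - f y) \<le> c * norm (A *v (z - y)) \<and> norm (A *v (z - y)) \<le> c * norm (f z - f y)"
          using e(2)[of A] by auto
        obtain i where i: "1 / real (Suc i) < d" by (rule exists_inverse_Suc_less[OF d(1)])
        have "0 < 1 / real (Suc i)" by simp
        from near_pieces(2)[OF this] obtain C :: "(real^'m) set" where C: "C \<in> near_pieces (1 / real (Suc i))" "y \<in> C" by blast
        have "(A, i, C) \<in> I" using A C by (auto simp: I_def)
        then have "(V (A, i, C), A) \<in> \<K>" by (force simp: \<K>_def)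
        moreover have "y \<in> V (A, i, C)" using d(2) i C(2) by (auto simp: V_def upper_set_def lower_set_def)
        ultimately show False using x y by blast
      qed
    qed
    then show "hausdorff CARD('m) (range f - (\<Union>(K, A)\<in>\<K>. f ` K)) = 0"
      using hausdorff_null_subset[OF hausdorff_null_Un[OF N0 hausdorff_degenerate_image[OF f]]] by blast
  qed
qed

definition ball_quot :: "nat \<Rightarrow> 'a::metric_space set \<Rightarrow> 'a \<Rightarrow> real \<Rightarrow> ennreal" where
  "ball_quot k E x r = hausdorff k (E \<inter> cball x r) / ennreal (unit_ball_vol (real k) * r ^ k)"

lemma has_density_ball_quot: "has_density k E x \<theta> \<longleftrightarrow> (ball_quot k E x \<longlongrightarrow> \<theta>) (at_right 0)"
  unfolding has_density_def ball_quot_def ..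

lemma le_ball_quot_iff:
  assumes "0 < r" "0 \<le> t"
  shows "ennreal t \<le> ball_quot k E x r \<longleftrightarrow> ennreal (t * (unit_ball_vol (real k) * r ^ k)) \<le> hausdorff k (E \<inter> cball x r)"
  using le_ball_ratio_iff[OF assms, of k "hausdorff_on k E" x]
  by (simp add: ball_ratio_def ball_quot_def emeasure_hausdorff_on Int_commute)

lemma ball_quot_le_iff:
  assumes "0 < r" "0 \<le> t"
  shows "ball_quot k E x r \<le> ennreal t \<longleftrightarrow> hausdorff k (E \<inter> cball x r) \<le> ennreal (t * (unit_ball_vol (real k) * r ^ k))"
proof -
  let ?c = "unit_ball_vol (real k) * r ^ k"
  have c: "0 < ?c" using assms(1) by (rule unit_ball_vol_power_pos)
  show ?thesis
  proof (cases "hausdorff k (E \<inter> cball x r)")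
    case (real m)
    then show ?thesis using c assms(2)
      by (simp add: ball_quot_def divide_ennreal pos_divide_le_eq)
  next
    case top
    then show ?thesis using assms by (simp add: ball_quot_def ennreal_top_divide top_unique)
  qed
qed

lemma ball_quot_subadditive: "A \<subseteq> B \<union> C \<Longrightarrow> ball_quot k A x r \<le> ball_quot k B x r + ball_quot k C x r"
  unfolding ball_quot_def add_divide_distrib_ennreal[symmetric]
  by (intro divide_right_mono_ennreal order_trans[OF hausdorff_mono hausdorff_Un]) auto

lemma ball_quot_mono: "A \<subseteq> B \<Longrightarrow> ball_quot k A x r \<le> ball_quot k B x r"
  unfolding ball_quot_def by (intro divide_right_mono_ennreal hausdorff_mono) auto

lemma has_density_0_mono:
  assumes "has_density k B x 0" "A \<subseteq> B" shows "has_density k A x 0"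
proof -
  have lim: "(ball_quot k B x \<longlongrightarrow> 0) (at_right 0)" using assms(1) by (simp add: has_density_ball_quot)
  have "(ball_quot k A x \<longlongrightarrow> 0) (at_right 0)"
    by (rule tendsto_sandwich[OF _ _ tendsto_const lim]) (auto intro!: always_eventually ball_quot_mono assms(2))
  then show ?thesis by (simp add: has_density_ball_quot)
qed

lemma has_density_0_Un:
  assumes "has_density k A x 0" "has_density k B x 0" shows "has_density k (A \<union> B) x 0"
proof -
  have "((\<lambda>r. ball_quot k A x r + ball_quot k B x r) \<longlongrightarrow> 0 + 0) (at_right 0)"
    using assms unfolding has_density_ball_quot by (intro tendsto_add)
  then have lim: "((\<lambda>r. ball_quot k A x r + ball_quot k B x r) \<longlongrightarrow> 0) (at_right 0)" by simp
  have "(ball_quot k (A \<union> B) x \<longlongrightarrow> 0) (at_right 0)"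
    by (rule tendsto_sandwich[OF _ _ tendsto_const lim]) (auto intro!: always_eventually ball_quot_subadditive)
  then show ?thesis by (simp add: has_density_ball_quot)
qed

lemma density_zero_ae_finite:
  fixes E :: "'a::euclidean_space set"
  assumes "E \<in> hausdorff_sets k" "hausdorff k E < \<infinity>"
  shows "hausdorff k {x. x \<notin> E \<and> \<not> has_density k E x 0} = 0"
  using assms(1)
proof (rule density_zero_ae)
  show "hausdorff k (E \<inter> ball 0 R) < \<infinity>" for R
    using assms(2) hausdorff_mono[of "E \<inter> ball 0 R" E k] by (auto intro: order_le_less_trans)
qed

lemma hausdorff_compact_finite:
  fixes K :: "'a::euclidean_space set"
  assumes "compact K" shows "hausdorff DIM('a) K < \<infinity>"
  using emeasure_bounded_finite[OF compact_imp_bounded[OF assms]] assms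
  by (simp add: hausdorff_eq_lborel compact_imp_closed)

text \<open>The part of \<open>f ` K\<close> in a ball of radius \<open>r\<close> comes from the part of \<open>A K\<close> in a ball of radius \<open>c r\<close>.\<close>

lemma piece_upper:
  fixes f :: "real^'m \<Rightarrow> real^'n"
  assumes K: "comparable_on c f A K" and c: "1 < c" and x: "x \<in> f ` K" and r: "0 < r"
  shows "ball_quot CARD('m) (f ` K) x r \<le> ennreal (c ^ (2 * CARD('m)))"
proof -
  let ?k = "CARD('m)"
  obtain y where y: "y \<in> K" "x = f y" using x by blast
  define K1 where "K1 = {z\<in>K. dist (A *v y) (A *v z) \<le> c * r}"
  have "f ` K \<inter> cball x r \<subseteq> f ` K1"
  proof
    fix w assume "w \<in> f ` K \<inter> cball x r"
    then obtain z where z: "z \<in> K" "w = f z" "dist (f y) (f z) \<le> r" using y by auto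
    have "dist (A *v y) (A *v z) \<le> c * dist (f y) (f z)" using K y z by (auto simp: comparable_on_def)
    also have "\<dots> \<le> c * r" using z c by simp
    finally show "w \<in> f ` K1" using z by (auto simp: K1_def)
  qed
  then have "hausdorff ?k (f ` K \<inter> cball x r) \<le> hausdorff ?k (f ` K1)" by (rule hausdorff_mono)
  also have "\<dots> \<le> ennreal (c ^ ?k) * hausdorff ?k ((*v) A ` K1)"
    using K c by (intro hausdorff_image_le) (auto simp: comparable_on_def K1_def)
  also have "hausdorff ?k ((*v) A ` K1) \<le> hausdorff ?k (cball (A *v y) (c * r))"
    by (rule hausdorff_mono) (auto simp: K1_def)
  also have "hausdorff ?k (cball (A *v y) (c * r)) = ennreal (unit_ball_vol (real ?k) * (c * r) ^ ?k)"
    using emeasure_lborel_cball[of "c * r" "A *v y"] hausdorff_eq_lborel[of "cball (A *v y) (c * r)"] c r by simp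
  finally have "hausdorff ?k (f ` K \<inter> cball x r) \<le> ennreal (c ^ ?k) * ennreal (unit_ball_vol (real ?k) * (c * r) ^ ?k)"
    by (simp add: mult_left_mono)
  also have "\<dots> = ennreal (c ^ ?k * (unit_ball_vol (real ?k) * (c * r) ^ ?k))"
    using c r by (intro ennreal_mult[symmetric]) auto
  also have "c ^ ?k * (unit_ball_vol (real ?k) * (c * r) ^ ?k) = c ^ (2 * ?k) * (unit_ball_vol (real ?k) * r ^ ?k)"
  proof -
    have "c ^ (2 * ?k) = c ^ ?k * c ^ ?k" by (simp add: mult_2 power_add)
    then show ?thesis by (simp add: power_mult_distrib)
  qed
  finally show ?thesis using c r by (subst ball_quot_le_iff) auto
qed

text \<open>At almost every point of \<open>A K\<close> the complement of \<open>A K\<close> has density zero. There a small ball of radius \<open>r / c\<close> is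
  filled by \<open>A K\<close> but for the proportion \<open>1 - 1 / c\<close>, and the image of its part in \<open>A K\<close> lies in a ball of radius \<open>r\<close>.\<close>

lemma piece_lower:
  fixes f :: "real^'m \<Rightarrow> real^'n"
  assumes K: "compact K" "comparable_on c f A K" and c: "1 < c"
  shows "hausdorff CARD('m) {x\<in>f ` K. \<not> (\<forall>\<^sub>F r in at_right 0. ennreal (1 / c ^ (2 * CARD('m) + 1)) \<le> ball_quot CARD('m) (f ` K) x r)} = 0"
proof -
  let ?k = "CARD('m)"
  define K' where "K' = (*v) A ` K"
  have cK': "compact K'" unfolding K'_def
    using K(1) by (intro compact_continuous_image linear_continuous_on matrix_vector_mul_bounded_linear)
  define N where "N = {u. u \<notin> - K' \<and> \<not> has_density ?k (- K') u 0}"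
  have N: "hausdorff ?k N = 0"
    unfolding N_def
  proof (rule density_zero_ae)
    have "- K' \<in> sets borel" using cK' by (simp add: compact_imp_closed)
    then show "- K' \<in> hausdorff_sets ?k" using borel_subset_hausdorff_sets by blast
    fix R
    have "hausdorff ?k (- K' \<inter> ball 0 R) \<le> hausdorff ?k (cball (0::real^'m) R)"
      by (rule hausdorff_mono) auto
    also have "\<dots> < \<infinity>" using hausdorff_compact_finite[OF compact_cball, of "0::real^'m" R] by simp
    finally show "hausdorff ?k (- K' \<inter> ball 0 R) < \<infinity>" .
  qed
  have "hausdorff ?k (f ` {y\<in>K. A *v y \<in> N}) \<le> ennreal (c ^ ?k) * hausdorff ?k ((*v) A ` {y\<in>K. A *v y \<in> N})"
    using K c by (intro hausdorff_image_le) (auto simp: comparable_on_def)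
  also have "hausdorff ?k ((*v) A ` {y\<in>K. A *v y \<in> N}) = 0"
    by (rule hausdorff_null_subset[OF N]) auto
  finally have null: "hausdorff ?k (f ` {y\<in>K. A *v y \<in> N}) = 0" by simp
  show ?thesis
  proof (rule hausdorff_null_subset[OF null], safe)
    fix y assume y: "y \<in> K" and bad: "\<not> (\<forall>\<^sub>F r in at_right 0. ennreal (1 / c ^ (2 * ?k + 1)) \<le> ball_quot ?k (f ` K) (f y) r)"
    have "A *v y \<in> N"
    proof (rule ccontr)
      assume "A *v y \<notin> N"
      then have "(ball_quot ?k (- K') (A *v y) \<longlongrightarrow> 0) (at_right 0)"
        using y by (auto simp: N_def K'_def has_density_ball_quot)
      moreover have pos: "0 < 1 - 1 / c" using c by simp
      ultimately have "\<forall>\<^sub>F r in at_right 0. ball_quot ?k (- K') (A *v y) r < ennreal (1 - 1 / c)"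
        by (intro order_tendstoD(2)) auto
      then obtain d where d: "0 < d" "\<And>r. 0 < r \<Longrightarrow> r < d \<Longrightarrow> ball_quot ?k (- K') (A *v y) r < ennreal (1 - 1 / c)"
        unfolding eventually_at_right_field by blast
      have "ennreal (1 / c ^ (2 * ?k + 1)) \<le> ball_quot ?k (f ` K) (f y) r" if r: "0 < r" "r < d" for r
      proof -
        define s where "s = r / c"
        define K1 where "K1 = {z\<in>K. dist (A *v y) (A *v z) \<le> s}"
        have s: "0 < s" "s < d" using r c d(1) by (auto simp: s_def divide_less_eq) 
          (smt (verit) mult_less_cancel_left2)
        have eq: "K' \<inter> cball (A *v y) s = (*v) A ` K1" by (auto simp: K'_def K1_def)
        let ?V = "unit_ball_vol (real ?k) * s ^ ?k"
        have V: "0 < ?V" using s(1) by (rule unit_ball_vol_power_pos)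
        have full: "hausdorff ?k (cball (A *v y) s) = ennreal ?V"
          using emeasure_lborel_cball[of s "A *v y"] hausdorff_eq_lborel[of "cball (A *v y) s"] s by simp
        have "ennreal ?V \<le> hausdorff ?k (K' \<inter> cball (A *v y) s) + hausdorff ?k (- K' \<inter> cball (A *v y) s)"
          unfolding full[symmetric] by (rule order_trans[OF hausdorff_mono hausdorff_Un]) auto
        also have "hausdorff ?k (- K' \<inter> cball (A *v y) s) \<le> ennreal ((1 - 1 / c) * ?V)"
          using d(2)[OF s] s pos ball_quot_le_iff[of s "1 - 1 / c" ?k "- K'" "A *v y"] by (simp add: less_imp_le)
        finally have "ennreal ?V \<le> hausdorff ?k ((*v) A ` K1) + ennreal ((1 - 1 / c) * ?V)"
          unfolding eq by (simp add: add_left_mono)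
        moreover have "ennreal ?V = ennreal (?V / c) + ennreal ((1 - 1 / c) * ?V)"
        proof -
          have "0 \<le> ?V / c" "0 \<le> (1 - 1 / c) * ?V" using V c pos by (auto intro!: divide_nonneg_nonneg mult_nonneg_nonneg less_imp_le[OF V] less_imp_le[OF pos])
          moreover have "?V = ?V / c + (1 - 1 / c) * ?V" by (simp add: left_diff_distrib)
          ultimately show ?thesis by (metis ennreal_plus)
        qed
        ultimately have "ennreal (?V / c) \<le> hausdorff ?k ((*v) A ` K1)"
          by (simp add: add.commute ennreal_add_left_cancel_le)
        also have "\<dots> \<le> ennreal (c ^ ?k) * hausdorff ?k (f ` K1)"
          using K c by (intro hausdorff_image_le) (auto simp: comparable_on_def K1_def)
        also have "hausdorff ?k (f ` K1) \<le> hausdorff ?k (f ` K \<inter> cball (f y) r)"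
        proof (rule hausdorff_mono)
          show "f ` K1 \<subseteq> f ` K \<inter> cball (f y) r"
          proof safe
            fix z assume z: "z \<in> K1"
            then have "dist (f y) (f z) \<le> c * dist (A *v y) (A *v z)" using K y by (auto simp: comparable_on_def K1_def)
            also have "\<dots> \<le> c * s" using z c by (simp add: K1_def)
            also have "\<dots> = r" using c by (simp add: s_def)
            finally show "f z \<in> cball (f y) r" by simp
          qed (auto simp: K1_def)
        qed
        finally have le: "ennreal (?V / c) \<le> ennreal (c ^ ?k) * hausdorff ?k (f ` K \<inter> cball (f y) r)"
          by (simp add: mult_left_mono)
        have "ennreal (1 / c ^ (2 * ?k + 1) * (unit_ball_vol (real ?k) * r ^ ?k)) = ennreal (1 / c ^ ?k) * ennreal (?V / c)"
        proof -
          have "c ^ (2 * ?k + 1) = c ^ ?k * (c ^ ?k * c)" by (simp add: mult_2 power_add)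
          then have "1 / c ^ (2 * ?k + 1) * (unit_ball_vol (real ?k) * r ^ ?k) = 1 / c ^ ?k * (?V / c)"
            by (simp add: s_def power_divide)
          moreover have "0 \<le> 1 / c ^ ?k" "0 \<le> ?V / c" using c V by simp_all
          ultimately show ?thesis by (simp only: ennreal_mult)
        qed
        also have "\<dots> \<le> ennreal (1 / c ^ ?k) * (ennreal (c ^ ?k) * hausdorff ?k (f ` K \<inter> cball (f y) r))"
          using le by (rule mult_left_mono) simp
        also have "\<dots> = hausdorff ?k (f ` K \<inter> cball (f y) r)"
          using c by (simp add: mult.assoc[symmetric] ennreal_mult[symmetric])
        finally show ?thesis using r c by (subst le_ball_quot_iff) auto
      qed
      then have "\<forall>\<^sub>F r in at_right 0. ennreal (1 / c ^ (2 * ?k + 1)) \<le> ball_quot ?k (f ` K) (f y) r"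
        unfolding eventually_at_right_field using d(1) by blast
      then show False using bad by simp
    qed
    then show "f y \<in> f ` {y\<in>K. A *v y \<in> N}" using y by blast
  qed
qed

text \<open>The powers of \<open>c\<close> are the bounds for a single piece; the summand \<open>c - 1\<close> makes room for the difference
  between \<open>E\<close> and the piece, which has density zero at almost every common point.\<close>

definition nearly_density_1 :: "nat \<Rightarrow> 'a::metric_space set \<Rightarrow> real \<Rightarrow> 'a \<Rightarrow> bool" where
  "nearly_density_1 k E c x \<longleftrightarrow> (\<forall>\<^sub>F r in at_right 0.
     ennreal (1 / c ^ (2 * k + 1)) \<le> ball_quot k E x r + ennreal (c - 1) \<and>
     ball_quot k E x r \<le> ennreal (c ^ (2 * k)) + ennreal (c - 1))"

lemma has_density_1I:
  assumes "\<And>m. nearly_density_1 k E (1 + 1 / real (Suc m)) x"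
  shows "has_density k E x 1"
  unfolding has_density_ball_quot
proof (rule order_tendstoI)
  let ?c = "\<lambda>m. 1 + 1 / real (Suc m)"
  have c: "?c \<longlonglongrightarrow> 1"
    using tendsto_add[OF tendsto_const LIMSEQ_inverse_real_of_nat, of "1::real"] by (simp add: inverse_eq_divide)
  fix a :: ennreal
  {
    assume a: "1 < a"
    have "(\<lambda>m. ennreal (?c m ^ (2 * k)) + ennreal (?c m - 1)) \<longlonglongrightarrow> ennreal (1 ^ (2 * k)) + ennreal (1 - 1)"
      by (intro tendsto_add tendsto_ennrealI tendsto_power tendsto_diff c tendsto_const)
    then have "\<forall>\<^sub>F m in sequentially. ennreal (?c m ^ (2 * k)) + ennreal (?c m - 1) < a"
      using a by (intro order_tendstoD(2)) auto
    then obtain m where m: "ennreal (?c m ^ (2 * k)) + ennreal (?c m - 1) < a"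
      by (meson eventually_happens sequentially_bot)
    show "\<forall>\<^sub>F r in at_right 0. ball_quot k E x r < a"
      using assms[of m] unfolding nearly_density_1_def
      by eventually_elim (rule order_le_less_trans[OF conjunct2 m])
  }
  {
    assume a: "a < 1"
    obtain t where t: "a < t" "t < 1" using dense[OF a] by blast
    have "(\<lambda>m. ennreal (1 / ?c m ^ (2 * k + 1))) \<longlonglongrightarrow> ennreal (1 / 1 ^ (2 * k + 1))"
      by (intro tendsto_ennrealI tendsto_divide tendsto_power c tendsto_const) simp
    then have "\<forall>\<^sub>F m in sequentially. t < ennreal (1 / ?c m ^ (2 * k + 1))"
      using t by (intro order_tendstoD(1)) auto
    moreover have "(\<lambda>m. a + ennreal (?c m - 1)) \<longlonglongrightarrow> a + ennreal (1 - 1)"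
      by (intro tendsto_add tendsto_ennrealI tendsto_diff c tendsto_const)
    then have "\<forall>\<^sub>F m in sequentially. a + ennreal (?c m - 1) < t"
      using t by (intro order_tendstoD(2)) auto
    ultimately have "\<forall>\<^sub>F m in sequentially. a + ennreal (?c m - 1) < ennreal (1 / ?c m ^ (2 * k + 1))"
      by eventually_elim (rule less_trans)
    then obtain m where m: "a + ennreal (?c m - 1) < ennreal (1 / ?c m ^ (2 * k + 1))"
      by (meson eventually_happens sequentially_bot)
    show "\<forall>\<^sub>F r in at_right 0. a < ball_quot k E x r"
      using assms[of m] unfolding nearly_density_1_def
    proof eventually_elim
      fix r assume h: "ennreal (1 / ?c m ^ (2 * k + 1)) \<le> ball_quot k E x r + ennreal (?c m - 1) \<and>
         ball_quot k E x r \<le> ennreal (?c m ^ (2 * k)) + ennreal (?c m - 1)"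
      show "a < ball_quot k E x r"
      proof (rule ccontr)
        assume "\<not> a < ball_quot k E x r"
        then have "ball_quot k E x r + ennreal (?c m - 1) \<le> a + ennreal (?c m - 1)"
          by (intro add_right_mono) simp
        then show False using h m by (meson leD order_trans)
      qed
    qed
  }
qed

text \<open>Let \<open>P\<close> be a piece of the image. At almost every point of \<open>E \<inter> P\<close> both \<open>E - P\<close> and \<open>P - E\<close> have density
  zero, so that \<open>E\<close> inherits the density bounds of \<open>P\<close>.\<close>

lemma nearly_density_1_ae:
  fixes f :: "real^'m \<Rightarrow> real^'n"
  assumes f: "L-lipschitz_on UNIV f" and c: "1 < c"
    and E: "E \<in> hausdorff_sets CARD('m)" "hausdorff CARD('m) E < \<infinity>"
  shows "hausdorff CARD('m) {x\<in>E \<inter> range f. \<not> nearly_density_1 CARD('m) E c x} = 0"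
proof -
  let ?k = "CARD('m)"
  obtain \<K> :: "((real^'m) set \<times> (real^'m^'m)) set" where \<K>: "countable \<K>"
    "\<forall>p\<in>\<K>. compact (fst p) \<and> comparable_on c f (snd p) (fst p)"
    "hausdorff ?k (range f - (\<Union>(K, A)\<in>\<K>. f ` K)) = 0"
  proof (rule lipschitz_image_pieces[OF f c])
    fix \<K> :: "((real^'m) set \<times> (real^'m^'m)) set"
    assume "countable \<K>" "\<And>K A. (K, A) \<in> \<K> \<Longrightarrow> compact K \<and> comparable_on c f A K"
      "hausdorff ?k (range f - (\<Union>(K, A)\<in>\<K>. f ` K)) = 0"
    then show ?thesis by (intro that[of \<K>]) auto
  qed
  have piece: "hausdorff ?k {x\<in>E \<inter> f ` fst p. \<not> nearly_density_1 ?k E c x} = 0" if p: "p \<in> \<K>" for p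
  proof -
    define P A where "P = f ` fst p" and "A = snd p"
    have K: "compact (fst p)" "comparable_on c f A (fst p)" using \<K>(2) p by (auto simp: A_def)
    have cP: "compact P" unfolding P_def
      using K(1) lipschitz_on_continuous_on[OF f] by (intro compact_continuous_image) (auto intro: continuous_on_subset)
    have Pm: "P \<in> hausdorff_sets ?k" 
      using borel_closed[OF compact_imp_closed[OF cP]] borel_subset_hausdorff_sets by (rule rev_subsetD)
    have "hausdorff ?k P \<le> ennreal (L ^ ?k) * hausdorff ?k (fst p)"
      unfolding P_def using f by (intro hausdorff_lipschitz_image) (rule lipschitz_on_subset, auto)
    also have "\<dots> < \<infinity>" using hausdorff_compact_finite[OF K(1)] by (simp add: ennreal_mult_less_top)
    finally have Pfin: "hausdorff ?k P < \<infinity>" .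
    have fin: "hausdorff ?k (E - P) < \<infinity>" "hausdorff ?k (P - E) < \<infinity>"
      using E(2) Pfin hausdorff_mono[of "E - P" E ?k] hausdorff_mono[of "P - E" P ?k] by (auto intro: order_le_less_trans)
    let ?N1 = "{x. x \<notin> E - P \<and> \<not> has_density ?k (E - P) x 0}"
    let ?N2 = "{x. x \<notin> P - E \<and> \<not> has_density ?k (P - E) x 0}"
    let ?N3 = "{x\<in>P. \<not> (\<forall>\<^sub>F r in at_right 0. ennreal (1 / c ^ (2 * ?k + 1)) \<le> ball_quot ?k P x r)}"
    have "hausdorff ?k ?N1 = 0"
      by (rule density_zero_ae_finite[OF hausdorff_sets_Diff[OF E(1) Pm] fin(1)])
    moreover have "hausdorff ?k ?N2 = 0"
      by (rule density_zero_ae_finite[OF hausdorff_sets_Diff[OF Pm E(1)] fin(2)])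
    moreover have "hausdorff ?k ?N3 = 0" unfolding P_def by (rule piece_lower[OF K c])
    ultimately have null: "hausdorff ?k (?N1 \<union> ?N2 \<union> ?N3) = 0" by (intro hausdorff_null_Un)
    have "nearly_density_1 ?k E c x" if x: "x \<in> E" "x \<in> P" "x \<notin> ?N1 \<union> ?N2 \<union> ?N3" for x
    proof -
      have pos: "0 < ennreal (c - 1)" using c by simp
      have 1: "\<forall>\<^sub>F r in at_right 0. ball_quot ?k (E - P) x r < ennreal (c - 1)"
        using x pos by (intro order_tendstoD(2)) (auto simp: has_density_ball_quot)
      have 2: "\<forall>\<^sub>F r in at_right 0. ball_quot ?k (P - E) x r < ennreal (c - 1)"
        using x pos by (intro order_tendstoD(2)) (auto simp: has_density_ball_quot)
      have 3: "\<forall>\<^sub>F r in at_right 0. ennreal (1 / c ^ (2 * ?k + 1)) \<le> ball_quot ?k P x r" using x by blast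
      have 4: "\<forall>\<^sub>F r in at_right 0. (0::real) < r" by (simp add: eventually_at_right_less)
      show ?thesis unfolding nearly_density_1_def using 1 2 3 4
      proof eventually_elim
        case (elim r)
        have "ball_quot ?k P x r \<le> ball_quot ?k E x r + ball_quot ?k (P - E) x r"
          by (rule ball_quot_subadditive) auto
        also have "\<dots> \<le> ball_quot ?k E x r + ennreal (c - 1)" using elim(2) by (intro add_left_mono) simp
        finally have lo: "ennreal (1 / c ^ (2 * ?k + 1)) \<le> ball_quot ?k E x r + ennreal (c - 1)"
          using elim(3) by (rule order_trans[rotated])
        have "ball_quot ?k E x r \<le> ball_quot ?k P x r + ball_quot ?k (E - P) x r"
          by (rule ball_quot_subadditive) auto
        also have "\<dots> \<le> ennreal (c ^ (2 * ?k)) + ennreal (c - 1)"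
          using elim(1,4) piece_upper[OF K(2) c] x(2) by (intro add_mono) (auto simp: P_def)
        finally show ?case using lo by simp
      qed
    qed
    then show ?thesis
      by (intro hausdorff_null_subset[OF null]) (auto simp: P_def)
  qed
  have "hausdorff ?k (\<Union>p\<in>\<K>. {x\<in>E \<inter> f ` fst p. \<not> nearly_density_1 ?k E c x}) = 0"
    using \<K>(1) piece by (rule hausdorff_null_UN)
  from hausdorff_null_Un[OF \<K>(3) this] show ?thesis
    by (rule hausdorff_null_subset) (auto simp: case_prod_beta)
qed

theorem rectifiable_density_1_ae:
  fixes E :: "(real^'n) set" and m :: "(real^'m) itself"
  assumes E: "rectifiable m E"
  shows "hausdorff CARD('m) {x\<in>E. \<not> has_density CARD('m) E x 1} = 0"
proof -
  let ?k = "CARD('m)"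
  have E': "E \<in> hausdorff_sets ?k" "hausdorff ?k E < \<infinity>" using E by (auto simp: rectifiable_def)
  obtain f :: "nat \<Rightarrow> real^'m \<Rightarrow> real^'n" where f: "\<And>i. \<exists>L. L-lipschitz_on UNIV (f i)"
    and rest: "hausdorff ?k (E - (\<Union>i. range (f i))) = 0"
    using E unfolding rectifiable_def countably_rectifiable_def by auto
  let ?c = "\<lambda>m. 1 + 1 / real (Suc m)"
  have "hausdorff ?k {x\<in>E \<inter> range (f i). \<not> nearly_density_1 ?k E (?c m) x} = 0" for i m
    using f[of i] nearly_density_1_ae[OF _ _ E', of _ "f i" "?c m"] by auto
  then have "hausdorff ?k (\<Union>i. \<Union>m. {x\<in>E \<inter> range (f i). \<not> nearly_density_1 ?k E (?c m) x}) = 0"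
    by (intro hausdorff_null_UN) auto
  from hausdorff_null_Un[OF rest this] show ?thesis
  proof (rule hausdorff_null_subset)
    show "{x\<in>E. \<not> has_density ?k E x 1} \<subseteq> (E - (\<Union>i. range (f i))) \<union>
       (\<Union>i. \<Union>m. {x\<in>E \<inter> range (f i). \<not> nearly_density_1 ?k E (?c m) x})"
    proof (rule subsetI, rule ccontr)
      fix x assume x: "x \<in> {x\<in>E. \<not> has_density ?k E x 1}" "x \<notin> (E - (\<Union>i. range (f i))) \<union>
         (\<Union>i. \<Union>m. {x\<in>E \<inter> range (f i). \<not> nearly_density_1 ?k E (?c m) x})"
      then obtain i where i: "x \<in> E" "x \<in> range (f i)" by blast
      have "nearly_density_1 ?k E (?c m) x" for m using x(2) i by blast
      then have "has_density ?k E x 1" by (rule has_density_1I)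
      then show False using x(1) by simp
    qed
  qed
qed

text \<open>Borel measurability of the set of points of density one: closed balls give upper, open balls give lower
  semicontinuous functions of the centre, and in the bound from above the two may be exchanged.\<close>

lemma closed_ball_measure_ge:
  fixes M :: "'a::euclidean_space measure"
  assumes M: "sets M = sets borel" "finite_measure M"
  shows "closed {x. c \<le> emeasure M (cball x r)}"
proof (rule closed_sequential_limits[THEN iffD2], intro allI impI)
  interpret finite_measure M by fact
  fix x :: "nat \<Rightarrow> 'a" and l assume x: "(\<forall>n. x n \<in> {x. c \<le> emeasure M (cball x r)}) \<and> x \<longlonglongrightarrow> l"
  have le: "c \<le> emeasure M (cball l (r + 1 / real (Suc m)))" for m
  proof -
    have "\<forall>\<^sub>F n in sequentially. dist (x n) l < 1 / real (Suc m)"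
      using x by (intro tendstoD) auto
    then obtain n where n: "dist (x n) l < 1 / real (Suc m)" by (meson eventually_happens sequentially_bot)
    have "cball (x n) r \<subseteq> cball l (r + 1 / real (Suc m))"
    proof
      fix y assume "y \<in> cball (x n) r"
      then show "y \<in> cball l (r + 1 / real (Suc m))"
        using n dist_triangle[of l y "x n"] by (simp add: dist_commute)
    qed
    then have "emeasure M (cball (x n) r) \<le> emeasure M (cball l (r + 1 / real (Suc m)))"
      using M by (intro emeasure_mono) auto
    moreover have "c \<le> emeasure M (cball (x n) r)" using x by simp
    ultimately show ?thesis by (rule order_trans[rotated])
  qed
  have inter: "(\<Inter>m. cball l (r + 1 / real (Suc m))) = cball l r"
  proof (intro set_eqI iffI)
    fix y assume y: "y \<in> (\<Inter>m. cball l (r + 1 / real (Suc m)))"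
    have "(\<lambda>m. r + 1 / real (Suc m)) \<longlonglongrightarrow> r + 0"
      using tendsto_add[OF tendsto_const LIMSEQ_inverse_real_of_nat, of r] by (simp add: inverse_eq_divide)
    then have "dist l y \<le> r + 0" by (rule Lim_bounded2) (use y in auto)
    then show "y \<in> cball l r" by simp
  next
    fix y assume "y \<in> cball l r"
    then have "dist l y \<le> r" by simp
    then have "dist l y \<le> r + 1 / real (Suc m)" for m
      by (rule order_trans) simp
    then show "y \<in> (\<Inter>m. cball l (r + 1 / real (Suc m)))" by auto
  qed
  have "(\<lambda>m. emeasure M (cball l (r + 1 / real (Suc m)))) \<longlonglongrightarrow> emeasure M (\<Inter>m. cball l (r + 1 / real (Suc m)))"
  proof (rule Lim_emeasure_decseq)
    show "decseq (\<lambda>m. cball l (r + 1 / real (Suc m)))"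
      by (intro decseq_SucI subset_cball) (simp add: frac_le)
    show "range (\<lambda>m. cball l (r + 1 / real (Suc m))) \<subseteq> sets M"
      unfolding M(1) by (rule image_subsetI) simp
    show "emeasure M (cball l (r + 1 / real (Suc m))) \<noteq> \<infinity>" for m
      using emeasure_finite by simp
  qed
  then have "(\<lambda>m. emeasure M (cball l (r + 1 / real (Suc m)))) \<longlonglongrightarrow> emeasure M (cball l r)"
    by (simp only: inter)
  then have "c \<le> emeasure M (cball l r)" by (rule Lim_bounded2) (simp only: le simp_thms)
  then show "l \<in> {x. c \<le> emeasure M (cball x r)}" by simp
qed

lemma closed_ball_measure_le:
  fixes M :: "'a::euclidean_space measure"
  assumes M: "sets M = sets borel"
  shows "closed {x. emeasure M (ball x r) \<le> c}"
proof (rule closed_sequential_limits[THEN iffD2], intro allI impI)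
  fix x :: "nat \<Rightarrow> 'a" and l assume x: "(\<forall>n. x n \<in> {x. emeasure M (ball x r) \<le> c}) \<and> x \<longlonglongrightarrow> l"
  have le: "emeasure M (ball l (r - 1 / real (Suc m))) \<le> c" for m
  proof -
    have "\<forall>\<^sub>F n in sequentially. dist (x n) l < 1 / real (Suc m)"
      using x by (intro tendstoD) auto
    then obtain n where n: "dist (x n) l < 1 / real (Suc m)" by (meson eventually_happens sequentially_bot)
    have "ball l (r - 1 / real (Suc m)) \<subseteq> ball (x n) r"
    proof
      fix y assume "y \<in> ball l (r - 1 / real (Suc m))"
      then show "y \<in> ball (x n) r" using n dist_triangle[of "x n" y l] by simp
    qed
    then have "emeasure M (ball l (r - 1 / real (Suc m))) \<le> emeasure M (ball (x n) r)"
      using M by (intro emeasure_mono) auto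
    moreover have "emeasure M (ball (x n) r) \<le> c" using x by simp
    ultimately show ?thesis by (rule order_trans)
  qed
  have union: "(\<Union>m. ball l (r - 1 / real (Suc m))) = ball l r"
  proof (intro set_eqI iffI)
    fix y assume "y \<in> ball l r"
    then have "0 < r - dist l y" by simp
    then obtain m where "1 / real (Suc m) < r - dist l y" by (rule exists_inverse_Suc_less)
    then show "y \<in> (\<Union>m. ball l (r - 1 / real (Suc m)))" by (auto intro!: exI[of _ m])
  next
    fix y assume "y \<in> (\<Union>m. ball l (r - 1 / real (Suc m)))"
    then obtain m where "dist l y < r - 1 / real (Suc m)" by auto
    moreover have "0 < 1 / real (Suc m)" by simp
    ultimately have "dist l y < r" by linarith
    then show "y \<in> ball l r" by simp
  qed
  have "(\<lambda>m. emeasure M (ball l (r - 1 / real (Suc m)))) \<longlonglongrightarrow> emeasure M (\<Union>m. ball l (r - 1 / real (Suc m)))"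
  proof (rule Lim_emeasure_incseq)
    show "incseq (\<lambda>m. ball l (r - 1 / real (Suc m)))"
      by (intro incseq_SucI subset_ball) (simp add: frac_le)
    show "range (\<lambda>m. ball l (r - 1 / real (Suc m))) \<subseteq> sets M"
      unfolding M by (rule image_subsetI) simp
  qed
  then have "(\<lambda>m. emeasure M (ball l (r - 1 / real (Suc m)))) \<longlonglongrightarrow> emeasure M (ball l r)"
    by (simp only: union)
  then have "emeasure M (ball l r) \<le> c" by (rule Lim_bounded) (simp only: le simp_thms)
  then show "l \<in> {x. emeasure M (ball x r) \<le> c}" by simp
qed

lemma borel_density_1:
  fixes E :: "'a::euclidean_space set"
  assumes fin: "hausdorff k E < \<infinity>"
  shows "{x. has_density k E x 1} \<in> sets borel"
proof -
  let ?M = "hausdorff_on k E" and ?v = "\<lambda>r. unit_ball_vol (real k) * r ^ k"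
  have M: "sets ?M = sets borel" "finite_measure ?M" using finite_measure_hausdorff_on[OF fin] by auto
  define e where "e m = 1 / real (Suc m)" for m
  have e: "0 < e m" "e m \<le> 1" for m by (auto simp: e_def)
  define Lo where "Lo m j = (\<Inter>r\<in>{0<..<e j}. {x. ennreal ((1 - e m) * ?v r) \<le> emeasure ?M (cball x r)})" for m j
  define Up where "Up m j = (\<Inter>r\<in>{0<..<e j}. {x. emeasure ?M (ball x r) \<le> ennreal ((1 + e m) * ?v r)})" for m j
  have cl: "closed (Lo m j)" "closed (Up m j)" for m j
    unfolding Lo_def Up_def using M by (auto intro!: closed_INT closed_ball_measure_ge closed_ball_measure_le)
  \<comment> \<open>A closed ball is contained in the open balls of larger radii.\<close>
  have ballq: "ball_quot k E x r \<le> ennreal (1 + e m)" if x: "x \<in> Up m j" and r: "0 < r" "r < e j" for x m j r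
  proof -
    have le: "emeasure ?M (cball x r) \<le> ennreal ((1 + e m) * ?v s)" if s: "r < s" "s < e j" for s
    proof -
      have "emeasure ?M (cball x r) \<le> emeasure ?M (ball x s)"
        using s by (intro emeasure_mono) auto
      also have "\<dots> \<le> ennreal ((1 + e m) * ?v s)" using x r s by (auto simp: Up_def)
      finally show ?thesis .
    qed
    have lim: "((\<lambda>s. ennreal ((1 + e m) * ?v s)) \<longlongrightarrow> ennreal ((1 + e m) * ?v r)) (at_right r)"
      by (intro tendsto_ennrealI tendsto_intros)
    have "emeasure ?M (cball x r) \<le> ennreal ((1 + e m) * ?v r)"
      using lim by (rule tendsto_lowerbound) (use le r in \<open>auto simp: eventually_at_right_field intro!: exI[of _ "e j"]\<close>)
    then show ?thesis using r e[of m] ball_quot_le_iff[of r "1 + e m" k E x]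
      by (simp add: emeasure_hausdorff_on Int_commute)
  qed
  have "{x. has_density k E x 1} = (\<Inter>m. \<Union>j. Lo m j \<inter> Up m j)"
  proof (intro set_eqI iffI)
    fix x assume "x \<in> {x. has_density k E x 1}"
    then have lim: "(ball_quot k E x \<longlongrightarrow> 1) (at_right 0)" by (simp add: has_density_ball_quot)
    have "\<exists>j. x \<in> Lo m j \<inter> Up m j" for m
    proof -
      have "\<forall>\<^sub>F r in at_right 0. ennreal (1 - e m) < ball_quot k E x r"
        using lim e[of m] by (intro order_tendstoD(1)) (auto simp: ennreal_less_one_iff)
      moreover have "\<forall>\<^sub>F r in at_right 0. ball_quot k E x r < ennreal (1 + e m)"
        using lim e[of m] by (intro order_tendstoD(2)) (auto simp: ennreal_1[symmetric] ennreal_less_iff simp del: ennreal_1)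
      ultimately have "\<forall>\<^sub>F r in at_right 0. ennreal (1 - e m) < ball_quot k E x r \<and> ball_quot k E x r < ennreal (1 + e m)"
        by (rule eventually_conj)
      then obtain d where d: "0 < d" "\<And>r. 0 < r \<Longrightarrow> r < d \<Longrightarrow> ennreal (1 - e m) < ball_quot k E x r \<and> ball_quot k E x r < ennreal (1 + e m)"
        unfolding eventually_at_right_field by blast
      obtain j where j: "e j < d" using exists_inverse_Suc_less[OF d(1)] unfolding e_def by blast
      have "ennreal ((1 - e m) * ?v r) \<le> emeasure ?M (cball x r)" "emeasure ?M (ball x r) \<le> ennreal ((1 + e m) * ?v r)"
        if r: "0 < r" "r < e j" for r
      proof -
        have b: "ennreal (1 - e m) \<le> ball_quot k E x r" "ball_quot k E x r \<le> ennreal (1 + e m)"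
          using d(2)[of r] r j by auto
        show "ennreal ((1 - e m) * ?v r) \<le> emeasure ?M (cball x r)"
          using b(1) r e[of m] le_ball_quot_iff[of r "1 - e m" k E x] by (simp add: emeasure_hausdorff_on Int_commute)
        have "emeasure ?M (ball x r) \<le> emeasure ?M (cball x r)" by (intro emeasure_mono) auto
        also have "\<dots> \<le> ennreal ((1 + e m) * ?v r)"
          using b(2) r e[of m] ball_quot_le_iff[of r "1 + e m" k E x] by (simp add: emeasure_hausdorff_on Int_commute)
        finally show "emeasure ?M (ball x r) \<le> ennreal ((1 + e m) * ?v r)" .
      qed
      then have "x \<in> Lo m j \<inter> Up m j" by (auto simp: Lo_def Up_def)
      then show ?thesis ..
    qed
    then show "x \<in> (\<Inter>m. \<Union>j. Lo m j \<inter> Up m j)" by blast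
  next
    fix x assume x: "x \<in> (\<Inter>m. \<Union>j. Lo m j \<inter> Up m j)"
    have near: "\<forall>\<^sub>F r in at_right 0. ennreal (1 - e m) \<le> ball_quot k E x r \<and> ball_quot k E x r \<le> ennreal (1 + e m)" for m
    proof -
      obtain j where j: "x \<in> Lo m j" "x \<in> Up m j" using x by blast
      have "ennreal (1 - e m) \<le> ball_quot k E x r \<and> ball_quot k E x r \<le> ennreal (1 + e m)" if r: "0 < r" "r < e j" for r
      proof
        have "ennreal ((1 - e m) * ?v r) \<le> emeasure ?M (cball x r)" using j(1) r by (auto simp: Lo_def)
        then show "ennreal (1 - e m) \<le> ball_quot k E x r"
          using r e[of m] le_ball_quot_iff[of r "1 - e m" k E x] by (simp add: emeasure_hausdorff_on Int_commute)
      qed (rule ballq[OF j(2) r])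
      then show ?thesis unfolding eventually_at_right_field using e(1)[of j] by blast
    qed
    have e_lim: "e \<longlonglongrightarrow> 0" unfolding e_def using LIMSEQ_inverse_real_of_nat by (simp add: inverse_eq_divide)
    have "(ball_quot k E x \<longlongrightarrow> 1) (at_right 0)"
    proof (rule order_tendstoI)
      fix a :: ennreal assume a: "a < 1"
      have "(\<lambda>m. ennreal (1 - e m)) \<longlonglongrightarrow> ennreal (1 - 0)" by (intro tendsto_ennrealI tendsto_intros e_lim)
      then have "\<forall>\<^sub>F m in sequentially. a < ennreal (1 - e m)" using a by (intro order_tendstoD(1)) auto
      then obtain m where "a < ennreal (1 - e m)" by (meson eventually_happens sequentially_bot)
      then show "\<forall>\<^sub>F r in at_right 0. a < ball_quot k E x r" using near[of m] by (auto elim: eventually_mono)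
    next
      fix a :: ennreal assume a: "1 < a"
      have "(\<lambda>m. ennreal (1 + e m)) \<longlonglongrightarrow> ennreal (1 + 0)" by (intro tendsto_ennrealI tendsto_intros e_lim)
      then have "\<forall>\<^sub>F m in sequentially. ennreal (1 + e m) < a" using a by (intro order_tendstoD(2)) auto
      then obtain m where "ennreal (1 + e m) < a" by (meson eventually_happens sequentially_bot)
      then show "\<forall>\<^sub>F r in at_right 0. ball_quot k E x r < a" using near[of m] by (auto elim: eventually_mono)
    qed
    then show "x \<in> {x. has_density k E x 1}" by (simp add: has_density_ball_quot)
  qed
  also have "\<dots> \<in> sets borel"
    using cl by (intro sets.countable_INT'' sets.countable_UN'' ) (auto intro!: borel_closed)
  finally show ?thesis .
qed

section \<open>The measure on the space of approximate germs\<close>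

lemma has_density_unique:
  "has_density k E x \<theta> \<Longrightarrow> has_density k E x \<theta>' \<Longrightarrow> \<theta> = \<theta>'"
  unfolding has_density_def by (rule tendsto_unique[OF trivial_limit_at_right_real])

lemma has_density_empty: "has_density k {} x 0"
  by (simp add: has_density_def)

lemma has_density_cong_null:
  assumes "hausdorff k (A - B) = 0" "hausdorff k (B - A) = 0"
  shows "has_density k A x \<theta> \<longleftrightarrow> has_density k B x \<theta>"
proof -
  have "hausdorff k (A \<inter> C) = hausdorff k (B \<inter> C)" for C
    using hausdorff_null_subset[OF assms(1), of "A \<inter> C - B \<inter> C"] hausdorff_null_subset[OF assms(2), of "B \<inter> C - A \<inter> C"]
    by (intro antisym hausdorff_le_of_diff_null) auto
  then show ?thesis by (simp add: has_density_def)
qed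

lemma hausdorff_sets_UN:
  fixes A :: "nat \<Rightarrow> 'a::metric_space set"
  assumes "\<And>i. A i \<in> hausdorff_sets k" shows "(\<Union>i. A i) \<in> hausdorff_sets k"
proof -
  have "(\<Union>i. A i) \<in> sets (hausdorff_measure k)"
    using assms by (intro sets.countable_UN'') simp_all
  then show ?thesis by simp
qed

locale germs =
  fixes \<Omega> :: "(real^'n) set" and m :: "(real^'m) itself"
  assumes open_dom: "open \<Omega>"
begin

abbreviation \<E> :: "(real^'n) set set" where "\<E> \<equiv> germ_base m \<Omega>"
abbreviation \<gamma> where "\<gamma> \<equiv> germ_map m \<Omega>"
abbreviation \<M> where "\<M> \<equiv> germ_measure m \<Omega>"

definition mu :: "(real^'n) set \<Rightarrow> ((real^'n) \<times> (real^'n) set set) set \<Rightarrow> ennreal" where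
  "mu E A = hausdorff CARD('m) {x \<in> E. \<gamma> E x \<in> A}"

lemma germ_baseD:
  assumes "E \<in> \<E>"
  shows "E \<subseteq> \<Omega>" "E \<in> sets borel" "rectifiable m E" "E \<in> hausdorff_sets CARD('m)" "hausdorff CARD('m) E < \<infinity>"
    "x \<in> E \<Longrightarrow> has_density CARD('m) E x 1"
  using assms by (auto simp: germ_base_def rectifiable_def)

text \<open>The points of density one of \<open>E\<close> differ from \<open>E\<close> by a null set, so they have density one also
  with respect to themselves.\<close>

lemma rectifiable_germ_base:
  assumes E: "rectifiable m E" "E \<subseteq> \<Omega>"
  obtains E' where "E' \<in> \<E>" "hausdorff CARD('m) (E - E') = 0" "hausdorff CARD('m) (E' - E) = 0"
proof -
  define E' where "E' = \<Omega> \<inter> {x. has_density CARD('m) E x 1}"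
  have EH: "E \<in> hausdorff_sets CARD('m)" "hausdorff CARD('m) E < \<infinity>" using E(1) by (auto simp: rectifiable_def)
  have 1: "hausdorff CARD('m) (E - E') = 0"
    by (rule hausdorff_null_subset[OF rectifiable_density_1_ae[OF E(1)]]) (use E(2) in \<open>auto simp: E'_def\<close>)
  have 2: "hausdorff CARD('m) (E' - E) = 0"
    by (rule hausdorff_null_subset[OF density_zero_ae_finite[OF EH]])
      (auto simp: E'_def dest: has_density_unique[of "CARD('m)" E _ 0 1])
  have borel: "E' \<in> sets borel" unfolding E'_def using open_dom borel_density_1[OF EH(2)] by auto
  have "rectifiable m E'"
    unfolding rectifiable_def
  proof (intro conjI)
    obtain f :: "nat \<Rightarrow> real^'m \<Rightarrow> real^'n" where f: "\<forall>i. \<exists>L. L-lipschitz_on UNIV (f i)"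
      "hausdorff CARD('m) (E - (\<Union>i. range (f i))) = 0"
      using E(1) unfolding rectifiable_def countably_rectifiable_def by auto
    have "hausdorff CARD('m) (E' - (\<Union>i. range (f i))) = 0"
      by (rule hausdorff_null_subset[OF hausdorff_null_Un[OF f(2) 2]]) auto
    then show "countably_rectifiable m E'"
      unfolding countably_rectifiable_def using f(1) by (intro exI[of _ f]) simp
    show "E' \<in> hausdorff_sets DIM(real^'m)" using borel borel_subset_hausdorff_sets by auto
    show "hausdorff DIM(real^'m) E' < \<infinity>"
      using hausdorff_le_of_diff_null[OF 2] EH(2) by (simp add: order_le_less_trans)
  qed
  moreover have "x \<in> E' \<longleftrightarrow> has_density CARD('m) E' x 1" if "x \<in> \<Omega>" for x
  proof -
    have "x \<in> E' \<longleftrightarrow> has_density CARD('m) E x 1" using that by (simp add: E'_def)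
    then show ?thesis using has_density_cong_null[OF 1 2] by (simp only:)
  qed
  moreover have "E' \<subseteq> \<Omega>" by (simp add: E'_def)
  ultimately have "E' \<in> \<E>" using borel by (simp add: germ_base_def)
  then show ?thesis using that 1 2 by blast
qed

lemma empty_germ_base: "{} \<in> \<E>"
proof -
  have "0-lipschitz_on UNIV (\<lambda>_::real^'m. 0::real^'n)" by (rule lipschitz_onI) simp_all
  then have "countably_rectifiable m ({} :: (real^'n) set)"
    unfolding countably_rectifiable_def
    by (intro exI[of _ "\<lambda>_::nat. \<lambda>_::real^'m. 0::real^'n"] conjI allI exI[of _ "0::real"]) simp_all
  then have "rectifiable m ({} :: (real^'n) set)"
    using null_in_hausdorff_sets[of "CARD('m)" "{} :: (real^'n) set"] by (simp add: rectifiable_def)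
  moreover have "\<not> has_density CARD('m) {} x 1" for x :: "real^'n"
    using has_density_unique[OF has_density_empty, of "CARD('m)" x 1] by auto
  ultimately show ?thesis by (simp add: germ_base_def)
qed

text \<open>The union of two members of the germ base is rectifiable.\<close>

lemma germ_base_directed:
  assumes "E1 \<in> \<E>" "E2 \<in> \<E>"
  obtains E where "E \<in> \<E>" "hausdorff CARD('m) (E1 - E) = 0" "hausdorff CARD('m) (E2 - E) = 0"
proof -
  obtain f :: "nat \<Rightarrow> real^'m \<Rightarrow> real^'n" where f: "\<And>i. \<exists>L. L-lipschitz_on UNIV (f i)"
      "hausdorff CARD('m) (E1 - (\<Union>i. range (f i))) = 0"
    using germ_baseD(3)[OF assms(1)] unfolding rectifiable_def countably_rectifiable_def by auto
  obtain g :: "nat \<Rightarrow> real^'m \<Rightarrow> real^'n" where g: "\<And>i. \<exists>L. L-lipschitz_on UNIV (g i)"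
      "hausdorff CARD('m) (E2 - (\<Union>i. range (g i))) = 0"
    using germ_baseD(3)[OF assms(2)] unfolding rectifiable_def countably_rectifiable_def by auto
  define h where "h i = (if even i then f (i div 2) else g (i div 2))" for i
  have h: "h (2 * i) = f i" "h (2 * i + 1) = g i" for i by (auto simp: h_def)
  have "range (f i) \<subseteq> (\<Union>i. range (h i))" "range (g i) \<subseteq> (\<Union>i. range (h i))" for i
    unfolding h(1)[of i, symmetric] h(2)[of i, symmetric] by (rule UN_upper, simp)+
  then have sub: "(\<Union>i. range (f i)) \<subseteq> (\<Union>i. range (h i))" "(\<Union>i. range (g i)) \<subseteq> (\<Union>i. range (h i))"
    by (simp_all add: UN_least)
  have "(E1 \<union> E2) - (\<Union>i. range (h i)) \<subseteq> (E1 - (\<Union>i. range (f i))) \<union> (E2 - (\<Union>i. range (g i)))"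
    using sub by (rule_tac subsetI) (elim DiffE UnE; meson DiffI UnI1 UnI2 subsetD)
  then have "hausdorff CARD('m) ((E1 \<union> E2) - (\<Union>i. range (h i))) = 0"
    by (rule hausdorff_null_subset[OF hausdorff_null_Un[OF f(2) g(2)]])
  moreover have "\<forall>i. \<exists>L. L-lipschitz_on UNIV (h i)" using f(1) g(1) by (auto simp: h_def)
  ultimately have "countably_rectifiable m (E1 \<union> E2)"
    unfolding countably_rectifiable_def by (intro exI[of _ h]) simp
  then have "rectifiable m (E1 \<union> E2)"
    using germ_baseD(4,5)[OF assms(1)] germ_baseD(4,5)[OF assms(2)] hausdorff_Un[of "CARD('m)" E1 E2]
    by (auto simp: rectifiable_def intro!: hausdorff_sets_Un intro: order_le_less_trans)
  then obtain E where "E \<in> \<E>" "hausdorff CARD('m) ((E1 \<union> E2) - E) = 0"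
    using rectifiable_germ_base[of "E1 \<union> E2"] germ_baseD(1) assms by (metis Un_least)
  then show ?thesis using that by (metis Un_Diff Un_upper1 Un_upper2 hausdorff_null_subset)
qed

lemma equiv_germ_rel: "equiv (germ_base_at m \<Omega> x) (germ_rel m \<Omega> x)"
proof (rule equivI)
  show "germ_rel m \<Omega> x \<subseteq> germ_base_at m \<Omega> x \<times> germ_base_at m \<Omega> x" by (auto simp: germ_rel_def)
  show "refl_on (germ_base_at m \<Omega> x) (germ_rel m \<Omega> x)"
    by (auto simp: refl_on_def germ_rel_def has_density_empty)
  show "sym (germ_rel m \<Omega> x)" by (auto simp: sym_def germ_rel_def Un_commute)
  show "trans (germ_rel m \<Omega> x)"
  proof (rule transI)
    fix A B C assume h: "(A, B) \<in> germ_rel m \<Omega> x" "(B, C) \<in> germ_rel m \<Omega> x"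
    have "has_density CARD('m) ((A - B \<union> (B - A)) \<union> (B - C \<union> (C - B))) x 0"
      using h by (intro has_density_0_Un[of _ "A - B \<union> (B - A)"]) (simp_all add: germ_rel_def)
    then have "has_density CARD('m) (A - C \<union> (C - A)) x 0" by (rule has_density_0_mono) auto
    then show "(A, C) \<in> germ_rel m \<Omega> x" using h by (auto simp: germ_rel_def)
  qed
qed

lemma germ_map_eq_iff:
  assumes "E \<in> \<E>" "E' \<in> \<E>" "x \<in> E" "x \<in> E'"
  shows "\<gamma> E x = \<gamma> E' x \<longleftrightarrow> has_density CARD('m) ((E - E') \<union> (E' - E)) x 0"
proof -
  have at: "E \<in> germ_base_at m \<Omega> x" "E' \<in> germ_base_at m \<Omega> x" using assms by (auto simp: germ_base_at_def)
  have "\<gamma> E x = \<gamma> E' x \<longleftrightarrow> (E, E') \<in> germ_rel m \<Omega> x"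
    using eq_equiv_class_iff[OF equiv_germ_rel at] by (simp add: germ_map_def)
  then show ?thesis using at by (simp add: germ_rel_def)
qed

lemma fst_germ_map [simp]: "fst (\<gamma> E x) = x"
  by (simp add: germ_map_def)

lemma germ_map_in_space: "E \<in> \<E> \<Longrightarrow> x \<in> E \<Longrightarrow> \<gamma> E x \<in> germ_space m \<Omega>"
  using germ_baseD(1)[of E] by (auto simp: germ_map_def germ_space_def germ_base_at_def intro: quotientI)

text \<open>Almost every point outside the symmetric difference of \<open>E\<close> and \<open>E'\<close> is a point of density zero of it.\<close>

lemma germ_map_ae_eq:
  assumes "E \<in> \<E>" "E' \<in> \<E>"
  shows "hausdorff CARD('m) {x \<in> E \<inter> E'. \<gamma> E x \<noteq> \<gamma> E' x} = 0"
proof -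
  let ?D = "(E - E') \<union> (E' - E)"
  have "?D \<in> hausdorff_sets CARD('m)" using germ_baseD(4) assms by (intro hausdorff_sets_Un hausdorff_sets_Diff)
  moreover have "hausdorff CARD('m) ?D \<le> hausdorff CARD('m) E + hausdorff CARD('m) E'"
    by (rule order_trans[OF hausdorff_mono hausdorff_Un]) auto
  then have "hausdorff CARD('m) ?D < \<infinity>" using germ_baseD(5)[OF assms(1)] germ_baseD(5)[OF assms(2)]
    by (auto intro: order_le_less_trans)
  ultimately have null: "hausdorff CARD('m) {x. x \<notin> ?D \<and> \<not> has_density CARD('m) ?D x 0} = 0" by (rule density_zero_ae_finite)
  have "{x \<in> E \<inter> E'. \<gamma> E x \<noteq> \<gamma> E' x} \<subseteq> {x. x \<notin> ?D \<and> \<not> has_density CARD('m) ?D x 0}"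
    using germ_map_eq_iff[OF assms] by auto
  then show ?thesis by (rule hausdorff_null_subset[OF null])
qed

lemma sigma_algebra_germ_sets: "sigma_algebra (germ_space m \<Omega>) (germ_sets m \<Omega>)"
  unfolding sigma_algebra_iff2
proof (intro conjI allI ballI impI)
  show "germ_sets m \<Omega> \<subseteq> Pow (germ_space m \<Omega>)" by (auto simp: germ_sets_def)
  show "{} \<in> germ_sets m \<Omega>" using null_in_hausdorff_sets[of "CARD('m)" "{} :: (real^'n) set"] by (simp add: germ_sets_def)
next
  fix A assume A: "A \<in> germ_sets m \<Omega>"
  have "{x \<in> E. \<gamma> E x \<in> germ_space m \<Omega> - A} \<in> hausdorff_sets CARD('m)" if E: "E \<in> \<E>" for E
  proof -
    have "{x \<in> E. \<gamma> E x \<in> germ_space m \<Omega> - A} = E - {x \<in> E. \<gamma> E x \<in> A}"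
      using germ_map_in_space[OF E] by auto
    then show ?thesis using A E germ_baseD(4)[OF E] by (auto simp: germ_sets_def intro!: hausdorff_sets_Diff)
  qed
  then show "germ_space m \<Omega> - A \<in> germ_sets m \<Omega>" by (auto simp: germ_sets_def)
next
  fix A :: "nat \<Rightarrow> _" assume A: "range A \<subseteq> germ_sets m \<Omega>"
  have "{x \<in> E. \<gamma> E x \<in> (\<Union>i. A i)} \<in> hausdorff_sets CARD('m)" if E: "E \<in> \<E>" for E
  proof -
    have "{x \<in> E. \<gamma> E x \<in> (\<Union>i. A i)} = (\<Union>i. {x \<in> E. \<gamma> E x \<in> A i})" by auto
    moreover have "{x \<in> E. \<gamma> E x \<in> A i} \<in> hausdorff_sets CARD('m)" for i
      using A E by (auto simp: germ_sets_def)
    ultimately show ?thesis by (simp only:) (rule hausdorff_sets_UN)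
  qed
  moreover have "(\<Union>i. A i) \<subseteq> germ_space m \<Omega>" using A by (auto simp: germ_sets_def)
  ultimately show "(\<Union>i. A i) \<in> germ_sets m \<Omega>" by (simp add: germ_sets_def)
qed

lemma germ_setsD: "A \<in> germ_sets m \<Omega> \<Longrightarrow> E \<in> \<E> \<Longrightarrow> {x \<in> E. \<gamma> E x \<in> A} \<in> hausdorff_sets CARD('m)"
  by (simp add: germ_sets_def)

lemma sets_germ_push [simp]: "sets (germ_push m \<Omega> E) = germ_sets m \<Omega>"
  unfolding germ_push_def by (rule sigma_algebra.sets_measure_of_eq[OF sigma_algebra_germ_sets])

lemma emeasure_germ_push:
  assumes E: "E \<in> \<E>" and A: "A \<in> germ_sets m \<Omega>"
  shows "emeasure (germ_push m \<Omega> E) A = mu E A"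
proof -
  have "emeasure (germ_push m \<Omega> E) A = hausdorff CARD('m) {x \<in> E. \<gamma> E x \<in> A}"
    unfolding germ_push_def DIM_cart DIM_real mult_1_right
  proof (rule emeasure_measure_of_sigma[OF sigma_algebra_germ_sets])
    show "positive (germ_sets m \<Omega>) (\<lambda>A. hausdorff CARD('m) {x \<in> E. \<gamma> E x \<in> A})" by (simp add: positive_def)
    show "countably_additive (germ_sets m \<Omega>) (\<lambda>A. hausdorff CARD('m) {x \<in> E. \<gamma> E x \<in> A})"
    proof (rule countably_additiveI)
      fix A :: "nat \<Rightarrow> _" assume A: "range A \<subseteq> germ_sets m \<Omega>" "disjoint_family A"
      let ?B = "\<lambda>i. {x \<in> E. \<gamma> E x \<in> A i}"
      have B: "?B i \<in> hausdorff_sets CARD('m)" for i using A(1) E by (intro germ_setsD) auto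
      have "(\<Sum>i. hausdorff CARD('m) (?B i)) = (\<Sum>i. emeasure (hausdorff_measure CARD('m)) (?B i))"
        using B by (simp add: emeasure_hausdorff_measure)
      also have "\<dots> = emeasure (hausdorff_measure CARD('m)) (\<Union>i. ?B i)"
        using B A(2) by (intro suminf_emeasure) (auto simp: disjoint_family_on_def)
      also have "\<dots> = hausdorff CARD('m) (\<Union>i. ?B i)"
        using B by (intro emeasure_hausdorff_measure hausdorff_sets_UN)
      also have "(\<Union>i. ?B i) = {x \<in> E. \<gamma> E x \<in> (\<Union>i. A i)}" by auto
      finally show "(\<Sum>i. hausdorff CARD('m) (?B i)) = hausdorff CARD('m) {x \<in> E. \<gamma> E x \<in> (\<Union>i. A i)}" .
    qed
  qed (rule A)
  then show ?thesis by (simp add: mu_def)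
qed

lemma mu_mono_base:
  assumes "E \<in> \<E>" "E' \<in> \<E>" "hausdorff CARD('m) (E - E') = 0"
  shows "mu E A \<le> mu E' A"
  unfolding mu_def
proof (rule hausdorff_le_of_diff_null)
  show "hausdorff CARD('m) ({x \<in> E. \<gamma> E x \<in> A} - {x \<in> E'. \<gamma> E' x \<in> A}) = 0"
    by (rule hausdorff_null_subset[OF hausdorff_null_Un[OF assms(3) germ_map_ae_eq[OF assms(1,2)]]]) auto
qed

lemma sets_germ_measure [simp]: "sets \<M> = germ_sets m \<Omega>"
proof -
  have "sets \<M> = sets (germ_push m \<Omega> {})"
    unfolding germ_measure_def using empty_germ_base by (intro sets_SUP) auto
  then show ?thesis by simp
qed

lemma space_germ_measure [simp]: "space \<M> = germ_space m \<Omega>"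
proof -
  have "space \<M> = space (germ_push m \<Omega> {})" by (rule sets_eq_imp_space_eq) simp
  then show ?thesis
    using sigma_algebra.space_measure_of_eq[OF sigma_algebra_germ_sets] by (simp add: germ_push_def)
qed

text \<open>The family of the measures \<open>mu E\<close> is directed, so its least upper bound is the setwise supremum.\<close>

lemma emeasure_germ_measure:
  assumes A: "A \<in> germ_sets m \<Omega>"
  shows "emeasure \<M> A = (SUP E\<in>\<E>. mu E A)"
proof (rule antisym)
  show "(SUP E\<in>\<E>. mu E A) \<le> emeasure \<M> A"
  proof (rule SUP_least)
    fix E assume E: "E \<in> \<E>"
    have "germ_push m \<Omega> E \<le> \<M>" unfolding germ_measure_def using E by (rule SUP_upper)
    then have "emeasure (germ_push m \<Omega> E) A \<le> emeasure \<M> A" by (rule le_measureD3) simp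
    then show "mu E A \<le> emeasure \<M> A" using emeasure_germ_push[OF E A] by simp
  qed
  have "emeasure \<M> A = (SUP J\<in>{J. J \<noteq> {} \<and> finite J \<and> J \<subseteq> \<E>}. emeasure (SUP E\<in>J. germ_push m \<Omega> E) A)"
    unfolding germ_measure_def using empty_germ_base A
    by (intro emeasure_SUP[where N="germ_push m \<Omega> {}"]) auto
  also have "\<dots> \<le> (SUP E\<in>\<E>. mu E A)"
  proof (rule SUP_least)
    fix J assume J: "J \<in> {J. J \<noteq> {} \<and> finite J \<and> J \<subseteq> \<E>}"
    have "finite J" "J \<subseteq> \<E>" using J by auto
    then have "\<exists>E\<in>\<E>. \<forall>E'\<in>J. hausdorff CARD('m) (E' - E) = 0"
    proof (induction J rule: finite_induct)
      case empty then show ?case using empty_germ_base by auto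
    next
      case (insert F J)
      then obtain E where E: "E \<in> \<E>" "\<forall>E'\<in>J. hausdorff CARD('m) (E' - E) = 0" by auto
      obtain G where G: "G \<in> \<E>" "hausdorff CARD('m) (E - G) = 0" "hausdorff CARD('m) (F - G) = 0"
        using germ_base_directed[OF E(1), of F] insert.prems by auto
      have "hausdorff CARD('m) (E' - G) = 0" if "E' \<in> J" for E'
        using hausdorff_null_subset[OF hausdorff_null_Un[OF bspec[OF E(2) that] G(2)], of "E' - G"] by auto
      then show ?case using G by auto
    qed
    then obtain E where E: "E \<in> \<E>" "\<And>E'. E' \<in> J \<Longrightarrow> hausdorff CARD('m) (E' - E) = 0" by blast
    have "germ_push m \<Omega> E' \<le> germ_push m \<Omega> E" if "E' \<in> J" for E'
    proof -
      have "E' \<in> \<E>" using that J by auto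
      then show ?thesis
        by (subst le_measure) (auto simp: emeasure_germ_push E(1) intro!: mu_mono_base E(2)[OF that])
    qed
    then have "(SUP E\<in>J. germ_push m \<Omega> E) \<le> germ_push m \<Omega> E" by (rule SUP_least)
    moreover have "sets (SUP E\<in>J. germ_push m \<Omega> E) = sets (germ_push m \<Omega> E)"
      using J by (intro sets_SUP) auto
    ultimately have "emeasure (SUP E\<in>J. germ_push m \<Omega> E) A \<le> emeasure (germ_push m \<Omega> E) A"
      by (rule le_measureD3)
    also have "\<dots> = mu E A" by (rule emeasure_germ_push[OF E(1) A])
    also have "\<dots> \<le> (SUP E\<in>\<E>. mu E A)" using E(1) by (rule SUP_upper)
    finally show "emeasure (SUP E\<in>J. germ_push m \<Omega> E) A \<le> (SUP E\<in>\<E>. mu E A)" .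
  qed
  finally show "emeasure \<M> A \<le> (SUP E\<in>\<E>. mu E A)" .
qed

definition fibre :: "(real^'n) set \<Rightarrow> ((real^'n) \<times> (real^'n) set set) set" where
  "fibre B = fst -` B \<inter> germ_space m \<Omega>"

lemma germ_in_fibre: "E \<in> \<E> \<Longrightarrow> {x \<in> E. \<gamma> E x \<in> fibre B} = B \<inter> E"
  using germ_map_in_space by (auto simp: fibre_def)

lemma fibre_sets: "B \<in> sets borel \<Longrightarrow> fibre B \<in> germ_sets m \<Omega>"
proof -
  assume B: "B \<in> sets borel"
  have "B \<inter> E \<in> hausdorff_sets CARD('m)" if "E \<in> \<E>" for E
    using B germ_baseD(4)[OF that] borel_subset_hausdorff_sets by (intro hausdorff_sets_Int) auto
  then show ?thesis by (simp add: germ_sets_def germ_in_fibre) (simp add: fibre_def)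
qed

lemma measurable_fst_germ: "fst \<in> \<M> \<rightarrow>\<^sub>M restrict_space borel \<Omega>"
proof (rule measurable_restrict_space2)
  show "fst \<in> space \<M> \<rightarrow> \<Omega>" by (auto simp: germ_space_def)
  show "fst \<in> \<M> \<rightarrow>\<^sub>M borel"
    using fibre_sets by (intro measurableI) (auto simp: fibre_def)
qed

lemma rect_outer_eq:
  assumes B: "B \<in> sets borel"
  shows "rect_outer m \<Omega> B = emeasure \<M> (fibre B)"
proof -
  have "rect_outer m \<Omega> B = (SUP E\<in>\<E>. hausdorff CARD('m) (B \<inter> E))"
    unfolding rect_outer_def DIM_cart DIM_real mult_1_right
  proof (rule antisym)
    show "(SUP E\<in>\<E>. hausdorff CARD('m) (B \<inter> E)) \<le> (SUP E\<in>{E. E \<subseteq> \<Omega> \<and> rectifiable m E}. hausdorff CARD('m) (B \<inter> E))"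
      using germ_baseD(1,3) by (intro SUP_subset_mono) auto
    show "(SUP E\<in>{E. E \<subseteq> \<Omega> \<and> rectifiable m E}. hausdorff CARD('m) (B \<inter> E)) \<le> (SUP E\<in>\<E>. hausdorff CARD('m) (B \<inter> E))"
    proof (rule SUP_least)
      fix E assume "E \<in> {E. E \<subseteq> \<Omega> \<and> rectifiable m E}"
      then obtain E' where E': "E' \<in> \<E>" "hausdorff CARD('m) (E - E') = 0" using rectifiable_germ_base by blast
      have "hausdorff CARD('m) (B \<inter> E) \<le> hausdorff CARD('m) (B \<inter> E')"
        by (rule hausdorff_le_of_diff_null) (rule hausdorff_null_subset[OF E'(2)], auto)
      also have "\<dots> \<le> (SUP E\<in>\<E>. hausdorff CARD('m) (B \<inter> E))" using E'(1) by (rule SUP_upper)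
      finally show "hausdorff CARD('m) (B \<inter> E) \<le> (SUP E\<in>\<E>. hausdorff CARD('m) (B \<inter> E))" .
    qed
  qed
  also have "\<dots> = (SUP E\<in>\<E>. mu E (fibre B))" by (simp add: mu_def germ_in_fibre)
  finally show ?thesis using emeasure_germ_measure[OF fibre_sets[OF B]] by simp
qed

text \<open>Both measures assign to a Borel set \<open>B\<close> the supremum of the measures of \<open>B \<inter> E\<close> over the germ base.\<close>

theorem rect_measure_eq_distr: "rect_measure m \<Omega> = distr \<M> (restrict_space borel \<Omega>) fst"
proof -
  let ?B = "restrict_space borel \<Omega> :: (real^'n) measure"
  have em: "emeasure (distr \<M> ?B fst) B = rect_outer m \<Omega> B" if "B \<in> sets ?B" for B
  proof -
    have "B \<in> sets borel" using that open_dom by (auto simp: sets_restrict_space)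
    then show ?thesis
      using emeasure_distr[OF measurable_fst_germ that] rect_outer_eq by (simp add: fibre_def)
  qed
  have "rect_measure m \<Omega> = measure_of \<Omega> (sets ?B) (emeasure (distr \<M> ?B fst))"
    unfolding rect_measure_def
  proof (rule measure_of_eq)
    have sp: "space ?B = \<Omega>" by (simp add: space_restrict_space)
    show "sets ?B \<subseteq> Pow \<Omega>" using sets.space_closed[of ?B] sp by simp
    show "rect_outer m \<Omega> B = emeasure (distr \<M> ?B fst) B" if "B \<in> sigma_sets \<Omega> (sets ?B)" for B
      using em[of B] that sets.sigma_sets_eq[of ?B] sp by simp
  qed
  also have "\<dots> = distr \<M> ?B fst"
    using measure_of_of_measure[of "distr \<M> ?B fst"] by (simp add: space_restrict_space)
  finally show ?thesis .
qed

lemma sets_rect_measure: "sets (rect_measure m \<Omega>) = sets (restrict_space borel \<Omega>)"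
  by (simp add: rect_measure_eq_distr)

lemma emeasure_rect_measure:
  assumes "B \<in> sets borel" "B \<subseteq> \<Omega>"
  shows "emeasure (rect_measure m \<Omega>) B = emeasure \<M> (fibre B)"
proof -
  have "B \<in> sets (restrict_space borel \<Omega>)" using assms open_dom by (auto simp: sets_restrict_space image_iff intro!: bexI[of _ B])
  then show ?thesis
    unfolding rect_measure_eq_distr using emeasure_distr[OF measurable_fst_germ] by (simp add: fibre_def)
qed

text \<open>No \<open>mu E'\<close> sees more over \<open>E\<close> than \<open>mu E\<close> does, since \<open>E'\<close> has the germs of \<open>E\<close> at almost all common
  points.\<close>

lemma emeasure_Int_fibre:
  assumes E: "E \<in> \<E>" and A: "A \<in> germ_sets m \<Omega>"
  shows "emeasure \<M> (A \<inter> fibre E) = mu E A"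
proof -
  have Ab: "A \<inter> fibre E \<in> germ_sets m \<Omega>"
    using A fibre_sets[OF germ_baseD(2)[OF E]] sets.Int[of A \<M> "fibre E"] by simp
  have "mu E' (A \<inter> fibre E) \<le> mu E A" if E': "E' \<in> \<E>" for E'
    unfolding mu_def
  proof (rule hausdorff_le_of_diff_null)
    show "hausdorff CARD('m) ({x \<in> E'. \<gamma> E' x \<in> A \<inter> fibre E} - {x \<in> E. \<gamma> E x \<in> A}) = 0"
      by (rule hausdorff_null_subset[OF germ_map_ae_eq[OF E E']]) (auto simp: fibre_def)
  qed
  moreover have "mu E (A \<inter> fibre E) = mu E A"
  proof -
    have "{x \<in> E. \<gamma> E x \<in> A \<inter> fibre E} = {x \<in> E. \<gamma> E x \<in> A}"
      using germ_map_in_space[OF E] by (auto simp: fibre_def)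
    then show ?thesis by (simp add: mu_def)
  qed
  ultimately show ?thesis unfolding emeasure_germ_measure[OF Ab] using E
    by (intro antisym SUP_least) (auto intro!: SUP_upper2[of E])
qed

lemma emeasure_germ_measure_fibres:
  assumes A: "A \<in> germ_sets m \<Omega>"
  shows "emeasure \<M> A = (SUP E\<in>\<E>. emeasure \<M> (A \<inter> fibre E))"
  unfolding emeasure_germ_measure[OF A] by (simp add: emeasure_Int_fibre A)

lemma emeasure_fibre:
  assumes "E \<in> \<E>" "B \<in> sets borel" "B \<subseteq> E"
  shows "emeasure \<M> (fibre B) = hausdorff CARD('m) B"
proof -
  have "fibre B \<inter> fibre E = fibre B" using assms(3) by (auto simp: fibre_def)
  then show ?thesis
    using emeasure_Int_fibre[OF assms(1) fibre_sets[OF assms(2)]] assms germ_in_fibre[OF assms(1), of B]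
    by (simp add: mu_def Int_absorb2)
qed

text \<open>Over a fixed member \<open>E\<close> of the germ base almost every fibre is a single germ; hence
  the measurable sets over \<open>E\<close> come from Borel subsets of \<open>E\<close>.\<close>

lemma germ_set_over_base:
  assumes E: "E \<in> \<E>" and A: "A \<in> germ_sets m \<Omega>"
  obtains B where "B \<in> sets borel" "B \<subseteq> E" "emeasure \<M> (fibre B - A) = 0" "emeasure \<M> (A \<inter> fibre E - fibre B) = 0"
proof -
  define D where "D = {x \<in> E. \<gamma> E x \<in> A}"
  have D: "D \<in> hausdorff_sets CARD('m)" unfolding D_def by (rule germ_setsD[OF A E])
  have "hausdorff CARD('m) D < \<infinity>"
    using germ_baseD(5)[OF E] hausdorff_mono[of D E "CARD('m)"] by (auto simp: D_def intro: order_le_less_trans)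
  then obtain B where B: "B \<in> sets borel" "B \<subseteq> D" "hausdorff CARD('m) (D - B) = 0"
    by (rule hausdorff_sets_inner_borel[OF D])
  have BE: "B \<subseteq> E" using B(2) by (auto simp: D_def)
  have sets: "fibre B - A \<in> germ_sets m \<Omega>" "A - fibre B \<in> germ_sets m \<Omega>"
    using A fibre_sets[OF B(1)] sets.Diff[of A \<M> "fibre B"] sets.Diff[of "fibre B" \<M> A] by simp_all
  have "(fibre B - A) \<inter> fibre E = fibre B - A" using BE by (auto simp: fibre_def)
  then have "emeasure \<M> (fibre B - A) = mu E (fibre B - A)" using emeasure_Int_fibre[OF E sets(1)] by simp
  moreover have "{x \<in> E. \<gamma> E x \<in> fibre B - A} = {}" using B(2) by (auto simp: D_def fibre_def)
  ultimately have 1: "emeasure \<M> (fibre B - A) = 0" by (simp only: mu_def hausdorff_empty)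
  have "A \<inter> fibre E - fibre B = (A - fibre B) \<inter> fibre E" by auto
  then have "emeasure \<M> (A \<inter> fibre E - fibre B) = mu E (A - fibre B)" using emeasure_Int_fibre[OF E sets(2)] by simp
  moreover have "{x \<in> E. \<gamma> E x \<in> A - fibre B} = D - B"
    using germ_map_in_space[OF E] by (auto simp: D_def fibre_def)
  ultimately have 2: "emeasure \<M> (A \<inter> fibre E - fibre B) = 0" by (simp only: mu_def B(3))
  show ?thesis using that[OF B(1) BE 1 2] .
qed

end

section \<open>Bounded functionals on the integrable functions\<close>

text \<open>Adding \<open>C\<close> times the measure to \<open>\<nu>\<close> makes it nonnegative and at most \<open>2 C\<close> times the measure. The bound turns
  finite additivity into countable additivity, as the tails of a disjoint union have small measure.\<close>

lemma bounded_additive_density: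
  fixes \<nu> :: "'a set \<Rightarrow> real"
  assumes "finite_measure M" and C: "0 \<le> C"
    and add: "\<And>A B. A \<in> sets M \<Longrightarrow> B \<in> sets M \<Longrightarrow> A \<inter> B = {} \<Longrightarrow> \<nu> (A \<union> B) = \<nu> A + \<nu> B"
    and bound: "\<And>A. A \<in> sets M \<Longrightarrow> \<bar>\<nu> A\<bar> \<le> C * measure M A"
  obtains D where "D \<in> borel_measurable M" "\<And>x. \<bar>D x\<bar> \<le> C"
    "\<And>A. A \<in> sets M \<Longrightarrow> \<nu> A = (LINT x|M. indicator A x * D x)"
proof -
  interpret finite_measure M by fact
  define \<kappa> where "\<kappa> A = \<nu> A + C * measure M A" for A
  have \<kappa>: "0 \<le> \<kappa> A" "\<kappa> A \<le> 2 * C * measure M A" if "A \<in> sets M" for A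
    using bound[OF that] by (auto simp: \<kappa>_def)
  have \<nu>0: "\<nu> {} = 0" using bound[of "{}"] by simp
  have sums: "(\<lambda>i. \<kappa> (A i)) sums \<kappa> (\<Union>i. A i)" if A: "range A \<subseteq> sets M" "disjoint_family A" for A :: "nat \<Rightarrow> 'a set"
  proof -
    have Am: "A i \<in> sets M" for i using A(1) by auto
    have UM: "(\<Union>i. A i) \<in> sets M" using Am by auto
    have msums: "(\<lambda>i. measure M (A i)) sums measure M (\<Union>i. A i)"
      using A by (rule finite_measure_UNION)
    have part: "(\<Union>i<n. A i) \<in> sets M" "\<nu> (\<Union>i<n. A i) = (\<Sum>i<n. \<nu> (A i))"
      "measure M (\<Union>i<n. A i) = (\<Sum>i<n. measure M (A i))" for n
    proof -
      show U: "(\<Union>i<n. A i) \<in> sets M" for n using Am by auto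
      have dis: "(\<Union>i<n. A i) \<inter> A n = {}" for n using A(2) by (auto simp: disjoint_family_on_def disjoint_iff) (metis less_irrefl)
      have e: "(\<Union>i<Suc n. A i) = (\<Union>i<n. A i) \<union> A n" for n by (auto simp: lessThan_Suc)
      show "\<nu> (\<Union>i<n. A i) = (\<Sum>i<n. \<nu> (A i))"
        by (induction n) (simp_all add: \<nu>0 e add[OF U Am dis] del: UN_simps)
      show "measure M (\<Union>i<n. A i) = (\<Sum>i<n. measure M (A i))"
        by (induction n) (simp_all add: e finite_measure_Union[OF U Am dis] del: UN_simps)
    qed
    have le: "norm ((\<Sum>i<n. \<nu> (A i)) - \<nu> (\<Union>i. A i)) \<le> C * (measure M (\<Union>i. A i) - (\<Sum>i<n. measure M (A i)))" for n
    proof -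
      let ?U = "\<Union>i<n. A i" and ?V = "\<Union>i. A i"
      have sub: "?U \<subseteq> ?V" by auto
      have VU: "?V - ?U \<in> sets M" using UM part(1) by (rule sets.Diff)
      have "\<nu> (?U \<union> (?V - ?U)) = \<nu> ?U + \<nu> (?V - ?U)" by (rule add[OF part(1) VU]) auto
      moreover have "?U \<union> (?V - ?U) = ?V" using sub by blast
      ultimately have "\<nu> ?V = \<nu> ?U + \<nu> (?V - ?U)" by simp
      then have "norm ((\<Sum>i<n. \<nu> (A i)) - \<nu> ?V) = \<bar>\<nu> (?V - ?U)\<bar>" by (simp add: part(2))
      also have "\<dots> \<le> C * measure M (?V - ?U)" by (rule bound[OF VU])
      also have "measure M (?V - ?U) = measure M ?V - measure M ?U"
        by (rule finite_measure_Diff[OF UM part(1) sub])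
      finally show ?thesis by (simp add: part(3))
    qed
    have "(\<lambda>n. C * (measure M (\<Union>i. A i) - (\<Sum>i<n. measure M (A i)))) \<longlonglongrightarrow> C * (measure M (\<Union>i. A i) - measure M (\<Union>i. A i))"
      using msums unfolding sums_def by (intro tendsto_intros)
    then have "(\<lambda>n. C * (measure M (\<Union>i. A i) - (\<Sum>i<n. measure M (A i)))) \<longlonglongrightarrow> 0" by simp
    then have "(\<lambda>n. (\<Sum>i<n. \<nu> (A i)) - \<nu> (\<Union>i. A i)) \<longlonglongrightarrow> 0"
      by (rule Lim_null_comparison[rotated]) (intro always_eventually allI le)
    then have "(\<lambda>i. \<nu> (A i)) sums \<nu> (\<Union>i. A i)" unfolding sums_def by (simp add: LIM_zero_iff)
    then show ?thesis unfolding \<kappa>_def by (intro sums_add sums_mult msums)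
  qed
  define N where "N = measure_of (space M) (sets M) (\<lambda>A. ennreal (\<kappa> A))"
  have emN: "emeasure N A = ennreal (\<kappa> A)" if "A \<in> sets M" for A
    unfolding N_def
  proof (rule emeasure_measure_of_sigma[OF sets.sigma_algebra_axioms])
    show "positive (sets M) (\<lambda>A. ennreal (\<kappa> A))" by (simp add: positive_def \<kappa>_def \<nu>0)
    show "countably_additive (sets M) (\<lambda>A. ennreal (\<kappa> A))"
    proof (rule countably_additiveI)
      fix A :: "nat \<Rightarrow> 'a set" assume "range A \<subseteq> sets M" "disjoint_family A"
      then show "(\<Sum>i. ennreal (\<kappa> (A i))) = ennreal (\<kappa> (\<Union> (range A)))"
        using sums \<kappa>(1) by (intro suminf_ennreal_eq) auto
    qed
  qed (rule that)
  have setsN: "sets N = sets M" unfolding N_def by (simp add: sets.sets_measure_of_eq)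
  have "emeasure N A \<le> ennreal (2 * C) * emeasure M A" if "A \<in> sets M" for A
    unfolding emN[OF that] using \<kappa>(2)[OF that] C
    by (simp add: emeasure_eq_measure ennreal_mult[symmetric] ennreal_leI)
  then obtain D where D[measurable]: "D \<in> borel_measurable M" and D0: "\<And>x. 0 \<le> D x" "\<And>x. D x \<le> 2 * C"
      and dens: "density M (\<lambda>x. ennreal (D x)) = N"
    using bounded_density[OF sigma_finite_measure_axioms setsN, of "2 * C"] C by auto
  show ?thesis
  proof (rule that[of "\<lambda>x. D x - C"])
    show "(\<lambda>x. D x - C) \<in> borel_measurable M" by measurable
    show "\<bar>D x - C\<bar> \<le> C" for x using D0[of x] by auto
    fix A assume A[measurable]: "A \<in> sets M"
    have nn: "(\<integral>\<^sup>+x. ennreal (indicator A x * D x) \<partial>M) = ennreal (\<kappa> A)"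
    proof -
      have "(\<integral>\<^sup>+x. ennreal (indicator A x * D x) \<partial>M) = (\<integral>\<^sup>+x. ennreal (D x) * indicator A x \<partial>M)"
        by (intro nn_integral_cong) (auto simp: indicator_def)
      also have "\<dots> = emeasure (density M (\<lambda>x. ennreal (D x))) A"
        by (rule emeasure_density[symmetric]) measurable
      finally show ?thesis using dens emN[OF A] by simp
    qed
    have hb: "has_bochner_integral M (\<lambda>x. indicator A x * D x) (\<kappa> A)"
      by (rule has_bochner_integral_nn_integral[OF _ _ _ nn]) (use D0 \<kappa>(1)[OF A] in auto)
    have hc: "has_bochner_integral M (\<lambda>x. indicator A x * C) (measure M A * C)"
      using A by (intro has_bochner_integral_mult_left has_bochner_integral_real_indicator) (auto simp: less_top[symmetric])
    have "has_bochner_integral M (\<lambda>x. indicator A x * (D x - C)) (\<kappa> A - measure M A * C)"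
      using has_bochner_integral_diff[OF hb hc] by (simp add: right_diff_distrib)
    then show "\<nu> A = (LINT x|M. indicator A x * (D x - C))"
      by (simp add: has_bochner_integral_integral_eq \<kappa>_def mult.commute)
  qed
qed

lemma Linf_AE_bound:
  assumes "g \<in> Linf_fun M"
  shows "g \<in> borel_measurable M" "AE z in M. \<bar>g z\<bar> \<le> enn2real (esssup M (\<lambda>x. ennreal \<bar>g x\<bar>))"
proof -
  have fin: "esssup M (\<lambda>x. ennreal \<bar>g x\<bar>) < \<infinity>" using assms by (simp add: Linf_fun_def)
  show "g \<in> borel_measurable M" using assms by (simp add: Linf_fun_def)
  have "AE z in M. ennreal \<bar>g z\<bar> \<le> esssup M (\<lambda>x. ennreal \<bar>g x\<bar>)" by (rule esssup_AE)
  then show "AE z in M. \<bar>g z\<bar> \<le> enn2real (esssup M (\<lambda>x. ennreal \<bar>g x\<bar>))"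
  proof eventually_elim
    fix z assume "ennreal \<bar>g z\<bar> \<le> esssup M (\<lambda>x. ennreal \<bar>g x\<bar>)"
    then have "enn2real (ennreal \<bar>g z\<bar>) \<le> enn2real (esssup M (\<lambda>x. ennreal \<bar>g x\<bar>))"
      using fin by (intro enn2real_mono) auto
    then show "\<bar>g z\<bar> \<le> enn2real (esssup M (\<lambda>x. ennreal \<bar>g x\<bar>))" by simp
  qed
qed

text \<open>The indicator of \<open>A\<close> is the limit, in mean, of indicators of subsets \<open>B\<close> of \<open>A\<close> at which the functional vanishes.\<close>

lemma bounded_functional_eq_0:
  fixes \<theta> :: "('a \<Rightarrow> real) \<Rightarrow> real"
  assumes C: "0 \<le> C"
    and add: "\<And>f h. integrable M f \<Longrightarrow> integrable M h \<Longrightarrow> \<theta> (\<lambda>x. f x + h x) = \<theta> f + \<theta> h"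
    and scale: "\<And>c f. integrable M f \<Longrightarrow> \<theta> (\<lambda>x. c * f x) = c * \<theta> f"
    and bound: "\<And>f. integrable M f \<Longrightarrow> \<bar>\<theta> f\<bar> \<le> C * (\<integral>x. \<bar>f x\<bar> \<partial>M)"
    and dense: "\<And>A e. A \<in> sets M \<Longrightarrow> emeasure M A < \<infinity> \<Longrightarrow> 0 < e \<Longrightarrow>
       \<exists>B\<in>sets M. B \<subseteq> A \<and> measure M (A - B) < e \<and> \<theta> (indicator B) = 0"
    and f: "integrable M f"
  shows "\<theta> f = 0"
  using f
proof (induction rule: integrable_induct)
  case (base A c)
  have A: "integrable M (indicator A :: 'a \<Rightarrow> real)" using base by (intro integrable_real_indicator) auto
  have "\<bar>\<theta> (indicator A)\<bar> \<le> e" if e: "0 < e" for e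
  proof -
    obtain B where B: "B \<in> sets M" "B \<subseteq> A" "measure M (A - B) < e / (C + 1)" "\<theta> (indicator B) = 0"
      using dense[OF base, of "e / (C + 1)"] e C by auto
    have fin: "emeasure M B < \<infinity>" "emeasure M (A - B) < \<infinity>"
      using base B emeasure_mono[of B A M] emeasure_mono[of "A - B" A M] by (auto intro: order_le_less_trans)
    have int: "integrable M (indicator B :: 'a \<Rightarrow> real)" "integrable M (indicator (A - B) :: 'a \<Rightarrow> real)"
      using fin B base by (auto intro!: integrable_real_indicator)
    have "(indicator A :: 'a \<Rightarrow> real) = (\<lambda>x. indicator B x + indicator (A - B) x)"
      by (rule ext) (use B(2) in \<open>auto simp: indicator_def\<close>)
    then have "\<theta> (indicator A) = \<theta> (indicator B) + \<theta> (indicator (A - B))"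
      using add[OF int] by simp
    then have "\<bar>\<theta> (indicator A)\<bar> \<le> C * (\<integral>x. \<bar>indicator (A - B) x\<bar> \<partial>M)"
      using bound[OF int(2)] B(4) by simp
    also have "(\<integral>x. \<bar>indicator (A - B) x :: real\<bar> \<partial>M) = measure M (A - B)"
      using B base by (simp add: abs_indicator)
    also have "C * measure M (A - B) \<le> C * (e / (C + 1))" using B(3) C by (intro mult_left_mono) auto
    also have "\<dots> \<le> e" using C e by (simp add: field_simps)
    finally show ?thesis .
  qed
  then have "\<bar>\<theta> (indicator A)\<bar> \<le> 0" by (rule field_le_epsilon[of _ 0, simplified])
  then have "\<theta> (indicator A) = 0" by simp
  moreover have "(\<lambda>x. indicator A x *\<^sub>R c) = (\<lambda>x. c * indicator A x)" by (auto simp: mult.commute)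
  ultimately show ?case using scale[OF A, of c] by simp
next
  case (add f g)
  then show ?case using assms(2)[of f g] by simp
next
  case (lim f s)
  have "\<bar>\<theta> f\<bar> \<le> C * (\<integral>x. \<bar>f x - s i x\<bar> \<partial>M)" for i
  proof -
    have i1: "integrable M (\<lambda>x. - 1 * s i x)" using lim(1) by (intro integrable_mult_right)
    have i2: "integrable M (\<lambda>x. f x + (- 1 * s i x))" using lim(4) i1 by (rule Bochner_Integration.integrable_add)
    have "\<theta> (\<lambda>x. f x + (- 1 * s i x)) = \<theta> f" using assms(2)[OF lim(4) i1] scale[OF lim(1), of "- 1" i] lim(5)[of i] by simp
    then show ?thesis using bound[OF i2] by simp
  qed
  moreover have "(\<lambda>i. C * (\<integral>x. \<bar>f x - s i x\<bar> \<partial>M)) \<longlonglongrightarrow> C * (\<integral>x. 0 \<partial>M)"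
  proof (intro tendsto_mult tendsto_const integral_dominated_convergence[where w="\<lambda>x. 3 * \<bar>f x\<bar>"])
    show "(\<lambda>x. \<bar>f x - s i x\<bar>) \<in> borel_measurable M" for i using lim(1)[of i] lim(4) by measurable
    show "integrable M (\<lambda>x. 3 * \<bar>f x\<bar>)" using lim(4) by (intro integrable_mult_right integrable_abs)
    show "AE x in M. (\<lambda>i. \<bar>f x - s i x\<bar>) \<longlonglongrightarrow> 0"
    proof (rule AE_I2)
      fix x assume "x \<in> space M"
      from lim(2)[OF this] have "(\<lambda>i. \<bar>f x - s i x\<bar>) \<longlonglongrightarrow> \<bar>f x - f x\<bar>" by (intro tendsto_intros)
      then show "(\<lambda>i. \<bar>f x - s i x\<bar>) \<longlonglongrightarrow> 0" by simp
    qed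
    show "AE x in M. norm \<bar>f x - s i x\<bar> \<le> 3 * \<bar>f x\<bar>" for i
      using lim(3)[of _ i] by (intro AE_I2) (smt (verit) real_norm_def)
  qed auto
  ultimately have "\<bar>\<theta> f\<bar> \<le> C * (\<integral>x. 0 \<partial>M)" by (intro LIMSEQ_le_const) auto
  then show ?case by simp
qed

context germs
begin

abbreviation \<I> where "\<I> \<equiv> rect_measure m \<Omega>"

lemma integral_rect_measure:
  fixes f :: "real^'n \<Rightarrow> real"
  assumes "integrable \<I> f"
  shows "integrable \<M> (\<lambda>z. f (fst z))" "(\<integral>z. f (fst z) \<partial>\<M>) = (\<integral>x. f x \<partial>\<I>)"
proof -
  have f: "integrable (distr \<M> (restrict_space borel \<Omega>) fst) f" using assms by (simp add: rect_measure_eq_distr)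
  show "integrable \<M> (\<lambda>z. f (fst z))" using measurable_fst_germ f by (rule integrable_distr)
  show "(\<integral>z. f (fst z) \<partial>\<M>) = (\<integral>x. f x \<partial>\<I>)"
    unfolding rect_measure_eq_distr
    using integral_distr[OF measurable_fst_germ, of f] f borel_measurable_integrable[OF f] by simp
qed

lemma pairing:
  fixes f :: "real^'n \<Rightarrow> real"
  assumes g: "g \<in> borel_measurable \<M>" "AE z in \<M>. \<bar>g z\<bar> \<le> C" and f: "integrable \<I> f"
  shows "integrable \<M> (\<lambda>z. g z * f (fst z))" "\<bar>\<integral>z. g z * f (fst z) \<partial>\<M>\<bar> \<le> C * (\<integral>x. \<bar>f x\<bar> \<partial>\<I>)"
proof -
  have ip: "integrable \<M> (\<lambda>z. f (fst z))" by (rule integral_rect_measure(1)[OF f])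
  have Cf: "integrable \<M> (\<lambda>z. C * \<bar>f (fst z)\<bar>)" using ip by (intro integrable_mult_right integrable_abs)
  have AE: "AE z in \<M>. norm (g z * f (fst z)) \<le> C * \<bar>f (fst z)\<bar>"
    using g(2) by eventually_elim (simp add: abs_mult mult_right_mono)
  have meas: "(\<lambda>z. g z * f (fst z)) \<in> borel_measurable \<M>"
    using g(1) borel_measurable_integrable[OF ip] by (rule borel_measurable_times)
  show int: "integrable \<M> (\<lambda>z. g z * f (fst z))"
  proof (rule Bochner_Integration.integrable_bound[OF Cf meas])
    show "AE z in \<M>. norm (g z * f (fst z)) \<le> norm (C * \<bar>f (fst z)\<bar>)"
      using AE by eventually_elim simp
  qed
  have "\<bar>\<integral>z. g z * f (fst z) \<partial>\<M>\<bar> \<le> (\<integral>z. norm (g z * f (fst z)) \<partial>\<M>)"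
    using integral_norm_bound[of \<M> "\<lambda>z. g z * f (fst z)"] by simp
  also have "\<dots> \<le> (\<integral>z. C * \<bar>f (fst z)\<bar> \<partial>\<M>)"
    using int Cf AE by (intro integral_mono_AE) auto
  also have "\<dots> = C * (\<integral>z. \<bar>f (fst z)\<bar> \<partial>\<M>)" by simp
  also have "(\<integral>z. \<bar>f (fst z)\<bar> \<partial>\<M>) = (\<integral>x. \<bar>f x\<bar> \<partial>\<I>)"
    using integral_rect_measure(2)[of "\<lambda>x. \<bar>f x\<bar>"] f by simp
  finally show "\<bar>\<integral>z. g z * f (fst z) \<partial>\<M>\<bar> \<le> C * (\<integral>x. \<bar>f x\<bar> \<partial>\<I>)" .
qed

lemma borel_in_rect_measure: "B \<in> sets borel \<Longrightarrow> B \<subseteq> \<Omega> \<Longrightarrow> B \<in> sets \<I>"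
  unfolding sets_rect_measure by (auto simp: sets_restrict_space image_iff intro!: bexI[of _ B])

lemma rect_measure_in_borel: "B \<in> sets \<I> \<Longrightarrow> B \<in> sets borel \<and> B \<subseteq> \<Omega>"
  unfolding sets_rect_measure using open_dom by (auto simp: sets_restrict_space)

lemma emeasure_rect_base:
  assumes "E \<in> \<E>" "B \<in> sets borel" "B \<subseteq> E"
  shows "emeasure \<I> B = hausdorff CARD('m) B" "emeasure \<I> B < \<infinity>"
proof -
  have "B \<subseteq> \<Omega>" using assms(3) germ_baseD(1)[OF assms(1)] by auto
  then show "emeasure \<I> B = hausdorff CARD('m) B"
    using emeasure_rect_measure[OF assms(2)] emeasure_fibre[OF assms] by simp
  then show "emeasure \<I> B < \<infinity>"
    using hausdorff_mono[OF assms(3), of "CARD('m)"] germ_baseD(5)[OF assms(1)] by (simp add: order_le_less_trans)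
qed

text \<open>The set where \<open>g\<close>, or else \<open>- g\<close>, exceeds \<open>c\<close> has a non-null part over some member of the germ base.
  Up to a null set this part is the preimage of a Borel set, whose normalised indicator serves as \<open>f\<close>.\<close>

lemma pairing_lower_bound:
  assumes g: "g \<in> borel_measurable \<M>" "AE z in \<M>. \<bar>g z\<bar> \<le> C"
    and c: "0 \<le> c" "ennreal c < esssup \<M> (\<lambda>z. ennreal \<bar>g z\<bar>)"
  obtains f where "integrable \<I> f" "(\<integral>x. \<bar>f x\<bar> \<partial>\<I>) = 1" "c \<le> \<bar>\<integral>z. g z * f (fst z) \<partial>\<M>\<bar>"
proof -
  have [measurable]: "g \<in> borel_measurable \<M>" by (rule g(1))
  have "0 < emeasure \<M> {z\<in>space \<M>. ennreal c < ennreal \<bar>g z\<bar>}"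
    using g(1) c(2) by (intro esssup_pos_measure) measurable
  also have "{z\<in>space \<M>. ennreal c < ennreal \<bar>g z\<bar>} = {z\<in>space \<M>. c < g z} \<union> {z\<in>space \<M>. c < - g z}"
    using c(1) by (auto simp: ennreal_less_iff)
  also have "emeasure \<M> ({z\<in>space \<M>. c < g z} \<union> {z\<in>space \<M>. c < - g z}) \<le>
      emeasure \<M> {z\<in>space \<M>. c < g z} + emeasure \<M> {z\<in>space \<M>. c < - g z}"
    by (rule emeasure_subadditive) measurable
  finally have "0 < emeasure \<M> {z\<in>space \<M>. c < 1 * g z} \<or> 0 < emeasure \<M> {z\<in>space \<M>. c < (-1) * g z}"
    by (auto simp: zero_less_iff_neq_zero)
  then obtain s :: real where s: "\<bar>s\<bar> = 1" "0 < emeasure \<M> {z\<in>space \<M>. c < s * g z}"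
  proof
    assume "0 < emeasure \<M> {z\<in>space \<M>. c < 1 * g z}"
    then show ?thesis by (intro that[of 1]) simp_all
  next
    assume "0 < emeasure \<M> {z\<in>space \<M>. c < (-1) * g z}"
    then show ?thesis by (intro that[of "-1"]) simp_all
  qed
  define A where "A = {z\<in>space \<M>. c < s * g z}"
  have "A \<in> sets \<M>" unfolding A_def by measurable
  then have A: "A \<in> germ_sets m \<Omega>" by simp
  have "0 < (SUP E\<in>\<E>. emeasure \<M> (A \<inter> fibre E))"
    using s(2) emeasure_germ_measure_fibres[OF A] by (simp add: A_def)
  then obtain E where E: "E \<in> \<E>" "0 < emeasure \<M> (A \<inter> fibre E)" by (auto simp: less_SUP_iff)
  obtain B where B: "B \<in> sets borel" "B \<subseteq> E" "emeasure \<M> (fibre B - A) = 0" "emeasure \<M> (A \<inter> fibre E - fibre B) = 0"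
    by (rule germ_set_over_base[OF E(1) A])
  have Bm: "fibre B \<in> sets \<M>" "fibre E \<in> sets \<M>" using fibre_sets B(1) germ_baseD(2)[OF E(1)] by auto
  have BI: "B \<in> sets \<I>" using B germ_baseD(1)[OF E(1)] by (intro borel_in_rect_measure) auto
  define b where "b = measure \<I> B"
  have eb: "emeasure \<I> B = ennreal b"
    unfolding b_def using emeasure_rect_base(2)[OF E(1) B(1,2)] by (simp add: emeasure_eq_ennreal_measure)
  have AEB: "A \<inter> fibre E - fibre B \<in> sets \<M>" by (rule sets.Diff[OF sets.Int[OF \<open>A \<in> sets \<M>\<close> Bm(2)] Bm(1)])
  have "emeasure \<M> (A \<inter> fibre E) \<le> emeasure \<M> (fibre B \<union> (A \<inter> fibre E - fibre B))"
    by (rule emeasure_mono[OF _ sets.Un[OF Bm(1) AEB]]) blast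
  also have "\<dots> \<le> emeasure \<M> (fibre B) + emeasure \<M> (A \<inter> fibre E - fibre B)"
    by (rule emeasure_subadditive[OF Bm(1) AEB])
  finally have "0 < emeasure \<M> (fibre B)" using E(2) B(4) by (simp add: order_less_le_trans)
  also have "emeasure \<M> (fibre B) = ennreal b"
    using eb emeasure_rect_measure[of B] B germ_baseD(1)[OF E(1)] by auto
  finally have b: "0 < b" by simp
  define f where "f x = indicator B x / b" for x
  have intB: "integrable \<I> (indicator B :: _ \<Rightarrow> real)" using BI eb by (intro integrable_real_indicator) auto
  have f: "integrable \<I> f" unfolding f_def using intB by (rule integrable_divide)
  have "(\<integral>x. \<bar>f x\<bar> \<partial>\<I>) = (\<integral>x. indicator B x / b \<partial>\<I>)"
    using b by (intro Bochner_Integration.integral_cong) (auto simp: f_def indicator_def)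
  also have "\<dots> = 1" using BI b by (simp add: b_def)
  finally have f1: "(\<integral>x. \<bar>f x\<bar> \<partial>\<I>) = 1" .
  have int: "integrable \<M> (\<lambda>z. g z * f (fst z))" by (rule pairing(1)[OF g f])
  have "c = (\<integral>z. c * f (fst z) \<partial>\<M>)"
  proof -
    have "(\<integral>x. f x \<partial>\<I>) = 1" using BI b by (simp add: f_def b_def)
    then show ?thesis using integral_rect_measure(2)[OF f] by simp
  qed
  also have "\<dots> \<le> (\<integral>z. s * (g z * f (fst z)) \<partial>\<M>)"
  proof (rule integral_mono_AE)
    show "integrable \<M> (\<lambda>z. c * f (fst z))" using integral_rect_measure(1)[OF f] by (rule integrable_mult_right)
    show "integrable \<M> (\<lambda>z. s * (g z * f (fst z)))" using int by (rule integrable_mult_right)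
    have "fibre B - A \<in> null_sets \<M>" using B(3) Bm \<open>A \<in> sets \<M>\<close> by (intro null_setsI sets.Diff)
    then have "AE z in \<M>. z \<notin> fibre B - A" by (rule AE_not_in)
    then show "AE z in \<M>. c * f (fst z) \<le> s * (g z * f (fst z))"
      using AE_space
    proof eventually_elim
      fix z assume z: "z \<notin> fibre B - A" "z \<in> space \<M>"
      show "c * f (fst z) \<le> s * (g z * f (fst z))"
      proof (cases "fst z \<in> B")
        case True
        then have "z \<in> A" using z by (auto simp: fibre_def)
        then have "c \<le> s * g z" by (simp add: A_def)
        then have "c * f (fst z) \<le> (s * g z) * f (fst z)" using b by (intro mult_right_mono) (auto simp: f_def)
        then show ?thesis by (simp add: mult.assoc)
      qed (simp add: f_def)
    qed
  qed
  also have "\<dots> = s * (\<integral>z. g z * f (fst z) \<partial>\<M>)" by simp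
  also have "\<dots> \<le> \<bar>s * (\<integral>z. g z * f (fst z) \<partial>\<M>)\<bar>" by simp
  also have "\<dots> = \<bar>\<integral>z. g z * f (fst z) \<partial>\<M>\<bar>" using s(1) by (simp add: abs_mult)
  finally show ?thesis using that[OF f f1] by simp
qed

end

section \<open>Recovering the density of a functional from germs\<close>

locale germ_functional = germs \<Omega> m
  for \<Omega> :: "(real^'n) set" and m :: "(real^'m) itself" +
  fixes \<phi> :: "(real^'n \<Rightarrow> real) \<Rightarrow> real" and C :: real
  assumes C: "0 \<le> C"
    and add: "\<And>f h. integrable \<I> f \<Longrightarrow> integrable \<I> h \<Longrightarrow> \<phi> (\<lambda>x. f x + h x) = \<phi> f + \<phi> h"
    and scale: "\<And>c f. integrable \<I> f \<Longrightarrow> \<phi> (\<lambda>x. c * f x) = c * \<phi> f"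
    and bound: "\<And>f. integrable \<I> f \<Longrightarrow> \<bar>\<phi> f\<bar> \<le> C * (\<integral>x. \<bar>f x\<bar> \<partial>\<I>)"
begin

lemma integrable_base_indicator:
  assumes "E \<in> \<E>" "B \<in> sets borel" "B \<subseteq> E"
  shows "integrable \<I> (indicator B :: real^'n \<Rightarrow> real)"
proof -
  have "B \<in> sets \<I>" using assms germ_baseD(1)[OF assms(1)] by (intro borel_in_rect_measure) auto
  then show ?thesis using emeasure_rect_base(2)[OF assms] by (intro integrable_real_indicator) auto
qed

lemma indicator_bound:
  assumes "E \<in> \<E>" "B \<in> sets borel" "B \<subseteq> E"
  shows "\<bar>\<phi> (indicator B)\<bar> \<le> C * enn2real (hausdorff CARD('m) B)"
proof -
  have "B \<in> sets \<I>" using assms germ_baseD(1)[OF assms(1)] by (intro borel_in_rect_measure) auto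
  then have "(\<integral>x. \<bar>indicator B x :: real\<bar> \<partial>\<I>) = enn2real (hausdorff CARD('m) B)"
    using emeasure_rect_base(1)[OF assms] by (simp add: abs_indicator measure_def)
  then show ?thesis using bound[OF integrable_base_indicator[OF assms]] by simp
qed

lemma indicator_add:
  assumes "E \<in> \<E>" "A \<in> sets borel" "A \<subseteq> E" "B \<in> sets borel" "B \<subseteq> E" "A \<inter> B = {}"
  shows "\<phi> (indicator (A \<union> B)) = \<phi> (indicator A) + \<phi> (indicator B)"
proof -
  have "(indicator (A \<union> B) :: real^'n \<Rightarrow> real) = (\<lambda>x. indicator A x + indicator B x)"
    by (rule ext) (use assms(6) in \<open>auto simp: indicator_def\<close>)
  then show ?thesis
    using add[OF integrable_base_indicator[OF assms(1,2,3)] integrable_base_indicator[OF assms(1,4,5)]] by simp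
qed

lemma base_density_exists:
  assumes E: "E \<in> \<E>"
  shows "\<exists>D :: real^'n \<Rightarrow> real. D \<in> borel_measurable borel \<and> (\<forall>x. \<bar>D x\<bar> \<le> C) \<and>
    (\<forall>B\<in>sets borel. \<phi> (indicator (B \<inter> E)) = (LINT x|hausdorff_on CARD('m) E. indicator B x * D x))"
proof -
  let ?M = "hausdorff_on CARD('m) E"
  have EB: "E \<in> sets borel" by (rule germ_baseD(2)[OF E])
  have fin: "finite_measure ?M" by (rule finite_measure_hausdorff_on[OF germ_baseD(5)[OF E]])
  obtain D where D: "D \<in> borel_measurable ?M" "\<And>x. \<bar>D x\<bar> \<le> C"
    "\<And>A. A \<in> sets ?M \<Longrightarrow> \<phi> (indicator (A \<inter> E)) = (LINT x|?M. indicator A x * D x)"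
  proof (rule bounded_additive_density[OF fin C, of "\<lambda>A. \<phi> (indicator (A \<inter> E))"])
    fix A B assume "A \<in> sets ?M" "B \<in> sets ?M" and dis: "A \<inter> B = {}"
    then have AB: "A \<inter> E \<in> sets borel" "B \<inter> E \<in> sets borel" using EB by simp_all
    have "\<phi> (indicator ((A \<inter> E) \<union> (B \<inter> E))) = \<phi> (indicator (A \<inter> E)) + \<phi> (indicator (B \<inter> E))"
      by (rule indicator_add[OF E AB(1) _ AB(2)]) (use dis in auto)
    then show "\<phi> (indicator ((A \<union> B) \<inter> E)) = \<phi> (indicator (A \<inter> E)) + \<phi> (indicator (B \<inter> E))"
      by (simp add: Int_Un_distrib2)
  next
    fix A assume A: "A \<in> sets ?M"
    then have "A \<inter> E \<in> sets borel" using EB by simp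
    from indicator_bound[OF E this] A show "\<bar>\<phi> (indicator (A \<inter> E))\<bar> \<le> C * measure ?M A"
      by (simp add: measure_def emeasure_hausdorff_on)
  next
    fix D assume h: "D \<in> borel_measurable ?M" "\<And>x. \<bar>D x\<bar> \<le> C"
      "\<And>A. A \<in> sets ?M \<Longrightarrow> \<phi> (indicator (A \<inter> E)) = (LINT x|?M. indicator A x * D x)"
    show thesis by (rule that[OF h])
  qed
  have "D \<in> borel_measurable borel" using D(1) by (simp add: measurable_cong_sets[OF sets_hausdorff_on refl])
  then show ?thesis using D(2,3) by (intro exI[of _ D]) simp
qed

definition base_density :: "(real^'n) set \<Rightarrow> real^'n \<Rightarrow> real" where
  "base_density E = (SOME D. D \<in> borel_measurable borel \<and> (\<forall>x. \<bar>D x\<bar> \<le> C) \<and>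
    (\<forall>B\<in>sets borel. \<phi> (indicator (B \<inter> E)) = (LINT x|hausdorff_on CARD('m) E. indicator B x * D x)))"

lemma base_density:
  assumes E: "E \<in> \<E>"
  shows "base_density E \<in> borel_measurable borel" "\<bar>base_density E x\<bar> \<le> C"
    "B \<in> sets borel \<Longrightarrow> \<phi> (indicator (B \<inter> E)) = (LINT x|hausdorff_on CARD('m) E. indicator B x * base_density E x)"
  using someI_ex[OF base_density_exists[OF E], folded base_density_def] by blast+

definition functional_quot :: "(real^'n) set \<Rightarrow> real^'n \<Rightarrow> real \<Rightarrow> real" where
  "functional_quot E x r = \<phi> (indicator (cball x r \<inter> E)) / (unit_ball_vol (real CARD('m)) * r ^ CARD('m))"

text \<open>The quotient is the product of a mean value of \<open>base_density E\<close> near \<open>x\<close> and a ball quotient of \<open>E\<close>, which tends to one.\<close>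

lemma functional_quot_tendsto:
  assumes E: "E \<in> \<E>" and x: "x \<in> E"
    and osc: "(mean_osc CARD('m) (hausdorff_on CARD('m) E) (base_density E) x \<longlongrightarrow> 0) (at_right 0)"
  shows "(functional_quot E x \<longlongrightarrow> base_density E x) (at_right 0)"
proof -
  let ?M = "hausdorff_on CARD('m) E" and ?D = "base_density E"
  interpret finite_measure ?M by (rule finite_measure_hausdorff_on[OF germ_baseD(5)[OF E]])
  have [measurable]: "?D \<in> borel_measurable borel" by (rule base_density(1)[OF E])
  have Dm: "?D \<in> borel_measurable ?M" by (simp add: measurable_cong_sets[OF sets_hausdorff_on refl])
  define q where "q r = enn2real (ball_quot CARD('m) E x r)" for r
  define osc where "osc r = enn2real (mean_osc CARD('m) ?M ?D x r)" for r
  have q: "(q \<longlongrightarrow> 1) (at_right 0)"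
    unfolding q_def using germ_baseD(6)[OF E x] by (intro tendsto_enn2real) (simp_all add: has_density_ball_quot)
  have osc0: "(osc \<longlongrightarrow> 0) (at_right 0)"
    unfolding osc_def using osc by (intro tendsto_enn2real) simp_all
  have le: "norm (functional_quot E x r - ?D x * q r) \<le> osc r" if r: "0 < r" for r
  proof -
    let ?v = "unit_ball_vol (real CARD('m)) * r ^ CARD('m)"
    have v: "0 < ?v" using r by (rule unit_ball_vol_power_pos)
    let ?K = "cball x r"
    have K: "?K \<in> sets ?M" by simp
    have iK: "integrable ?M (indicator ?K :: real^'n \<Rightarrow> real)" by (intro integrable_real_indicator K) (simp add: less_top[symmetric])
    have i1: "integrable ?M (\<lambda>y. indicator ?K y * ?D y)"
    proof (rule integrable_const_bound[of _ C])
      show "AE y in ?M. norm (indicator ?K y * ?D y) \<le> C"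
        using base_density(2)[OF E] C by (intro AE_I2) (simp add: indicator_def)
      show "(\<lambda>y. indicator ?K y * ?D y) \<in> borel_measurable ?M"
        by (intro borel_measurable_times Dm borel_measurable_indicator K)
    qed
    have i2: "integrable ?M (\<lambda>y. indicator ?K y * ?D x)" using iK by (rule integrable_mult_left)
    have m: "emeasure ?M ?K = hausdorff CARD('m) (E \<inter> ?K)" by (simp add: emeasure_hausdorff_on Int_commute)
    have "emeasure ?M ?K = ennreal (measure ?M ?K)" by (rule emeasure_eq_measure)
    then have qr: "q r = measure ?M ?K / ?v"
      using m v by (simp add: q_def ball_quot_def divide_ennreal[OF measure_nonneg v] measure_nonneg del: emeasure_hausdorff_on)
    have fq: "functional_quot E x r = (LINT y|?M. indicator ?K y * ?D y) / ?v"
      using base_density(3)[OF E, of ?K] by (simp add: functional_quot_def)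
    have "(LINT y|?M. indicator ?K y * ?D x) = measure ?M ?K * ?D x" using K by simp
    then have "functional_quot E x r - ?D x * q r = (LINT y|?M. indicator ?K y * ?D y - indicator ?K y * ?D x) / ?v"
      unfolding fq qr using Bochner_Integration.integral_diff[OF i1 i2] by (simp add: diff_divide_distrib mult.commute)
    then have "norm (functional_quot E x r - ?D x * q r) = \<bar>LINT y|?M. indicator ?K y * ?D y - indicator ?K y * ?D x\<bar> / ?v"
      using v by (simp add: abs_divide)
    also have "\<dots> \<le> (LINT y|?M. norm (indicator ?K y * ?D y - indicator ?K y * ?D x)) / ?v"
      using integral_norm_bound[of ?M "\<lambda>y. indicator ?K y * ?D y - indicator ?K y * ?D x"] v
      by (intro divide_right_mono) simp_all
    also have "\<dots> = osc r"
    proof -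
      let ?h = "\<lambda>y. norm (indicator ?K y * ?D y - indicator ?K y * ?D x)"
      have ih: "integrable ?M ?h" using i1 i2 by (intro integrable_norm Bochner_Integration.integrable_diff)
      have "(\<integral>\<^sup>+y\<in>?K. ennreal \<bar>?D y - ?D x\<bar> \<partial>?M) = (\<integral>\<^sup>+y. ennreal (?h y) \<partial>?M)"
        by (intro nn_integral_cong) (simp add: indicator_def)
      also have "\<dots> = ennreal (LINT y|?M. ?h y)" using ih by (intro nn_integral_eq_integral) simp_all
      finally have "mean_osc CARD('m) ?M ?D x r = ennreal ((LINT y|?M. ?h y) / ?v)"
        unfolding mean_osc_def using divide_ennreal[OF _ v, of "LINT y|?M. ?h y"] by simp
      then show ?thesis using v by (simp add: osc_def)
    qed
    finally show ?thesis .
  qed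
  have "((\<lambda>r. functional_quot E x r - ?D x * q r) \<longlongrightarrow> 0) (at_right 0)"
    using osc0 by (rule Lim_null_comparison[rotated])
      (use le in \<open>auto simp: eventually_at_topological intro!: exI[of _ UNIV]\<close>)
  moreover have "((\<lambda>r. ?D x * q r) \<longlongrightarrow> ?D x * 1) (at_right 0)" using q by (intro tendsto_intros)
  ultimately have "((\<lambda>r. (functional_quot E x r - ?D x * q r) + ?D x * q r) \<longlongrightarrow> 0 + ?D x * 1) (at_right 0)"
    by (rule tendsto_add)
  then show ?thesis by simp
qed

text \<open>Sets with the same germ at \<open>x\<close> differ by a set of density zero at \<open>x\<close>, and \<open>\<phi>\<close> is bounded by the measure.\<close>

lemma functional_quot_diff:
  assumes E: "E \<in> \<E>" "E' \<in> \<E>" and dens: "has_density CARD('m) ((E - E') \<union> (E' - E)) x 0"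
  shows "((\<lambda>r. functional_quot E x r - functional_quot E' x r) \<longlongrightarrow> 0) (at_right 0)"
proof -
  let ?D = "(E - E') \<union> (E' - E)"
  have "((\<lambda>r. enn2real (ball_quot CARD('m) ?D x r)) \<longlongrightarrow> 0) (at_right 0)"
    using dens by (intro tendsto_enn2real) (simp_all add: has_density_ball_quot)
  then have "((\<lambda>r. 2 * C * enn2real (ball_quot CARD('m) ?D x r)) \<longlongrightarrow> 2 * C * 0) (at_right 0)"
    by (intro tendsto_mult tendsto_const) simp
  then have lim: "((\<lambda>r. 2 * C * enn2real (ball_quot CARD('m) ?D x r)) \<longlongrightarrow> 0) (at_right 0)" by simp
  have le: "norm (functional_quot E x r - functional_quot E' x r) \<le> 2 * C * enn2real (ball_quot CARD('m) ?D x r)"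
    if r: "0 < r" for r
  proof -
    let ?v = "unit_ball_vol (real CARD('m)) * r ^ CARD('m)"
    have v: "0 < ?v" using r by (rule unit_ball_vol_power_pos)
    let ?K = "cball x r"
    define h where "h = enn2real (hausdorff CARD('m) (?D \<inter> ?K))"
    have hnn: "0 \<le> h" by (simp add: h_def)
    have "hausdorff CARD('m) (?D \<inter> ?K) \<le> hausdorff CARD('m) E + hausdorff CARD('m) E'"
      by (rule order_trans[OF hausdorff_mono hausdorff_Un]) auto
    then have fin: "hausdorff CARD('m) (?D \<inter> ?K) < \<infinity>"
      using germ_baseD(5)[OF E(1)] germ_baseD(5)[OF E(2)] by (auto intro: order_le_less_trans)
    have bor: "E \<in> sets borel" "E' \<in> sets borel" using E germ_baseD(2) by auto
    have part: "\<bar>\<phi> (indicator (?K \<inter> F)) - \<phi> (indicator (?K \<inter> (F \<inter> F')))\<bar> \<le> C * h"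
      if F: "F \<in> \<E>" "F \<in> sets borel" "F' \<in> sets borel" "F - F' \<subseteq> ?D" for F F'
    proof -
      have "?K \<inter> F = (?K \<inter> (F \<inter> F')) \<union> (?K \<inter> (F - F'))" by blast
      also have "\<phi> (indicator \<dots>) = \<phi> (indicator (?K \<inter> (F \<inter> F'))) + \<phi> (indicator (?K \<inter> (F - F')))"
        by (rule indicator_add[OF F(1)]) (use F(2,3) in auto)
      finally have "\<bar>\<phi> (indicator (?K \<inter> F)) - \<phi> (indicator (?K \<inter> (F \<inter> F')))\<bar> = \<bar>\<phi> (indicator (?K \<inter> (F - F')))\<bar>" by simp
      also have "\<dots> \<le> C * enn2real (hausdorff CARD('m) (?K \<inter> (F - F')))"
        by (rule indicator_bound[OF F(1)]) (use F(2,3) in auto)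
      also have "\<dots> \<le> C * h"
        unfolding h_def using fin F(4) C by (intro mult_left_mono enn2real_mono hausdorff_mono) auto
      finally show ?thesis .
    qed
    have p1: "\<bar>\<phi> (indicator (?K \<inter> E)) - \<phi> (indicator (?K \<inter> (E \<inter> E')))\<bar> \<le> C * h" by (rule part[OF E(1) bor]) auto
    have p2: "\<bar>\<phi> (indicator (?K \<inter> E')) - \<phi> (indicator (?K \<inter> (E' \<inter> E)))\<bar> \<le> C * h" by (rule part[OF E(2) bor(2,1)]) auto
    have "\<bar>\<phi> (indicator (?K \<inter> E)) - \<phi> (indicator (?K \<inter> E'))\<bar> \<le> 2 * C * h"
      using p1 p2 by (simp add: Int_commute[of E' E])
    then have "\<bar>\<phi> (indicator (?K \<inter> E)) - \<phi> (indicator (?K \<inter> E'))\<bar> / ?v \<le> 2 * C * h / ?v"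
      using v by (intro divide_right_mono) simp_all
    moreover have "hausdorff CARD('m) (?D \<inter> ?K) = ennreal h" using fin by (simp add: h_def)
    then have "enn2real (ball_quot CARD('m) ?D x r) = h / ?v"
      using divide_ennreal[OF _ v, of h] v by (simp add: ball_quot_def hnn)
    ultimately show ?thesis
      using v by (simp add: functional_quot_def diff_divide_distrib[symmetric] abs_divide)
  qed
  show ?thesis
    using lim by (rule Lim_null_comparison[rotated])
      (use le in \<open>auto simp: eventually_at_topological intro!: exI[of _ UNIV]\<close>)
qed

text \<open>All representatives of a germ yield the same limit, if there is one; the truncation makes the function
  bounded also at the other germs.\<close>

definition germ_density :: "(real^'n) \<times> (real^'n) set set \<Rightarrow> real" where
  "germ_density z = max (- C) (min C (Lim (at_right 0) (functional_quot (SOME E. E \<in> snd z) (fst z))))"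

lemma germ_density_bound: "\<bar>germ_density z\<bar> \<le> C"
  using C by (auto simp: germ_density_def)

lemma germ_density_eq:
  assumes E: "E \<in> \<E>" and x: "x \<in> E"
    and osc: "(mean_osc CARD('m) (hausdorff_on CARD('m) E) (base_density E) x \<longlongrightarrow> 0) (at_right 0)"
  shows "germ_density (\<gamma> E x) = base_density E x"
proof -
  define E' where "E' = (SOME E'. E' \<in> snd (\<gamma> E x))"
  have "E \<in> germ_base_at m \<Omega> x" using E x by (simp add: germ_base_at_def)
  then have "E \<in> snd (\<gamma> E x)" using equiv_class_self[OF equiv_germ_rel] by (simp add: germ_map_def)
  then have "E' \<in> snd (\<gamma> E x)" unfolding E'_def by (rule someI)
  then have E': "E' \<in> \<E>" "has_density CARD('m) ((E - E') \<union> (E' - E)) x 0"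
    by (auto simp: germ_map_def germ_rel_def germ_base_at_def)
  have "((\<lambda>r. functional_quot E x r - (functional_quot E x r - functional_quot E' x r)) \<longlongrightarrow> base_density E x - 0) (at_right 0)"
    by (intro tendsto_diff functional_quot_tendsto[OF E x osc] functional_quot_diff[OF E E'])
  then have "(functional_quot E' x \<longlongrightarrow> base_density E x) (at_right 0)" by simp
  then have "Lim (at_right 0) (functional_quot E' x) = base_density E x"
    by (rule tendsto_Lim[OF trivial_limit_at_right_real])
  then show ?thesis using base_density(2)[OF E, of x] by (auto simp: germ_density_def E'_def)
qed

lemma germ_density_ae_eq:
  assumes E: "E \<in> \<E>"
  shows "hausdorff CARD('m) {x \<in> E. germ_density (\<gamma> E x) \<noteq> base_density E x} = 0"
proof -
  have "hausdorff CARD('m) (E \<inter> ball 0 R) < \<infinity>" for R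
    using germ_baseD(5)[OF E] hausdorff_mono[of "E \<inter> ball 0 R" E "CARD('m)"] by (auto intro: order_le_less_trans)
  from mean_osc_tendsto_0_ae[OF germ_baseD(2)[OF E] this base_density(1,2)[OF E]]
  show ?thesis by (rule hausdorff_null_subset) (use germ_density_eq[OF E] germ_baseD(6)[OF E] in auto)
qed

text \<open>On each member of the germ base the function agrees almost everywhere with a Borel function, and null sets are
  Hausdorff measurable.\<close>

lemma germ_density_measurable: "germ_density \<in> borel_measurable \<M>"
proof (rule measurableI)
  fix S :: "real set" assume S: "S \<in> sets borel"
  have "{x \<in> E. \<gamma> E x \<in> germ_density -` S \<inter> space \<M>} \<in> hausdorff_sets CARD('m)" if E: "E \<in> \<E>" for E
  proof (rule hausdorff_sets_cong_null)
    let ?A = "E \<inter> base_density E -` S" and ?B = "{x \<in> E. \<gamma> E x \<in> germ_density -` S \<inter> space \<M>}"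
    have "base_density E -` S \<in> sets borel" using measurable_sets[OF base_density(1)[OF E] S] by simp
    then show "?A \<in> hausdorff_sets CARD('m)"
      using germ_baseD(4)[OF E] borel_subset_hausdorff_sets by (intro hausdorff_sets_Int) auto
    show "hausdorff CARD('m) (?A - ?B) = 0" "hausdorff CARD('m) (?B - ?A) = 0"
      by (rule hausdorff_null_subset[OF germ_density_ae_eq[OF E]], use germ_map_in_space[OF E] in auto)+
  qed
  then show "germ_density -` S \<inter> space \<M> \<in> sets \<M>" by (auto simp: germ_sets_def)
qed simp

lemma hausdorff_on_base:
  assumes E: "E \<in> \<E>"
  shows "hausdorff_on CARD('m) E = distr (density \<M> (\<lambda>z. ennreal (indicator (fibre E) z))) borel fst"
proof (rule measure_eqI)
  fix A assume "A \<in> sets (hausdorff_on CARD('m) E)"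
  then have A: "A \<in> sets borel" by simp
  have f: "fst \<in> density \<M> (\<lambda>z. ennreal (indicator (fibre E) z)) \<rightarrow>\<^sub>M borel"
    using measurable_restrict_space2_iff measurable_fst_germ by (simp add: measurable_restrict_space2_iff)
  have Em: "fibre E \<in> sets \<M>" "fst -` A \<inter> space \<M> \<in> sets \<M>"
    using fibre_sets[OF germ_baseD(2)[OF E]] fibre_sets[OF A] by (simp_all add: fibre_def)
  have "emeasure (distr (density \<M> (\<lambda>z. ennreal (indicator (fibre E) z))) borel fst) A
      = emeasure (density \<M> (\<lambda>z. ennreal (indicator (fibre E) z))) (fst -` A \<inter> space \<M>)"
    using emeasure_distr[OF f A] by simp
  also have "\<dots> = (\<integral>\<^sup>+z. ennreal (indicator (fibre E) z) * indicator (fst -` A \<inter> space \<M>) z \<partial>\<M>)"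
    using Em by (intro emeasure_density measurable_compose[OF _ measurable_ennreal] borel_measurable_indicator)
  also have "\<dots> = (\<integral>\<^sup>+z. indicator (fibre (A \<inter> E)) z \<partial>\<M>)"
    by (intro nn_integral_cong) (auto simp: indicator_def fibre_def)
  also have "\<dots> = emeasure \<M> (fibre (A \<inter> E))"
    using fibre_sets[of "A \<inter> E"] A germ_baseD(2)[OF E] by (intro nn_integral_indicator) auto
  also have "\<dots> = hausdorff CARD('m) (A \<inter> E)"
    using A germ_baseD(2)[OF E] by (intro emeasure_fibre[OF E]) auto
  finally show "emeasure (hausdorff_on CARD('m) E) A = emeasure (distr (density \<M> (\<lambda>z. ennreal (indicator (fibre E) z))) borel fst) A"
    using A by (simp add: emeasure_hausdorff_on)
qed simp

lemma indicator_representation: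
  assumes E: "E \<in> \<E>" and B: "B \<in> sets borel" "B \<subseteq> E"
  shows "\<phi> (indicator B) = (\<integral>z. germ_density z * indicator B (fst z) \<partial>\<M>)"
proof -
  let ?D = "base_density E" and ?M = "density \<M> (\<lambda>z. ennreal (indicator (fibre E) z))"
  have fst: "fst \<in> \<M> \<rightarrow>\<^sub>M borel" using measurable_fst_germ by (simp add: measurable_restrict_space2_iff)
  then have f: "fst \<in> ?M \<rightarrow>\<^sub>M borel" by simp
  have Em: "fibre E \<in> sets \<M>" using fibre_sets[OF germ_baseD(2)[OF E]] by simp
  have h: "(\<lambda>x. indicator B x * ?D x) \<in> borel_measurable borel"
    using B base_density(1)[OF E] by (intro borel_measurable_times borel_measurable_indicator)
  have hf: "(\<lambda>z. indicator B (fst z) * ?D (fst z)) \<in> borel_measurable \<M>"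
    using measurable_compose[OF fst h] .
  have "B \<inter> E = B" using B(2) by auto
  then have "\<phi> (indicator B) = (LINT x|hausdorff_on CARD('m) E. indicator B x * ?D x)"
    using base_density(3)[OF E B(1)] by simp
  also have "\<dots> = (LINT z|?M. indicator B (fst z) * ?D (fst z))"
    unfolding hausdorff_on_base[OF E] by (rule integral_distr[OF f h])
  also have "\<dots> = (LINT z|\<M>. indicator (fibre E) z *\<^sub>R (indicator B (fst z) * ?D (fst z)))"
    using Em by (intro integral_density hf borel_measurable_indicator) auto
  also have "\<dots> = (\<integral>z. germ_density z * indicator B (fst z) \<partial>\<M>)"
  proof (rule integral_cong_AE)
    show "(\<lambda>z. indicator (fibre E) z *\<^sub>R (indicator B (fst z) * ?D (fst z))) \<in> borel_measurable \<M>"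
      using Em hf by (intro borel_measurable_scaleR borel_measurable_indicator)
    have "(\<lambda>z. indicator B (fst z) :: real) \<in> borel_measurable \<M>"
      using fst B(1) by measurable
    then show "(\<lambda>z. germ_density z * indicator B (fst z)) \<in> borel_measurable \<M>"
      by (rule borel_measurable_times[OF germ_density_measurable])
    define N where "N = {z \<in> space \<M>. germ_density z \<noteq> ?D (fst z)}"
    have "(\<lambda>z. ?D (fst z)) \<in> borel_measurable \<M>" by (rule measurable_compose[OF fst base_density(1)[OF E]])
    then have N: "N \<in> sets \<M>" unfolding N_def using germ_density_measurable by measurable
    have "emeasure \<M> (N \<inter> fibre E) = mu E N" using emeasure_Int_fibre[OF E] N by simp
    also have "\<dots> = 0"
      unfolding mu_def by (rule hausdorff_null_subset[OF germ_density_ae_eq[OF E]]) (auto simp: N_def)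
    finally have "N \<inter> fibre E \<in> null_sets \<M>" using N Em by (intro null_setsI sets.Int)
    then have "AE z in \<M>. z \<notin> N \<inter> fibre E" by (rule AE_not_in)
    then show "AE z in \<M>. indicator (fibre E) z *\<^sub>R (indicator B (fst z) * ?D (fst z)) = germ_density z * indicator B (fst z)"
      using AE_space
    proof eventually_elim
      fix z assume z: "z \<notin> N \<inter> fibre E" "z \<in> space \<M>"
      have "fst z \<in> B \<Longrightarrow> z \<in> fibre E" using z(2) B(2) by (auto simp: fibre_def)
      then show "indicator (fibre E) z *\<^sub>R (indicator B (fst z) * ?D (fst z)) = germ_density z * indicator B (fst z)"
        using z by (auto simp: N_def indicator_def)
    qed
  qed
  finally show ?thesis .
qed

text \<open>Both sides are bounded functionals of \<open>f\<close> which agree on indicators of Borel subsets of members of the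
  germ base, and these sets exhaust every set of finite measure.\<close>

theorem representation:
  fixes f :: "real^'n \<Rightarrow> real"
  assumes f: "integrable \<I> f"
  shows "\<phi> f = (\<integral>z. germ_density z * f (fst z) \<partial>\<M>)"
proof -
  note pair = pairing[OF germ_density_measurable AE_I2[OF germ_density_bound]]
  have "\<phi> f - (\<integral>z. germ_density z * f (fst z) \<partial>\<M>) = 0"
  proof (rule bounded_functional_eq_0[where M=\<I> and C="C + C" and \<theta>="\<lambda>f. \<phi> f - (\<integral>z. germ_density z * f (fst z) \<partial>\<M>)"])
    show "0 \<le> C + C" using C by simp
    show "integrable \<I> f" by (rule f)
  next
    fix f h :: "real^'n \<Rightarrow> real" assume fh: "integrable \<I> f" "integrable \<I> h"
    have "(\<integral>z. germ_density z * (f (fst z) + h (fst z)) \<partial>\<M>) = (\<integral>z. germ_density z * f (fst z) \<partial>\<M>) + (\<integral>z. germ_density z * h (fst z) \<partial>\<M>)"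
      unfolding distrib_left using pair(1)[OF fh(1)] pair(1)[OF fh(2)] by (rule Bochner_Integration.integral_add)
    then show "\<phi> (\<lambda>x. f x + h x) - (\<integral>z. germ_density z * (f (fst z) + h (fst z)) \<partial>\<M>) =
       \<phi> f - (\<integral>z. germ_density z * f (fst z) \<partial>\<M>) + (\<phi> h - (\<integral>z. germ_density z * h (fst z) \<partial>\<M>))"
      using add[OF fh] by simp
  next
    fix c and f :: "real^'n \<Rightarrow> real" assume "integrable \<I> f"
    then show "\<phi> (\<lambda>x. c * f x) - (\<integral>z. germ_density z * (c * f (fst z)) \<partial>\<M>) = c * (\<phi> f - (\<integral>z. germ_density z * f (fst z) \<partial>\<M>))"
      using scale by (simp add: mult.left_commute right_diff_distrib)
  next
    fix f :: "real^'n \<Rightarrow> real" assume "integrable \<I> f"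
    then show "\<bar>\<phi> f - (\<integral>z. germ_density z * f (fst z) \<partial>\<M>)\<bar> \<le> (C + C) * (\<integral>x. \<bar>f x\<bar> \<partial>\<I>)"
      using bound[of f] pair(2)[of f] by (simp add: distrib_right)
  next
    fix A e assume A: "A \<in> sets \<I>" "emeasure \<I> A < \<infinity>" and e: "(0::real) < e"
    have Ab: "A \<in> sets borel" "A \<subseteq> \<Omega>" using rect_measure_in_borel[OF A(1)] by auto
    define a where "a = measure \<I> A"
    have a: "emeasure \<I> A = ennreal a" unfolding a_def using A(2) by (simp add: emeasure_eq_ennreal_measure)
    obtain E where E: "E \<in> \<E>" "measure \<I> (A - A \<inter> E) < e"
    \<comment> \<open>The case distinction keeps \<open>a - e\<close> nonnegative, so that it embeds into the extended reals.\<close>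
    proof (cases "a < e")
      case True
      then show ?thesis using that[OF empty_germ_base] by (simp add: a_def)
    next
      case False
      then have "ennreal (a - e) < ennreal a" using e by (simp add: ennreal_less_iff)
      also have "ennreal a = (SUP E\<in>\<E>. emeasure \<M> (fibre A \<inter> fibre E))"
        using a emeasure_rect_measure[OF Ab] emeasure_germ_measure_fibres[OF fibre_sets[OF Ab(1)]] by simp
      finally obtain E where E: "E \<in> \<E>" "ennreal (a - e) < emeasure \<M> (fibre A \<inter> fibre E)"
        unfolding less_SUP_iff by blast
      have "fibre A \<inter> fibre E = fibre (A \<inter> E)" by (auto simp: fibre_def)
      moreover have AE: "A \<inter> E \<in> sets borel" "A \<inter> E \<subseteq> \<Omega>" using Ab germ_baseD(2)[OF E(1)] by auto
      ultimately have "ennreal (a - e) < emeasure \<I> (A \<inter> E)" using E(2) emeasure_rect_measure[OF AE] by simp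
      moreover have AI: "A \<inter> E \<in> sets \<I>" using AE by (rule borel_in_rect_measure)
      have "emeasure \<I> (A \<inter> E) \<noteq> \<infinity>" using emeasure_mono[of "A \<inter> E" A \<I>] A by auto
      then have "emeasure \<I> (A \<inter> E) = ennreal (measure \<I> (A \<inter> E))" by (simp add: emeasure_eq_ennreal_measure)
      ultimately have "a - e < measure \<I> (A \<inter> E)" using False by (simp add: ennreal_less_iff)
      moreover have "measure \<I> (A - A \<inter> E) = a - measure \<I> (A \<inter> E)"
        unfolding a_def using A AI by (intro measure_Diff) auto
      ultimately show ?thesis using that[OF E(1)] by simp
    qed
    have AE: "A \<inter> E \<in> sets borel" "A \<inter> E \<subseteq> \<Omega>" using Ab germ_baseD(2)[OF E(1)] by auto
    show "\<exists>B\<in>sets \<I>. B \<subseteq> A \<and> measure \<I> (A - B) < e \<and>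
        \<phi> (indicator B) - (\<integral>z. germ_density z * indicator B (fst z) \<partial>\<M>) = 0"
      using E(2) borel_in_rect_measure[OF AE] indicator_representation[OF E(1) AE(1)] by (intro bexI[of _ "A \<inter> E"]) auto
  qed
  then show ?thesis by simp
qed

end

section \<open>Spaces of classes modulo equality almost everywhere\<close>

locale ae_function_space =
  fixes M :: "'a measure" and F :: "('a \<Rightarrow> real) set" and N :: "('a \<Rightarrow> real) \<Rightarrow> real"
  assumes add_closed: "f \<in> F \<Longrightarrow> g \<in> F \<Longrightarrow> (\<lambda>x. f x + g x) \<in> F"
    and scale_closed: "f \<in> F \<Longrightarrow> (\<lambda>x. c * f x) \<in> F"
    and norm_cong: "f \<in> F \<Longrightarrow> g \<in> F \<Longrightarrow> AE x in M. f x = g x \<Longrightarrow> N f = N g"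
begin

abbreviation "ae_class f \<equiv> ae_rel M F `` {f}"

lemma equiv_ae_rel: "equiv F (ae_rel M F)"
proof (rule equivI)
  show "ae_rel M F \<subseteq> F \<times> F" by (auto simp: ae_rel_def)
  show "refl_on F (ae_rel M F)" by (auto simp: refl_on_def ae_rel_def)
  show "sym (ae_rel M F)" by (auto simp: sym_def ae_rel_def)
  show "trans (ae_rel M F)"
  proof (rule transI)
    fix f g h assume "(f, g) \<in> ae_rel M F" "(g, h) \<in> ae_rel M F"
    then have *: "f \<in> F" "h \<in> F" "AE x in M. f x = g x" "AE x in M. g x = h x" by (auto simp: ae_rel_def)
    from *(3,4) have "AE x in M. f x = h x" by eventually_elim simp
    then show "(f, h) \<in> ae_rel M F" using * by (simp add: ae_rel_def)
  qed
qed

lemma ae_class_eq_iff: "f \<in> F \<Longrightarrow> g \<in> F \<Longrightarrow> ae_class f = ae_class g \<longleftrightarrow> (AE x in M. f x = g x)"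
  using eq_equiv_class_iff[OF equiv_ae_rel, of f g] by (simp add: ae_rel_def)

lemma self_in_ae_class: "f \<in> F \<Longrightarrow> f \<in> ae_class f"
  by (rule equiv_class_self[OF equiv_ae_rel])

lemma in_ae_classD: "g \<in> ae_class f \<Longrightarrow> g \<in> F \<and> (AE x in M. f x = g x)"
  by (simp add: ae_rel_def)

lemma elems_ae_quotient: "elems (ae_quotient M F N) = ae_class ` F"
  by (auto simp: ae_quotient_def quotient_def)

lemma vadd_ae_class:
  assumes "f \<in> F" "g \<in> F"
  shows "vadd (ae_quotient M F N) (ae_class f) (ae_class g) = ae_class (\<lambda>x. f x + g x)"
proof -
  have "ae_class (\<lambda>x. f' x + g' x) = ae_class (\<lambda>x. f x + g x)"
    if "f' \<in> ae_class f" "g' \<in> ae_class g" for f' g'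
  proof -
    have *: "f' \<in> F" "g' \<in> F" "AE x in M. f x = f' x" "AE x in M. g x = g' x" using that in_ae_classD by blast+
    from *(3,4) have "AE x in M. f' x + g' x = f x + g x" by eventually_elim simp
    then show ?thesis using * assms ae_class_eq_iff add_closed by blast
  qed
  then have "(\<Union>f'\<in>ae_class f. \<Union>g'\<in>ae_class g. ae_class (\<lambda>x. f' x + g' x)) = ae_class (\<lambda>x. f x + g x)"
    using self_in_ae_class[OF assms(1)] self_in_ae_class[OF assms(2)] by blast
  then show ?thesis by (simp add: ae_quotient_def)
qed

lemma vscale_ae_class:
  assumes "f \<in> F"
  shows "vscale (ae_quotient M F N) c (ae_class f) = ae_class (\<lambda>x. c * f x)"
proof -
  have "ae_class (\<lambda>x. c * f' x) = ae_class (\<lambda>x. c * f x)" if "f' \<in> ae_class f" for f'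
  proof -
    have *: "f' \<in> F" "AE x in M. f x = f' x" using that in_ae_classD by blast+
    from *(2) have "AE x in M. c * f' x = c * f x" by eventually_elim simp
    then show ?thesis using * assms ae_class_eq_iff scale_closed by blast
  qed
  then have "(\<Union>f'\<in>ae_class f. ae_class (\<lambda>x. c * f' x)) = ae_class (\<lambda>x. c * f x)"
    using self_in_ae_class[OF assms] by blast
  then show ?thesis by (simp add: ae_quotient_def)
qed

lemma vnorm_ae_class:
  assumes "f \<in> F"
  shows "vnorm (ae_quotient M F N) (ae_class f) = N f"
proof -
  have "N f' = N f" if "f' \<in> ae_class f" for f'
    using norm_cong[of f f'] in_ae_classD[OF that] assms by simp
  then have "N ` ae_class f = {N f}" using self_in_ae_class[OF assms] by blast
  then show ?thesis by (simp add: ae_quotient_def)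
qed

end

lemma ae_function_space_L1: "ae_function_space M (L1_fun M) (\<lambda>f. \<integral>x. \<bar>f x\<bar> \<partial>M)"
proof
  fix f g :: "'a \<Rightarrow> real" assume fg: "f \<in> L1_fun M" "g \<in> L1_fun M" "AE x in M. f x = g x"
  show "(\<integral>x. \<bar>f x\<bar> \<partial>M) = (\<integral>x. \<bar>g x\<bar> \<partial>M)"
  proof (rule integral_cong_AE)
    show "(\<lambda>x. \<bar>f x\<bar>) \<in> borel_measurable M" "(\<lambda>x. \<bar>g x\<bar>) \<in> borel_measurable M"
      using fg(1,2) by (auto simp: L1_fun_def)
    show "AE x in M. \<bar>f x\<bar> = \<bar>g x\<bar>" using fg(3) by eventually_elim simp
  qed
qed (auto simp: L1_fun_def)

lemma Linf_funI:
  assumes g: "g \<in> borel_measurable M" and "AE x in M. \<bar>g x\<bar> \<le> C"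
  shows "g \<in> Linf_fun M"
proof -
  have "AE x in M. ennreal \<bar>g x\<bar> \<le> ennreal C" using assms(2) by eventually_elim (rule ennreal_leI)
  then have "esssup M (\<lambda>x. ennreal \<bar>g x\<bar>) \<le> ennreal C" using g by (intro esssup_I) measurable
  then show ?thesis using g by (simp add: Linf_fun_def order_le_less_trans)
qed

lemma ae_function_space_Linf: "ae_function_space M (Linf_fun M) (\<lambda>g. enn2real (esssup M (\<lambda>x. ennreal \<bar>g x\<bar>)))"
proof
  fix f g :: "'a \<Rightarrow> real" assume fg: "f \<in> Linf_fun M" "g \<in> Linf_fun M"
  note f = Linf_AE_bound[OF fg(1)] and g = Linf_AE_bound[OF fg(2)]
  let ?N = "\<lambda>g. enn2real (esssup M (\<lambda>x. ennreal \<bar>g x\<bar>))"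
  show "(\<lambda>x. f x + g x) \<in> Linf_fun M"
  proof (rule Linf_funI)
    show "(\<lambda>x. f x + g x) \<in> borel_measurable M" using f(1) g(1) by (rule borel_measurable_add)
    show "AE x in M. \<bar>f x + g x\<bar> \<le> ?N f + ?N g" using f(2) g(2) by eventually_elim simp
  qed
  assume eq: "AE x in M. f x = g x"
  have "esssup M (\<lambda>x. ennreal \<bar>f x\<bar>) = esssup M (\<lambda>x. ennreal \<bar>g x\<bar>)"
  proof (rule esssup_AE_cong)
    show "(\<lambda>x. ennreal \<bar>f x\<bar>) \<in> borel_measurable M" "(\<lambda>x. ennreal \<bar>g x\<bar>) \<in> borel_measurable M"
      using f(1) g(1) by measurable
    show "AE x in M. ennreal \<bar>f x\<bar> = ennreal \<bar>g x\<bar>" using eq by eventually_elim simp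
  qed
  then show "?N f = ?N g" by simp
next
  fix f :: "'a \<Rightarrow> real" and c :: real assume "f \<in> Linf_fun M"
  note f = Linf_AE_bound[OF this]
  show "(\<lambda>x. c * f x) \<in> Linf_fun M"
  proof (rule Linf_funI)
    show "(\<lambda>x. c * f x) \<in> borel_measurable M" using f(1) by (intro borel_measurable_times borel_measurable_const)
    show "AE x in M. \<bar>c * f x\<bar> \<le> \<bar>c\<bar> * enn2real (esssup M (\<lambda>x. ennreal \<bar>f x\<bar>))"
      using f(2) by eventually_elim (simp add: abs_mult mult_left_mono)
  qed
qed

section \<open>The duality\<close>

context germs
begin

interpretation L1: ae_function_space \<I> "L1_fun \<I>" "\<lambda>f. \<integral>x. \<bar>f x\<bar> \<partial>\<I>"
  by (rule ae_function_space_L1)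

interpretation Linf: ae_function_space \<M> "Linf_fun \<M>" "\<lambda>g. enn2real (esssup \<M> (\<lambda>x. ennreal \<bar>g x\<bar>))"
  by (rule ae_function_space_Linf)

abbreviation Lone where "Lone \<equiv> L1_space \<I>"
abbreviation Linfty where "Linfty \<equiv> Linf_space \<M>"
abbreviation sup_norm where "sup_norm g \<equiv> enn2real (esssup \<M> (\<lambda>x. ennreal \<bar>g x\<bar>))"

lemmas L1_elems = L1.elems_ae_quotient[folded L1_space_def L1_class_def]
  and L1_add = L1.vadd_ae_class[folded L1_space_def L1_class_def]
  and L1_scale = L1.vscale_ae_class[folded L1_space_def L1_class_def]
  and L1_norm = L1.vnorm_ae_class[folded L1_space_def L1_class_def]
  and Linf_elems = Linf.elems_ae_quotient[folded Linf_space_def Linf_class_def]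
  and Linf_add = Linf.vadd_ae_class[folded Linf_space_def Linf_class_def]
  and Linf_scale = Linf.vscale_ae_class[folded Linf_space_def Linf_class_def]
  and Linf_norm = Linf.vnorm_ae_class[folded Linf_space_def Linf_class_def]
  and Linf_class_eq_iff = Linf.ae_class_eq_iff[folded Linf_class_def]

lemma L1_class_in: "f \<in> L1_fun \<I> \<Longrightarrow> L1_class \<I> f \<in> elems Lone"
  by (simp add: L1_elems)

lemma zero_in_L1: "(\<lambda>_. 0) \<in> L1_fun \<I>"
  by (simp add: L1_fun_def)

lemma pairing_Linf:
  assumes "g \<in> Linf_fun \<M>" "f \<in> L1_fun \<I>"
  shows "integrable \<M> (\<lambda>z. g z * f (fst z))" "\<bar>\<integral>z. g z * f (fst z) \<partial>\<M>\<bar> \<le> sup_norm g * (\<integral>x. \<bar>f x\<bar> \<partial>\<I>)"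
  using pairing[OF Linf_AE_bound[OF assms(1)], of f] assms(2) by (simp_all add: L1_fun_def)

text \<open>Equality almost everywhere on \<open>\<Omega>\<close> pulls back to germs, because the measure on \<open>\<Omega>\<close> is the image of the germ measure.\<close>

lemma Upsilon_class:
  assumes g: "g \<in> Linf_fun \<M>" and f: "f \<in> L1_fun \<I>"
  shows "Upsilon m \<Omega> (Linf_class \<M> g) (L1_class \<I> f) = (\<integral>z. g z * f (fst z) \<partial>\<M>)"
proof -
  let ?p = "\<lambda>(g, f). \<integral>z. g z * (f \<circ> fst) z \<partial>\<M>"
  have "(\<integral>z. g' z * f' (fst z) \<partial>\<M>) = (\<integral>z. g z * f (fst z) \<partial>\<M>)"
    if h: "g' \<in> Linf_class \<M> g" "f' \<in> L1_class \<I> f" for g' f'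
  proof (rule integral_cong_AE)
    have g': "g' \<in> Linf_fun \<M>" "AE z in \<M>. g z = g' z" using Linf.in_ae_classD h(1) by (simp_all add: Linf_class_def)
    have f': "f' \<in> L1_fun \<I>" "AE x in \<I>. f x = f' x" using L1.in_ae_classD h(2) by (simp_all add: L1_class_def)
    show "(\<lambda>z. g' z * f' (fst z)) \<in> borel_measurable \<M>" "(\<lambda>z. g z * f (fst z)) \<in> borel_measurable \<M>"
      by (rule borel_measurable_integrable[OF pairing_Linf(1)], fact, fact)+
    have "AE z in \<M>. f (fst z) = f' (fst z)"
      using f'(2) unfolding rect_measure_eq_distr by (rule AE_distrD[OF measurable_fst_germ])
    then show "AE z in \<M>. g' z * f' (fst z) = g z * f (fst z)" using g'(2) by eventually_elim simp
  qed
  then have "?p ` (Linf_class \<M> g \<times> L1_class \<I> f) \<subseteq> {\<integral>z. g z * f (fst z) \<partial>\<M>}" by auto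
  moreover have "(g, f) \<in> Linf_class \<M> g \<times> L1_class \<I> f"
    using Linf.self_in_ae_class[OF g] L1.self_in_ae_class[OF f] by (simp add: Linf_class_def L1_class_def)
  then have "?p (g, f) \<in> ?p ` (Linf_class \<M> g \<times> L1_class \<I> f)" by (rule imageI)
  ultimately have "?p ` (Linf_class \<M> g \<times> L1_class \<I> f) = {\<integral>z. g z * f (fst z) \<partial>\<M>}" by auto
  then show ?thesis using L1_class_in[OF f] by (simp add: Upsilon_def)
qed

lemma Upsilon_eqI:
  assumes "\<phi> \<in> extensional (elems Lone)" "\<psi> \<in> extensional (elems Lone)"
    and "\<And>f. f \<in> L1_fun \<I> \<Longrightarrow> \<phi> (L1_class \<I> f) = \<psi> (L1_class \<I> f)"
  shows "\<phi> = \<psi>"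
  by (rule extensionalityI[OF assms(1,2)]) (use assms(3) in \<open>auto simp: L1_elems\<close>)

lemma Upsilon_extensional: "Upsilon m \<Omega> G \<in> extensional (elems Lone)"
  by (simp add: Upsilon_def)

lemma integral_pairing_add:
  assumes g: "g \<in> Linf_fun \<M>" and f: "f \<in> L1_fun \<I>" "h \<in> L1_fun \<I>"
  shows "(\<integral>z. g z * (f (fst z) + h (fst z)) \<partial>\<M>) = (\<integral>z. g z * f (fst z) \<partial>\<M>) + (\<integral>z. g z * h (fst z) \<partial>\<M>)"
  unfolding distrib_left using pairing_Linf(1)[OF g f(1)] pairing_Linf(1)[OF g f(2)] by (rule Bochner_Integration.integral_add)

lemma Upsilon_in_dual:
  assumes g: "g \<in> Linf_fun \<M>"
  shows "Upsilon m \<Omega> (Linf_class \<M> g) \<in> elems (dual_space Lone)"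
proof -
  let ?U = "Upsilon m \<Omega> (Linf_class \<M> g)"
  have "linear_between Lone real_space ?U"
    unfolding linear_between_def
  proof (intro conjI ballI allI)
    fix x y assume "x \<in> elems Lone" "y \<in> elems Lone"
    then obtain f h where f: "f \<in> L1_fun \<I>" "x = L1_class \<I> f" and h: "h \<in> L1_fun \<I>" "y = L1_class \<I> h"
      by (auto simp: L1_elems)
    show "?U (vadd Lone x y) = vadd real_space (?U x) (?U y)"
      using f h by (simp add: L1_add Upsilon_class[OF g] L1.add_closed real_space_def integral_pairing_add[OF g])
  next
    fix c x assume "x \<in> elems Lone"
    then obtain f where f: "f \<in> L1_fun \<I>" "x = L1_class \<I> f" by (auto simp: L1_elems)
    show "?U (vscale Lone c x) = vscale real_space c (?U x)"
      using f by (simp add: L1_scale Upsilon_class[OF g] L1.scale_closed real_space_def mult.left_commute)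
  qed (simp add: real_space_def)
  moreover have "continuous_between Lone real_space ?U"
    unfolding continuous_between_def
  proof (intro ballI allI impI)
    fix x and e :: real assume x: "x \<in> elems Lone" and e: "0 < e"
    then obtain f where f: "f \<in> L1_fun \<I>" "x = L1_class \<I> f" by (auto simp: L1_elems)
    have K: "0 \<le> sup_norm g" by simp
    have frac: "k * (e / (k + 1)) < e" if "0 \<le> k" for k using that e by (simp add: field_simps)
    show "\<exists>d>0. \<forall>y\<in>elems Lone. vnorm Lone (vadd Lone y (vscale Lone (-1) x)) < d \<longrightarrow>
       vnorm real_space (vadd real_space (?U y) (vscale real_space (-1) (?U x))) < e"
    proof (intro exI[of _ "e / (sup_norm g + 1)"] conjI ballI impI)
      show "0 < e / (sup_norm g + 1)" using e by (rule divide_pos_pos[OF _ add_nonneg_pos[OF K zero_less_one]])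
      fix y assume y: "y \<in> elems Lone" and lt: "vnorm Lone (vadd Lone y (vscale Lone (-1) x)) < e / (sup_norm g + 1)"
      then obtain h where h: "h \<in> L1_fun \<I>" "y = L1_class \<I> h" by (auto simp: L1_elems)
      define u where "u = (\<lambda>x. h x + (-1) * f x)"
      have mf: "(\<lambda>x. (-1) * f x) \<in> L1_fun \<I>" by (rule L1.scale_closed[OF f(1)])
      have u: "u \<in> L1_fun \<I>" unfolding u_def by (rule L1.add_closed[OF h(1) mf])
      have "vadd Lone y (vscale Lone (-1) x) = L1_class \<I> u"
        unfolding f(2) h(2) u_def L1_scale[OF f(1)] by (rule L1_add[OF h(1) mf])
      then have ulow: "(\<integral>x. \<bar>u x\<bar> \<partial>\<I>) < e / (sup_norm g + 1)" using lt L1_norm[OF u] by simp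
      have "?U y - ?U x = (\<integral>z. g z * u (fst z) \<partial>\<M>)"
        unfolding f(2) h(2) Upsilon_class[OF g f(1)] Upsilon_class[OF g h(1)] u_def
        using integral_pairing_add[OF g h(1) mf] by simp
      then have "\<bar>?U y - ?U x\<bar> \<le> sup_norm g * (\<integral>x. \<bar>u x\<bar> \<partial>\<I>)" using pairing_Linf(2)[OF g u] by simp
      also have "\<dots> \<le> sup_norm g * (e / (sup_norm g + 1))" using ulow K by (intro mult_left_mono) auto
      also have "\<dots> < e" by (rule frac[OF K])
      finally show "vnorm real_space (vadd real_space (?U y) (vscale real_space (-1) (?U x))) < e"
        by (simp add: real_space_def)
    qed
  qed
  ultimately show ?thesis using Upsilon_extensional by (simp add: dual_space_def)
qed

lemma vnorm_Upsilon:
  assumes g: "g \<in> Linf_fun \<M>"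
  shows "vnorm (dual_space Lone) (Upsilon m \<Omega> (Linf_class \<M> g)) = sup_norm g"
proof -
  let ?U = "Upsilon m \<Omega> (Linf_class \<M> g)" and ?B = "{x \<in> elems Lone. vnorm Lone x \<le> 1}"
  have le: "\<bar>?U x\<bar> \<le> sup_norm g" if x: "x \<in> ?B" for x
  proof -
    obtain f where f: "f \<in> L1_fun \<I>" "x = L1_class \<I> f" using x by (auto simp: L1_elems)
    have f1: "(\<integral>x. \<bar>f x\<bar> \<partial>\<I>) \<le> 1" using x f(2) L1_norm[OF f(1)] by simp
    have "\<bar>?U x\<bar> \<le> sup_norm g * (\<integral>x. \<bar>f x\<bar> \<partial>\<I>)"
      using pairing_Linf(2)[OF g f(1)] Upsilon_class[OF g f(1)] f(2) by simp
    also have "\<dots> \<le> sup_norm g * 1" using f1 by (intro mult_left_mono) simp_all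
    finally show ?thesis by simp
  qed
  have bdd: "bdd_above ((\<lambda>x. \<bar>?U x\<bar>) ` ?B)" using le by (intro bdd_aboveI2)
  have z: "L1_class \<I> (\<lambda>_. 0) \<in> ?B" using L1_class_in[OF zero_in_L1] L1_norm[OF zero_in_L1] by simp
  have "(SUP x\<in>?B. \<bar>?U x\<bar>) = sup_norm g"
  proof (rule antisym)
    show "(SUP x\<in>?B. \<bar>?U x\<bar>) \<le> sup_norm g" using z le by (intro cSUP_least) auto
    show "sup_norm g \<le> (SUP x\<in>?B. \<bar>?U x\<bar>)"
    proof (rule dense_le)
      fix c assume c: "c < sup_norm g"
      show "c \<le> (SUP x\<in>?B. \<bar>?U x\<bar>)"
      proof (cases "0 \<le> c")
        case True
        have "esssup \<M> (\<lambda>x. ennreal \<bar>g x\<bar>) < \<infinity>" using g by (simp add: Linf_fun_def)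
        then have eq: "ennreal (sup_norm g) = esssup \<M> (\<lambda>x. ennreal \<bar>g x\<bar>)" by simp
        have "ennreal c < ennreal (sup_norm g)" using c True by (simp only: ennreal_less_iff)
        then have c': "ennreal c < esssup \<M> (\<lambda>x. ennreal \<bar>g x\<bar>)"
          using eq by (rule ord_less_eq_trans)
        obtain f where f: "integrable \<I> f" "(\<integral>x. \<bar>f x\<bar> \<partial>\<I>) = 1" "c \<le> \<bar>\<integral>z. g z * f (fst z) \<partial>\<M>\<bar>"
          by (rule pairing_lower_bound[OF Linf_AE_bound[OF g] True c'])
        have fL: "f \<in> L1_fun \<I>" using f(1) by (simp add: L1_fun_def)
        have "L1_class \<I> f \<in> ?B" using L1_class_in[OF fL] L1_norm[OF fL] f(2) by simp
        from cSUP_upper[OF this bdd] show ?thesis using f(3) Upsilon_class[OF g fL] by simp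
      next
        case False
        then show ?thesis using cSUP_upper[OF z bdd] abs_ge_zero[of "?U (L1_class \<I> (\<lambda>_. 0))"] by linarith
      qed
    qed
  qed
  then show ?thesis by (simp add: dual_space_def)
qed

lemma linear_between_Upsilon: "linear_between Linfty (dual_space Lone) (Upsilon m \<Omega>)"
  unfolding linear_between_def
proof (intro conjI ballI allI)
  fix G assume "G \<in> elems Linfty"
  then obtain g where g: "g \<in> Linf_fun \<M>" "G = Linf_class \<M> g" by (auto simp: Linf_elems)
  then show "Upsilon m \<Omega> G \<in> elems (dual_space Lone)" using Upsilon_in_dual by simp
  fix c :: real
  show "Upsilon m \<Omega> (vscale Linfty c G) = vscale (dual_space Lone) c (Upsilon m \<Omega> G)"
  proof (rule Upsilon_eqI)
    show "Upsilon m \<Omega> (vscale Linfty c G) \<in> extensional (elems Lone)" by (rule Upsilon_extensional)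
    show "vscale (dual_space Lone) c (Upsilon m \<Omega> G) \<in> extensional (elems Lone)" by (simp add: dual_space_def)
    fix f assume f: "f \<in> L1_fun \<I>"
    show "Upsilon m \<Omega> (vscale Linfty c G) (L1_class \<I> f) = vscale (dual_space Lone) c (Upsilon m \<Omega> G) (L1_class \<I> f)"
      using L1_class_in[OF f]
      by (simp add: g(2) Linf_scale[OF g(1)] Upsilon_class[OF Linf.scale_closed[OF g(1)] f] Upsilon_class[OF g(1) f] dual_space_def mult.assoc)
  qed
next
  fix G H assume "G \<in> elems Linfty" "H \<in> elems Linfty"
  then obtain g h where g: "g \<in> Linf_fun \<M>" "G = Linf_class \<M> g" and h: "h \<in> Linf_fun \<M>" "H = Linf_class \<M> h"
    by (auto simp: Linf_elems)
  show "Upsilon m \<Omega> (vadd Linfty G H) = vadd (dual_space Lone) (Upsilon m \<Omega> G) (Upsilon m \<Omega> H)"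
  proof (rule Upsilon_eqI)
    show "Upsilon m \<Omega> (vadd Linfty G H) \<in> extensional (elems Lone)" by (rule Upsilon_extensional)
    show "vadd (dual_space Lone) (Upsilon m \<Omega> G) (Upsilon m \<Omega> H) \<in> extensional (elems Lone)" by (simp add: dual_space_def)
    fix f assume f: "f \<in> L1_fun \<I>"
    have "(\<integral>z. (g z + h z) * f (fst z) \<partial>\<M>) = (\<integral>z. g z * f (fst z) \<partial>\<M>) + (\<integral>z. h z * f (fst z) \<partial>\<M>)"
      unfolding distrib_right using pairing_Linf(1)[OF g(1) f] pairing_Linf(1)[OF h(1) f] by (rule Bochner_Integration.integral_add)
    then show "Upsilon m \<Omega> (vadd Linfty G H) (L1_class \<I> f) = vadd (dual_space Lone) (Upsilon m \<Omega> G) (Upsilon m \<Omega> H) (L1_class \<I> f)"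
      using L1_class_in[OF f]
      by (simp add: g(2) h(2) Linf_add[OF g(1) h(1)] Upsilon_class[OF Linf.add_closed[OF g(1) h(1)] f]
          Upsilon_class[OF g(1) f] Upsilon_class[OF h(1) f] dual_space_def)
  qed
qed

lemma inj_on_Upsilon: "inj_on (Upsilon m \<Omega>) (elems Linfty)"
proof (rule inj_onI)
  fix G H assume "G \<in> elems Linfty" "H \<in> elems Linfty" and eq: "Upsilon m \<Omega> G = Upsilon m \<Omega> H"
  then obtain g h where g: "g \<in> Linf_fun \<M>" "G = Linf_class \<M> g" and h: "h \<in> Linf_fun \<M>" "H = Linf_class \<M> h"
    by (auto simp: Linf_elems)
  define d where "d = (\<lambda>z. g z + (-1) * h z)"
  have mh: "(\<lambda>z. (-1) * h z) \<in> Linf_fun \<M>" by (rule Linf.scale_closed[OF h(1)])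
  have d: "d \<in> Linf_fun \<M>" unfolding d_def by (rule Linf.add_closed[OF g(1) mh])
  have zero: "Upsilon m \<Omega> (Linf_class \<M> d) (L1_class \<I> f) = 0" if f: "f \<in> L1_fun \<I>" for f
  proof -
    have "(\<integral>z. d z * f (fst z) \<partial>\<M>) = (\<integral>z. g z * f (fst z) \<partial>\<M>) - (\<integral>z. h z * f (fst z) \<partial>\<M>)"
      using Bochner_Integration.integral_diff[OF pairing_Linf(1)[OF g(1) f] pairing_Linf(1)[OF h(1) f]]
      by (simp add: d_def left_diff_distrib)
    also have "\<dots> = 0"
      using arg_cong[OF eq, of "\<lambda>U. U (L1_class \<I> f)"] Upsilon_class[OF g(1) f] Upsilon_class[OF h(1) f] g(2) h(2) by simp
    finally show ?thesis using Upsilon_class[OF d f] by simp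
  qed
  have ne: "{x \<in> elems Lone. vnorm Lone x \<le> 1} \<noteq> {}" using L1_class_in[OF zero_in_L1] L1_norm[OF zero_in_L1] by auto
  have "sup_norm d = (SUP x\<in>{x \<in> elems Lone. vnorm Lone x \<le> 1}. \<bar>Upsilon m \<Omega> (Linf_class \<M> d) x\<bar>)"
    using vnorm_Upsilon[OF d] by (simp add: dual_space_def)
  also have "\<dots> = (SUP x\<in>{x \<in> elems Lone. vnorm Lone x \<le> 1}. 0)"
    by (rule SUP_cong) (use zero in \<open>auto simp: L1_elems\<close>)
  also have "\<dots> = 0" using ne by (rule cSUP_const)
  finally have "AE z in \<M>. \<bar>d z\<bar> \<le> 0" using Linf_AE_bound(2)[OF d] by simp
  then have "AE z in \<M>. g z = h z" by eventually_elim (simp add: d_def)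
  then show "G = H" using g h Linf_class_eq_iff by simp
qed

text \<open>Continuity at zero bounds \<open>\<psi>\<close>, by scaling; lifted to functions, \<open>\<psi>\<close> is then represented by
  its germ density.\<close>

lemma Upsilon_surj:
  assumes \<psi>: "\<psi> \<in> elems (dual_space Lone)"
  obtains g where "g \<in> Linf_fun \<M>" "Upsilon m \<Omega> (Linf_class \<M> g) = \<psi>"
proof -
  have ext: "\<psi> \<in> extensional (elems Lone)" and lin: "linear_between Lone real_space \<psi>"
    and cont: "continuous_between Lone real_space \<psi>" using \<psi> by (auto simp: dual_space_def)
  have linA: "\<And>x y. x \<in> elems Lone \<Longrightarrow> y \<in> elems Lone \<Longrightarrow> \<psi> (vadd Lone x y) = \<psi> x + \<psi> y"
    and linS: "\<And>c x. x \<in> elems Lone \<Longrightarrow> \<psi> (vscale Lone c x) = c * \<psi> x"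
    using lin by (simp_all add: linear_between_def real_space_def)
  define \<phi> where "\<phi> f = \<psi> (L1_class \<I> f)" for f
  have add: "\<phi> (\<lambda>x. f x + h x) = \<phi> f + \<phi> h" if fh: "f \<in> L1_fun \<I>" "h \<in> L1_fun \<I>" for f h
    using linA[OF L1_class_in[OF fh(1)] L1_class_in[OF fh(2)]] L1_add[OF fh] by (simp add: \<phi>_def)
  have scale: "\<phi> (\<lambda>x. c * f x) = c * \<phi> f" if f: "f \<in> L1_fun \<I>" for c f
    using linS[OF L1_class_in[OF f]] L1_scale[OF f] by (simp add: \<phi>_def)
  let ?z = "L1_class \<I> (\<lambda>_. 0)"
  have z: "?z \<in> elems Lone" by (rule L1_class_in[OF zero_in_L1])
  have \<phi>0: "\<phi> (\<lambda>_. 0) = 0" using scale[OF zero_in_L1, of 0] by simp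
  obtain d where d: "0 < d" and small: "\<And>y. y \<in> elems Lone \<Longrightarrow> vnorm Lone (vadd Lone y (vscale Lone (-1) ?z)) < d \<Longrightarrow>
       vnorm real_space (vadd real_space (\<psi> y) (vscale real_space (-1) (\<psi> ?z))) < 1"
    using cont z unfolding continuous_between_def by (meson zero_less_one)
  have small': "\<bar>\<phi> f\<bar> < 1" if f: "f \<in> L1_fun \<I>" "(\<integral>x. \<bar>f x\<bar> \<partial>\<I>) < d" for f
  proof -
    have "vadd Lone (L1_class \<I> f) (vscale Lone (-1) ?z) = L1_class \<I> f"
      using L1_scale[OF zero_in_L1, of "-1"] L1_add[OF f(1) zero_in_L1] by simp
    then show ?thesis using small[OF L1_class_in[OF f(1)]] f(2) L1_norm[OF f(1)] \<phi>0
      by (simp add: real_space_def \<phi>_def)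
  qed
  have bound: "\<bar>\<phi> f\<bar> \<le> 1 / d * (\<integral>x. \<bar>f x\<bar> \<partial>\<I>)" if f: "f \<in> L1_fun \<I>" for f
  proof (rule field_le_epsilon)
    fix e :: real assume e: "0 < e"
    let ?n = "\<integral>x. \<bar>f x\<bar> \<partial>\<I>"
    have n: "0 \<le> ?n" by simp
    \<comment> \<open>A number slightly above the norm, and positive even if the norm is \<open>0\<close>.\<close>
    define t where "t = ?n + e * d"
    have t: "0 < t" "?n < t" using n e d by (simp_all add: t_def add_nonneg_pos)
    have "(\<integral>x. \<bar>d / t * f x\<bar> \<partial>\<I>) = d / t * ?n" using d t(1) by (simp add: abs_mult)
    also have "\<dots> < d" using t d by (simp add: field_simps)
    finally have "\<bar>\<phi> (\<lambda>x. d / t * f x)\<bar> < 1" using L1.scale_closed[OF f] by (intro small')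
    then have "d / t * \<bar>\<phi> f\<bar> < 1" using scale[OF f, of "d / t"] d t(1) by (simp add: abs_mult)
    then have "\<bar>\<phi> f\<bar> \<le> t / d" using d t(1) by (simp add: field_simps)
    also have "t / d = 1 / d * ?n + e" using d by (simp add: t_def field_simps)
    finally show "\<bar>\<phi> f\<bar> \<le> 1 / d * ?n + e" .
  qed
  interpret germ_functional \<Omega> m \<phi> "1 / d"
  proof
    show "0 \<le> 1 / d" using d by simp
  qed (use add scale bound in \<open>simp_all add: L1_fun_def\<close>)
  have g: "germ_density \<in> Linf_fun \<M>"
    by (rule Linf_funI[OF germ_density_measurable AE_I2[OF germ_density_bound]])
  have "Upsilon m \<Omega> (Linf_class \<M> germ_density) = \<psi>"
  proof (rule Upsilon_eqI[OF Upsilon_extensional ext])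
    fix f assume f: "f \<in> L1_fun \<I>"
    then show "Upsilon m \<Omega> (Linf_class \<M> germ_density) (L1_class \<I> f) = \<psi> (L1_class \<I> f)"
      using Upsilon_class[OF g f] representation[of f] by (simp add: L1_fun_def \<phi>_def)
  qed
  then show ?thesis using that[OF g] by blast
qed

theorem isometric_isomorphism_Upsilon:
  "isometric_isomorphism Linfty (dual_space Lone) (Upsilon m \<Omega>)"
  unfolding isometric_isomorphism_def
proof (intro conjI ballI)
  show "linear_between Linfty (dual_space Lone) (Upsilon m \<Omega>)" by (rule linear_between_Upsilon)
  have "elems (dual_space Lone) \<subseteq> Upsilon m \<Omega> ` elems Linfty"
  proof
    fix \<psi> assume "\<psi> \<in> elems (dual_space Lone)"
    then obtain g where "g \<in> Linf_fun \<M>" "Upsilon m \<Omega> (Linf_class \<M> g) = \<psi>" by (rule Upsilon_surj)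
    then show "\<psi> \<in> Upsilon m \<Omega> ` elems Linfty" by (auto simp: Linf_elems)
  qed
  moreover have "Upsilon m \<Omega> ` elems Linfty \<subseteq> elems (dual_space Lone)"
    using Upsilon_in_dual by (auto simp: Linf_elems)
  ultimately show "bij_betw (Upsilon m \<Omega>) (elems Linfty) (elems (dual_space Lone))"
    using inj_on_Upsilon by (auto simp: bij_betw_def)
  fix G assume "G \<in> elems Linfty"
  then obtain g where "g \<in> Linf_fun \<M>" "G = Linf_class \<M> g" by (auto simp: Linf_elems)
  then show "vnorm (dual_space Lone) (Upsilon m \<Omega> G) = vnorm Linfty G"
    using vnorm_Upsilon Linf_norm by simp
qed

end

theorem theorem2p7:
  fixes \<Omega> :: "(real ^ 'n) set"
  assumes "CARD('n) \<ge> 2"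
    and "CARD('m::finite) = CARD('n) - 1"
    and "open \<Omega>"
  shows "(\<forall>g \<in> Linf_fun (germ_measure TYPE(real ^ 'm) \<Omega>).
          \<forall>f \<in> L1_fun (rect_measure TYPE(real ^ 'm) \<Omega>).
            integrable (germ_measure TYPE(real ^ 'm) \<Omega>) (\<lambda>z. g z * (f \<circ> fst) z) \<and>
            Upsilon TYPE(real ^ 'm) \<Omega>
              (Linf_class (germ_measure TYPE(real ^ 'm) \<Omega>) g)
              (L1_class (rect_measure TYPE(real ^ 'm) \<Omega>) f)
            = (\<integral>z. g z * (f \<circ> fst) z \<partial>germ_measure TYPE(real ^ 'm) \<Omega>)) \<and>
         isometric_isomorphism
           (Linf_space (germ_measure TYPE(real ^ 'm) \<Omega>))
           (dual_space (L1_space (rect_measure TYPE(real ^ 'm) \<Omega>)))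
           (Upsilon TYPE(real ^ 'm) \<Omega>)"
proof -
  interpret germs \<Omega> "TYPE(real ^ 'm)" by unfold_locales (rule assms(3))
  show ?thesis
  proof (intro conjI ballI)
    fix g f assume gf: "g \<in> Linf_fun \<M>" "f \<in> L1_fun \<I>"
    show "integrable \<M> (\<lambda>z. g z * (f \<circ> fst) z)" using pairing_Linf(1)[OF gf] by simp
    show "Upsilon TYPE(real ^ 'm) \<Omega> (Linf_class \<M> g) (L1_class \<I> f) = (\<integral>z. g z * (f \<circ> fst) z \<partial>\<M>)"
      using Upsilon_class[OF gf] by simp
  qed (rule isometric_isomorphism_Upsilon)
qed

end
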